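(* For positive integers $m,n$, let $s(m,n)$ denote the total number of subgroups of the group $\mathbb{Z}_m\times\mathbb{Z}_n$ and $c(m,n)$ the number of cyclic subgroups of $\mathbb{Z}_m\times\mathbb{Z}_n$, where $\mathbb{Z}_k$ is the additive group of residue classes modulo $k$. For real $x>0$ define $$\widetilde{D}_s(x)=\sum_{\substack{m,n\ge 1\\ mn\le x}} s(m,n)\log\frac{x}{mn},\qquad \widetilde{D}_c(x)=\sum_{\substack{m,n\ge 1\\ mn\le x}} c(m,n)\log\frac{x}{mn}.$$ Then there exist polynomials $\widetilde{P}_4(u)$ and $\widetilde{R}_4(u)$ of degree $4$ with computable (real) coefficients such that for every real $x>2$, $$\widetilde{D}_s(x)=x\,\widetilde{P}_4(\log x)+O\!\left(x^{1/2}\log x\right)$$ and $$\widetilde{D}_c(x)=x\,\widetilde{R}_4(\log x)+O\!\left(x^{1/2}\log x\right).$$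
   Context: Here $\log$ is the natural logarithm, and the implied constants in the $O$-terms are absolute (independent of $x$). *)

theory Defs
  imports
    Complex_Main
    "HOL-Algebra.Elementary_Groups"
    "HOL-Computational_Algebra.Polynomial"
begin

abbreviation ZZ :: "nat \<Rightarrow> nat \<Rightarrow> (int \<times> int) monoid" where
  "ZZ m n \<equiv> integer_mod_group m \<times>\<times> integer_mod_group n"

definition num_subgroups :: "nat \<Rightarrow> nat \<Rightarrow> nat" where
  "num_subgroups m n = card {H. subgroup H (ZZ m n)}"

definition num_cyclic_subgroups :: "nat \<Rightarrow> nat \<Rightarrow> nat" where
  "num_cyclic_subgroups m n =
     card {H. subgroup H (ZZ m n) \<and> cyclic_group ((ZZ m n)\<lparr>carrier := H\<rparr>)}"

definition hyperbola_region :: "real \<Rightarrow> (nat \<times> nat) set" where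
  "hyperbola_region x = {(m, n). 1 \<le> m \<and> 1 \<le> n \<and> real (m * n) \<le> x}"

text \<open>This rules out the convention that a sum over an infinite set is 0.\<close>

lemma finite_hyperbola_region: "finite (hyperbola_region x)"
proof (rule finite_subset)
  show "hyperbola_region x \<subseteq> {..nat \<lfloor>x\<rfloor>} \<times> {..nat \<lfloor>x\<rfloor>}"
  proof
    fix p assume "p \<in> hyperbola_region x"
    then obtain m n where p: "p = (m, n)" and m: "1 \<le> m" and n: "1 \<le> n"
      and le: "real (m * n) \<le> x"
      by (auto simp: hyperbola_region_def)
    have "m * n \<le> nat \<lfloor>x\<rfloor>" using le by (simp add: le_nat_floor)
    moreover have "m \<le> m * n" "n \<le> m * n" using m n by auto
    ultimately have "m \<le> nat \<lfloor>x\<rfloor>" "n \<le> nat \<lfloor>x\<rfloor>" by linarith+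
    then show "p \<in> {..nat \<lfloor>x\<rfloor>} \<times> {..nat \<lfloor>x\<rfloor>}" using p by simp
  qed
qed simp

definition D_s :: "real \<Rightarrow> real" where
  "D_s x = (\<Sum>(m, n)\<in>hyperbola_region x. real (num_subgroups m n) * ln (x / real (m * n)))"

definition D_c :: "real \<Rightarrow> real" where
  "D_c x = (\<Sum>(m, n)\<in>hyperbola_region x. real (num_cyclic_subgroups m n) * ln (x / real (m * n)))"

text \<open>
  \<open>recursive_fn n f\<close>: \<open>f\<close>, restricted to argument lists of length \<open>n\<close>, is a total
  recursive function of arity \<open>n\<close> in the sense of Kleene. Values on lists of other
  lengths are irrelevant. Minimization is only applied to regular functions, so every
  function obtained is total.
\<close>

inductive recursive_fn :: "nat \<Rightarrow> (nat list \<Rightarrow> nat) \<Rightarrow> bool" where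
  zero: "recursive_fn n (\<lambda>xs. 0)"
| succ: "recursive_fn 1 (\<lambda>xs. Suc (xs ! 0))"
| proj: "i < n \<Longrightarrow> recursive_fn n (\<lambda>xs. xs ! i)"
| comp: "recursive_fn (length gs) f \<Longrightarrow> (\<forall>g\<in>set gs. recursive_fn n g) \<Longrightarrow>
    recursive_fn n (\<lambda>xs. f (map (\<lambda>g. g xs) gs))"
| prec: "recursive_fn n g \<Longrightarrow> recursive_fn (Suc (Suc n)) h \<Longrightarrow>
    recursive_fn (Suc n) (\<lambda>xs. rec_nat (g (tl xs)) (\<lambda>k r. h (k # r # tl xs)) (hd xs))"
| mini: "recursive_fn (Suc n) f \<Longrightarrow> (\<forall>xs. length xs = n \<longrightarrow> (\<exists>k. f (k # xs) = 0)) \<Longrightarrow>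
    recursive_fn n (\<lambda>xs. LEAST k. f (k # xs) = 0)"

definition computable_nat_fun :: "(nat \<Rightarrow> nat) \<Rightarrow> bool" where
  "computable_nat_fun a \<longleftrightarrow> (\<exists>f. recursive_fn 1 f \<and> (\<forall>n. a n = f [n]))"

text \<open>
  A real is computable if an algorithm produces, given \<open>n\<close>, a fraction with denominator
  \<open>n + 1\<close> within \<open>1 / (n + 1)\<close> of it; the integer numerator is given as a difference
  of two computable natural numbers.
\<close>

definition computable_real :: "real \<Rightarrow> bool" where
  "computable_real r \<longleftrightarrow> (\<exists>a b. computable_nat_fun a \<and> computable_nat_fun b \<and>
     (\<forall>n. \<bar>r - (real (a n) - real (b n)) / real (n + 1)\<bar> \<le> 1 / real (n + 1)))"

end

theory Submission
  imports
    Defs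
    "HOL-Algebra.Multiplicative_Group"
    "HOL-Computational_Algebra.Squarefree"
    "HOL-Number_Theory.Totient"
    "HOL-Complex_Analysis.Complex_Analysis"
    "HOL-Probability.Sinc_Integral"
    "HOL-Real_Asymp.Real_Asymp"
begin

text \<open>
  Hermite normal forms of the lattices containing \<open>m\<int> \<times> n\<int>\<close> give
  \<open>s(m, n) = \<Sum>a|m. \<Sum>b|n. gcd(a, b)\<close>, and counting generators gives the same formula for
  \<open>c(m, n)\<close> with \<open>\<phi>(gcd(a, b))\<close>. The substitution \<open>(k, a, b) \<mapsto> (g, ka/g, kb/g)\<close> with
  \<open>g = gcd(a, b)\<close> turns \<open>\<Sum>k. D_s(x/k\<^sup>2)\<close> into the sum \<open>T(x)\<close> of \<open>l log(x/(abcdl\<^sup>2))\<close> over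
  \<open>abcdl\<^sup>2 \<le> x\<close>, whose Dirichlet series is \<open>\<zeta>(z)\<^sup>4 \<zeta>(2z - 1)\<close>; and \<open>\<Sum>d|n. \<phi>(d) = n\<close> gives
  \<open>D_s(x) = \<Sum>k. D_c(x/k\<^sup>2)\<close>. Perron's formula with the line shifted to \<open>Re z = 1/2 - \<delta>\<close>,
  \<open>\<delta> = 1/108\<close>, yields \<open>T(x) = x Q(log x) + O(x\<^bsup>1/2 - \<delta>\<^esup>)\<close>, the pole of order 5 at 1 making
  \<open>Q\<close> of degree 4. On that line the fourth moment of \<open>\<zeta>\<close> is controlled by the mean value theorem
  for Dirichlet polynomials, after the Kusmin-Landau and van der Corput inequalities have
  shortened the sums, and this makes the integral against \<open>1/z\<^sup>2\<close> converge absolutely.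
  Moebius inversion over squares then costs \<open>O(x\<^bsup>1/2\<^esup>)\<close> for \<open>D_s\<close> and one more logarithm for
  \<open>D_c\<close>. Finally \<open>D(2\<^sup>k)/2\<^sup>k\<close> is computable to any precision and is, up to a vanishing error, a
  polynomial in \<open>k\<close>, whose coefficients can be read off successively from the leading one.
\<close>

text \<open>The line must lie strictly left of 1/2: the sum over k of (x/k^2)^s is O(x^(1/2)) only
  for s < 1/2, and an error of exact order x^(1/2) in T would leave log x after the first inversion
  and log^2 x after the second. There zeta is reached through its partial sums alone, without
  functional equation. For t of size u^6 the partial sum is cut at u^4: squaring the short piece and
  taking out the squared maximum of the rest both cost u^8 in the fourth moment. With zeta(2z - 1)
  of size u^3 and the weight u^(-12) this leaves u^(-1), against a total loss of u^(54 delta) from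
  moving left; delta = 1/108 leaves u^(-1/2). Inside the strip the integrand is bounded only by a
  power of |Im z|, so horizontal segments need not vanish; a factor exp(e z^2) with e tending to 0
  repairs this. Poles are subtracted before the shift and evaluated on Re z = 2, so no residue
  calculus is needed. The constants in the error terms enter the algorithms for the coefficients at
  most as fixed numerals, so none has to be found effectively.\<close>

hide_const (open) up_ring.coeff up_ring.monom module.smult

section \<open>Exponential sums\<close>

lemma cot_half_diff:
  fixes d d' :: real
  assumes "0 < d" "d \<le> d'" "d' \<le> pi"
  shows "cot (d'/2) \<le> cot (d/2)"
proof -
  have s: "sin (d/2) > 0" "sin (d'/2) > 0" using assms by (auto intro!: sin_gt_zero)
  have "0 \<le> sin (d'/2 - d/2)" using assms by (intro sin_ge_zero) auto
  also have "sin (d'/2 - d/2) = sin (d'/2) * cos (d/2) - cos (d'/2) * sin (d/2)" by (rule sin_diff)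
  finally have "cos (d'/2) * sin (d/2) \<le> cos (d/2) * sin (d'/2)" by (simp add: mult.commute)
  then show ?thesis using s by (simp add: cot_def divide_simps)
qed

lemma cot_half_le:
  fixes d :: real
  assumes "0 < d" "d \<le> pi"
  shows "cot (d/2) \<le> 2 / d" "0 \<le> cot (d/2)"
proof -
  have s: "sin (d/2) > 0" using assms by (auto intro!: sin_gt_zero)
  have c: "cos (d/2) \<ge> 0" using assms by (auto intro!: cos_ge_zero)
  show "0 \<le> cot (d/2)" using s c by (simp add: cot_def)
  have "d/2 * cos (d/2) \<le> sin (d/2)"
  proof -
    let ?f = "\<lambda>x::real. sin x - x * cos x"
    have "?f 0 \<le> ?f (d/2)"
    proof (rule DERIV_nonneg_imp_nondecreasing[of 0 "d/2" ?f])
      show "0 \<le> d/2" using assms by simp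
      fix x :: real assume x: "0 \<le> x" "x \<le> d/2"
      have "(?f has_real_derivative x * sin x) (at x)"
        by (auto intro!: derivative_eq_intros simp: algebra_simps)
      moreover have "x * sin x \<ge> 0" using x assms by (intro mult_nonneg_nonneg sin_ge_zero) auto
      ultimately show "\<exists>y. (?f has_real_derivative y) (at x) \<and> 0 \<le> y" by blast
    qed
    then show ?thesis by simp
  qed
  then show "cot (d/2) \<le> 2 / d" using s assms by (simp add: cot_def divide_simps mult_ac)
qed

text \<open>This is 1/(1 - e^(id)) = 1/2 + (i/2) cot(d/2), by the half-angle formulas. Only the
  imaginary part depends on \<open>d\<close>, so a monotone \<open>d\<close> makes these factors
  move monotonically along a vertical line.\<close>

lemma inverse_one_minus_cis:
  assumes "sin (d/2) \<noteq> 0"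
  shows "(1 - cis d) * Complex (1/2) (cot (d/2) / 2) = 1"
proof -
  have c: "cos d = 1 - 2 * (sin (d/2))\<^sup>2" using cos_double_sin[of "d/2"] by simp
  have s: "sin d = 2 * sin (d/2) * cos (d/2)" using sin_double[of "d/2"] by simp
  have p: "cos (d/2) * cos (d/2) = 1 - sin (d/2) * sin (d/2)"
    using sin_cos_squared_add[of "d/2"] by (simp add: power2_eq_square)
  then have q: "2 * (cos (d/2) * cos (d/2)) + 2 * (sin (d/2) * sin (d/2)) = 2" by linarith
  show ?thesis
  proof (rule complex_eqI)
    show "Re ((1 - cis d) * Complex (1/2) (cot (d/2) / 2)) = Re 1"
      using assms q by (simp add: c s cot_def power2_eq_square field_simps)
    show "Im ((1 - cis d) * Complex (1/2) (cot (d/2) / 2)) = Im 1"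
      using assms q by (simp add: c s cot_def power2_eq_square field_simps)
  qed
qed

text \<open>With \<open>c n\<close> = 1/(1 - cis(d n)) each term is a difference: cis(th n) = c n
  (cis(th n) - cis(th (n + 1))). After summation by parts only |c (n + 1) - c n| matters, and as the
  increments \<open>d\<close> decrease in (0, pi] these lengths telescope to a difference of
  cotangents, each between 0 and 2/D. Enlarging 2 + 3/D to 12/D uses D \<le> pi < 4.\<close>

lemma kusmin_landau:
  fixes th :: "nat \<Rightarrow> real"
  assumes ab: "a \<le> b" and D: "0 < D" "D \<le> pi"
    and lo: "\<And>n. a \<le> n \<Longrightarrow> n < b \<Longrightarrow> D \<le> th (Suc n) - th n"
    and hi: "\<And>n. a \<le> n \<Longrightarrow> n < b \<Longrightarrow> th (Suc n) - th n \<le> pi"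
    and mono: "\<And>n. a \<le> n \<Longrightarrow> Suc n < b \<Longrightarrow> th (Suc (Suc n)) - th (Suc n) \<le> th (Suc n) - th n"
  shows "norm (\<Sum>n=a..b. cis (th n)) \<le> 12 / D"
proof (cases "a = b")
  case True
  have "1 \<le> 12 / D" using D pi_less_4 by (simp add: divide_simps)
  then show ?thesis using True by (simp add: norm_mult)
next
  case False
  define d where "d n = th (Suc n) - th n" for n
  define c where "c n = Complex (1/2) (cot (d n / 2) / 2)" for n
  have dpos: "0 < d n" "d n \<le> pi" "D \<le> d n" if "a \<le> n" "n < b" for n
    using lo[OF that] hi[OF that] D by (auto simp: d_def)
  have step: "cis (th n) = cis (th n) * c n - cis (th (Suc n)) * c n" if "a \<le> n" "n < b" for n
  proof -
    have "sin (d n / 2) > 0" using dpos[OF that] by (intro sin_gt_zero) auto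
    then have "(1 - cis (d n)) * c n = 1" unfolding c_def by (intro inverse_one_minus_cis) auto
    then have "cis (th n) * ((1 - cis (d n)) * c n) = cis (th n)" by simp
    moreover have "cis (th n) * cis (d n) = cis (th (Suc n))" by (simp add: d_def cis_mult)
    ultimately show ?thesis by (metis (no_types, lifting) left_diff_distrib mult.assoc mult.right_neutral right_diff_distrib)
  qed
  \<comment> \<open>The boundary term is carried along with the partial sum: with m = a + k, passing
    to m + 1 then adds just \<open>cis (th (Suc m)) * (c (Suc m) - c m)\<close>.\<close>
  have main: "norm ((\<Sum>n=a..<Suc (a + k). cis (th n)) + cis (th (Suc (a + k))) * c (a + k))
      \<le> norm (c a) + (cot (d (a+k) / 2) - cot (d a / 2)) / 2" if "a + k < b" for k
    using that
  proof (induction k)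
    case 0
    then have "cis (th a) + cis (th (Suc a)) * c a = cis (th a) * c a"
      using step[of a] ab False by (metis diff_add_cancel le_neq_implies_less order_refl)
    then have "(\<Sum>n=a..<Suc (a + 0). cis (th n)) + cis (th (Suc (a + 0))) * c (a + 0) = cis (th a) * c a"
      by simp
    then show ?case by (simp add: norm_mult)
  next
    case (Suc k)
    let ?m = "a + k"
    have IH: "norm ((\<Sum>n=a..<Suc ?m. cis (th n)) + cis (th (Suc ?m)) * c ?m)
      \<le> norm (c a) + (cot (d ?m / 2) - cot (d a / 2)) / 2" using Suc by simp
    have st: "cis (th (Suc ?m)) = cis (th (Suc ?m)) * c (Suc ?m) - cis (th (Suc (Suc ?m))) * c (Suc ?m)"
      using Suc.prems by (intro step) auto
    have eq: "(\<Sum>n=a..<Suc (a + Suc k). cis (th n)) + cis (th (Suc (a + Suc k))) * c (a + Suc k)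
      = ((\<Sum>n=a..<Suc ?m. cis (th n)) + cis (th (Suc ?m)) * c ?m) + cis (th (Suc ?m)) * (c (Suc ?m) - c ?m)"
      using st by (simp add: algebra_simps)
    have dd: "d (Suc ?m) \<le> d ?m" using mono[of ?m] Suc.prems by (simp add: d_def)
    have "c (Suc ?m) - c ?m = \<i> * of_real ((cot (d (Suc ?m) / 2) - cot (d ?m / 2)) / 2)"
      by (simp add: c_def complex_eq_iff)
    moreover have "cot (d ?m / 2) \<le> cot (d (Suc ?m) / 2)"
      using dpos[of ?m] dpos[of "Suc ?m"] dd Suc.prems by (intro cot_half_diff) auto
    ultimately have "norm (c (Suc ?m) - c ?m) = (cot (d (Suc ?m) / 2) - cot (d ?m / 2)) / 2"
      by (simp only: norm_mult norm_ii norm_of_real) simp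
    then have "norm (cis (th (Suc ?m)) * (c (Suc ?m) - c ?m)) = (cot (d (Suc ?m) / 2) - cot (d ?m / 2)) / 2"
      by (simp add: norm_mult)
    then show ?case unfolding eq using IH by (intro order.trans[OF norm_triangle_ineq]) (simp add: field_simps)
  qed
  define m where "m = b - 1"
  have m: "b = Suc m" "a \<le> m" "m < b" using ab False by (auto simp: m_def)
  have nc: "norm (c n) \<le> 1/2 + 1/D" if "a \<le> n" "n < b" for n
  proof -
    have "norm (c n) \<le> \<bar>1/2\<bar> + \<bar>cot (d n / 2) / 2\<bar>" unfolding c_def using cmod_le[of "Complex (1/2) (cot (d n / 2) / 2)"] by simp
    moreover have "cot (d n / 2) \<le> 2 / d n" "0 \<le> cot (d n / 2)" using cot_half_le dpos[OF that] by auto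
    moreover have "2 / d n \<le> 2 / D" using dpos[OF that] D by (simp add: frac_le)
    ultimately show ?thesis by simp
  qed
  have "norm ((\<Sum>n=a..<b. cis (th n)) + cis (th b) * c m) \<le> norm (c a) + (cot (d m / 2) - cot (d a / 2)) / 2"
    using main[of "m - a"] m by simp
  also have "\<dots> \<le> (1/2 + 1/D) + 1/D"
  proof -
    have "cot (d m / 2) \<le> 2 / d m" "0 \<le> cot (d a / 2)" using cot_half_le dpos[of m] dpos[of a] m ab False by auto
    moreover have "2 / d m \<le> 2 / D" using dpos[of m] m D by (simp add: frac_le)
    moreover have "norm (c a) \<le> 1/2 + 1/D" using nc[of a] m by simp
    moreover have "A + (x - z) / 2 \<le> 1/2 + w + w" if "x \<le> y" "0 \<le> z" "y \<le> 2 * w" "A \<le> 1/2 + w" for A x y z w :: real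
      using that by (simp add: field_simps)
    moreover have "2 / D = 2 * (1 / D)" by simp
    ultimately show ?thesis by metis
  qed
  finally have A: "norm ((\<Sum>n=a..<b. cis (th n)) + cis (th b) * c m) \<le> 1/2 + 2/D" by simp
  have "(\<Sum>n=a..b. cis (th n)) = ((\<Sum>n=a..<b. cis (th n)) + cis (th b) * c m) + (cis (th b) - cis (th b) * c m)"
    using ab by (simp add: sum.last_plus atLeastLessThanSuc_atLeastAtMost[symmetric] m(1))
  then have "norm (\<Sum>n=a..b. cis (th n)) \<le> norm ((\<Sum>n=a..<b. cis (th n)) + cis (th b) * c m) + norm (cis (th b) - cis (th b) * c m)"
    by (simp only: norm_triangle_ineq)
  also have "\<dots> \<le> (1/2 + 2/D) + norm (cis (th b) - cis (th b) * c m)" using A by (rule add_right_mono)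
  also have "norm (cis (th b) - cis (th b) * c m) \<le> 1 + (1/2 + 1/D)"
    using nc[of m] m by (intro order.trans[OF norm_triangle_ineq4]) (simp add: norm_mult)
  finally have "norm (\<Sum>n=a..b. cis (th n)) \<le> 2 + 3/D" by simp
  also have "\<dots> \<le> 12 / D" using D pi_less_4 by (simp add: divide_simps)
  finally show ?thesis .
qed

section \<open>Van der Corput differencing\<close>

lemma norm_sum_squared:
  fixes z :: "'a \<Rightarrow> complex"
  shows "of_real ((norm (\<Sum>i\<in>A. z i))\<^sup>2) = (\<Sum>i\<in>A. \<Sum>j\<in>A. z i * cnj (z j))"
  by (simp only: complex_norm_square cnj_sum sum_product)

text \<open>Shifting by h < H leaves the sum unchanged because \<open>xi\<close> vanishes outside
  (N, M]. Averaging over h and applying Cauchy-Schwarz to the M - N + H + 1 window positions brings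
  in the correlations of \<open>xi\<close> at distance |h - h'|: for each h the diagonal gives at
  most M - N, and the rest at most 2K(1 + 1/2 + ... + 1/H).\<close>

lemma van_der_corput_inequality:
  fixes xi :: "nat \<Rightarrow> complex"
  assumes supp: "\<And>n. n \<le> N \<or> n > M \<Longrightarrow> xi n = 0" and bd: "\<And>n. norm (xi n) \<le> 1"
    and H: "1 \<le> H" "H \<le> N" and NM: "N \<le> M"
    and corr: "\<And>r. 1 \<le> r \<Longrightarrow> r < H \<Longrightarrow> norm (\<Sum>n=Suc N..M - r. xi (n + r) * cnj (xi n)) \<le> K / r"
    and K: "0 \<le> K"
  shows "(norm (\<Sum>n=Suc N..M. xi n))\<^sup>2 \<le> real (M - N + H + 1) / real H * (real (M - N) + 2 * K * harm H)"
proof -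
  define S where "S = (\<Sum>n=Suc N..M. xi n)"
  \<comment> \<open>Every window of length \<open>H\<close> that meets (N, M] starts in here;
    \<open>H \<le> N\<close> makes the subtraction of naturals exact.\<close>
  define I where "I = {N-H..M}"
  have fin: "finite I" by (simp add: I_def)
  have cardI: "card I = M - N + H + 1" using H NM by (simp add: I_def)
  have shift: "(\<Sum>m\<in>I. xi (m + h)) = S" if "h < H" for h
  proof -
    have "(\<Sum>m\<in>I. xi (m + h)) = (\<Sum>n\<in>(\<lambda>m. m + h) ` I. xi n)"
      by (subst sum.reindex) (auto simp: inj_on_def)
    also have "\<dots> = (\<Sum>n=Suc N..M. xi n)"
    proof (rule sum.mono_neutral_right)
      show "finite ((\<lambda>m. m + h) ` I)" using fin by simp
      show "{Suc N..M} \<subseteq> (\<lambda>m. m + h) ` I"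
      proof
        fix n assume n: "n \<in> {Suc N..M}"
        then have "n = (n - h) + h" "n - h \<in> I" using that H by (auto simp: I_def)
        then show "n \<in> (\<lambda>m. m + h) ` I" by blast
      qed
      show "\<forall>i\<in>(\<lambda>m. m + h) ` I - {Suc N..M}. xi i = 0" using supp by auto
    qed
    finally show ?thesis by (simp add: S_def)
  qed
  have HS: "of_nat H * S = (\<Sum>m\<in>I. \<Sum>h<H. xi (m + h))"
    by (subst sum.swap) (simp add: shift)
  have "(norm (of_nat H * S))\<^sup>2 \<le> (\<Sum>m\<in>I. norm (\<Sum>h<H. xi (m + h)))\<^sup>2"
    unfolding HS by (intro power_mono norm_sum) simp
  also have "\<dots> \<le> card I * (\<Sum>m\<in>I. (norm (\<Sum>h<H. xi (m + h)))\<^sup>2)"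
    using Cauchy_Schwarz_ineq_sum[of "\<lambda>_. 1" "\<lambda>m. norm (\<Sum>h<H. xi (m + h))" I] by simp
  finally have CS: "(real H * norm S)\<^sup>2 \<le> card I * (\<Sum>m\<in>I. (norm (\<Sum>h<H. xi (m + h)))\<^sup>2)"
    by (simp add: norm_mult)
  have corr_le: "norm (\<Sum>m\<in>I. xi (m + h) * cnj (xi (m + h'))) \<le> K / (h - h')" if "h' < h" "h < H" for h h'
  proof -
    let ?r = "h - h'"
    have "(\<Sum>m\<in>I. xi (m + h) * cnj (xi (m + h'))) = (\<Sum>n\<in>(\<lambda>m. m + h') ` I. xi (n + ?r) * cnj (xi n))"
      using that by (subst sum.reindex) (auto simp: inj_on_def intro!: sum.cong)
    also have "\<dots> = (\<Sum>n=Suc N..M - ?r. xi (n + ?r) * cnj (xi n))"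
    proof (rule sum.mono_neutral_right)
      show "finite ((\<lambda>m. m + h') ` I)" using fin by simp
      show "{Suc N..M - ?r} \<subseteq> (\<lambda>m. m + h') ` I"
      proof
        fix n assume n: "n \<in> {Suc N..M - ?r}"
        then have "n = (n - h') + h'" "n - h' \<in> I" using that H by (auto simp: I_def)
        then show "n \<in> (\<lambda>m. m + h') ` I" by blast
      qed
      show "\<forall>i\<in>(\<lambda>m. m + h') ` I - {Suc N..M - ?r}. xi (i + ?r) * cnj (xi i) = 0"
      proof
        fix n assume "n \<in> (\<lambda>m. m + h') ` I - {Suc N..M - ?r}"
        then have "n \<le> N \<or> n + ?r > M" by auto
        then show "xi (n + ?r) * cnj (xi n) = 0" using supp by auto
      qed
    qed
    finally show ?thesis using corr[of ?r] that by simp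
  qed
  have corr_le': "norm (\<Sum>m\<in>I. xi (m + h) * cnj (xi (m + h'))) \<le> K / \<bar>int h - int h'\<bar>" if "h' \<noteq> h" "h < H" "h' < H" for h h'
  proof (cases "h' < h")
    case True
    then show ?thesis using corr_le[of h' h] that by (simp add: of_nat_diff)
  next
    case False
    then have "h < h'" using that by simp
    have "(\<Sum>m\<in>I. xi (m + h) * cnj (xi (m + h'))) = cnj (\<Sum>m\<in>I. xi (m + h') * cnj (xi (m + h)))"
      by (simp add: mult.commute)
    then have "norm (\<Sum>m\<in>I. xi (m + h) * cnj (xi (m + h'))) = norm (\<Sum>m\<in>I. xi (m + h') * cnj (xi (m + h)))"
      by (simp only: complex_mod_cnj)
    then show ?thesis using corr_le[of h h'] \<open>h < h'\<close> that by (simp add: of_nat_diff)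
  qed
  have diag: "norm (\<Sum>m\<in>I. xi (m + h) * cnj (xi (m + h))) \<le> real (M - N)" if "h < H" for h
  proof -
    have "(\<Sum>m\<in>I. xi (m + h) * cnj (xi (m + h))) = (\<Sum>n\<in>(\<lambda>m. m + h) ` I. xi n * cnj (xi n))"
      by (subst sum.reindex) (auto simp: inj_on_def)
    also have "\<dots> = (\<Sum>n\<in>(\<lambda>m. m + h) ` I \<inter> {Suc N..M}. xi n * cnj (xi n))"
    proof (rule sum.mono_neutral_right)
      show "\<forall>i\<in>(\<lambda>m. m + h) ` I - (\<lambda>m. m + h) ` I \<inter> {Suc N..M}. xi i * cnj (xi i) = 0"
        using supp by (metis Diff_iff IntI Suc_le_eq atLeastAtMost_iff mult_zero_left not_le)
    qed (use fin in auto)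
    also have "norm \<dots> \<le> (\<Sum>n\<in>(\<lambda>m. m + h) ` I \<inter> {Suc N..M}. 1)"
    proof (rule order.trans[OF norm_sum], rule sum_mono)
      fix n show "norm (xi n * cnj (xi n)) \<le> 1" using bd[of n] by (simp add: norm_mult mult_le_one)
    qed
    also have "\<dots> \<le> real (card {Suc N..M})" by (simp add: card_mono del: card_atLeastAtMost)
    finally show ?thesis by simp
  qed
  have harm_le: "(\<Sum>h'\<in>{..<H} - {h}. K / \<bar>int h - int h'\<bar>) \<le> 2 * K * harm H" if h: "h < H" for h
  proof -
    have e: "{..<H} - {h} = {..<h} \<union> {Suc h..<H}" using h by auto
    have "(\<Sum>h'\<in>{..<H} - {h}. K / \<bar>int h - int h'\<bar>) = (\<Sum>h'<h. K / \<bar>int h - int h'\<bar>) + (\<Sum>h'=Suc h..<H. K / \<bar>int h - int h'\<bar>)"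
      unfolding e by (rule sum.union_disjoint) auto
    also have "(\<Sum>h'<h. K / \<bar>int h - int h'\<bar>) = (\<Sum>r=1..h. K / r)"
      by (rule sum.reindex_bij_witness[of _ "\<lambda>r. h - r" "\<lambda>h'. h - h'"]) (auto simp: of_nat_diff)
    also have "(\<Sum>h'=Suc h..<H. K / \<bar>int h - int h'\<bar>) = (\<Sum>r=1..<H - h. K / r)"
      by (rule sum.reindex_bij_witness[of _ "\<lambda>r. h + r" "\<lambda>h'. h' - h"]) (auto simp: of_nat_diff)
    also have "(\<Sum>r=1..h. K / r) \<le> (\<Sum>r=1..H. K / r)" using h K by (intro sum_mono2) auto
    also have "(\<Sum>r=1..<H - h. K / r) \<le> (\<Sum>r=1..H. K / r)" using h K by (intro sum_mono2) auto
    also have "(\<Sum>r=1..H. K / r) = K * harm H" by (simp add: harm_def sum_distrib_left divide_inverse)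
    finally show ?thesis by simp
  qed
  have "(\<Sum>m\<in>I. (norm (\<Sum>h<H. xi (m + h)))\<^sup>2) = norm (complex_of_real (\<Sum>m\<in>I. (norm (\<Sum>h<H. xi (m + h)))\<^sup>2))"
    by (simp only: norm_of_real) (simp add: sum_nonneg)
  also have "complex_of_real (\<Sum>m\<in>I. (norm (\<Sum>h<H. xi (m + h)))\<^sup>2)
      = (\<Sum>m\<in>I. \<Sum>h<H. \<Sum>h'<H. xi (m + h) * cnj (xi (m + h')))"
    by (simp only: of_real_sum norm_sum_squared)
  also have "\<dots> = (\<Sum>h<H. \<Sum>m\<in>I. \<Sum>h'<H. xi (m + h) * cnj (xi (m + h')))"
    by (rule sum.swap)
  also have "\<dots> = (\<Sum>h<H. \<Sum>h'<H. \<Sum>m\<in>I. xi (m + h) * cnj (xi (m + h')))"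
    by (rule sum.cong[OF refl], rule sum.swap)
  also have "norm \<dots> \<le> (\<Sum>h<H. \<Sum>h'<H. norm (\<Sum>m\<in>I. xi (m + h) * cnj (xi (m + h'))))"
    by (intro order.trans[OF norm_sum] sum_mono norm_sum)
  also have "\<dots> \<le> (\<Sum>h<H. real (M - N) + 2 * K * harm H)"
  proof (rule sum_mono)
    fix h assume h: "h \<in> {..<H}"
    have "(\<Sum>h'<H. norm (\<Sum>m\<in>I. xi (m + h) * cnj (xi (m + h'))))
      = norm (\<Sum>m\<in>I. xi (m + h) * cnj (xi (m + h))) + (\<Sum>h'\<in>{..<H} - {h}. norm (\<Sum>m\<in>I. xi (m + h) * cnj (xi (m + h'))))"
      using h by (subst sum.remove[of _ h]) auto
    also have "\<dots> \<le> real (M - N) + (\<Sum>h'\<in>{..<H} - {h}. K / \<bar>int h - int h'\<bar>)"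
      using h by (intro add_mono diag sum_mono corr_le') auto
    also have "\<dots> \<le> real (M - N) + 2 * K * harm H" using harm_le[of h] h by simp
    finally show "(\<Sum>h'<H. norm (\<Sum>m\<in>I. xi (m + h) * cnj (xi (m + h')))) \<le> real (M - N) + 2 * K * harm H" .
  qed
  also have "\<dots> = H * (real (M - N) + 2 * K * harm H)" by simp
  finally have "(real H * norm S)\<^sup>2 \<le> card I * (H * (real (M - N) + 2 * K * harm H))"
    by (intro order.trans[OF CS]) (rule mult_left_mono, auto)
  moreover have "real (card I) * (H * (real (M - N) + 2 * K * harm H))
      = (real H)\<^sup>2 * (real (M - N + H + 1) / real H * (real (M - N) + 2 * K * harm H))"
    using H unfolding cardI by (simp add: power2_eq_square)
  ultimately have "(real H)\<^sup>2 * (norm S)\<^sup>2 \<le> (real H)\<^sup>2 * (real (M - N + H + 1) / real H * (real (M - N) + 2 * K * harm H))"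
    by (simp only: power_mult_distrib)
  moreover have "0 < (real H)\<^sup>2" using H by simp
  ultimately show ?thesis unfolding S_def by (rule mult_left_le_imp_le)
qed

section \<open>Mean values of Dirichlet polynomials\<close>

lemma norm_integral_cis_le:
  fixes w :: real
  assumes "w \<noteq> 0" "a \<le> b"
  shows "norm (integral {a..b} (\<lambda>t. cis (t * w))) \<le> 2 / \<bar>w\<bar>"
proof -
  have "((\<lambda>t. cis (t * w)) has_integral (cis (b * w) / (\<i> * w) - cis (a * w) / (\<i> * w))) {a..b}"
  proof (rule fundamental_theorem_of_calculus)
    fix t assume "t \<in> {a..b}"
    have "((\<lambda>t. exp (\<i> * of_real (t * w)) / (\<i> * w)) has_vector_derivative exp (\<i> * of_real (t * w))) (at t within {a..b})"
      using assms by (auto intro!: derivative_eq_intros has_vector_derivative_real_field simp: field_simps)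
    then show "((\<lambda>t. cis (t * w) / (\<i> * w)) has_vector_derivative cis (t * w)) (at t within {a..b})"
      by (simp add: cis_conv_exp)
  qed (use assms in auto)
  then have "integral {a..b} (\<lambda>t. cis (t * w)) = cis (b * w) / (\<i> * w) - cis (a * w) / (\<i> * w)"
    by (rule integral_unique)
  also have "norm \<dots> \<le> 1 / \<bar>w\<bar> + 1 / \<bar>w\<bar>"
    by (intro order.trans[OF norm_triangle_ineq4] add_mono) (auto simp: norm_divide norm_mult)
  finally show ?thesis by simp
qed

text \<open>From ln y \<le> y - 1. This is the spacing of the frequencies ln n, which makes the
  off-diagonal integrals in the mean value theorem small.\<close>

lemma abs_ln_diff_ge:
  fixes m n X :: nat
  assumes "m \<noteq> n" "1 \<le> m" "1 \<le> n" "m \<le> X" "n \<le> X"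
  shows "\<bar>real m - real n\<bar> / X \<le> \<bar>ln (real m) - ln (real n)\<bar>"
proof -
  have *: "(real b - real a) / X \<le> ln (real b) - ln (real a)" if "a < b" "1 \<le> a" "b \<le> X" for a b :: nat
  proof -
    have "(real b - real a) / X \<le> (real b - real a) / b"
      using that by (intro divide_left_mono) auto
    also have "\<dots> = 1 - real a / b" using that by (simp add: field_simps)
    also have "\<dots> \<le> - ln (real a / b)" using ln_le_minus_one[of "real a / b"] that by simp
    also have "\<dots> = ln (real b) - ln (real a)" using that by (simp add: ln_div)
    finally show ?thesis .
  qed
  show ?thesis
  proof (cases "m < n")
    case True
    then show ?thesis using *[of m n] assms by auto
  next
    case False
    then show ?thesis using *[of n m] assms by auto
  qed
qed

text \<open>In the expanded square the diagonal gives the length of the interval. Off the diagonal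
  the oscillating integral is at most 2X/|m - n|; with |a_m a_n| \<le> (|a_m|^2 + |a_n|^2)/2 the sum
  over the other index is harmonic. This costs a factor log X but avoids Hilbert's
  inequality.\<close>

lemma mean_value_theorem_dirichlet_polynomial:
  fixes a :: "nat \<Rightarrow> complex"
  assumes A: "A \<subseteq> {1..X}" and T: "T \<le> T'"
  shows "integral {T..T'} (\<lambda>t. (norm (\<Sum>n\<in>A. a n * cis (- t * ln n)))\<^sup>2)
    \<le> (T' - T + 4 * X * harm X) * (\<Sum>n\<in>A. (norm (a n))\<^sup>2)"
proof -
  have fin: "finite A" using A finite_subset by blast
  define w where "w m n = ln (real n) - ln (real m)" for m n :: nat
  have cont: "continuous_on {T..T'} (\<lambda>t. cis (t * c))" for c :: real
    by (intro continuous_intros)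
  have exp: "of_real ((norm (\<Sum>n\<in>A. a n * cis (- t * ln n)))\<^sup>2)
     = (\<Sum>m\<in>A. \<Sum>n\<in>A. a m * cnj (a n) * cis (t * w m n))" for t :: real
  proof -
    have "of_real ((norm (\<Sum>n\<in>A. a n * cis (- t * ln n)))\<^sup>2)
       = (\<Sum>m\<in>A. \<Sum>n\<in>A. (a m * cis (- t * ln m)) * cnj (a n * cis (- t * ln n)))"
      by (rule norm_sum_squared)
    also have "\<dots> = (\<Sum>m\<in>A. \<Sum>n\<in>A. a m * cnj (a n) * cis (t * w m n))"
    proof (intro sum.cong refl)
      fix m n
      have "cis (- t * ln m) * cnj (cis (- t * ln n)) = cis (t * w m n)"
        by (simp add: cis_cnj cis_mult w_def algebra_simps)
      then show "(a m * cis (- t * ln m)) * cnj (a n * cis (- t * ln n)) = a m * cnj (a n) * cis (t * w m n)"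
        by (simp add: algebra_simps)
    qed
    finally show ?thesis .
  qed
  have intgr: "(\<lambda>t. (norm (\<Sum>n\<in>A. a n * cis (- t * ln n)))\<^sup>2) integrable_on {T..T'}"
    by (intro integrable_continuous_interval continuous_intros)
  have "of_real (integral {T..T'} (\<lambda>t. (norm (\<Sum>n\<in>A. a n * cis (- t * ln n)))\<^sup>2))
     = integral {T..T'} (\<lambda>t. complex_of_real ((norm (\<Sum>n\<in>A. a n * cis (- t * ln n)))\<^sup>2))"
    by (rule integral_linear[OF intgr bounded_linear_of_real, unfolded o_def, symmetric])
  also have "\<dots> = (\<Sum>m\<in>A. \<Sum>n\<in>A. a m * cnj (a n) * integral {T..T'} (\<lambda>t. cis (t * w m n)))"
    unfolding exp
    by (rule integral_unique)
       (intro has_integral_sum fin has_integral_mult_right integrable_integral integrable_continuous_interval cont)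
  also have "norm \<dots> \<le> (\<Sum>m\<in>A. \<Sum>n\<in>A. norm (a m) * norm (a n) * (if m = n then T' - T else 2 * X / \<bar>real m - real n\<bar>))"
  proof (intro order.trans[OF norm_sum] sum_mono)
    fix m n assume mn: "m \<in> A" "n \<in> A"
    have "norm (integral {T..T'} (\<lambda>t. cis (t * w m n))) \<le> (if m = n then T' - T else 2 * X / \<bar>real m - real n\<bar>)"
    proof (cases "m = n")
      case True
      then show ?thesis using T by (simp add: w_def)
    next
      case False
      have b: "1 \<le> m" "1 \<le> n" "m \<le> X" "n \<le> X" using mn A by auto
      have lb: "\<bar>real n - real m\<bar> / X \<le> \<bar>w m n\<bar>" unfolding w_def using abs_ln_diff_ge[of n m X] False b by auto
      moreover have p: "0 < \<bar>real n - real m\<bar> / X" using False b by auto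
      ultimately have wne: "w m n \<noteq> 0" by auto
      have "norm (integral {T..T'} (\<lambda>t. cis (t * w m n))) \<le> 2 / \<bar>w m n\<bar>"
        using wne T by (rule norm_integral_cis_le)
      also have "\<dots> \<le> 2 / (\<bar>real n - real m\<bar> / X)" using lb p by (intro divide_left_mono mult_pos_pos) auto
      finally show ?thesis using False by (simp add: abs_minus_commute)
    qed
    then show "norm (a m * cnj (a n) * integral {T..T'} (\<lambda>t. cis (t * w m n)))
       \<le> norm (a m) * norm (a n) * (if m = n then T' - T else 2 * X / \<bar>real m - real n\<bar>)"
      by (simp only: norm_mult complex_mod_cnj) (intro mult_left_mono mult_nonneg_nonneg, auto)
  qed
  also have "\<dots> \<le> (\<Sum>m\<in>A. \<Sum>n\<in>A. ((norm (a m))\<^sup>2 + (norm (a n))\<^sup>2) / 2 * (if m = n then T' - T else 2 * X / \<bar>real m - real n\<bar>))"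
  proof (intro sum_mono mult_right_mono)
    fix m n show "norm (a m) * norm (a n) \<le> ((norm (a m))\<^sup>2 + (norm (a n))\<^sup>2) / 2"
      using sum_squares_bound[of "norm (a m)" "norm (a n)"] by simp
    show "0 \<le> (if m = n then T' - T else 2 * X / \<bar>real m - real n\<bar>)" using T by simp
  qed
  also have "\<dots> = (\<Sum>m\<in>A. \<Sum>n\<in>A. (norm (a m))\<^sup>2 / 2 * (if m = n then T' - T else 2 * X / \<bar>real m - real n\<bar>))
     + (\<Sum>m\<in>A. \<Sum>n\<in>A. (norm (a n))\<^sup>2 / 2 * (if m = n then T' - T else 2 * X / \<bar>real m - real n\<bar>))"
    by (simp add: add_divide_distrib distrib_right sum.distrib)
  also have "(\<Sum>m\<in>A. \<Sum>n\<in>A. (norm (a n))\<^sup>2 / 2 * (if m = n then T' - T else 2 * X / \<bar>real m - real n\<bar>))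
     = (\<Sum>m\<in>A. \<Sum>n\<in>A. (norm (a m))\<^sup>2 / 2 * (if m = n then T' - T else 2 * X / \<bar>real m - real n\<bar>))"
    by (subst sum.swap) (intro sum.cong refl, auto simp: abs_minus_commute)
  also have "(\<Sum>m\<in>A. \<Sum>n\<in>A. (norm (a m))\<^sup>2 / 2 * (if m = n then T' - T else 2 * X / \<bar>real m - real n\<bar>))
    \<le> (\<Sum>m\<in>A. (norm (a m))\<^sup>2 / 2 * (T' - T + 4 * X * harm X))"
  proof (rule sum_mono)
    fix m assume m: "m \<in> A"
    have "(\<Sum>n\<in>A. (if m = n then T' - T else 2 * X / \<bar>real m - real n\<bar>)) = (T' - T) + (\<Sum>n\<in>A - {m}. 2 * X / \<bar>real m - real n\<bar>)"
      using fin m by (subst sum.remove[of _ m]) auto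
    also have "(\<Sum>n\<in>A - {m}. 2 * X / \<bar>real m - real n\<bar>) \<le> (\<Sum>n\<in>{1..X} - {m}. 2 * X / \<bar>real m - real n\<bar>)"
      using A by (intro sum_mono2) auto
    also have "\<dots> = (\<Sum>n\<in>{1..<m}. 2 * X / \<bar>real m - real n\<bar>) + (\<Sum>n\<in>{m<..X}. 2 * X / \<bar>real m - real n\<bar>)"
    proof -
      have "{1..X} - {m} = {1..<m} \<union> {m<..X}" using m A by auto
      show ?thesis unfolding \<open>{1..X} - {m} = {1..<m} \<union> {m<..X}\<close> by (rule sum.union_disjoint) auto
    qed
    also have "(\<Sum>n\<in>{1..<m}. 2 * X / \<bar>real m - real n\<bar>) = (\<Sum>r\<in>{1..<m}. 2 * X / r)"
      by (rule sum.reindex_bij_witness[of _ "\<lambda>r. m - r" "\<lambda>n. m - n"]) (auto simp: of_nat_diff)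
    also have "(\<Sum>n\<in>{m<..X}. 2 * X / \<bar>real m - real n\<bar>) = (\<Sum>r\<in>{1..X-m}. 2 * X / r)"
      by (rule sum.reindex_bij_witness[of _ "\<lambda>r. m + r" "\<lambda>n. n - m"]) (auto simp: of_nat_diff)
    also have "(\<Sum>r\<in>{1..<m}. 2 * X / r) \<le> (\<Sum>r\<in>{1..X}. 2 * X / real r)" using m A by (intro sum_mono2) auto
    also have "(\<Sum>r\<in>{1..X-m}. 2 * X / r) \<le> (\<Sum>r\<in>{1..X}. 2 * X / real r)" by (intro sum_mono2) auto
    also have "(\<Sum>r\<in>{1..X}. 2 * X / real r) = 2 * X * harm X" by (simp add: harm_def sum_distrib_left divide_inverse)
    finally have "(\<Sum>n\<in>A. (if m = n then T' - T else 2 * X / \<bar>real m - real n\<bar>)) \<le> T' - T + 4 * X * harm X" by (simp add: algebra_simps)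
    then show "(\<Sum>n\<in>A. (norm (a m))\<^sup>2 / 2 * (if m = n then T' - T else 2 * X / \<bar>real m - real n\<bar>))
      \<le> (norm (a m))\<^sup>2 / 2 * (T' - T + 4 * X * harm X)"
      unfolding sum_distrib_left[symmetric] by (intro mult_left_mono) auto
  qed
  finally have "norm (complex_of_real (integral {T..T'} (\<lambda>t. (norm (\<Sum>n\<in>A. a n * cis (- t * ln n)))\<^sup>2)))
    \<le> 2 * (\<Sum>m\<in>A. (norm (a m))\<^sup>2 / 2 * (T' - T + 4 * X * harm X))" by linarith
  also have "\<dots> = (T' - T + 4 * X * harm X) * (\<Sum>n\<in>A. (norm (a n))\<^sup>2)"
    unfolding sum_distrib_left by (intro sum.cong refl) simp
  finally have "\<bar>integral {T..T'} (\<lambda>t. (norm (\<Sum>n\<in>A. a n * cis (- t * ln n)))\<^sup>2)\<bar>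
      \<le> (T' - T + real (4 * X) * harm X) * (\<Sum>n\<in>A. (norm (a n))\<^sup>2)" unfolding norm_of_real .
  then have "integral {T..T'} (\<lambda>t. (norm (\<Sum>n\<in>A. a n * cis (- t * ln n)))\<^sup>2)
      \<le> (T' - T + real (4 * X) * harm X) * (\<Sum>n\<in>A. (norm (a n))\<^sup>2)" by (rule order.trans[OF abs_ge_self])
  then show ?thesis by simp
qed

section \<open>Sums of n^(-it) over dyadic blocks\<close>

lemma harm_le_one_plus_ln:
  assumes "1 \<le> n"
  shows "harm n \<le> 1 + ln (real n)"
  using assms
proof (induction n rule: dec_induct)
  case base
  then show ?case by (simp add: harm_def)
next
  case (step n)
  have "harm (Suc n) = harm n + 1 / real (Suc n)" by (simp add: harm_Suc inverse_eq_divide)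
  moreover have "1 / real (Suc n) \<le> ln (real (Suc n)) - ln (real n)"
  proof -
    have "ln (real n / real (Suc n)) \<le> real n / real (Suc n) - 1" using step by (intro ln_le_minus_one) auto
    also have "real n / real (Suc n) - 1 = - (1 / real (Suc n))" by (simp add: field_simps)
    finally show ?thesis using step by (simp add: ln_div)
  qed
  ultimately show ?case using step by linarith
qed

text \<open>The differenced phase has increments t ln(1 + x n) with x n = r/(n(n + r + 1)). They
  decrease in n, stay below t r/N^2 \<le> 1, and are at least D = t r/(4 N^2) because n + 1 and n +
  r are at most 2N. So Kusmin-Landau applies, and 12/D is the bound.\<close>

lemma sum_cis_differences_le:
  fixes t :: real
  assumes t: "1 \<le> t" and N: "1 \<le> N" and M: "M \<le> 2 * N" and r: "1 \<le> r" "64 * t * real r \<le> (real N)\<^sup>2"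
  shows "norm (\<Sum>n=Suc N..M - r. cis (t * (ln (real n) - ln (real (n + r))))) \<le> (48 * (real N)\<^sup>2 / t) / r"
proof (cases "Suc N \<le> M - r")
  case False
  then show ?thesis using t by simp
next
  case True
  define D where "D = t * r / (4 * (real N)\<^sup>2)"
  define x where "x n = real r / (real n * real (n + r + 1))" for n
  have Np: "0 < (real N)\<^sup>2" using N by simp
  have Dpos: "0 < D" using t r Np by (simp add: D_def)
  have Dle: "D \<le> pi"
  proof -
    have "0 \<le> t * real r" using t by simp
    then have "t * real r \<le> 4 * (real N)\<^sup>2" using r by (simp add: algebra_simps)
    then have "D \<le> 1" using Np by (simp add: D_def)
    then show ?thesis using pi_gt3 by linarith
  qed
  have one_x: "1 + x n = (real (Suc n) * real (n + r)) / (real n * real (n + r + 1))" if "1 \<le> n" for n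
  proof -
    have "real n * real (n + r + 1) \<noteq> 0" using that by simp
    then have "1 + x n = (real n * real (n + r + 1) + real r) / (real n * real (n + r + 1))"
      by (simp add: x_def add_divide_distrib del: of_nat_add mult_eq_0_iff)
    moreover have "real n * real (n + r + 1) + real r = real (Suc n) * real (n + r)" by (simp add: algebra_simps)
    ultimately show ?thesis by simp
  qed
  have d: "t * (ln (real (Suc n)) - ln (real (Suc n + r))) - t * (ln (real n) - ln (real (n + r))) = t * ln (1 + x n)"
    if "1 \<le> n" for n
  proof -
    have "1 + x n = (real (Suc n) * real (n + r)) / (real n * real (Suc n + r))"
      using one_x[OF that] by simp
    also have "ln \<dots> = ln (real (Suc n)) + ln (real (n + r)) - (ln (real n) + ln (real (Suc n + r)))"
      using that by (subst ln_div) (auto simp: ln_mult)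
    finally have e: "ln (1 + x n) = ln (real (Suc n)) + ln (real (n + r)) - (ln (real n) + ln (real (Suc n + r)))" .
    show ?thesis unfolding e by (simp add: algebra_simps)
  qed
  have xpos: "0 < x n" if "1 \<le> n" for n using that r by (simp add: x_def)
  have "norm (\<Sum>n=Suc N..M - r. cis (t * (ln (real n) - ln (real (n + r))))) \<le> 12 / D"
  proof (rule kusmin_landau[OF True Dpos Dle])
    fix n assume n: "Suc N \<le> n" "n < M - r"
    have n1: "1 \<le> n" using n by simp
    have "D = t * (real r / (real (2 * N) * real (2 * N)))" by (simp add: D_def power2_eq_square)
    also have "\<dots> \<le> t * (real r / (real (Suc n) * real (n + r)))"
    proof (intro mult_left_mono divide_left_mono mult_mono)
      have "Suc n \<le> 2 * N" "n + r \<le> 2 * N" using n M by linarith+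
      then show "real (Suc n) \<le> real (2 * N)" "real (n + r) \<le> real (2 * N)" by linarith+
    qed (use n r N t in auto)
    also have "real r / (real (Suc n) * real (n + r)) = x n / (1 + x n)"
    proof -
      have "real n * real (n + r + 1) \<noteq> 0" using n1 by simp
      then show ?thesis unfolding one_x[OF n1] by (simp add: x_def del: of_nat_add mult_eq_0_iff)
    qed
    also have "x n / (1 + x n) \<le> ln (1 + x n)"
    proof -
      have "ln (1 / (1 + x n)) \<le> 1 / (1 + x n) - 1" using xpos[OF n1] by (intro ln_le_minus_one) auto
      also have "1 / (1 + x n) - 1 = - (x n / (1 + x n))" using xpos[OF n1] by (simp add: field_simps)
      finally show ?thesis using xpos[OF n1] by (simp add: ln_div)
    qed
    finally show "D \<le> t * (ln (real (Suc n)) - ln (real (Suc n + r))) - t * (ln (real n) - ln (real (n + r)))"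
      using d[OF n1] t by (simp add: mult_left_mono)
    have "t * ln (1 + x n) \<le> t * x n" using xpos[OF n1] t by (intro mult_left_mono ln_add_one_self_le_self) auto
    also have "\<dots> \<le> t * (real r / (real N * real N))"
      unfolding x_def using n N r t by (intro mult_left_mono divide_left_mono mult_mono) auto
    also have "\<dots> \<le> 1"
    proof -
      have "0 \<le> t * real r" using t by simp
      then have "t * real r \<le> real N * real N" using r by (simp add: algebra_simps power2_eq_square)
      then show ?thesis using N by simp
    qed
    also have "\<dots> \<le> pi" using pi_gt3 by linarith
    finally show "t * (ln (real (Suc n)) - ln (real (Suc n + r))) - t * (ln (real n) - ln (real (n + r))) \<le> pi"
      using d[OF n1] by simp
  next
    fix n assume n: "Suc N \<le> n" "Suc n < M - r"
    have n1: "1 \<le> n" using n by simp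
    have "x (Suc n) \<le> x n" unfolding x_def using n1 r by (intro divide_left_mono mult_mono) auto
    then have "t * ln (1 + x (Suc n)) \<le> t * ln (1 + x n)" using xpos[of n] xpos[of "Suc n"] n1 t
      by (intro mult_left_mono) auto
    then show "t * (ln (real (Suc (Suc n))) - ln (real (Suc (Suc n) + r))) - t * (ln (real (Suc n)) - ln (real (Suc n + r)))
      \<le> t * (ln (real (Suc n)) - ln (real (Suc n + r))) - t * (ln (real n) - ln (real (n + r)))"
      using d[of n] d[of "Suc n"] n1 by simp
  qed
  also have "12 / D = (48 * (real N)\<^sup>2 / t) / r" using t r Np by (simp add: D_def field_simps)
  finally show ?thesis .
qed

text \<open>One differencing followed by Kusmin-Landau. With \<open>H\<close> about N^2/(64 t)
  shifts, the correlation at distance r costs N^2/(t r), so the square of the sum is of order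
  (N/H)(N + (N^2/t) log t), that is t + N log t; \<open>N \<le> 64 t\<close> turns this into t log
  t. Below sqrt(64 t) terms the trivial bound is enough.\<close>

lemma van_der_corput_bound:
  "\<exists>C>0. \<forall>t\<ge>1. \<forall>N M. N \<le> M \<longrightarrow> M \<le> 2 * N \<longrightarrow> real N \<le> 64 * t \<longrightarrow>
     norm (\<Sum>n=Suc N..M. cis (- t * ln (real n))) \<le> C * (sqrt t * (1 + ln t))"
proof (intro exI conjI allI impI)
  show "(0::real) < 5000" by simp
  fix t :: real and N M :: nat assume t: "1 \<le> t" and NM: "N \<le> M" "M \<le> 2 * N" and Nt: "real N \<le> 64 * t"
  let ?S = "\<Sum>n=Suc N..M. cis (- t * ln (real n))"
  have lt: "0 \<le> ln t" using t by simp
  show "norm ?S \<le> 5000 * (sqrt t * (1 + ln t))"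
  proof (cases "(real N)\<^sup>2 < 64 * t")
    case True
    have "norm ?S \<le> (\<Sum>n=Suc N..M. 1)" by (rule order.trans[OF norm_sum]) (simp add: sum_mono)
    also have "\<dots> \<le> real N" using NM by simp
    also have "\<dots> \<le> sqrt (64 * t)" using True by (intro real_le_rsqrt) simp
    also have "\<dots> = 8 * sqrt t" by (simp add: real_sqrt_mult)
    also have "\<dots> \<le> 5000 * (sqrt t * (1 + ln t))"
      using lt t by (simp add: mult_le_cancel_left distrib_left add_increasing2)
    finally show ?thesis .
  next
    case False
    then have N2: "64 * t \<le> (real N)\<^sup>2" by simp
    then have N1: "1 \<le> N" using t by (cases N) auto
    \<comment> \<open>The largest number of shifts for which the increments of the differenced phase
      stay within the hypothesis of \<open>sum_cis_differences_le\<close>. The bound on N by 64 t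
      keeps it at most \<open>N\<close>.\<close>
    define H where "H = nat \<lfloor>(real N)\<^sup>2 / (64 * t)\<rfloor>"
    have q1: "1 \<le> (real N)\<^sup>2 / (64 * t)" using N2 t by simp
    have H1: "1 \<le> H" using q1 unfolding H_def by (simp add: le_nat_floor)
    have Hle: "real H \<le> (real N)\<^sup>2 / (64 * t)" using q1 by (simp add: H_def)
    have Hge: "(real N)\<^sup>2 / (128 * t) \<le> real H"
    proof -
      have "(real N)\<^sup>2 / (64 * t) < real H + 1" unfolding H_def using q1 by linarith
      then have "(real N)\<^sup>2 / (64 * t) \<le> 2 * real H" using H1 by linarith
      then show ?thesis using t by (simp add: field_simps)
    qed
    have HN: "H \<le> N"
    proof -
      have "(real N)\<^sup>2 / (64 * t) \<le> real N" using Nt t N1 by (simp add: field_simps power2_eq_square mult_left_mono)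
      then show ?thesis using Hle by linarith
    qed
    define xi where "xi n = (if N < n \<and> n \<le> M then cis (- t * ln (real n)) else 0)" for n
    define K where "K = 48 * (real N)\<^sup>2 / t"
    have S: "?S = (\<Sum>n=Suc N..M. xi n)" by (rule sum.cong) (auto simp: xi_def)
    have vdc: "(norm (\<Sum>n=Suc N..M. xi n))\<^sup>2 \<le> real (M - N + H + 1) / real H * (real (M - N) + 2 * K * harm H)"
    proof (rule van_der_corput_inequality[OF _ _ H1 HN NM(1)])
      fix r :: nat assume r: "1 \<le> r" "r < H"
      have "(\<Sum>n=Suc N..M - r. xi (n + r) * cnj (xi n)) = (\<Sum>n=Suc N..M - r. cis (t * (ln (real n) - ln (real (n + r)))))"
        by (rule sum.cong) (auto simp: xi_def cis_cnj cis_mult algebra_simps)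
      moreover have "64 * t * real r \<le> (real N)\<^sup>2"
      proof -
        have "real r \<le> (real N)\<^sup>2 / (64 * t)" using r Hle by linarith
        then show ?thesis using t by (simp add: field_simps)
      qed
      ultimately show "norm (\<Sum>n=Suc N..M - r. xi (n + r) * cnj (xi n)) \<le> K / r"
        unfolding K_def using sum_cis_differences_le[OF t N1 NM(2) r(1)] by simp
    qed (use t in \<open>auto simp: xi_def K_def\<close>)
    have harmH: "harm H \<le> 6 * (1 + ln t)"
    proof -
      have "real H \<le> 64 * t" using HN Nt by linarith
      then have "ln (real H) \<le> ln (64 * t)" using H1 by simp
      also have "\<dots> = ln 64 + ln t" using t by (simp add: ln_mult)
      finally have "ln (real H) \<le> ln 64 + ln t" .
      moreover have "ln 64 \<le> (5::real)"
      proof -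
        have "ln (64::real) = 6 * ln 2" using ln_realpow[of 2 6] by simp
        then show ?thesis using ln2_le_25_over_36 by simp
      qed
      ultimately have "ln (real H) \<le> 5 + ln t" by simp
      then have "1 + ln (real H) \<le> 6 * (1 + ln t)" using lt by simp
      then show ?thesis using harm_le_one_plus_ln[OF H1] by simp
    qed
    have "real (M - N + H + 1) / real H \<le> (3 * N) / ((real N)\<^sup>2 / (128 * t))"
    proof (rule frac_le)
      have "M - N + H + 1 \<le> 3 * N" using NM HN N1 by linarith
      then show "real (M - N + H + 1) \<le> real (3 * N)" by linarith
    qed (use Hge t N1 in auto)
    also have "\<dots> = 384 * t / N" using N1 t by (simp add: power2_eq_square field_simps)
    finally have A: "real (M - N + H + 1) / real H \<le> 384 * t / N" .
    have "real (M - N) \<le> real N" using NM by linarith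
    moreover have "2 * K * harm H \<le> 2 * K * (6 * (1 + ln t))" using harmH t by (intro mult_left_mono) (auto simp: K_def)
    moreover have "2 * K * (6 * (1 + ln t)) = 576 * ((real N)\<^sup>2 / t) * (1 + ln t)" by (simp add: K_def)
    ultimately have B: "real (M - N) + 2 * K * harm H \<le> N + 576 * ((real N)\<^sup>2 / t) * (1 + ln t)"
      by (metis add_mono)
    have "(norm ?S)\<^sup>2 \<le> 384 * t / N * (N + 576 * ((real N)\<^sup>2 / t) * (1 + ln t))"
      unfolding S by (rule order.trans[OF vdc]) (intro mult_mono A B, use t in \<open>auto simp: K_def harm_nonneg\<close>)
    also have "\<dots> = 384 * t + 221184 * N * (1 + ln t)" using N1 t by (simp add: field_simps power2_eq_square)
    also have "\<dots> \<le> 384 * t * (1 + ln t) + 221184 * (64 * t) * (1 + ln t)"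
      using Nt lt t by (intro add_mono mult_right_mono mult_left_mono) (auto simp: mult_le_cancel_left1)
    also have "\<dots> = 14156160 * t * (1 + ln t)" by (simp add: algebra_simps)
    also have "\<dots> \<le> 25000000 * t * (1 + ln t)\<^sup>2"
    proof -
      have "(1 + ln t) \<le> (1 + ln t)\<^sup>2" using lt by (simp add: power2_eq_square algebra_simps)
      then show ?thesis using lt t by (intro mult_mono) auto
    qed
    also have "\<dots> = (5000 * (sqrt t * (1 + ln t)))\<^sup>2" using t by (simp add: power_mult_distrib)
    finally show ?thesis by (rule power2_le_imp_le) (use lt t in simp)
  qed
qed

section \<open>The zeta function\<close>

definition npow :: "real \<Rightarrow> complex \<Rightarrow> complex" where
  "npow u s = exp (- s * of_real (ln u))"

lemma norm_npow: "0 < u \<Longrightarrow> norm (npow u s) = u powr (- Re s)"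
  by (simp add: npow_def powr_def)

lemma npow_one [simp]: "npow 1 s = 1"
  by (simp add: npow_def)

lemma cnj_npow: "cnj (npow u s) = npow u (cnj s)"
  by (simp add: npow_def exp_cnj)

lemma npow_diff_one: "0 < u \<Longrightarrow> npow u (s - 1) = of_real u * npow u s"
proof -
  assume u: "0 < u"
  have "npow u (s - 1) = exp (of_real (ln u)) * npow u s"
    by (simp add: npow_def algebra_simps flip: exp_add)
  also have "exp (complex_of_real (ln u)) = of_real u" using u by (simp add: exp_of_real)
  finally show ?thesis .
qed

lemma npow_has_vector_derivative:
  assumes "0 < n + w"
  shows "((\<lambda>w. npow (n + w) s) has_vector_derivative - s * npow (n + w) (s + 1)) (at w)"
proof -
  have e: "npow (n + w) (s + 1) = npow (n + w) s / of_real (n + w)"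
  proof -
    have "complex_of_real (n + w) \<noteq> 0" using assms by (simp only: of_real_eq_0_iff)
    then show ?thesis using npow_diff_one[OF assms, of "s + 1"] by (simp del: of_real_add)
  qed
  have "((\<lambda>w. - s * complex_of_real (ln (n + w))) has_vector_derivative - s * of_real (1 / (n + w))) (at w)"
    using assms
    by (intro has_vector_derivative_mult_right has_vector_derivative_of_real)
       (auto intro!: derivative_eq_intros simp: has_real_derivative_iff_has_vector_derivative[symmetric])
  then have "(exp \<circ> (\<lambda>w. - s * complex_of_real (ln (n + w))) has_vector_derivative
      (- s * of_real (1 / (n + w))) * exp (- s * complex_of_real (ln (n + w)))) (at w)"
    by (rule field_vector_diff_chain_at) (rule DERIV_exp)
  then show ?thesis unfolding e by (simp add: npow_def o_def)
qed

lemma mvt_bound: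
  fixes f :: "real \<Rightarrow> complex"
  assumes "0 \<le> b" "b \<le> 1" "\<And>x. 0 \<le> x \<Longrightarrow> x \<le> 1 \<Longrightarrow> (f has_vector_derivative f' x) (at x)"
    and "\<And>x. 0 \<le> x \<Longrightarrow> x \<le> 1 \<Longrightarrow> norm (f' x) \<le> B"
  shows "norm (f b - f 0) \<le> B"
proof (cases "b = 0")
  case True
  then show ?thesis using order.trans[OF norm_ge_zero assms(4)[of 0]] by simp
next
  case False
  then have b: "0 < b" using assms by simp
  have "continuous_on {0..b} f"
    by (intro continuous_at_imp_continuous_on ballI has_vector_derivative_continuous[OF assms(3)]) (use assms in auto)
  then have "\<exists>x\<in>{0<..<b}. norm (f b - f 0) \<le> norm ((\<lambda>h. h *\<^sub>R f' x) (b - 0))"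
    by (rule mvt_general[OF b, where f' = "\<lambda>x h. h *\<^sub>R f' x"]) (use assms in \<open>auto simp: has_vector_derivative_def\<close>)
  then obtain x where x: "0 < x" "x < b" "norm (f b - f 0) \<le> norm (b *\<^sub>R f' x)" by auto
  have "norm (b *\<^sub>R f' x) \<le> 1 * B" unfolding norm_scaleR using x assms by (intro mult_mono) auto
  then show ?thesis using x by simp
qed

text \<open>\<open>zterm n s / (s - 1)\<close> is the error of the trapezoidal rule for \<open>u\<^sup>-\<^sup>s\<close> on \<open>[n, n + 1]\<close>; the factor \<open>s - 1\<close> makes
  it entire in \<open>s\<close>.\<close>

definition zterm :: "nat \<Rightarrow> complex \<Rightarrow> complex" where
  "zterm n s = (s - 1) / 2 * (npow (real n) s + npow (real n + 1) s) + npow (real n + 1) (s - 1) - npow (real n) (s - 1)"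

text \<open>Let the right end point move: \<open>f w\<close> is the error on [n, n + w] multiplied
  by s - 1. Both \<open>f\<close> and \<open>f'\<close> vanish at 0 and \<open>f''\<close> carries a
  factor \<open>w\<close>, so two mean value estimates suffice. \<open>-2 \<le> Re s\<close> allows
  (n + w)^(-Re s - 2) to be replaced by its value at w = 0.\<close>

lemma norm_zterm_le:
  assumes n: "1 \<le> n" and s: "-2 \<le> Re s"
  shows "norm (zterm n s) \<le> norm ((s - 1) * s * (s + 1)) * real n powr (- Re s - 2)"
proof -
  define B where "B = norm ((s - 1) * s * (s + 1)) * real n powr (- Re s - 2)"
  define f where "f w = (s - 1) / 2 * (of_real w * (npow (real n) s + npow (real n + w) s)) + npow (real n + w) (s - 1) - npow (real n) (s - 1)" for w
  define f' where "f' w = (s - 1) / 2 * (npow (real n) s - npow (real n + w) s - of_real w * (s * npow (real n + w) (s + 1)))" for w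
  define f'' where "f'' w = (s - 1) / 2 * (of_real w * (s * ((s + 1) * npow (real n + w) (s + 2))))" for w
  have pos: "0 < real n + w" if "0 \<le> w" for w using n that by simp
  note d = npow_has_vector_derivative[OF pos]
  have d2: "((\<lambda>w. npow (real n + w) (s + 1)) has_vector_derivative - (s + 1) * npow (real n + w) (s + 2)) (at w)" if "0 \<le> w" for w
    using d[OF that, of "s + 1"] by (simp add: add.assoc)
  have d0: "((\<lambda>w. npow (real n + w) (s - 1)) has_vector_derivative - (s - 1) * npow (real n + w) s) (at w)" if "0 \<le> w" for w
    using d[OF that, of "s - 1"] by simp
  have dw: "((\<lambda>w. complex_of_real w) has_vector_derivative 1) (at w)" for w
    by (auto intro!: derivative_eq_intros)
  have df: "(f has_vector_derivative f' w) (at w)" if "0 \<le> w" "w \<le> 1" for w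
  proof -
    have "(f has_vector_derivative (s - 1) / 2 * (of_real w * (0 + - s * npow (real n + w) (s + 1)) + 1 * (npow (real n) s + npow (real n + w) s))
        + - (s - 1) * npow (real n + w) s - 0) (at w)"
      unfolding f_def
      by (intro has_vector_derivative_diff has_vector_derivative_add has_vector_derivative_mult_right
          has_vector_derivative_mult has_vector_derivative_const d d0 dw that(1))
    then show ?thesis by (simp add: f'_def field_simps)
  qed
  have df': "(f' has_vector_derivative f'' w) (at w)" if "0 \<le> w" "w \<le> 1" for w
  proof -
    have "(f' has_vector_derivative (s - 1) / 2 * (0 - - s * npow (real n + w) (s + 1)
        - (of_real w * (s * (- (s + 1) * npow (real n + w) (s + 2))) + 1 * (s * npow (real n + w) (s + 1))))) (at w)"
      unfolding f'_def
      by (intro has_vector_derivative_diff has_vector_derivative_mult_right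
          has_vector_derivative_mult has_vector_derivative_const d d2 dw that(1))
    then show ?thesis by (simp add: f''_def field_simps)
  qed
  have f''_le: "norm (f'' w) \<le> B" if w: "0 \<le> w" "w \<le> 1" for w
  proof -
    have "norm (f'' w) = norm ((s - 1) * s * (s + 1)) * (w / 2 * (real n + w) powr (- Re s - 2))"
      using w pos[of w] by (simp add: f''_def norm_mult norm_divide norm_npow)
    also have "w / 2 * (real n + w) powr (- Re s - 2) \<le> 1 * real n powr (- Re s - 2)"
      using w n s by (intro mult_mono powr_mono2') auto
    finally show ?thesis by (simp add: B_def mult_left_mono)
  qed
  have f'_le: "norm (f' w) \<le> B" if w: "0 \<le> w" "w \<le> 1" for w
    using mvt_bound[OF w df' f''_le] by (simp add: f'_def)
  have "norm (f 1 - f 0) \<le> B" by (rule mvt_bound[OF _ _ df f'_le]) auto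
  moreover have "f 1 - f 0 = zterm n s" by (simp add: f_def zterm_def)
  ultimately show ?thesis by (simp add: B_def)
qed

text \<open>With a, b the roots of n and n + 1, the difference 1/a - 1/b equals 1/(ab(a + b)), and b
  \<le> 3a/2. This telescoping majorant takes the place of an integral test, both for the zeta
  series and for the tails of the Moebius sums.\<close>

lemma powr_three_halves_telescope:
  assumes "1 \<le> n"
  shows "real n powr (-3/2) \<le> 6 * (real n powr (-1/2) - real (Suc n) powr (-1/2))"
proof -
  define a where "a = sqrt (real n)"
  define b where "b = sqrt (real (Suc n))"
  have a: "0 < a" "a\<^sup>2 = real n" and b: "0 < b" "b\<^sup>2 = a\<^sup>2 + 1" using assms by (auto simp: a_def b_def)
  have ab: "a \<le> b" by (simp add: a_def b_def)
  have a1: "1 \<le> a" using assms by (simp add: a_def)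
  have e: "real n powr (-3/2) = 1 / a^3" "real n powr (-1/2) = 1 / a" "real (Suc n) powr (-1/2) = 1 / b"
  proof -
    have "real n powr (-3/2) = (real n powr (1/2)) powr (-3)" by (simp add: powr_powr)
    also have "\<dots> = 1 / a^3" using a by (simp add: powr_half_sqrt a_def[symmetric] powr_minus_divide powr_numeral)
    finally show "real n powr (-3/2) = 1 / a^3" .
    show "real n powr (-1/2) = 1 / a" using a by (simp add: a_def powr_minus_divide powr_half_sqrt)
    show "real (Suc n) powr (-1/2) = 1 / b" by (simp add: b_def powr_minus_divide powr_half_sqrt)
  qed
  have "(b - a) * (b + a) = 1" using b by (simp add: power2_eq_square algebra_simps)
  then have d: "b - a = 1 / (b + a)" using a b by (simp add: field_simps)
  have "1 / a - 1 / b = (b - a) / (a * b)" using a b by (simp add: field_simps)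
  also have "\<dots> = 1 / ((b + a) * (a * b))" by (simp add: d)
  finally have f: "1 / a - 1 / b = 1 / ((b + a) * (a * b))" .
  have "b\<^sup>2 \<le> (3/2 * a)\<^sup>2" using b a1 by (simp add: power2_eq_square algebra_simps) (use mult_mono[OF a1 a1] in simp)
  then have b2: "b \<le> 3/2 * a" by (rule power2_le_imp_le) (use a in simp)
  have "(b + a) * (a * b) \<le> (3/2 * a + a) * (a * (3/2 * a))" using b2 a b by (intro mult_mono) auto
  also have "\<dots> \<le> 6 * a^3" using a by (simp add: power3_eq_cube)
  finally have "1 / (6 * a^3) \<le> 1 / ((b + a) * (a * b))" using a b by (intro divide_left_mono) auto
  then show ?thesis unfolding e f using a by (simp add: field_simps)
qed

text \<open>Continues \<open>(s - 1) \<zeta>(s)\<close> analytically to \<open>Re s > - 1\<close>.\<close>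

definition Zser :: "complex \<Rightarrow> complex" where
  "Zser s = 1 + (s - 1) / 2 + (\<Sum>k. zterm (Suc k) s)"

text \<open>The Euler-Maclaurin truncation of (s - 1) zeta(s): terms up to N, the last one with
  weight 1/2, plus the integral from N onwards.\<close>

definition zpart :: "nat \<Rightarrow> complex \<Rightarrow> complex" where
  "zpart N s = (s - 1) * ((\<Sum>n=1..N. npow (real n) s) - npow (real N) s / 2) + npow (real N) (s - 1)"

lemma zpart_eq: "1 + (s - 1) / 2 + (\<Sum>k<N. zterm (Suc k) s) = zpart (Suc N) s"
proof (induction N)
  case 0
  then show ?case by (simp add: zpart_def field_simps)
next
  case (Suc N)
  have "1 + (s - 1) / 2 + (\<Sum>k<Suc N. zterm (Suc k) s) = zpart (Suc N) s + zterm (Suc N) s"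
    using Suc by (simp add: add.assoc)
  also have "\<dots> = zpart (Suc (Suc N)) s"
    by (simp add: zpart_def zterm_def add.commute algebra_simps add_divide_distrib diff_divide_distrib)
  finally show ?case .
qed

text \<open>k^(-Re s - 2) is split into k^(-Re s - 1/2), which does not increase and is frozen at k
  = N, and k^(-3/2), which telescopes. This is where Re s \<ge> -1/2 enters.\<close>

lemma zterm_tail_bound:
  assumes s: "- 1/2 \<le> Re s" and N: "1 \<le> N" and k: "N \<le> k"
  shows "norm (zterm k s) \<le> (6 * norm ((s - 1) * s * (s + 1)) * real N powr (- Re s - 1/2))
    * (real k powr (-1/2) - real (Suc k) powr (-1/2))"
proof -
  have le: "norm (zterm k s) \<le> norm ((s - 1) * s * (s + 1)) * real k powr (- Re s - 2)"
    using assms by (intro norm_zterm_le) auto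
  have "real k powr (- Re s - 2) = real k powr (- Re s - 1/2) * real k powr (-3/2)"
  proof -
    have e: "- Re s - 2 = (- Re s - 1/2) + (-3/2)" by simp
    show ?thesis unfolding e by (rule powr_add)
  qed
  also have "\<dots> \<le> real N powr (- Re s - 1/2) * (6 * (real k powr (-1/2) - real (Suc k) powr (-1/2)))"
    using assms powr_three_halves_telescope[of k] by (intro mult_mono powr_mono2') auto
  finally have "norm ((s - 1) * s * (s + 1)) * real k powr (- Re s - 2)
    \<le> norm ((s - 1) * s * (s + 1)) * (real N powr (- Re s - 1/2) * (6 * (real k powr (-1/2) - real (Suc k) powr (-1/2))))"
    by (intro mult_left_mono) auto
  also have "\<dots> = (6 * norm ((s - 1) * s * (s + 1)) * real N powr (- Re s - 1/2))
    * (real k powr (-1/2) - real (Suc k) powr (-1/2))" by (simp only: mult_ac)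
  finally show ?thesis using le by linarith
qed

lemma zterm_tail_sum:
  assumes s: "- 1/2 \<le> Re s" and N: "1 \<le> N"
  shows "summable (\<lambda>k. norm (zterm (N + k) s))"
    and "norm (\<Sum>k. zterm (N + k) s) \<le> 6 * norm ((s - 1) * s * (s + 1)) * real N powr (- Re s - 1)"
proof -
  define c where "c = 6 * norm ((s - 1) * s * (s + 1)) * real N powr (- Re s - 1/2)"
  define g where "g k = real (N + k) powr (-1/2)" for k
  have "g \<longlonglongrightarrow> 0"
    unfolding g_def by real_asymp
  then have sums: "(\<lambda>k. c * (g k - g (Suc k))) sums (c * (g 0 - 0))"
    by (intro sums_mult telescope_sums')
  have le: "norm (zterm (N + k) s) \<le> c * (g k - g (Suc k))" for k
    using zterm_tail_bound[OF s N, of "N + k"] by (simp add: c_def g_def)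
  show sm: "summable (\<lambda>k. norm (zterm (N + k) s))"
    by (rule summable_comparison_test'[OF sums_summable[OF sums]]) (use le in auto)
  have "norm (\<Sum>k. zterm (N + k) s) \<le> (\<Sum>k. c * (g k - g (Suc k)))"
    by (rule norm_suminf_le[OF le sums_summable[OF sums]])
  also have "\<dots> = c * g 0" using sums_unique[OF sums] by simp
  also have "c * g 0 = 6 * norm ((s - 1) * s * (s + 1)) * real N powr (- Re s - 1)"
  proof -
    have e: "- Re s - 1 = (- Re s - 1/2) + (-1/2)" by simp
    show ?thesis unfolding e powr_add by (simp add: c_def g_def)
  qed
  finally show "norm (\<Sum>k. zterm (N + k) s) \<le> 6 * norm ((s - 1) * s * (s + 1)) * real N powr (- Re s - 1)" .
qed

text \<open>Keeping N free lets one inequality serve three purposes: growth on vertical lines (N =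
  1), holomorphy (N \<rightarrow> \<infinity>), and estimates of zeta by partial sums (N about
  t^(3/2)).\<close>

lemma Zser_approx:
  assumes s: "- 1/2 \<le> Re s" and N: "1 \<le> N"
  shows "norm (Zser s - zpart N s) \<le> 6 * norm ((s - 1) * s * (s + 1)) * real N powr (- Re s - 1)"
proof -
  obtain M where M: "N = Suc M" using N by (cases N) auto
  have sm: "summable (\<lambda>k. zterm (Suc k) s)"
    by (rule summable_norm_cancel) (use zterm_tail_sum(1)[OF s, of 1] in simp)
  have "(\<Sum>k. zterm (Suc k) s) = (\<Sum>k. zterm (Suc (k + M)) s) + (\<Sum>k<M. zterm (Suc k) s)"
    by (rule suminf_split_initial_segment[OF sm])
  then have "Zser s - zpart N s = (\<Sum>k. zterm (N + k) s)"
    using zpart_eq[of s M] by (simp add: Zser_def M algebra_simps)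
  then show ?thesis using zterm_tail_sum(2)[OF s N] by simp
qed

lemma Zser_bound:
  assumes s: "- 1/2 \<le> Re s"
  shows "norm (Zser s) \<le> 8 * (1 + norm s) ^ 3"
proof -
  have "norm (Zser s) \<le> norm (zpart 1 s) + norm (Zser s - zpart 1 s)"
    using norm_triangle_ineq[of "zpart 1 s" "Zser s - zpart 1 s"] by simp
  also have "norm (Zser s - zpart 1 s) \<le> 6 * norm ((s - 1) * s * (s + 1))"
    using Zser_approx[OF s, of 1] by simp
  also have "norm ((s - 1) * s * (s + 1)) \<le> (1 + norm s) * (1 + norm s) * (1 + norm s)"
    unfolding norm_mult
    by (intro mult_mono) (auto intro: order.trans[OF norm_triangle_ineq4] order.trans[OF norm_triangle_ineq])
  also have "norm (zpart 1 s) \<le> 2 * (1 + norm s)"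
  proof -
    have "zpart 1 s = (s + 1) / 2" by (simp add: zpart_def field_simps)
    then have "norm (zpart 1 s) = norm ((s + 1) / 2)" by (simp only:)
    also have "\<dots> = norm (s + 1) / 2" by (simp add: norm_divide)
    finally have "norm (zpart 1 s) = norm (s + 1) / 2" .
    also have "\<dots> \<le> (norm s + 1) / 2" using norm_triangle_ineq[of s 1] by simp
    also have "\<dots> \<le> 2 * (1 + norm s)" using norm_ge_zero[of s] by simp
    finally show ?thesis .
  qed
  also have "2 * (1 + norm s) \<le> 2 * (1 + norm s)^3"
  proof -
    have "(1 + norm s)^1 \<le> (1 + norm s)^3" by (rule power_increasing) auto
    then show ?thesis by simp
  qed
  finally show ?thesis by (simp add: power3_eq_cube)
qed

lemma cnj_Zser: "- 1/2 \<le> Re s \<Longrightarrow> Zser (cnj s) = cnj (Zser s)"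
proof -
  assume s: "- 1/2 \<le> Re s"
  have sm: "summable (\<lambda>k. zterm (Suc k) s)"
    by (rule summable_norm_cancel) (use zterm_tail_sum(1)[OF s, of 1] in simp)
  have eq: "cnj (zterm k s) = zterm k (cnj s)" for k
    by (simp add: zterm_def cnj_npow)
  have "(\<lambda>k. cnj (zterm (Suc k) s)) sums cnj (\<Sum>k. zterm (Suc k) s)"
    by (rule sums_cnj[THEN iffD2]) (rule summable_sums[OF sm])
  then have "(\<lambda>k. zterm (Suc k) (cnj s)) sums cnj (\<Sum>k. zterm (Suc k) s)"
    by (simp only: eq)
  then show ?thesis by (simp add: Zser_def sums_iff)
qed

lemma holomorphic_npow: "npow u holomorphic_on A"
  unfolding npow_def [abs_def] by (intro holomorphic_intros)

lemma holomorphic_Zser: "Zser holomorphic_on {s. - 1/2 < Re s}"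
proof (rule holomorphic_uniform_sequence[where f = "\<lambda>N. zpart (Suc N)"])
  show "open {s. - 1/2 < Re s}" by (rule open_halfspace_Re_gt)
  show "zpart (Suc N) holomorphic_on {s. - 1/2 < Re s}" for N
    unfolding zpart_def [abs_def]
    by (intro holomorphic_intros holomorphic_on_compose[OF _ holomorphic_npow, unfolded o_def] holomorphic_npow) auto
  fix s assume s: "s \<in> {s. - 1/2 < Re s}"
  obtain d where d: "0 < d" "cball s d \<subseteq> {s. - 1/2 < Re s}"
    using open_contains_cball[of "{s. - 1/2 < Re s}"] open_halfspace_Re_gt s by blast
  define R where "R = 6 * (1 + (norm s + d)) ^ 3"
  have "uniform_limit (cball s d) (\<lambda>N. zpart (Suc N)) Zser sequentially"
  proof (rule uniform_limitI)
    fix e :: real assume e: "0 < e"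
    have "(\<lambda>N. R * real (Suc N) powr (-1/2)) \<longlonglongrightarrow> 0" by real_asymp
    then have "\<forall>\<^sub>F N in sequentially. R * real (Suc N) powr (-1/2) < e" by (rule order_tendstoD) (rule e)
    then show "\<forall>\<^sub>F N in sequentially. \<forall>x\<in>cball s d. dist (zpart (Suc N) x) (Zser x) < e"
    proof (rule eventually_mono, intro ballI)
      fix N x assume N: "R * real (Suc N) powr (-1/2) < e" and x: "x \<in> cball s d"
      have re: "- 1/2 \<le> Re x" using x d by force
      have nx: "norm x \<le> norm s + d" using x norm_triangle_ineq2[of x s] by (simp add: dist_norm norm_minus_commute)
      have "norm ((x - 1) * x * (x + 1)) \<le> (1 + (norm s + d)) * (1 + (norm s + d)) * (1 + (norm s + d))"
        unfolding norm_mult using nx d(1) norm_ge_zero[of s]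
        by (intro mult_mono) (auto intro: order.trans[OF norm_triangle_ineq4] order.trans[OF norm_triangle_ineq])
      then have "6 * norm ((x - 1) * x * (x + 1)) \<le> R" by (simp add: R_def power3_eq_cube)
      moreover have "real (Suc N) powr (- Re x - 1) \<le> real (Suc N) powr (-1/2)"
        using re by (intro powr_mono) auto
      moreover have "0 \<le> R" using d(1) by (simp add: R_def)
      ultimately have "6 * norm ((x - 1) * x * (x + 1)) * real (Suc N) powr (- Re x - 1) \<le> R * real (Suc N) powr (-1/2)"
        by (intro mult_mono) auto
      then show "dist (zpart (Suc N) x) (Zser x) < e"
        using Zser_approx[OF re, of "Suc N"] N by (simp add: dist_norm norm_minus_commute)
    qed
  qed
  then show "\<exists>d>0. cball s d \<subseteq> {s. - 1/2 < Re s} \<and> uniform_limit (cball s d) (\<lambda>N. zpart (Suc N)) Zser sequentially"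
    using d by blast
qed

lemma Zser_limit:
  assumes s: "1 < Re s"
  shows "(\<lambda>N. \<Sum>n=1..N. npow (real n) s) \<longlonglongrightarrow> Zser s / (s - 1)"
proof -
  have s1: "s \<noteq> 1" using s by auto
  have A: "(\<lambda>N. npow (real (Suc N)) s / 2) \<longlonglongrightarrow> 0"
  proof (rule tendsto_norm_zero_cancel)
    have "(\<lambda>N. real (Suc N) powr (- Re s) / 2) \<longlonglongrightarrow> 0" using s by real_asymp
    then show "(\<lambda>N. norm (npow (real (Suc N)) s / 2)) \<longlonglongrightarrow> 0" by (simp add: norm_divide norm_npow)
  qed
  have B: "(\<lambda>N. npow (real (Suc N)) (s - 1)) \<longlonglongrightarrow> 0"
  proof (rule tendsto_norm_zero_cancel)
    have "(\<lambda>N. real (Suc N) powr (- (Re s - 1))) \<longlonglongrightarrow> 0" using s by real_asymp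
    then show "(\<lambda>N. norm (npow (real (Suc N)) (s - 1))) \<longlonglongrightarrow> 0" by (simp add: norm_npow)
  qed
  have C: "(\<lambda>N. zpart (Suc N) s) \<longlonglongrightarrow> Zser s"
  proof (rule Lim_null_comparison[THEN Lim_null[THEN iffD2]])
    show "\<forall>\<^sub>F N in sequentially. norm (zpart (Suc N) s - Zser s) \<le> 6 * norm ((s - 1) * s * (s + 1)) * real (Suc N) powr (- Re s - 1)"
    proof (intro always_eventually allI)
      fix N show "norm (zpart (Suc N) s - Zser s) \<le> 6 * norm ((s - 1) * s * (s + 1)) * real (Suc N) powr (- Re s - 1)"
        using Zser_approx[of s "Suc N"] s by (simp add: norm_minus_commute del: of_nat_Suc)
    qed
    show "(\<lambda>N. 6 * norm ((s - 1) * s * (s + 1)) * real (Suc N) powr (- Re s - 1)) \<longlonglongrightarrow> 0"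
      using s by real_asymp
  qed
  have "(\<lambda>N. (zpart (Suc N) s - npow (real (Suc N)) (s - 1)) / (s - 1) + npow (real (Suc N)) s / 2) \<longlonglongrightarrow> (Zser s - 0) / (s - 1) + 0"
    using s1 by (intro tendsto_intros A B C) auto
  moreover have "(zpart (Suc N) s - npow (real (Suc N)) (s - 1)) / (s - 1) + npow (real (Suc N)) s / 2 = (\<Sum>n=1..Suc N. npow (real n) s)" for N
    using s1 by (simp add: zpart_def del: sum.cl_ivl_Suc)
  ultimately have "(\<lambda>N. \<Sum>n=1..Suc N. npow (real n) s) \<longlonglongrightarrow> Zser s / (s - 1)" by simp
  then show ?thesis by (rule LIMSEQ_imp_Suc)
qed

lemma Zser_1: "Zser 1 = 1"
proof -
  have "norm (Zser 1 - zpart 1 1) \<le> 0" using Zser_approx[of 1 1] by simp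
  then show ?thesis by (simp add: zpart_def)
qed

section \<open>Partial summation and weighted exponential sums\<close>

lemma npow_Complex:
  assumes "0 < u"
  shows "npow u (Complex \<sigma> t) = of_real (u powr (- \<sigma>)) * cis (- t * ln u)"
proof -
  have "- Complex \<sigma> t * of_real (ln u) = of_real (- \<sigma> * ln u) + \<i> * of_real (- t * ln u)"
    by (simp add: complex_eq_iff)
  then have "npow u (Complex \<sigma> t) = exp (of_real (- \<sigma> * ln u)) * exp (\<i> * of_real (- t * ln u))"
    unfolding npow_def by (simp only: exp_add)
  also have "exp (complex_of_real (- \<sigma> * ln u)) = of_real (u powr (- \<sigma>))"
    using assms by (simp only: exp_of_real powr_def) simp
  finally show ?thesis by (simp only: cis_conv_exp)
qed

lemma sum_split_Suc:
  fixes f :: "nat \<Rightarrow> 'a :: comm_monoid_add"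
  assumes "m \<le> Suc a" "a \<le> b"
  shows "(\<Sum>n=m..b. f n) = (\<Sum>n=m..a. f n) + (\<Sum>n=Suc a..b. f n)"
proof -
  have "{m..b} = {m..a} \<union> {Suc a..b}" using assms by auto
  then have "sum f {m..b} = sum f ({m..a} \<union> {Suc a..b})" by (rule arg_cong)
  also have "\<dots> = sum f {m..a} + sum f {Suc a..b}" by (rule sum.union_disjoint) auto
  finally show ?thesis .
qed

text \<open>Summation by parts: a monotone weight with values in [0, W] has total variation at most
  W, and the boundary term contributes another K W.\<close>

lemma abel_sum_bound:
  fixes w :: "nat \<Rightarrow> real" and x :: "nat \<Rightarrow> complex"
  assumes ab: "a \<le> b" and W: "0 \<le> W"
    and X: "\<And>m. a \<le> m \<Longrightarrow> m \<le> b \<Longrightarrow> norm (\<Sum>n=Suc a..m. x n) \<le> K"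
    and w: "\<And>n. Suc a \<le> n \<Longrightarrow> n \<le> b \<Longrightarrow> 0 \<le> w n \<and> w n \<le> W"
    and mono: "(\<forall>n. Suc a \<le> n \<longrightarrow> n < b \<longrightarrow> w (Suc n) \<le> w n) \<or> (\<forall>n. Suc a \<le> n \<longrightarrow> n < b \<longrightarrow> w n \<le> w (Suc n))"
  shows "norm (\<Sum>n=Suc a..b. of_real (w n) * x n) \<le> 2 * K * W"
proof (cases "a = b")
  case True
  have "0 \<le> K" using order.trans[OF norm_ge_zero X[of a]] ab by simp
  then show ?thesis using True W by simp
next
  case False
  then have ab': "Suc a \<le> b" using ab by simp
  have K: "0 \<le> K" using order.trans[OF norm_ge_zero X[of a]] ab by simp
  define S where "S m = (\<Sum>n=Suc a..m. x n)" for m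
  have S: "norm (S m) \<le> K" if "Suc a \<le> m" "m \<le> b" for m using X[of m] that by (simp add: S_def)
  have eq: "(\<Sum>n=Suc a..m. of_real (w n) * x n) = of_real (w m) * S m + (\<Sum>n=Suc a..<m. of_real (w n - w (Suc n)) * S n)"
    if "Suc a \<le> m" for m using that
  proof (induction m rule: dec_induct)
    case base
    then show ?case by (simp add: S_def)
  next
    case (step m)
    have "S (Suc m) = S m + x (Suc m)" using step by (simp add: S_def)
    then show ?case using step by (simp add: algebra_simps)
  qed
  have "(\<Sum>n=Suc a..<b. \<bar>w n - w (Suc n)\<bar>) = \<bar>w b - w (Suc a)\<bar>"
  proof (use mono in \<open>elim disjE\<close>)
    assume m: "\<forall>n. Suc a \<le> n \<longrightarrow> n < b \<longrightarrow> w (Suc n) \<le> w n"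
    have "(\<Sum>n=Suc a..<b. \<bar>w n - w (Suc n)\<bar>) = (\<Sum>n=Suc a..<b. - (w (Suc n) - w n))"
      using m by (intro sum.cong) auto
    also have "\<dots> = - (w b - w (Suc a))" unfolding sum_negf by (subst sum_Suc_diff'[OF ab']) simp
    finally have e: "(\<Sum>n=Suc a..<b. \<bar>w n - w (Suc n)\<bar>) = - (w b - w (Suc a))" .
    moreover have "0 \<le> (\<Sum>n=Suc a..<b. \<bar>w n - w (Suc n)\<bar>)" by (intro sum_nonneg) simp
    ultimately show ?thesis by linarith
  next
    assume m: "\<forall>n. Suc a \<le> n \<longrightarrow> n < b \<longrightarrow> w n \<le> w (Suc n)"
    have "(\<Sum>n=Suc a..<b. \<bar>w n - w (Suc n)\<bar>) = (\<Sum>n=Suc a..<b. w (Suc n) - w n)"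
      using m by (intro sum.cong) auto
    also have "\<dots> = w b - w (Suc a)" by (rule sum_Suc_diff'[OF ab'])
    finally have e: "(\<Sum>n=Suc a..<b. \<bar>w n - w (Suc n)\<bar>) = w b - w (Suc a)" .
    moreover have "0 \<le> (\<Sum>n=Suc a..<b. \<bar>w n - w (Suc n)\<bar>)" by (intro sum_nonneg) simp
    ultimately show ?thesis by linarith
  qed
  moreover have "\<bar>w b - w (Suc a)\<bar> \<le> W" using w[of b] w[of "Suc a"] ab' by auto
  ultimately have var: "(\<Sum>n=Suc a..<b. \<bar>w n - w (Suc n)\<bar>) \<le> W" by simp
  have "norm (\<Sum>n=Suc a..b. of_real (w n) * x n) \<le> norm (of_real (w b) * S b) + norm (\<Sum>n=Suc a..<b. of_real (w n - w (Suc n)) * S n)"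
    unfolding eq[OF ab'] by (rule norm_triangle_ineq)
  also have "norm (of_real (w b) * S b) \<le> W * K"
    using w[of b] S[of b] ab' W by (simp only: norm_mult norm_of_real) (intro mult_mono, auto)
  also have "norm (\<Sum>n=Suc a..<b. of_real (w n - w (Suc n)) * S n) \<le> (\<Sum>n=Suc a..<b. \<bar>w n - w (Suc n)\<bar> * K)"
    using S by (intro order.trans[OF norm_sum] sum_mono) (simp only: norm_mult norm_of_real, intro mult_left_mono, auto)
  also have "\<dots> \<le> W * K" unfolding sum_distrib_right[symmetric] using var K by (rule mult_right_mono)
  finally show ?thesis by (simp add: mult_ac)
qed

text \<open>The block estimates require M \<le> 2N, so a long range is cut at A, 2A, 4A, ...; each
  doubling costs one K.\<close>

lemma dyadic_sum_bound:
  fixes x :: "nat \<Rightarrow> complex"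
  assumes blk: "\<And>N M. A \<le> N \<Longrightarrow> N \<le> M \<Longrightarrow> M \<le> 2 * N \<Longrightarrow> M \<le> B0 \<Longrightarrow> norm (\<Sum>n=Suc N..M. x n) \<le> K"
    and K: "0 \<le> K" and AB: "A \<le> B" "B \<le> 2 ^ k * A" "B \<le> B0"
  shows "norm (\<Sum>n=Suc A..B. x n) \<le> real k * K"
  using AB
proof (induction k arbitrary: B)
  case 0
  then show ?case by simp
next
  case (Suc k)
  show ?case
  proof (cases "B \<le> 2 ^ k * A")
    case True
    then have "norm (\<Sum>n=Suc A..B. x n) \<le> real k * K" using Suc by blast
    also have "\<dots> \<le> real (Suc k) * K" using K by (simp add: algebra_simps)
    finally show ?thesis .
  next
    case False
    define M where "M = 2 ^ k * A"
    have M: "A \<le> M" "M \<le> B" "B \<le> 2 * M" using False Suc.prems by (auto simp: M_def)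
    have "norm (\<Sum>n=Suc A..M. x n) \<le> real k * K" using M Suc by (intro Suc.IH) (auto simp: M_def)
    moreover have "norm (\<Sum>n=Suc M..B. x n) \<le> K" using M Suc.prems by (intro blk) auto
    moreover have "(\<Sum>n=Suc A..B. x n) = (\<Sum>n=Suc A..M. x n) + (\<Sum>n=Suc M..B. x n)"
      using M by (intro sum_split_Suc) auto
    ultimately have "norm (\<Sum>n=Suc A..B. x n) \<le> real k * K + K" by (metis norm_triangle_mono)
    then show ?thesis by (simp add: algebra_simps)
  qed
qed

text \<open>Both directions occur: the exponent -\<sigma> is positive on the line Re s = -2/108 and
  negative on Re s = 1/2 - 1/108.\<close>

lemma powr_monotone_disj:
  "(\<forall>n. Suc a \<le> n \<longrightarrow> n < b \<longrightarrow> real (Suc n) powr r \<le> real n powr r) \<or>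
   (\<forall>n. Suc a \<le> n \<longrightarrow> n < b \<longrightarrow> real n powr r \<le> real (Suc n) powr r)"
proof (cases "r \<ge> 0")
  case True
  have "real n powr r \<le> real (Suc n) powr r" for n using True by (intro powr_mono2) auto
  then show ?thesis by blast
next
  case False
  have "real (Suc n) powr r \<le> real n powr r" if "Suc a \<le> n" for n using False that by (intro powr_mono2') auto
  then show ?thesis by blast
qed

lemma van_der_corput_weighted:
  "\<exists>C>0. \<forall>t\<ge>1. \<forall>\<sigma> A B k W. 1 \<le> A \<longrightarrow> A \<le> B \<longrightarrow> B \<le> 2 ^ k * A \<longrightarrow> real B \<le> 64 * t \<longrightarrow> 0 \<le> W \<longrightarrow>
     (\<forall>n. A \<le> n \<longrightarrow> n \<le> B \<longrightarrow> real n powr (- \<sigma>) \<le> W) \<longrightarrow>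
     norm (\<Sum>n=Suc A..B. npow (real n) (Complex \<sigma> t)) \<le> real k * (2 * (C * (sqrt t * (1 + ln t))) * W)"
proof -
  obtain C where C: "C > 0" and vdc: "\<And>t N M. 1 \<le> t \<Longrightarrow> N \<le> M \<Longrightarrow> M \<le> 2 * N \<Longrightarrow> real N \<le> 64 * t \<Longrightarrow>
     norm (\<Sum>n=Suc N..M. cis (- t * ln (real n))) \<le> C * (sqrt t * (1 + ln t))"
    using van_der_corput_bound by blast
  show ?thesis
  proof (intro exI[of _ C] conjI C allI impI)
    fix t :: real and \<sigma> W :: real and A B k :: nat
    assume t: "1 \<le> t" and AB: "1 \<le> A" "A \<le> B" "B \<le> 2 ^ k * A" "real B \<le> 64 * t" and W: "0 \<le> W"
      and w: "\<forall>n. A \<le> n \<longrightarrow> n \<le> B \<longrightarrow> real n powr (- \<sigma>) \<le> W"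
    define K where "K = C * (sqrt t * (1 + ln t))"
    have K: "0 \<le> K" using C t by (simp add: K_def)
    show "norm (\<Sum>n=Suc A..B. npow (real n) (Complex \<sigma> t)) \<le> real k * (2 * (C * (sqrt t * (1 + ln t))) * W)"
      unfolding K_def[symmetric]
    proof (rule dyadic_sum_bound[where B0 = B])
      fix N M assume NM: "A \<le> N" "N \<le> M" "M \<le> 2 * N" "M \<le> B"
      have "(\<Sum>n=Suc N..M. npow (real n) (Complex \<sigma> t)) = (\<Sum>n=Suc N..M. of_real (real n powr (- \<sigma>)) * cis (- t * ln (real n)))"
        by (rule sum.cong) (auto simp: npow_Complex)
      also have "norm \<dots> \<le> 2 * K * W"
      proof (rule abel_sum_bound[OF NM(2) W])
        show "norm (\<Sum>n=Suc N..m. cis (- t * ln (real n))) \<le> K" if "N \<le> m" "m \<le> M" for m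
          unfolding K_def using NM AB that by (intro vdc t) auto
        show "0 \<le> real n powr (- \<sigma>) \<and> real n powr (- \<sigma>) \<le> W" if "Suc N \<le> n" "n \<le> M" for n
          using w that NM by auto
        show "(\<forall>n. Suc N \<le> n \<longrightarrow> n < M \<longrightarrow> real (Suc n) powr (- \<sigma>) \<le> real n powr (- \<sigma>)) \<or>
              (\<forall>n. Suc N \<le> n \<longrightarrow> n < M \<longrightarrow> real n powr (- \<sigma>) \<le> real (Suc n) powr (- \<sigma>))"
          by (rule powr_monotone_disj)
      qed
      finally show "norm (\<Sum>n=Suc N..M. npow (real n) (Complex \<sigma> t)) \<le> 2 * K * W" .
    qed (use AB K W in auto)
  qed
qed

lemma kusmin_landau_weighted:
  assumes t: "0 < t" "t \<le> 2 * real A" and AB: "1 \<le> A" "A \<le> B" and W: "0 \<le> W"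
    and w: "\<And>n. A \<le> n \<Longrightarrow> n \<le> B \<Longrightarrow> real n powr (- \<sigma>) \<le> W"
  shows "norm (\<Sum>n=Suc A..B. npow (real n) (Complex \<sigma> t)) \<le> 2 * (12 * real B / t) * W"
proof -
  have "(\<Sum>n=Suc A..B. npow (real n) (Complex \<sigma> t)) = (\<Sum>n=Suc A..B. of_real (real n powr (- \<sigma>)) * cis (- t * ln (real n)))"
    by (rule sum.cong) (auto simp: npow_Complex)
  also have "norm \<dots> \<le> 2 * (12 * real B / t) * W"
  proof (rule abel_sum_bound[OF AB(2) W])
    fix m assume m: "A \<le> m" "m \<le> B"
    show "norm (\<Sum>n=Suc A..m. cis (- t * ln (real n))) \<le> 12 * real B / t"
    proof (cases "Suc A \<le> m")
      case False
      then show ?thesis using t by simp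
    next
      case True
      have B: "0 < real B" using AB by linarith
      have dn: "t / real B \<le> t * ln (real (Suc n)) - t * ln (real n)" "t * ln (real (Suc n)) - t * ln (real n) \<le> 2"
        if n: "Suc A \<le> n" "n < m" for n
      proof -
        have "1 / real B \<le> 1 / real (Suc n)" using n m B by (intro divide_left_mono) auto
        also have "\<dots> \<le> ln (real (Suc n)) - ln (real n)"
          using ln_le_minus_one[of "real n / real (Suc n)"] n by (simp add: ln_div field_simps)
        finally have "t * (1 / real B) \<le> t * (ln (real (Suc n)) - ln (real n))" using t by (intro mult_left_mono) auto
        then show "t / real B \<le> t * ln (real (Suc n)) - t * ln (real n)" by (simp add: right_diff_distrib)
        have "ln (real (Suc n)) - ln (real n) \<le> 1 / real n"
          using ln_le_minus_one[of "real (Suc n) / real n"] n by (simp add: ln_div field_simps)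
        also have "\<dots> \<le> 1 / real A" using n AB by (intro divide_left_mono) auto
        finally have "t * (ln (real (Suc n)) - ln (real n)) \<le> t * (1 / real A)" using t by (intro mult_left_mono) auto
        also have "\<dots> \<le> 2" using t AB by (simp add: field_simps)
        finally show "t * ln (real (Suc n)) - t * ln (real n) \<le> 2" by (simp add: right_diff_distrib)
      qed
      have "norm (\<Sum>n=Suc A..m. cis (t * ln (real n))) \<le> 12 / (t / real B)"
      proof (rule kusmin_landau[OF True])
        show "0 < t / real B" using t B by simp
        have "t / real B \<le> 2" using t AB B by (simp add: field_simps)
        then show "t / real B \<le> pi" using pi_gt3 by linarith
        show "t / real B \<le> t * ln (real (Suc n)) - t * ln (real n)" if "Suc A \<le> n" "n < m" for n using dn that by blast
        show "t * ln (real (Suc n)) - t * ln (real n) \<le> pi" if "Suc A \<le> n" "n < m" for n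
          using dn(2)[OF that] pi_gt3 by linarith
        fix n assume n: "Suc A \<le> n" "Suc n < m"
        have e: "ln (real (Suc k)) - ln (real k) = ln (1 + 1 / real k)" if "1 \<le> k" for k
        proof -
          have "real (Suc k) / real k = 1 + 1 / real k" using that by (simp add: field_simps)
          moreover have "ln (real (Suc k) / real k) = ln (real (Suc k)) - ln (real k)" using that by (simp add: ln_div del: of_nat_Suc)
          ultimately show ?thesis by simp
        qed
        have "ln (1 + 1 / real (Suc n)) \<le> ln (1 + 1 / real n)"
        proof -
          have "1 / real (Suc n) \<le> 1 / real n" using n by (intro divide_left_mono) auto
          moreover have "0 < 1 + 1 / real (Suc n)" by (intro add_pos_nonneg) auto
          ultimately show ?thesis by simp
        qed
        then have "ln (real (Suc (Suc n))) - ln (real (Suc n)) \<le> ln (real (Suc n)) - ln (real n)"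
          using e[of n] e[of "Suc n"] n by (simp del: of_nat_Suc)
        then have "t * (ln (real (Suc (Suc n))) - ln (real (Suc n))) \<le> t * (ln (real (Suc n)) - ln (real n))"
          using t by (intro mult_left_mono) auto
        then show "t * ln (real (Suc (Suc n))) - t * ln (real (Suc n)) \<le> t * ln (real (Suc n)) - t * ln (real n)"
          by (simp only: right_diff_distrib)
      qed
      moreover have "(\<Sum>n=Suc A..m. cis (- t * ln (real n))) = cnj (\<Sum>n=Suc A..m. cis (t * ln (real n)))"
        by (simp add: cis_cnj)
      then have "norm (\<Sum>n=Suc A..m. cis (- t * ln (real n))) = norm (\<Sum>n=Suc A..m. cis (t * ln (real n)))"
        by (simp only: complex_mod_cnj)
      ultimately show ?thesis by simp
    qed
  next
    show "0 \<le> real n powr (- \<sigma>) \<and> real n powr (- \<sigma>) \<le> W" if "Suc A \<le> n" "n \<le> B" for n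
      using w[of n] that by auto
    show "(\<forall>n. Suc A \<le> n \<longrightarrow> n < B \<longrightarrow> real (Suc n) powr (- \<sigma>) \<le> real n powr (- \<sigma>)) \<or>
          (\<forall>n. Suc A \<le> n \<longrightarrow> n < B \<longrightarrow> real n powr (- \<sigma>) \<le> real (Suc n) powr (- \<sigma>))"
      by (rule powr_monotone_disj)
  qed
  finally show ?thesis .
qed

text \<open>This is \<open>\<zeta>(s)\<close> for \<open>Re s > - 1\<close>, with junk value 0 at the pole \<open>s = 1\<close>.\<close>

definition zet :: "complex \<Rightarrow> complex" where
  "zet s = Zser s / (s - 1)"

text \<open>From \<open>Zser_approx\<close> after division by s - 1; the constant 36 is 6 * 2 * 3,
  from |s| \<le> 2t and |s + 1| \<le> 3t.\<close>

lemma zet_approx: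
  assumes t: "1 \<le> t" and \<sigma>: "- 1/2 \<le> \<sigma>" "\<sigma> \<le> 1" and N: "1 \<le> N"
  shows "norm (zet (Complex \<sigma> t) - (\<Sum>n=1..N. npow (real n) (Complex \<sigma> t)))
    \<le> real N powr (- \<sigma>) + real N powr (1 - \<sigma>) / t + 36 * t\<^sup>2 * real N powr (- \<sigma> - 1)"
proof -
  define s where "s = Complex \<sigma> t"
  have s: "Re s = \<sigma>" "Im s = t" by (auto simp: s_def)
  have s1: "s - 1 \<noteq> 0" using s t by (auto simp: complex_eq_iff)
  have n1: "t \<le> norm (s - 1)" using abs_Im_le_cmod[of "s - 1"] s t by simp
  have n2: "norm s \<le> 2 * t" using cmod_le[of s] s \<sigma> t by linarith
  have n3: "norm (s + 1) \<le> 3 * t" using norm_triangle_ineq[of s 1] n2 t by simp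
  define err where "err = Zser s - zpart N s"
  have err: "norm err \<le> 6 * norm ((s - 1) * s * (s + 1)) * real N powr (- \<sigma> - 1)"
    unfolding err_def using Zser_approx[of s N] s \<sigma> N by simp
  have "zet s - (\<Sum>n=1..N. npow (real n) s) = - (npow (real N) s / 2) + npow (real N) (s - 1) / (s - 1) + err / (s - 1)"
  proof -
    have "Z / c - S = - (x / 2) + y / c + (Z - (c * (S - x / 2) + y)) / c" if "c \<noteq> 0" for Z c S x y :: complex
      using that by (simp add: field_simps)
    from this[OF s1] show ?thesis unfolding zet_def err_def zpart_def .
  qed
  also have "norm \<dots> \<le> norm (npow (real N) s / 2) + norm (npow (real N) (s - 1) / (s - 1)) + norm (err / (s - 1))"
    by (intro order.trans[OF norm_triangle_ineq] add_mono) auto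
  also have "norm (npow (real N) s / 2) \<le> real N powr (- \<sigma>)" using N s by (simp add: norm_divide norm_npow)
  also have "norm (npow (real N) (s - 1) / (s - 1)) \<le> real N powr (1 - \<sigma>) / t"
    using N s n1 t by (simp add: norm_divide norm_npow frac_le)
  also have "norm (err / (s - 1)) \<le> 36 * t\<^sup>2 * real N powr (- \<sigma> - 1)"
  proof -
    have "norm (err / (s - 1)) = norm err / norm (s - 1)" by (rule norm_divide)
    also have "\<dots> \<le> (6 * norm ((s - 1) * s * (s + 1)) * real N powr (- \<sigma> - 1)) / norm (s - 1)"
      using err by (rule divide_right_mono) simp
    also have "\<dots> = 6 * (norm s * norm (s + 1)) * real N powr (- \<sigma> - 1)" using s1 by (simp add: norm_mult)
    also have "\<dots> \<le> 6 * ((2 * t) * (3 * t)) * real N powr (- \<sigma> - 1)"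
      using n2 n3 t by (intro mult_right_mono mult_left_mono mult_mono) auto
    finally show ?thesis by (simp add: power2_eq_square)
  qed
  finally show ?thesis by (simp add: s_def)
qed

section \<open>Size of zeta on Re s = -2/108 and on Re s = 1/2 - 1/108\<close>

lemma quartic_ineq:
  fixes a b c :: real
  shows "(a + b + c) ^ 4 \<le> 27 * (a ^ 4 + b ^ 4 + c ^ 4)"
proof -
  have sq: "(x + y + z)\<^sup>2 \<le> 3 * (x\<^sup>2 + y\<^sup>2 + z\<^sup>2)" for x y z :: real
  proof -
    have "0 \<le> (x - y)\<^sup>2 + (y - z)\<^sup>2 + (x - z)\<^sup>2" by simp
    then show ?thesis by (simp add: power2_eq_square algebra_simps)
  qed
  have "(a + b + c) ^ 4 = ((a + b + c)\<^sup>2)\<^sup>2" by simp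
  also have "\<dots> \<le> (3 * (a\<^sup>2 + b\<^sup>2 + c\<^sup>2))\<^sup>2" by (intro power_mono sq) simp
  also have "\<dots> = 9 * (a\<^sup>2 + b\<^sup>2 + c\<^sup>2)\<^sup>2" unfolding power_mult_distrib by simp
  also have "\<dots> \<le> 9 * (3 * ((a\<^sup>2)\<^sup>2 + (b\<^sup>2)\<^sup>2 + (c\<^sup>2)\<^sup>2))" by (intro mult_left_mono sq) simp
  finally show ?thesis by simp
qed

text \<open>The solutions of p q = p' q' are parametrised by p = g a, q = b h, p' = g b, q' = a h
  with g = gcd(p, p'). Then 1/(p q) = 1/(g h a b), and letting the four variables run freely up to N
  only enlarges the sum.\<close>

lemma sum_same_product_le:
  "(\<Sum>(p, q, p', q') \<in> {(p, q, p', q'). p \<in> {1..N} \<and> q \<in> {1..N} \<and> p' \<in> {1..N} \<and> q' \<in> {1..N} \<and> p * q = p' * q'}. 1 / real (p * q))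
   \<le> (harm N :: real) ^ 4"
proof -
  let ?S = "{(p, q, p', q'). p \<in> {1..N} \<and> q \<in> {1..N} \<and> p' \<in> {1..N} \<and> q' \<in> {1..N} \<and> p * q = p' * q'}"
  let ?T = "{1..N} \<times> {1..N} \<times> {1..N} \<times> {1..N}"
  have fin: "finite ?S" by (rule finite_subset[of _ ?T]) auto
  have "(\<Sum>(p, q, p', q') \<in> ?S. 1 / real (p * q)) \<le> (\<Sum>(g, h, a, b)\<in>?T. 1 / (real g * real h * real a * real b))"
  proof (rule sum_le_included[where i = "\<lambda>(g, h, a, b). (g * a, b * h, g * b, a * h)"])
    show "\<forall>x\<in>?S. \<exists>y\<in>?T. (case y of (g, h, a, b) \<Rightarrow> (g * a, b * h, g * b, a * h)) = x \<and>
       (case x of (p, q, p', q') \<Rightarrow> 1 / real (p * q)) \<le> (case y of (g, h, a, b) \<Rightarrow> 1 / (real g * real h * real a * real b))"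
    proof
      fix x assume "x \<in> ?S"
      then obtain p q p' q' where x: "x = (p, q, p', q')" and r: "p \<in> {1..N}" "q \<in> {1..N}" "p' \<in> {1..N}" "q' \<in> {1..N}"
        and e: "p * q = p' * q'" by auto
      define g where "g = gcd p p'"
      have g0: "0 < g" using r by (simp add: g_def)
      define a b where "a = p div g" and "b = p' div g"
      have pa: "p = g * a" and pb: "p' = g * b" by (auto simp: a_def b_def g_def)
      have cop: "coprime a b" unfolding a_def b_def g_def using r by (intro div_gcd_coprime) auto
      have "g * (a * q) = g * (b * q')" using e by (simp add: pa pb mult.assoc)
      then have e2: "a * q = b * q'" using g0 by simp
      then have "b dvd a * q" by simp
      then have "b dvd q" using cop by (simp add: coprime_commute coprime_dvd_mult_right_iff)
      then obtain h where h: "q = b * h" by blast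
      have pos: "0 < a" "0 < b" "0 < h" using r pa pb h by (auto intro: gr0I)
      have "b * (a * h) = b * q'" using e2 h by (simp add: mult_ac)
      then have q': "q' = a * h" using pos by simp
      have "g \<le> p" "a \<le> p" "b \<le> p'" "h \<le> q" using pa pb h pos g0 by auto
      then have "(g, h, a, b) \<in> ?T" using r pos g0 by auto
      moreover have "1 / real (p * q) \<le> 1 / (real g * real h * real a * real b)" by (simp add: pa h mult_ac)
      ultimately show "\<exists>y\<in>?T. (case y of (g, h, a, b) \<Rightarrow> (g * a, b * h, g * b, a * h)) = x \<and>
        (case x of (p, q, p', q') \<Rightarrow> 1 / real (p * q)) \<le> (case y of (g, h, a, b) \<Rightarrow> 1 / (real g * real h * real a * real b))"
        by (intro bexI[of _ "(g, h, a, b)"]) (auto simp: x pa[symmetric] pb[symmetric] h[symmetric] q'[symmetric])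
    qed
  qed (use fin in auto)
  also have "\<dots> = (\<Sum>g\<in>{1..N}. \<Sum>h\<in>{1..N}. \<Sum>a\<in>{1..N}. \<Sum>b\<in>{1..N}. 1 / (real g * real h * real a * real b))"
    by (simp add: sum.cartesian_product split_def)
  also have "\<dots> = (\<Sum>g\<in>{1..N}. 1 / real g * (\<Sum>h\<in>{1..N}. 1 / real h * (\<Sum>a\<in>{1..N}. 1 / real a * (\<Sum>b\<in>{1..N}. 1 / real b))))"
    by (simp add: sum_distrib_left mult.assoc)
  also have "\<dots> = (harm N :: real) ^ 4"
    by (simp only: sum_distrib_right[symmetric] harm_def inverse_eq_divide power4_eq_xxxx mult.assoc)
  finally show ?thesis .
qed

text \<open>Parameters for the range \<open>u\<^sup>6 \<le> t \<le> 64 u\<^sup>6\<close> with \<open>u = 2\<^sup>j\<close>; \<open>eps\<close> is \<open>u\<^sup>\<delta>\<close> for \<open>\<delta> = 1/108\<close>.\<close>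

definition eps :: "nat \<Rightarrow> real" where "eps j = 2 powr (real j / 108)"
definition uu :: "nat \<Rightarrow> real" where "uu j = 2 ^ j"
definition LL :: "nat \<Rightarrow> real" where "LL j = 1 + real j"

lemma eps_ge1: "1 \<le> eps j" by (simp add: eps_def ge_one_powr_ge_zero)
lemma uu_ge1: "1 \<le> uu j" by (simp add: uu_def)
lemma LL_ge1: "1 \<le> LL j" by (simp add: LL_def)

lemma uu_eq_eps: "uu j = eps j ^ 108"
proof -
  have "eps j ^ 108 = eps j powr 108" using eps_ge1[of j] by (subst powr_numeral) auto
  also have "\<dots> = 2 powr (real j)" by (simp add: eps_def powr_powr)
  also have "\<dots> = uu j" by (simp add: uu_def powr_realpow)
  finally show ?thesis by simp
qed

lemma powr_uu_delta:
  assumes "0 \<le> c"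
  shows "(c * uu j ^ k) powr (real m / 108) = c powr (real m / 108) * eps j ^ (k * m)"
proof -
  have e: "0 < eps j" using eps_ge1[of j] by linarith
  have "(uu j ^ k) powr (real m / 108) = (eps j powr (real (108 * k))) powr (real m / 108)"
    by (simp only: uu_eq_eps power_mult[symmetric] powr_realpow[OF e])
  also have "\<dots> = eps j powr (real (k * m))" by (simp add: powr_powr)
  also have "\<dots> = eps j ^ (k * m)" using e by (rule powr_realpow)
  finally show ?thesis using assms uu_ge1[of j] by (subst powr_mult) auto
qed

lemma powr_64_uu_delta_le: "m \<le> 108 \<Longrightarrow> (64 * uu j ^ k) powr (real m / 108) \<le> 64 * eps j ^ (k * m)"
proof -
  assume m: "m \<le> 108"
  have "(64::real) powr (real m / 108) \<le> 64 powr 1" using m by (intro powr_mono) auto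
  then show ?thesis using eps_ge1[of j] by (subst powr_uu_delta) (auto intro!: mult_right_mono)
qed

lemma ln_uu: "ln (uu j) \<le> real j" "0 \<le> ln (uu j)"
proof -
  have e: "ln (uu j) = real j * ln 2" by (simp add: uu_def ln_realpow)
  show "ln (uu j) \<le> real j" unfolding e using ln_2_less_1 by (intro mult_left_le) auto
  show "0 \<le> ln (uu j)" unfolding e by simp
qed

lemma ln_128_uu6: "1 + ln (128 * uu j ^ 6) \<le> 8 * LL j"
proof -
  have "ln (128 * uu j ^ 6) = ln (2 ^ 7) + 6 * ln (uu j)" using uu_ge1[of j] by (simp add: ln_mult ln_realpow)
  also have "ln ((2::real) ^ 7) = 7 * ln 2" by (subst ln_realpow) auto
  also have "7 * ln 2 + 6 * ln (uu j) \<le> 7 * 1 + 6 * real j" using ln_uu[of j] ln_2_less_1 by (intro add_mono mult_left_mono) auto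
  finally show ?thesis by (simp add: LL_def)
qed

lemma harm_bounds:
  shows "harm (64 * (2 ^ j) ^ 6) \<le> 8 * LL j" "harm ((2 ^ j) ^ 4) \<le> 8 * LL j" "harm ((2 ^ j) ^ 8) \<le> 9 * LL j"
proof -
  have u: "1 \<le> uu j" by (rule uu_ge1)
  have r: "real (64 * (2 ^ j) ^ 6) = 64 * uu j ^ 6" "real ((2 ^ j) ^ 4) = uu j ^ 4" "real ((2 ^ j) ^ 8) = uu j ^ 8"
    by (simp_all add: uu_def)
  have "harm (64 * (2 ^ j) ^ 6) \<le> 1 + ln (64 * uu j ^ 6)" using harm_le_one_plus_ln[of "64 * (2 ^ j) ^ 6"] unfolding r by simp
  also have "\<dots> \<le> 1 + ln (128 * uu j ^ 6)" using u by simp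
  finally show A: "harm (64 * (2 ^ j) ^ 6) \<le> 8 * LL j" using ln_128_uu6[of j] by linarith
  have "harm ((2 ^ j) ^ 4) \<le> (harm (64 * (2 ^ j) ^ 6) :: real)"
  proof (rule harm_mono)
    have "(2 ^ j) ^ 4 \<le> ((2::nat) ^ j) ^ 6" by (intro power_increasing) auto
    then show "(2 ^ j) ^ 4 \<le> 64 * ((2::nat) ^ j) ^ 6" by linarith
  qed
  then show "harm ((2 ^ j) ^ 4) \<le> 8 * LL j" using A by linarith
  have "harm ((2 ^ j) ^ 8) \<le> 1 + ln (uu j ^ 8)" using harm_le_one_plus_ln[of "(2 ^ j) ^ 8"] unfolding r by simp
  also have "ln (uu j ^ 8) = 8 * ln (uu j)" using u by (subst ln_realpow) auto
  finally show "harm ((2 ^ j) ^ 8) \<le> 9 * LL j" using ln_uu[of j] by (simp add: LL_def)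
qed

lemma sqrt_t_ln_t_le:
  assumes "1 \<le> t" "t \<le> 128 * uu j ^ 6"
  shows "sqrt t * (1 + ln t) \<le> 96 * (uu j ^ 3 * LL j)"
proof -
  have "128 * uu j ^ 6 \<le> 144 * uu j ^ 6" using uu_ge1[of j] by simp
  then have "t \<le> 144 * uu j ^ 6" using assms(2) by linarith
  then have "t \<le> (12 * uu j ^ 3)\<^sup>2" by (simp add: power_mult_distrib flip: power_mult)
  then have "sqrt t \<le> 12 * uu j ^ 3" using uu_ge1[of j] by (intro real_le_lsqrt) auto
  moreover have "1 + ln t \<le> 8 * LL j"
  proof -
    have "ln t \<le> ln (128 * uu j ^ 6)" using assms by (subst ln_le_cancel_iff) auto
    then show ?thesis using ln_128_uu6[of j] by linarith
  qed
  ultimately have "sqrt t * (1 + ln t) \<le> (12 * uu j ^ 3) * (8 * LL j)"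
    using assms uu_ge1[of j] by (intro mult_mono) auto
  then show ?thesis by simp
qed

lemma norm_add4: "norm (a + b + c + d) \<le> norm a + norm b + norm c + norm d" for a b c d :: complex
  using norm_triangle_ineq[of "a + b + c" d] norm_triangle_ineq[of "a + b" c] norm_triangle_ineq[of a b] by linarith

text \<open>Slightly left of Re s = 0 the size of zeta is t^(1/2), that is u^3, up to small factors.
  The range of t goes up to 128 u^6 because the argument 2z - 1 doubles the imaginary part.\<close>

lemma zet_left_bound:
  "\<exists>C>0. \<forall>j t. uu j ^ 6 \<le> t \<longrightarrow> t \<le> 128 * uu j ^ 6 \<longrightarrow>
     norm (zet (Complex (- (2/108)) t)) \<le> C * (uu j ^ 3 * eps j ^ 18 * LL j ^ 2)"
proof -
  obtain C where C: "C > 0" and vdc: "\<And>t \<sigma> A B k W. 1 \<le> t \<Longrightarrow> 1 \<le> A \<Longrightarrow> A \<le> B \<Longrightarrow> B \<le> 2 ^ k * A \<Longrightarrow> real B \<le> 64 * t \<Longrightarrow> 0 \<le> W \<Longrightarrow>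
     (\<And>n. A \<le> n \<Longrightarrow> n \<le> B \<Longrightarrow> real n powr (- \<sigma>) \<le> W) \<Longrightarrow>
     norm (\<Sum>n=Suc A..B. npow (real n) (Complex \<sigma> t)) \<le> real k * (2 * (C * (sqrt t * (1 + ln t))) * W)"
    using van_der_corput_weighted by meson
  define D where "D = 1 + 6 * (2 * (C * 96) * 64) + 98304 + 64 + 4096 + 589824"
  show ?thesis
  proof (intro exI[of _ D] conjI allI impI)
    show "D > 0" using C by (simp add: D_def add_pos_pos)
    fix j :: nat and t :: real assume t: "uu j ^ 6 \<le> t" "t \<le> 128 * uu j ^ 6"
    define u e L where "u = uu j" and "e = eps j" and "L = LL j"
    have ge1: "1 \<le> u" "1 \<le> e" "1 \<le> L" by (auto simp: u_def e_def L_def uu_ge1 eps_ge1 LL_ge1)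
    have t1: "1 \<le> t" using t(1) one_le_power[OF uu_ge1, of j 6] by linarith
    define Q where "Q = u ^ 3 * e ^ 18 * L ^ 2"
    have Qge: "u ^ a * e ^ b * L ^ c \<le> Q" if "a \<le> 3" "b \<le> 18" "c \<le> 2" for a b c
      unfolding Q_def using ge1 that by (intro mult_mono power_increasing) auto
    have Q1: "1 \<le> Q" using Qge[of 0 0 0] by simp
    have Qu: "u ^ 3 * e ^ 18 \<le> Q" using Qge[of 3 18 0] by simp
    have Qe: "e ^ 18 \<le> Q" using Qge[of 0 18 0] by simp
    define \<sigma> :: real where "\<sigma> = - (2/108)"
    \<comment> \<open>Van der Corput covers n \<le> N2, since N2 \<le> 64 t, and Kusmin-Landau the
      rest. Stopping at N3, about t^(3/2), balances the remaining errors: N3/t and t^2/N3 are both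
      of order u^3.\<close>
    define N2 N3 :: nat where "N2 = 64 * (2 ^ j) ^ 6" and "N3 = 64 * (2 ^ j) ^ 9"
    have rN2: "real N2 = 64 * u ^ 6" and rN3: "real N3 = 64 * u ^ 9" by (auto simp: N2_def N3_def u_def uu_def)
    have N: "1 \<le> N2" "N2 \<le> N3"
    proof -
      show "1 \<le> N2" by (simp add: N2_def)
      have "real N2 \<le> real N3" unfolding rN2 rN3 using ge1 by (intro mult_left_mono power_increasing) auto
      then show "N2 \<le> N3" by simp
    qed
    have w2: "real n powr (- \<sigma>) \<le> 64 * e ^ 12" if "n \<le> N2" for n
    proof -
      have "real n powr (2/108) \<le> (64 * u ^ 6) powr (2/108)" using that rN2 by (intro powr_mono2) linarith+
      also have "\<dots> \<le> 64 * e ^ 12" using powr_64_uu_delta_le[of 2 j 6] by (simp add: u_def e_def)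
      finally show ?thesis by (simp add: \<sigma>_def)
    qed
    have N3w: "(64 * u ^ 9) powr (2/108) \<le> 64 * e ^ 18" using powr_64_uu_delta_le[of 2 j 9] by (simp add: u_def e_def)
    have w3: "real n powr (- \<sigma>) \<le> 64 * e ^ 18" if "n \<le> N3" for n
    proof -
      have "real n powr (2/108) \<le> (64 * u ^ 9) powr (2/108)" using that rN3 by (intro powr_mono2) linarith+
      also note N3w
      finally show ?thesis by (simp add: \<sigma>_def)
    qed
    have b1: "norm (\<Sum>n=Suc 1..N2. npow (real n) (Complex \<sigma> t)) \<le> (6 * (2 * (C * 96) * 64)) * Q"
    proof -
      have "norm (\<Sum>n=Suc 1..N2. npow (real n) (Complex \<sigma> t)) \<le> real (6 + 6 * j) * (2 * (C * (sqrt t * (1 + ln t))) * (64 * e ^ 12))"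
      proof (rule vdc[OF t1])
        show "N2 \<le> 2 ^ (6 + 6 * j) * 1" by (simp add: N2_def power_add power_mult[symmetric] mult.commute)
        show "real N2 \<le> 64 * t" using t(1) by (simp add: rN2 u_def)
      qed (use N w2 ge1 in auto)
      also have "real (6 + 6 * j) = 6 * L" by (simp add: L_def LL_def)
      also have "6 * L * (2 * (C * (sqrt t * (1 + ln t))) * (64 * e ^ 12)) \<le> 6 * L * (2 * (C * (96 * (u ^ 3 * L))) * (64 * e ^ 12))"
        using sqrt_t_ln_t_le[OF t1 t(2)] ge1 C by (intro mult_left_mono mult_right_mono) (auto simp: u_def L_def)
      also have "\<dots> = (6 * (2 * (C * 96) * 64)) * (u ^ 3 * e ^ 12 * L ^ 2)" by (simp add: power2_eq_square)
      also have "\<dots> \<le> (6 * (2 * (C * 96) * 64)) * Q" using C by (intro mult_left_mono Qge) auto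
      finally show ?thesis .
    qed
    have u9t: "u ^ 9 / t \<le> u ^ 3"
    proof -
      have "u ^ 9 / t \<le> u ^ 9 / u ^ 6" using t(1) t1 ge1 by (intro divide_left_mono mult_pos_pos) (auto simp: u_def)
      also have "\<dots> = u ^ 3" using ge1 by (simp add: power_diff[symmetric])
      finally show ?thesis .
    qed
    have b2: "norm (\<Sum>n=Suc N2..N3. npow (real n) (Complex \<sigma> t)) \<le> 98304 * Q"
    proof -
      have "norm (\<Sum>n=Suc N2..N3. npow (real n) (Complex \<sigma> t)) \<le> 2 * (12 * real N3 / t) * (64 * e ^ 18)"
        by (rule kusmin_landau_weighted) (use t t1 N w3 ge1 rN2 in \<open>auto simp: u_def\<close>)
      also have "\<dots> = 98304 * ((u ^ 9 / t) * e ^ 18)" by (simp add: rN3)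
      also have "\<dots> \<le> 98304 * (u ^ 3 * e ^ 18)" using u9t ge1 by (intro mult_left_mono mult_right_mono) auto
      also have "\<dots> \<le> 98304 * Q" using Qu by simp
      finally show ?thesis .
    qed
    have rem: "norm (zet (Complex \<sigma> t) - (\<Sum>n=1..N3. npow (real n) (Complex \<sigma> t)))
      \<le> real N3 powr (- \<sigma>) + real N3 powr (1 - \<sigma>) / t + 36 * t\<^sup>2 * real N3 powr (- \<sigma> - 1)"
      by (rule zet_approx) (use t1 N in \<open>auto simp: \<sigma>_def\<close>)
    have p0: "0 < real N3" using N by linarith
    have r1: "real N3 powr (- \<sigma>) \<le> 64 * Q" using w3[of N3] Qe by linarith
    have r2: "real N3 powr (1 - \<sigma>) / t \<le> 4096 * Q"
    proof -
      have "real N3 powr (1 - \<sigma>) = real N3 * real N3 powr (- \<sigma>)" using p0 powr_add[of "real N3" 1 "- \<sigma>"] by simp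
      also have "\<dots> \<le> (64 * u ^ 9) * (64 * e ^ 18)" using w3[of N3] ge1 by (intro mult_mono) (auto simp: rN3)
      finally have "real N3 powr (1 - \<sigma>) / t \<le> ((64 * u ^ 9) * (64 * e ^ 18)) / t" using t1 by (intro divide_right_mono) auto
      also have "\<dots> = 4096 * ((u ^ 9 / t) * e ^ 18)" by simp
      also have "\<dots> \<le> 4096 * (u ^ 3 * e ^ 18)" using u9t ge1 by (intro mult_left_mono mult_right_mono) auto
      also have "\<dots> \<le> 4096 * Q" using Qu by simp
      finally show ?thesis .
    qed
    have r3: "36 * t\<^sup>2 * real N3 powr (- \<sigma> - 1) \<le> 589824 * Q"
    proof -
      have "real N3 powr (- \<sigma> - 1) = real N3 powr (- \<sigma>) / real N3" using p0 by (simp add: powr_diff)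
      also have "\<dots> \<le> (64 * e ^ 18) / (64 * u ^ 9)" using w3[of N3] ge1 by (intro frac_le) (auto simp: rN3)
      also have "\<dots> = e ^ 18 / u ^ 9" by simp
      finally have a: "real N3 powr (- \<sigma> - 1) \<le> e ^ 18 / u ^ 9" .
      have "t\<^sup>2 \<le> (128 * u ^ 6)\<^sup>2" using t t1 by (intro power_mono) (auto simp: u_def)
      then have "t\<^sup>2 \<le> 16384 * u ^ 12" by (simp add: power_mult_distrib flip: power_mult)
      then have "36 * t\<^sup>2 * real N3 powr (- \<sigma> - 1) \<le> 36 * (16384 * u ^ 12) * (e ^ 18 / u ^ 9)"
        using a ge1 by (intro mult_mono) auto
      also have "\<dots> = 589824 * (u ^ 12 / u ^ 9 * e ^ 18)" by simp
      also have "u ^ 12 / u ^ 9 = u ^ 3" using ge1 by (simp add: power_diff[symmetric])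
      also have "589824 * (u ^ 3 * e ^ 18) \<le> 589824 * Q" using Qu by simp
      finally show ?thesis .
    qed
    have split: "(\<Sum>n=1..N3. npow (real n) (Complex \<sigma> t)) = 1 + (\<Sum>n=Suc 1..N2. npow (real n) (Complex \<sigma> t)) + (\<Sum>n=Suc N2..N3. npow (real n) (Complex \<sigma> t))"
      using sum_split_Suc[of 1 N2 N3 "\<lambda>n. npow (real n) (Complex \<sigma> t)"] sum_split_Suc[of 1 1 N2 "\<lambda>n. npow (real n) (Complex \<sigma> t)"] N by simp
    have "zet (Complex \<sigma> t) = 1 + (\<Sum>n=Suc 1..N2. npow (real n) (Complex \<sigma> t)) + (\<Sum>n=Suc N2..N3. npow (real n) (Complex \<sigma> t))
       + (zet (Complex \<sigma> t) - (\<Sum>n=1..N3. npow (real n) (Complex \<sigma> t)))" unfolding split by simp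
    then have "norm (zet (Complex \<sigma> t)) = norm (1 + (\<Sum>n=Suc 1..N2. npow (real n) (Complex \<sigma> t)) + (\<Sum>n=Suc N2..N3. npow (real n) (Complex \<sigma> t))
       + (zet (Complex \<sigma> t) - (\<Sum>n=1..N3. npow (real n) (Complex \<sigma> t))))" by (rule arg_cong)
    also have "\<dots> \<le> norm (1::complex) + norm (\<Sum>n=Suc 1..N2. npow (real n) (Complex \<sigma> t)) + norm (\<Sum>n=Suc N2..N3. npow (real n) (Complex \<sigma> t))
       + norm (zet (Complex \<sigma> t) - (\<Sum>n=1..N3. npow (real n) (Complex \<sigma> t)))" by (rule norm_add4)
    also have "\<dots> \<le> Q + (6 * (2 * (C * 96) * 64)) * Q + 98304 * Q + (64 * Q + 4096 * Q + 589824 * Q)"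
      using b1 b2 rem r1 r2 r3 Q1 by (intro add_mono) auto
    also have "\<dots> = D * Q" by (simp add: D_def algebra_simps)
    finally show "norm (zet (Complex (- (2/108)) t)) \<le> D * (uu j ^ 3 * eps j ^ 18 * LL j ^ 2)"
      by (simp add: \<sigma>_def Q_def u_def e_def L_def)
  qed
qed

definition sig0 :: real where "sig0 = 1/2 - 1/108"

lemma continuous_npow_line: "continuous_on A (\<lambda>t. npow u (Complex \<sigma> t))"
proof -
  have e: "Complex \<sigma> t = of_real \<sigma> + \<i> * of_real t" for t by (simp add: complex_eq_iff)
  show ?thesis unfolding npow_def e by (intro continuous_intros)
qed

lemma continuous_Zser_line:
  assumes "- 1/2 < \<sigma>"
  shows "continuous_on A (\<lambda>t. Zser (Complex \<sigma> t))"
proof -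
  have e: "(\<lambda>t. Complex \<sigma> t) = (\<lambda>t. of_real \<sigma> + \<i> * of_real t)" by (simp add: complex_eq_iff fun_eq_iff)
  have "continuous_on {s. - 1/2 < Re s} Zser" by (rule holomorphic_on_imp_continuous_on[OF holomorphic_Zser])
  then show ?thesis
    by (rule continuous_on_compose2) (use assms in \<open>auto simp: e intro!: continuous_intros\<close>)
qed

lemma continuous_zet_line:
  assumes "- 1/2 < \<sigma>" "\<sigma> \<noteq> 1"
  shows "continuous_on A (\<lambda>t. zet (Complex \<sigma> t))"
proof -
  have e: "(\<lambda>t. Complex \<sigma> t) = (\<lambda>t. of_real \<sigma> + \<i> * of_real t)" by (simp add: complex_eq_iff fun_eq_iff)
  have "continuous_on A (\<lambda>t. Complex \<sigma> t - 1)" unfolding e by (intro continuous_intros)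
  moreover have "Complex \<sigma> t - 1 \<noteq> 0" for t using assms by (auto simp: complex_eq_iff)
  ultimately show ?thesis unfolding zet_def by (intro continuous_on_divide continuous_Zser_line assms(1)) auto
qed

lemma square_dirichlet_polynomial:
  fixes N :: nat
  defines "r \<equiv> \<lambda>m. card {x \<in> {1..N} \<times> {1..N}. fst x * snd x = m}"
  shows "(\<Sum>n=1..N. npow (real n) (Complex \<sigma> t))\<^sup>2 = (\<Sum>m\<in>{1..N*N}. of_real (real (r m) * real m powr (- \<sigma>)) * cis (- t * ln (real m)))"
proof -
  define S where "S = {1..N} \<times> {1..N}"
  have "(\<Sum>n=1..N. npow (real n) (Complex \<sigma> t))\<^sup>2 = (\<Sum>x\<in>S. npow (real (fst x)) (Complex \<sigma> t) * npow (real (snd x)) (Complex \<sigma> t))"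
    by (simp add: power2_eq_square sum_product sum.cartesian_product S_def split_def)
  also have "\<dots> = (\<Sum>x\<in>S. npow (real (fst x * snd x)) (Complex \<sigma> t))"
    by (rule sum.cong) (auto simp: npow_def S_def ln_mult distrib_left simp flip: exp_add)
  also have "\<dots> = (\<Sum>m\<in>{1..N*N}. \<Sum>x | x \<in> S \<and> fst x * snd x = m. npow (real (fst x * snd x)) (Complex \<sigma> t))"
  proof (rule sum.group[symmetric])
    show "(\<lambda>x. fst x * snd x) ` S \<subseteq> {1..N*N}"
    proof
      fix m assume "m \<in> (\<lambda>x. fst x * snd x) ` S"
      then obtain p q where m: "m = p * q" "1 \<le> p" "p \<le> N" "1 \<le> q" "q \<le> N" by (auto simp: S_def)
      have "p * q \<le> N * N" using m by (intro mult_le_mono) auto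
      moreover have "1 \<le> p * q" using m by simp
      ultimately show "m \<in> {1..N*N}" using m by simp
    qed
  qed (auto simp: S_def)
  also have "\<dots> = (\<Sum>m\<in>{1..N*N}. of_nat (r m) * npow (real m) (Complex \<sigma> t))"
    by (rule sum.cong) (auto simp: r_def S_def)
  also have "\<dots> = (\<Sum>m\<in>{1..N*N}. of_real (real (r m) * real m powr (- \<sigma>)) * cis (- t * ln (real m)))"
    by (rule sum.cong) (auto simp: npow_Complex)
  finally show ?thesis .
qed

text \<open>r(m)^2 counts pairs of factorisations of m, so this is the sum over the solutions of p q
  = p' q' in disguise.\<close>

lemma sum_rep_squared_le:
  fixes N :: nat
  defines "r \<equiv> \<lambda>m. card {x \<in> {1..N} \<times> {1..N}. fst x * snd x = m}"
  shows "(\<Sum>m\<in>{1..N*N}. (real (r m))\<^sup>2 / real m) \<le> harm N ^ 4"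
proof -
  define Q where "Q = {(p, q, p', q'). p \<in> {1..N} \<and> q \<in> {1..N} \<and> p' \<in> {1..N} \<and> q' \<in> {1..N} \<and> p * q = p' * (q' :: nat)}"
  define h where "h = (\<lambda>(p, q, p' :: nat, q' :: nat). p * q :: nat)"
  have fin: "finite Q" by (rule finite_subset[of _ "{1..N} \<times> {1..N} \<times> {1..N} \<times> {1..N}"]) (auto simp: Q_def)
  have "(\<Sum>x\<in>Q. 1 / real (h x)) = (\<Sum>m\<in>{1..N*N}. \<Sum>x | x \<in> Q \<and> h x = m. 1 / real (h x))"
  proof (rule sum.group[symmetric])
    show "h ` Q \<subseteq> {1..N*N}"
    proof
      fix m assume "m \<in> h ` Q"
      then obtain p q where m: "m = p * q" "1 \<le> p" "p \<le> N" "1 \<le> q" "q \<le> N" by (auto simp: Q_def h_def)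
      have "p * q \<le> N * N" using m by (intro mult_le_mono) auto
      moreover have "1 \<le> p * q" using m by simp
      ultimately show "m \<in> {1..N*N}" using m by simp
    qed
  qed (auto simp: fin)
  also have "\<dots> = (\<Sum>m\<in>{1..N*N}. (real (r m))\<^sup>2 / real m)"
  proof (rule sum.cong[OF refl])
    fix m
    let ?A = "{x \<in> {1..N} \<times> {1..N}. fst x * snd x = m}"
    have "card {x. x \<in> Q \<and> h x = m} = card (?A \<times> ?A)"
      by (rule bij_betw_same_card[of "\<lambda>(p, q, p', q'). ((p, q), (p', q'))"],
          rule bij_betw_byWitness[where f' = "\<lambda>((p, q), (p', q')). (p, q, p', q')"]) (auto simp: Q_def h_def)
    then have "card {x. x \<in> Q \<and> h x = m} = r m * r m" by (simp add: r_def card_cartesian_product)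
    moreover have "(\<Sum>x | x \<in> Q \<and> h x = m. 1 / real (h x)) = (\<Sum>x | x \<in> Q \<and> h x = m. 1 / real m)"
      by (rule sum.cong) auto
    ultimately show "(\<Sum>x | x \<in> Q \<and> h x = m. 1 / real (h x)) = (real (r m))\<^sup>2 / real m"
      by (simp add: power2_eq_square)
  qed
  finally have "(\<Sum>m\<in>{1..N*N}. (real (r m))\<^sup>2 / real m) = (\<Sum>x\<in>Q. 1 / real (h x))" by simp
  also have "\<dots> = (\<Sum>(p, q, p', q') \<in> Q. 1 / real (p * q))" by (rule sum.cong) (auto simp: h_def)
  also have "\<dots> \<le> harm N ^ 4" unfolding Q_def by (rule sum_same_product_le)
  finally show ?thesis .
qed

lemma powr_two_sig0: "0 < x \<Longrightarrow> (x powr (- sig0))\<^sup>2 = x powr (2/108) / x"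
proof -
  assume x: "0 < x"
  have "(x powr (- sig0))\<^sup>2 = x powr (- sig0 + - sig0)" by (simp only: power2_eq_square powr_add)
  also have "\<dots> = x powr (2/108 - 1)" by (rule arg_cong[where f = "\<lambda>y. x powr y"]) (simp add: sig0_def)
  also have "\<dots> = x powr (2/108) / x" using x by (subst powr_diff) simp
  finally show ?thesis .
qed

text \<open>The fourth power is the square of a Dirichlet polynomial of length N^2 = u^8 with
  divisor-like coefficients, to which the mean value theorem applies. The length u^8 exceeds the
  length u^6 of the interval and determines the bound.\<close>

lemma fourth_moment_short:
  fixes j :: nat
  defines "u \<equiv> uu j" and "e \<equiv> eps j" and "L \<equiv> LL j"
  shows "integral {u^6..64*u^6} (\<lambda>t. norm (\<Sum>n=1..(2^j)^4. npow (real n) (Complex sig0 t)) ^ 4) \<le> 405504 * (u^8 * e^36 * L^6)"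
proof -
  define N :: nat where "N = (2^j)^4"
  define r where "r m = card {x \<in> {1..N} \<times> {1..N}. fst x * snd x = m}" for m
  have ge1: "1 \<le> u" "1 \<le> e" "1 \<le> L" by (auto simp: u_def e_def L_def uu_ge1 eps_ge1 LL_ge1)
  have NN: "N * N = (2^j)^8" by (simp add: N_def flip: power_add)
  have rNN: "real (N * N) = u^8" by (simp add: NN u_def uu_def)
  have T: "u^6 \<le> 64 * u^6" using ge1 by simp
  have "integral {u^6..64*u^6} (\<lambda>t. norm (\<Sum>n=1..N. npow (real n) (Complex sig0 t)) ^ 4)
     = integral {u^6..64*u^6} (\<lambda>t. (norm (\<Sum>m\<in>{1..N*N}. of_real (real (r m) * real m powr (- sig0)) * cis (- t * ln (real m))))\<^sup>2)"
  proof (rule integral_cong)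
    fix t
    have "norm (\<Sum>n=1..N. npow (real n) (Complex sig0 t)) ^ 4 = (norm ((\<Sum>n=1..N. npow (real n) (Complex sig0 t))\<^sup>2))\<^sup>2"
      by (simp add: norm_power flip: power_mult)
    then show "norm (\<Sum>n=1..N. npow (real n) (Complex sig0 t)) ^ 4 = (norm (\<Sum>m\<in>{1..N*N}. of_real (real (r m) * real m powr (- sig0)) * cis (- t * ln (real m))))\<^sup>2"
      unfolding square_dirichlet_polynomial r_def .
  qed
  also have "\<dots> \<le> (64 * u^6 - u^6 + 4 * real (N * N) * harm (N * N)) * (\<Sum>m\<in>{1..N*N}. (norm (complex_of_real (real (r m) * real m powr (- sig0))))\<^sup>2)"
    using mean_value_theorem_dirichlet_polynomial[OF subset_refl T, of "\<lambda>m. of_real (real (r m) * real m powr (- sig0))" "N * N"] by simp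
  also have "\<dots> \<le> (99 * (u^8 * L)) * (e^16 * (8 * L)^4)"
  proof (rule mult_mono)
    have "u^6 \<le> u^8 * L"
    proof -
      have "u^6 * 1 \<le> u^8 * L" using ge1 by (intro mult_mono power_increasing) auto
      then show ?thesis by simp
    qed
    moreover have "u^8 * harm (N * N) \<le> u^8 * (9 * L)" using harm_bounds(3)[of j] ge1 unfolding NN L_def by (intro mult_left_mono) auto
    ultimately show "64 * u^6 - u^6 + 4 * real (N * N) * harm (N * N) \<le> 99 * (u^8 * L)" unfolding rNN by simp
    have "(\<Sum>m\<in>{1..N*N}. (norm (complex_of_real (real (r m) * real m powr (- sig0))))\<^sup>2) \<le> (\<Sum>m\<in>{1..N*N}. e^16 * ((real (r m))\<^sup>2 / real m))"
    proof (rule sum_mono)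
      fix m assume m: "m \<in> {1..N*N}"
      have "real m \<le> u^8" using m rNN by (metis atLeastAtMost_iff of_nat_le_iff)
      then have "real m powr (2/108) \<le> (1 * u^8) powr (real 2/108)" by (simp add: powr_mono2)
      also have "\<dots> = e^16" unfolding u_def by (subst powr_uu_delta) (auto simp: e_def)
      finally have w: "real m powr (2/108) \<le> e^16" .
      have "(norm (complex_of_real (real (r m) * real m powr (- sig0))))\<^sup>2 = (real (r m))\<^sup>2 * (real m powr (- sig0))\<^sup>2"
        by (simp only: norm_of_real power2_abs power_mult_distrib)
      also have "\<dots> = real m powr (2/108) * ((real (r m))\<^sup>2 / real m)" using m by (subst powr_two_sig0) auto
      also have "\<dots> \<le> e^16 * ((real (r m))\<^sup>2 / real m)" using w by (rule mult_right_mono) simp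
      finally show "(norm (complex_of_real (real (r m) * real m powr (- sig0))))\<^sup>2 \<le> e^16 * ((real (r m))\<^sup>2 / real m)" .
    qed
    also have "\<dots> = e^16 * (\<Sum>m\<in>{1..N*N}. (real (r m))\<^sup>2 / real m)" by (rule sum_distrib_left[symmetric])
    also have "\<dots> \<le> e^16 * harm N ^ 4" unfolding r_def using ge1 by (intro mult_left_mono sum_rep_squared_le) auto
    also have "\<dots> \<le> e^16 * (8 * L)^4" using ge1 harm_bounds(2)[of j] by (intro mult_left_mono power_mono) (auto simp: N_def L_def harm_nonneg)
    finally show "(\<Sum>m\<in>{1..N*N}. (norm (complex_of_real (real (r m) * real m powr (- sig0))))\<^sup>2) \<le> e^16 * (8 * L)^4" .
  qed (use ge1 in \<open>auto intro!: sum_nonneg\<close>)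
  also have "\<dots> = 405504 * (u^8 * e^16 * L^5)" by (simp add: power_mult_distrib eval_nat_numeral)
  also have "\<dots> \<le> 405504 * (u^8 * e^36 * L^6)" using ge1 by (intro mult_left_mono mult_mono power_increasing) auto
  finally show ?thesis by (simp add: N_def)
qed

text \<open>For n > u^4 squaring would make the polynomial too long. Instead one factor |B|^2 is
  replaced by its maximum: van der Corput gives |B| of order u^3/u^2 = u, and the mean square of a
  polynomial of length u^6 over an interval of that length is of order u^6, so u^8 again. This
  balance fixes the cut at u^4.\<close>

lemma fourth_moment_middle:
  "\<exists>C>0. \<forall>j. integral {uu j^6..64*uu j^6} (\<lambda>t. norm (\<Sum>n=Suc ((2^j)^4)..64*(2^j)^6. npow (real n) (Complex sig0 t)) ^ 4)
     \<le> C * (uu j^8 * eps j^36 * LL j^6)"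
proof -
  obtain C where C: "C > 0" and vdc: "\<And>t \<sigma> A B k W. 1 \<le> t \<Longrightarrow> 1 \<le> A \<Longrightarrow> A \<le> B \<Longrightarrow> B \<le> 2 ^ k * A \<Longrightarrow> real B \<le> 64 * t \<Longrightarrow> 0 \<le> W \<Longrightarrow>
     (\<And>n. A \<le> n \<Longrightarrow> n \<le> B \<Longrightarrow> real n powr (- \<sigma>) \<le> W) \<Longrightarrow>
     norm (\<Sum>n=Suc A..B. npow (real n) (Complex \<sigma> t)) \<le> real k * (2 * (C * (sqrt t * (1 + ln t))) * W)"
    using van_der_corput_weighted by meson
  define D where "D = (1152 * C)\<^sup>2 * 1080832"
  show ?thesis
  proof (intro exI[of _ D] conjI allI)
    show "D > 0" using C by (simp add: D_def)
    fix j :: nat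
    define u e L where "u = uu j" and "e = eps j" and "L = LL j"
    have ge1: "1 \<le> u" "1 \<le> e" "1 \<le> L" by (auto simp: u_def e_def L_def uu_ge1 eps_ge1 LL_ge1)
    define N1 N2 :: nat where "N1 = (2^j)^4" and "N2 = 64 * (2^j)^6"
    have rN1: "real N1 = u^4" and rN2: "real N2 = 64 * u^6" by (auto simp: N1_def N2_def u_def uu_def)
    have N: "1 \<le> N1" "N1 \<le> N2"
    proof -
      show "1 \<le> N1" by (simp add: N1_def)
      have "(2 ^ j) ^ 4 \<le> ((2::nat) ^ j) ^ 6" by (intro power_increasing) auto
      then show "N1 \<le> N2" unfolding N1_def N2_def by linarith
    qed
    have T: "u^6 \<le> 64 * u^6" using ge1 by simp
    define B where "B t = (\<Sum>n=Suc N1..N2. npow (real n) (Complex sig0 t))" for t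
    have contB: "continuous_on S B" for S unfolding B_def by (intro continuous_intros continuous_npow_line)
    have w: "real n powr (- sig0) \<le> e^4 / u^2" if n: "N1 \<le> n" for n
    proof -
      have "real n powr (- sig0) \<le> (u^4) powr (- sig0)" using n rN1 N ge1 by (intro powr_mono2') (auto simp: sig0_def simp flip: rN1)
      also have "\<dots> = (u^4) powr (1/108) / (u^4) powr (1/2)" by (simp add: sig0_def flip: powr_diff)
      also have "(u^4) powr (1/108) = e^4" using powr_uu_delta[of 1 j 4 1] by (simp add: u_def e_def)
      also have "(u^4) powr (1/2) = u^2" using ge1 by (simp add: powr_half_sqrt real_sqrt_eq_iff real_sqrt_unique flip: power_mult)
      finally show ?thesis .
    qed
    have sup: "norm (B t) \<le> 1152 * C * (u * e^4 * L^2)" if t: "u^6 \<le> t" "t \<le> 64 * u^6" for t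
    proof -
      have t1: "1 \<le> t" using t(1) one_le_power[OF ge1(1), of 6] by linarith
      have "64 * u^6 \<le> 128 * u^6" using ge1 by simp
      then have t2: "t \<le> 128 * uu j^6" using t(2) unfolding u_def by linarith
      have "norm (B t) \<le> real (6 + 2 * j) * (2 * (C * (sqrt t * (1 + ln t))) * (e^4 / u^2))"
        unfolding B_def
      proof (rule vdc[OF t1])
        have "(2::nat) ^ (6 + 2 * j) * (2^j)^4 = 64 * ((2^j)^2 * (2^j)^4)" by (simp add: power_add power_mult[symmetric] mult.commute)
        also have "(2^j)^2 * (2^j)^4 = ((2::nat)^j)^6" by (simp flip: power_add)
        finally show "N2 \<le> 2 ^ (6 + 2 * j) * N1" by (simp add: N1_def N2_def)
        show "real N2 \<le> 64 * t" using t(1) by (simp add: rN2)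
      qed (use N w ge1 in auto)
      also have "\<dots> \<le> (6 * L) * (2 * (C * (96 * (u^3 * L))) * (e^4 / u^2))"
      proof (rule mult_mono)
        show "real (6 + 2 * j) \<le> 6 * L" by (simp add: L_def LL_def)
        show "2 * (C * (sqrt t * (1 + ln t))) * (e^4 / u^2) \<le> 2 * (C * (96 * (u^3 * L))) * (e^4 / u^2)"
          using sqrt_t_ln_t_le[OF t1 t2] C ge1 by (intro mult_left_mono mult_right_mono) (auto simp: u_def L_def)
      qed (use t1 C ge1 in auto)
      also have "\<dots> = 1152 * C * (u * e^4 * L^2)" using ge1 by (simp add: power2_eq_square power3_eq_cube)
      finally show ?thesis .
    qed
    have ms: "integral {u^6..64*u^6} (\<lambda>t. (norm (B t))\<^sup>2) \<le> 1080832 * (u^6 * e^12 * L^2)"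
    proof -
      have "integral {u^6..64*u^6} (\<lambda>t. (norm (B t))\<^sup>2) = integral {u^6..64*u^6} (\<lambda>t. (norm (\<Sum>n\<in>{Suc N1..N2}. of_real (real n powr (- sig0)) * cis (- t * ln (real n))))\<^sup>2)"
      proof (rule integral_cong)
        fix t
        have "B t = (\<Sum>n\<in>{Suc N1..N2}. of_real (real n powr (- sig0)) * cis (- t * ln (real n)))"
          unfolding B_def by (rule sum.cong) (auto simp: npow_Complex)
        then show "(norm (B t))\<^sup>2 = (norm (\<Sum>n\<in>{Suc N1..N2}. of_real (real n powr (- sig0)) * cis (- t * ln (real n))))\<^sup>2" by simp
      qed
      also have "\<dots> \<le> (64 * u^6 - u^6 + 4 * real N2 * harm N2) * (\<Sum>n\<in>{Suc N1..N2}. (norm (complex_of_real (real n powr (- sig0))))\<^sup>2)"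
        by (rule mean_value_theorem_dirichlet_polynomial) (use T in auto)
      also have "\<dots> \<le> (2111 * (u^6 * L)) * (64 * e^12 * (8 * L))"
      proof (rule mult_mono)
        have "u^6 * harm N2 \<le> u^6 * (8 * L)" using harm_bounds(1)[of j] ge1 unfolding N2_def L_def by (intro mult_left_mono) auto
        moreover have "u^6 * 1 \<le> u^6 * L" using ge1 by (intro mult_left_mono) auto
        ultimately show "64 * u^6 - u^6 + 4 * real N2 * harm N2 \<le> 2111 * (u^6 * L)" unfolding rN2 by simp
        have "(\<Sum>n\<in>{Suc N1..N2}. (norm (complex_of_real (real n powr (- sig0))))\<^sup>2) \<le> (\<Sum>n\<in>{Suc N1..N2}. (64 * e^12) * (1 / real n))"
        proof (rule sum_mono)
          fix n assume n: "n \<in> {Suc N1..N2}"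
          have "real n \<le> 64 * u^6" using n rN2 by (metis atLeastAtMost_iff of_nat_le_iff)
          then have "real n powr (2/108) \<le> (64 * u^6) powr (real 2/108)" by (simp add: powr_mono2)
          also have "\<dots> \<le> 64 * e^12" using powr_64_uu_delta_le[of 2 j 6] by (simp add: u_def e_def)
          finally have w: "real n powr (2/108) \<le> 64 * e^12" .
          have "(norm (complex_of_real (real n powr (- sig0))))\<^sup>2 = real n powr (2/108) * (1 / real n)"
            using n powr_two_sig0[of "real n"] by (simp only: norm_of_real power2_abs) simp
          also have "\<dots> \<le> (64 * e^12) * (1 / real n)" using w by (rule mult_right_mono) simp
          finally show "(norm (complex_of_real (real n powr (- sig0))))\<^sup>2 \<le> (64 * e^12) * (1 / real n)" .
        qed
        also have "\<dots> = 64 * e^12 * (\<Sum>n\<in>{Suc N1..N2}. 1 / real n)" by (rule sum_distrib_left[symmetric])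
        also have "\<dots> \<le> 64 * e^12 * harm N2"
          unfolding harm_def inverse_eq_divide using ge1 by (intro mult_left_mono sum_mono2) auto
        also have "\<dots> \<le> 64 * e^12 * (8 * L)" using harm_bounds(1)[of j] ge1 unfolding N2_def L_def by (intro mult_left_mono) auto
        finally show "(\<Sum>n\<in>{Suc N1..N2}. (norm (complex_of_real (real n powr (- sig0))))\<^sup>2) \<le> 64 * e^12 * (8 * L)" .
      qed (use ge1 in \<open>auto intro!: sum_nonneg\<close>)
      also have "\<dots> = 1080832 * (u^6 * e^12 * L^2)" by (simp add: power2_eq_square)
      finally show ?thesis .
    qed
    have "integral {u^6..64*u^6} (\<lambda>t. norm (B t) ^ 4) \<le> integral {u^6..64*u^6} (\<lambda>t. (1152 * C * (u * e^4 * L^2))\<^sup>2 * (norm (B t))\<^sup>2)"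
    proof (rule integral_le)
      show "(\<lambda>t. norm (B t) ^ 4) integrable_on {u^6..64*u^6}" "(\<lambda>t. (1152 * C * (u * e^4 * L^2))\<^sup>2 * (norm (B t))\<^sup>2) integrable_on {u^6..64*u^6}"
        by (intro integrable_continuous_interval continuous_intros contB)+
      fix t assume t: "t \<in> {u^6..64*u^6}"
      have "norm (B t) ^ 4 = (norm (B t))\<^sup>2 * (norm (B t))\<^sup>2" by (simp flip: power_add)
      also have "\<dots> \<le> (1152 * C * (u * e^4 * L^2))\<^sup>2 * (norm (B t))\<^sup>2" using sup[of t] t by (intro mult_right_mono power_mono) auto
      finally show "norm (B t) ^ 4 \<le> (1152 * C * (u * e^4 * L^2))\<^sup>2 * (norm (B t))\<^sup>2" .
    qed
    also have "\<dots> = (1152 * C * (u * e^4 * L^2))\<^sup>2 * integral {u^6..64*u^6} (\<lambda>t. (norm (B t))\<^sup>2)"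
      by (rule integral_mult_right)
    also have "\<dots> \<le> (1152 * C * (u * e^4 * L^2))\<^sup>2 * (1080832 * (u^6 * e^12 * L^2))" using ms by (rule mult_left_mono) simp
    also have "\<dots> = D * (u^8 * e^20 * L^6)" by (simp add: D_def power_mult_distrib eval_nat_numeral)
    also have "\<dots> \<le> D * (u^8 * e^36 * L^6)" using ge1 C by (intro mult_left_mono mult_mono power_increasing) (auto simp: D_def)
    finally show "integral {uu j^6..64*uu j^6} (\<lambda>t. norm (\<Sum>n=Suc ((2^j)^4)..64*(2^j)^6. npow (real n) (Complex sig0 t)) ^ 4)
       \<le> D * (uu j^8 * eps j^36 * LL j^6)" by (simp add: B_def N1_def N2_def u_def e_def L_def)
  qed
qed

text \<open>Past 64 u^6 nothing has to be averaged: Kusmin-Landau gives about u^9/t \<le> u^3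
  against weights n^(-sig0) of size u^(-3), and stopping at 64 u^9 leaves a bounded error, all up to
  powers of \<open>eps\<close>.\<close>

lemma zet_remainder_sig0:
  fixes j :: nat
  defines "u \<equiv> uu j" and "e \<equiv> eps j"
  assumes t: "u^6 \<le> t" "t \<le> 64 * u^6"
  shows "norm (zet (Complex sig0 t) - (\<Sum>n=1..(2^j)^4. npow (real n) (Complex sig0 t)) - (\<Sum>n=Suc ((2^j)^4)..64*(2^j)^6. npow (real n) (Complex sig0 t))) \<le> 32000 * e^9"
proof -
  have ge1: "1 \<le> u" "1 \<le> e" by (auto simp: u_def e_def uu_ge1 eps_ge1)
  have t1: "1 \<le> t" using t(1) one_le_power[OF ge1(1), of 6] by linarith
  define N1 N2 N3 :: nat where "N1 = (2^j)^4" and "N2 = 64 * (2^j)^6" and "N3 = 64 * (2^j)^9"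
  have rN1: "real N1 = u^4" and rN2: "real N2 = 64 * u^6" and rN3: "real N3 = 64 * u^9"
    by (auto simp: N1_def N2_def N3_def u_def uu_def)
  have N: "1 \<le> N1" "N1 \<le> N2" "N2 \<le> N3" "1 \<le> N3"
  proof -
    show "1 \<le> N1" "1 \<le> N3" by (simp_all add: N1_def N3_def)
    have "(2 ^ j) ^ 4 \<le> ((2::nat) ^ j) ^ 6" by (intro power_increasing) auto
    then show "N1 \<le> N2" unfolding N1_def N2_def by linarith
    have "(2 ^ j) ^ 6 \<le> ((2::nat) ^ j) ^ 9" by (intro power_increasing) auto
    then show "N2 \<le> N3" unfolding N3_def N2_def by linarith
  qed
  have e1: "1 \<le> e ^ 9" "e ^ 6 \<le> e ^ 9" using ge1 by (auto intro: power_increasing)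
  have u9t: "u ^ 9 / t \<le> u ^ 3"
  proof -
    have "u ^ 9 / t \<le> u ^ 9 / u ^ 6" using t(1) t1 ge1 by (intro divide_left_mono mult_pos_pos) auto
    also have "\<dots> = u ^ 3" using ge1 by (simp add: power_diff[symmetric])
    finally show ?thesis .
  qed
  have N3d: "real N3 powr (1/108) \<le> 64 * e ^ 9"
    using powr_64_uu_delta_le[of 1 j 9] by (simp add: rN3 u_def e_def)
  have b2: "norm (\<Sum>n=Suc N2..N3. npow (real n) (Complex sig0 t)) \<le> 12288 * e ^ 9"
  proof -
    have "norm (\<Sum>n=Suc N2..N3. npow (real n) (Complex sig0 t)) \<le> 2 * (12 * real N3 / t) * (8 * e ^ 6 / u ^ 3)"
    proof (rule kusmin_landau_weighted)
      fix n assume n: "N2 \<le> n" "n \<le> N3"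
      have "64 * u ^ 6 \<le> real n" using n(1) rN2 by (metis of_nat_le_iff)
      then have "real n powr (- sig0) \<le> (64 * u^6) powr (- sig0)" using ge1 by (intro powr_mono2') (auto simp: sig0_def)
      also have "\<dots> = (64 * u^6) powr (1/108) / (64 * u^6) powr (1/2)" by (simp add: sig0_def flip: powr_diff)
      also have "(64 * u^6) powr (1/2) = 8 * u ^ 3"
      proof -
        have "(64 * u^6) powr (1/2) = sqrt (64 * u^6)" using ge1 by (simp add: powr_half_sqrt)
        also have "\<dots> = sqrt ((8 * u^3)\<^sup>2)" by (rule arg_cong[where f = sqrt]) (simp add: power_mult_distrib flip: power_mult)
        also have "\<dots> = 8 * u^3" using ge1 by (intro real_sqrt_unique) auto
        finally show ?thesis .
      qed
      also have "(64 * u^6) powr (1/108) / (8 * u ^ 3) \<le> (64 * e ^ 6) / (8 * u ^ 3)"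
        using powr_64_uu_delta_le[of 1 j 6] ge1 by (intro divide_right_mono) (auto simp: u_def e_def)
      finally show "real n powr (- sig0) \<le> 8 * e ^ 6 / u ^ 3" by simp
    qed (use t t1 N ge1 rN2 in auto)
    also have "\<dots> = 12288 * (u ^ 9 / t) * e ^ 6 / u ^ 3" by (simp add: rN3)
    also have "\<dots> \<le> 12288 * u ^ 3 * e ^ 6 / u ^ 3" using u9t ge1 by (intro divide_right_mono mult_right_mono mult_left_mono) auto
    also have "\<dots> = 12288 * e ^ 6" using ge1 by simp
    also have "\<dots> \<le> 12288 * e ^ 9" using e1 by simp
    finally show ?thesis .
  qed
  have rem: "norm (zet (Complex sig0 t) - (\<Sum>n=1..N3. npow (real n) (Complex sig0 t)))
    \<le> real N3 powr (- sig0) + real N3 powr (1 - sig0) / t + 36 * t\<^sup>2 * real N3 powr (- sig0 - 1)"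
    by (rule zet_approx) (use t1 N in \<open>auto simp: sig0_def\<close>)
  have p0: "0 < real N3" using N by linarith
  have sq: "8 * u ^ 4 \<le> real N3 powr (1/2)" "real N3 powr (1/2) \<le> 8 * u ^ 5"
  proof -
    have e: "real N3 powr (1/2) = sqrt (64 * u ^ 9)" using ge1 by (simp add: powr_half_sqrt rN3)
    have "(8 * u ^ 4)\<^sup>2 = 64 * u ^ 8" "(8 * u ^ 5)\<^sup>2 = 64 * u ^ 10" by (simp_all add: power_mult_distrib flip: power_mult)
    moreover have "64 * u ^ 8 \<le> 64 * u ^ 9" "64 * u ^ 9 \<le> 64 * u ^ 10" using ge1 by (auto intro: power_increasing)
    ultimately show "8 * u ^ 4 \<le> real N3 powr (1/2)" "real N3 powr (1/2) \<le> 8 * u ^ 5"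
      unfolding e using ge1 by (auto intro!: real_le_rsqrt real_le_lsqrt)
  qed
  have r1: "real N3 powr (- sig0) \<le> e ^ 9"
  proof -
    have "real N3 powr (- sig0) \<le> real N3 powr 0" using N by (intro powr_mono) (auto simp: sig0_def)
    then show ?thesis using p0 e1 by simp
  qed
  have r2: "real N3 powr (1 - sig0) / t \<le> 512 * e ^ 9"
  proof -
    have ex: "1 - sig0 = 1/2 + 1/108" by (simp add: sig0_def)
    have "real N3 powr (1 - sig0) = real N3 powr (1/2) * real N3 powr (1/108)" unfolding ex by (rule powr_add)
    also have "\<dots> \<le> (8 * u ^ 5) * (64 * e ^ 9)" using sq N3d ge1 by (intro mult_mono) auto
    also have "\<dots> \<le> (8 * t) * (64 * e ^ 9)"
    proof -
      have "u ^ 5 \<le> u ^ 6" using ge1 by (intro power_increasing) auto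
      then have "u ^ 5 \<le> t" using t by linarith
      then show ?thesis using ge1 by (intro mult_right_mono mult_left_mono) auto
    qed
    also have "\<dots> = (512 * e ^ 9) * t" by simp
    finally show ?thesis using t1 by (simp add: pos_divide_le_eq)
  qed
  have r3: "36 * t\<^sup>2 * real N3 powr (- sig0 - 1) \<le> 18432 * e ^ 9"
  proof -
    have ex: "- sig0 - 1 = 1/108 - (1/2 + 1)" by (simp add: sig0_def)
    have "real N3 powr (- sig0 - 1) = real N3 powr (1/108) / (real N3 powr (1/2) * real N3)"
      unfolding ex powr_diff powr_add using p0 by simp
    also have "\<dots> \<le> (64 * e ^ 9) / ((8 * u ^ 4) * (64 * u ^ 9))"
      using N3d sq ge1 rN3 by (intro frac_le mult_mono) auto
    also have "\<dots> = e ^ 9 / (8 * u ^ 13)" by (simp flip: power_add)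
    finally have a: "real N3 powr (- sig0 - 1) \<le> e ^ 9 / (8 * u ^ 13)" .
    have "t\<^sup>2 \<le> (64 * u ^ 6)\<^sup>2" using t t1 by (intro power_mono) auto
    then have "t\<^sup>2 \<le> 4096 * u ^ 12" by (simp add: power_mult_distrib flip: power_mult)
    also have "\<dots> \<le> 4096 * u ^ 13" using ge1 by (intro mult_left_mono power_increasing) auto
    finally have "36 * t\<^sup>2 * real N3 powr (- sig0 - 1) \<le> 36 * (4096 * u ^ 13) * (e ^ 9 / (8 * u ^ 13))"
      using a ge1 by (intro mult_mono) auto
    also have "\<dots> = 18432 * e ^ 9" using ge1 by simp
    finally show ?thesis .
  qed
  have split: "(\<Sum>n=1..N3. npow (real n) (Complex sig0 t)) = (\<Sum>n=1..N1. npow (real n) (Complex sig0 t)) + (\<Sum>n=Suc N1..N2. npow (real n) (Complex sig0 t)) + (\<Sum>n=Suc N2..N3. npow (real n) (Complex sig0 t))"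
    using sum_split_Suc[of 1 N2 N3 "\<lambda>n. npow (real n) (Complex sig0 t)"] sum_split_Suc[of 1 N1 N2 "\<lambda>n. npow (real n) (Complex sig0 t)"] N by simp
  have "zet (Complex sig0 t) - (\<Sum>n=1..N1. npow (real n) (Complex sig0 t)) - (\<Sum>n=Suc N1..N2. npow (real n) (Complex sig0 t))
    = (zet (Complex sig0 t) - (\<Sum>n=1..N3. npow (real n) (Complex sig0 t))) + (\<Sum>n=Suc N2..N3. npow (real n) (Complex sig0 t))"
    unfolding split by simp
  also have "norm \<dots> \<le> norm (zet (Complex sig0 t) - (\<Sum>n=1..N3. npow (real n) (Complex sig0 t))) + norm (\<Sum>n=Suc N2..N3. npow (real n) (Complex sig0 t))"
    by (rule norm_triangle_ineq)
  also have "\<dots> \<le> (e ^ 9 + 512 * e ^ 9 + 18432 * e ^ 9) + 12288 * e ^ 9"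
    by (intro add_mono b2 order.trans[OF rem] r1 r2 r3)
  also have "\<dots> \<le> 32000 * e ^ 9" using e1 ge1 by simp
  finally show ?thesis unfolding N1_def N2_def .
qed

lemma fourth_moment:
  "\<exists>C>0. \<forall>j. integral {uu j^6..64*uu j^6} (\<lambda>t. norm (zet (Complex sig0 t)) ^ 4) \<le> C * (uu j^8 * eps j^36 * LL j^6)"
proof -
  obtain C where C: "C > 0" and mid: "\<And>j. integral {uu j^6..64*uu j^6} (\<lambda>t. norm (\<Sum>n=Suc ((2^j)^4)..64*(2^j)^6. npow (real n) (Complex sig0 t)) ^ 4)
     \<le> C * (uu j^8 * eps j^36 * LL j^6)" using fourth_moment_middle by blast
  define D where "D = 27 * (405504 + C + 32000^4 * 63)"
  show ?thesis
  proof (intro exI[of _ D] conjI allI)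
    show "D > 0" using C by (simp add: D_def)
    fix j :: nat
    define u e L where "u = uu j" and "e = eps j" and "L = LL j"
    have ge1: "1 \<le> u" "1 \<le> e" "1 \<le> L" by (auto simp: u_def e_def L_def uu_ge1 eps_ge1 LL_ge1)
    define A where "A t = (\<Sum>n=1..(2^j)^4. npow (real n) (Complex sig0 t))" for t
    define B where "B t = (\<Sum>n=Suc ((2^j)^4)..64*(2^j)^6. npow (real n) (Complex sig0 t))" for t
    define I where "I = {u^6..64*u^6}"
    define Q where "Q = u^8 * e^36 * L^6"
    have iA: "integral I (\<lambda>t. norm (A t) ^ 4) \<le> 405504 * Q"
      using fourth_moment_short[of j] by (simp add: A_def I_def Q_def u_def e_def L_def)
    have iB: "integral I (\<lambda>t. norm (B t) ^ 4) \<le> C * Q"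
      using mid[of j] by (simp add: B_def I_def Q_def u_def e_def L_def)
    have cA: "continuous_on I (\<lambda>t. norm (A t) ^ 4)" unfolding A_def by (intro continuous_intros continuous_npow_line)
    have cB: "continuous_on I (\<lambda>t. norm (B t) ^ 4)" unfolding B_def by (intro continuous_intros continuous_npow_line)
    have cZ: "continuous_on I (\<lambda>t. norm (zet (Complex sig0 t)) ^ 4)"
      by (intro continuous_intros continuous_zet_line) (auto simp: sig0_def)
    have int: "(\<lambda>t. norm (A t) ^ 4) integrable_on I" "(\<lambda>t. norm (B t) ^ 4) integrable_on I" "(\<lambda>t. norm (zet (Complex sig0 t)) ^ 4) integrable_on I"
      "(\<lambda>t. (32000 * e^9)^4 :: real) integrable_on I"
      unfolding I_def by (intro integrable_continuous_interval cA[unfolded I_def] cB[unfolded I_def] cZ[unfolded I_def] continuous_intros)+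
    have "integral I (\<lambda>t. norm (zet (Complex sig0 t)) ^ 4) \<le> integral I (\<lambda>t. 27 * (norm (A t) ^ 4 + norm (B t) ^ 4 + (32000 * e^9)^4))"
    proof (rule integral_le)
      show "(\<lambda>t. 27 * (norm (A t) ^ 4 + norm (B t) ^ 4 + (32000 * e^9)^4)) integrable_on I"
        unfolding I_def by (intro integrable_continuous_interval continuous_intros cA[unfolded I_def] cB[unfolded I_def])
      fix t assume t: "t \<in> I"
      have "norm (zet (Complex sig0 t) - A t - B t) \<le> 32000 * e^9"
        unfolding A_def B_def e_def by (rule zet_remainder_sig0) (use t in \<open>auto simp: I_def u_def\<close>)
      moreover have "norm (zet (Complex sig0 t)) \<le> norm (A t) + norm (B t) + norm (zet (Complex sig0 t) - A t - B t)"
        using norm_triangle_ineq[of "A t + B t" "zet (Complex sig0 t) - A t - B t"] norm_triangle_ineq[of "A t" "B t"] by simp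
      ultimately have "norm (zet (Complex sig0 t)) \<le> norm (A t) + norm (B t) + 32000 * e^9" by linarith
      then have "norm (zet (Complex sig0 t)) ^ 4 \<le> (norm (A t) + norm (B t) + 32000 * e^9) ^ 4" by (rule power_mono) simp
      also have "\<dots> \<le> 27 * (norm (A t) ^ 4 + norm (B t) ^ 4 + (32000 * e^9)^4)" by (rule quartic_ineq)
      finally show "norm (zet (Complex sig0 t)) ^ 4 \<le> 27 * (norm (A t) ^ 4 + norm (B t) ^ 4 + (32000 * e^9)^4)" .
    qed (rule int)
    also have "\<dots> = 27 * (integral I (\<lambda>t. norm (A t) ^ 4) + integral I (\<lambda>t. norm (B t) ^ 4) + integral I (\<lambda>t. (32000 * e^9)^4))"
      by (simp only: integral_mult_right integral_add[OF integrable_add[OF int(1,2)] int(4)] integral_add[OF int(1,2)])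
    also have "integral I (\<lambda>t. (32000 * e^9)^4) = (64*u^6 - u^6) * (32000 * e^9)^4" using ge1 by (simp add: I_def)
    also have "\<dots> = 32000^4 * 63 * (u^6 * e^36 * L^0)" by (simp add: power_mult_distrib flip: power_mult)
    also have "\<dots> \<le> 32000^4 * 63 * Q" unfolding Q_def using ge1 by (intro mult_left_mono mult_mono power_increasing) auto
    also have "27 * (integral I (\<lambda>t. norm (A t) ^ 4) + integral I (\<lambda>t. norm (B t) ^ 4) + 32000^4 * 63 * Q) \<le> 27 * (405504 * Q + C * Q + 32000^4 * 63 * Q)"
      using iA iB by (intro mult_left_mono add_mono) auto
    also have "\<dots> = D * Q" by (simp add: D_def algebra_simps)
    finally have "integral I (\<lambda>t. norm (zet (Complex sig0 t)) ^ 4) \<le> D * Q" by simp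
    then show "integral {uu j^6..64*uu j^6} (\<lambda>t. norm (zet (Complex sig0 t)) ^ 4) \<le> D * (uu j^8 * eps j^36 * LL j^6)"
      by (simp add: I_def Q_def u_def e_def L_def)
  qed
qed

section \<open>Mean value of the integrand on the shifted line\<close>

definition Fz :: "complex \<Rightarrow> complex" where
  "Fz z = zet z ^ 4 * zet (2 * z - 1)"

lemma Fz_moment_dyadic:
  "\<exists>C>0. \<forall>j. integral {64^j..64^Suc j} (\<lambda>t. norm (Fz (Complex sig0 t)) / t\<^sup>2) \<le> C * (2 powr (- real j / 2) * (1 + real j)^8)"
proof -
  obtain C1 where C1: "C1 > 0" and left: "\<And>j t. uu j ^ 6 \<le> t \<Longrightarrow> t \<le> 128 * uu j ^ 6 \<Longrightarrow>
     norm (zet (Complex (- (2/108)) t)) \<le> C1 * (uu j ^ 3 * eps j ^ 18 * LL j ^ 2)" using zet_left_bound by blast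
  obtain C2 where C2: "C2 > 0" and mom: "\<And>j. integral {uu j^6..64*uu j^6} (\<lambda>t. norm (zet (Complex sig0 t)) ^ 4) \<le> C2 * (uu j^8 * eps j^36 * LL j^6)"
    using fourth_moment by blast
  show ?thesis
  proof (intro exI[of _ "C1 * C2"] conjI allI)
    show "C1 * C2 > 0" using C1 C2 by simp
    fix j :: nat
    define u e L where "u = uu j" and "e = eps j" and "L = LL j"
    have ge1: "1 \<le> u" "1 \<le> e" "1 \<le> L" by (auto simp: u_def e_def L_def uu_ge1 eps_ge1 LL_ge1)
    have u6: "u^6 = 64^j"
    proof -
      have "u^6 = ((2::real)^6)^j" unfolding u_def uu_def by (simp only: power_mult[symmetric] mult.commute)
      then show ?thesis by simp
    qed
    have I: "{64^j..64^Suc j} = {u^6..64*u^6}" by (simp add: u6)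
    define K where "K = C1 * (u ^ 3 * e ^ 18 * L ^ 2) / u ^ 12"
    have e: "(\<lambda>t. Complex \<sigma> t) = (\<lambda>t. of_real \<sigma> + \<i> * of_real t)" for \<sigma> by (simp add: complex_eq_iff fun_eq_iff)
    have lin: "2 * Complex sig0 t - 1 = Complex (- (2/108)) (2 * t)" for t by (simp add: sig0_def complex_eq_iff)
    have cF: "continuous_on {u^6..64*u^6} (\<lambda>t. norm (Fz (Complex sig0 t)) / t\<^sup>2)"
    proof -
      have "continuous_on UNIV (\<lambda>t. zet (Complex (- (2/108)) t))" by (intro continuous_zet_line) auto
      then have "continuous_on {u^6..64*u^6} (\<lambda>t. zet (Complex (- (2/108)) (2 * t)))"
        by (rule continuous_on_compose2) (auto intro!: continuous_intros)
      moreover have "continuous_on {u^6..64*u^6} (\<lambda>t. zet (Complex sig0 t))" by (intro continuous_zet_line) (auto simp: sig0_def)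
      moreover have "0 < u^6" using ge1 by simp
      ultimately show ?thesis unfolding Fz_def lin by (intro continuous_intros) auto
    qed
    have cZ: "continuous_on {u^6..64*u^6} (\<lambda>t. norm (zet (Complex sig0 t)) ^ 4)"
      by (intro continuous_intros continuous_zet_line) (auto simp: sig0_def)
    have "integral {u^6..64*u^6} (\<lambda>t. norm (Fz (Complex sig0 t)) / t\<^sup>2) \<le> integral {u^6..64*u^6} (\<lambda>t. K * norm (zet (Complex sig0 t)) ^ 4)"
    proof (rule integral_le)
      show "(\<lambda>t. norm (Fz (Complex sig0 t)) / t\<^sup>2) integrable_on {u^6..64*u^6}" using cF by (rule integrable_continuous_interval)
      show "(\<lambda>t. K * norm (zet (Complex sig0 t)) ^ 4) integrable_on {u^6..64*u^6}"
        by (intro integrable_continuous_interval continuous_intros cZ)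
      fix t assume t: "t \<in> {u^6..64*u^6}"
      have tp: "0 < t" using t ge1 by (auto intro: less_le_trans[of 0 "u^6"])
      have "norm (zet (Complex (- (2/108)) (2 * t))) \<le> C1 * (u ^ 3 * e ^ 18 * L ^ 2)"
        unfolding u_def e_def L_def by (rule left) (use t tp in \<open>auto simp: u_def\<close>)
      then have "norm (Fz (Complex sig0 t)) \<le> norm (zet (Complex sig0 t)) ^ 4 * (C1 * (u ^ 3 * e ^ 18 * L ^ 2))"
        unfolding Fz_def lin norm_mult norm_power by (rule mult_left_mono) simp
      moreover have "u ^ 12 \<le> t\<^sup>2"
      proof -
        have "u ^ 12 = (u^6)\<^sup>2" by (simp flip: power_mult)
        also have "\<dots> \<le> t\<^sup>2" using t ge1 by (intro power_mono) auto
        finally show ?thesis .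
      qed
      ultimately have "norm (Fz (Complex sig0 t)) / t\<^sup>2 \<le> (norm (zet (Complex sig0 t)) ^ 4 * (C1 * (u ^ 3 * e ^ 18 * L ^ 2))) / u ^ 12"
        using ge1 C1 by (intro frac_le mult_nonneg_nonneg) auto
      then show "norm (Fz (Complex sig0 t)) / t\<^sup>2 \<le> K * norm (zet (Complex sig0 t)) ^ 4" by (simp add: K_def mult_ac)
    qed
    also have "\<dots> = K * integral {u^6..64*u^6} (\<lambda>t. norm (zet (Complex sig0 t)) ^ 4)" by (rule integral_mult_right)
    also have "\<dots> \<le> K * (C2 * (u^8 * e^36 * L^6))"
      using mom[of j] ge1 C1 by (intro mult_left_mono) (auto simp: u_def e_def L_def K_def)
    also have "\<dots> = C1 * C2 * ((u ^ 3 * u ^ 8 / u ^ 12) * (e ^ 18 * e ^ 36) * (L ^ 2 * L ^ 6))"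
      unfolding K_def by (simp only: times_divide_eq_left times_divide_eq_right mult_ac)
    \<comment> \<open>The powers of u leave u^(-1). The loss e^54 is u^(54/108) = u^(1/2), so half
      of the saving survives and the dyadic pieces are summable.\<close>
    also have "(u ^ 3 * u ^ 8 / u ^ 12) * (e ^ 18 * e ^ 36) * (L ^ 2 * L ^ 6) = 2 powr (- real j / 2) * (1 + real j)^8"
    proof -
      have "u ^ 3 * u ^ 8 / u ^ 12 = 1 / u" using ge1 by (simp add: eval_nat_numeral)
      moreover have "e ^ 18 * e ^ 36 = 2 powr (real j / 2)"
      proof -
        have "e ^ 18 * e ^ 36 = e ^ 54" by (simp flip: power_add)
        also have "\<dots> = e powr 54" using ge1 by (subst powr_numeral) auto
        also have "\<dots> = 2 powr (real j / 2)" by (simp add: e_def eps_def powr_powr)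
        finally show ?thesis .
      qed
      moreover have "u = 2 powr real j" by (simp add: u_def uu_def powr_realpow)
      moreover have "1 / 2 powr real j * 2 powr (real j / 2) = 2 powr (- real j / 2)"
      proof -
        have "1 / 2 powr real j * 2 powr (real j / 2) = 2 powr (real j / 2 - real j)" by (subst powr_diff) simp
        also have "\<dots> = 2 powr (- real j / 2)" by (rule arg_cong[where f = "\<lambda>y. 2 powr y"]) simp
        finally show ?thesis .
      qed
      moreover have "L ^ 2 * L ^ 6 = (1 + real j)^8" by (simp add: L_def LL_def flip: power_add)
      ultimately show ?thesis by simp
    qed
    finally show "integral {64^j..64^Suc j} (\<lambda>t. norm (Fz (Complex sig0 t)) / t\<^sup>2) \<le> C1 * C2 * (2 powr (- real j / 2) * (1 + real j)^8)"
      unfolding I .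
  qed
qed

lemma continuous_Fz_line: "continuous_on {1..} (\<lambda>t. norm (Fz (Complex sig0 t)) / t\<^sup>2)"
proof -
  have lin: "2 * Complex sig0 t - 1 = Complex (- (2/108)) (2 * t)" for t by (simp add: sig0_def complex_eq_iff)
  have "continuous_on UNIV (\<lambda>t. zet (Complex (- (2/108)) t))" by (intro continuous_zet_line) auto
  then have "continuous_on {1..} (\<lambda>t. zet (Complex (- (2/108)) (2 * t)))"
    by (rule continuous_on_compose2) (auto intro!: continuous_intros)
  moreover have "continuous_on {1..} (\<lambda>t. zet (Complex sig0 t))" by (intro continuous_zet_line) (auto simp: sig0_def)
  ultimately show ?thesis unfolding Fz_def lin by (intro continuous_intros) auto
qed

lemma Fz_moment: "\<exists>C>0. \<forall>R\<ge>1. integral {1..R} (\<lambda>t. norm (Fz (Complex sig0 t)) / t\<^sup>2) \<le> C"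
proof -
  let ?g = "\<lambda>t. norm (Fz (Complex sig0 t)) / t\<^sup>2"
  let ?a = "\<lambda>j. 2 powr (- real j / 2) * (1 + real j)^8"
  obtain C where C: "C > 0" and dy: "\<And>j. integral {64^j..64^Suc j} ?g \<le> C * ?a j" using Fz_moment_dyadic by blast
  have sm: "summable ?a"
  proof (rule summable_comparison_test_bigo)
    show "summable (\<lambda>n. norm (1 / real n ^ 2))" using inverse_power_summable[of 2, where 'a = real] by (simp add: inverse_eq_divide)
    show "?a \<in> O(\<lambda>n. 1 / real n ^ 2)" by real_asymp
  qed
  have int: "?g integrable_on {a..b}" if "1 \<le> a" for a b
    by (rule integrable_continuous_interval, rule continuous_on_subset[OF continuous_Fz_line]) (use that in auto)
  have J: "integral {1..64^J} ?g \<le> C * (\<Sum>j<J. ?a j)" for J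
  proof (induction J)
    case 0
    then show ?case by simp
  next
    case (Suc J)
    have le: "(1::real) \<le> 64^J" "(64::real)^J \<le> 64^Suc J" by auto
    have "integral {1..64^Suc J} ?g = integral {1..64^J} ?g + integral {64^J..64^Suc J} ?g"
      by (rule Henstock_Kurzweil_Integration.integral_combine[symmetric]) (use le int in auto)
    then show ?case using Suc dy[of J] by (simp add: distrib_left)
  qed
  show ?thesis
  proof (intro exI[of _ "C * suminf ?a + 1"] conjI allI impI)
    have s0: "0 \<le> suminf ?a" by (rule suminf_nonneg[OF sm]) simp
    then show "0 < C * suminf ?a + 1" using C by (simp add: add_nonneg_pos)
    fix R :: real assume R: "1 \<le> R"
    obtain J where J': "R < 64 ^ J" using real_arch_pow[of 64 R] by auto
    have "integral {1..R} ?g \<le> integral {1..64^J} ?g"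
      by (rule integral_subset_le) (use J' int in auto)
    also have "\<dots> \<le> C * (\<Sum>j<J. ?a j)" by (rule J)
    also have "\<dots> \<le> C * suminf ?a" using C by (intro mult_left_mono sum_le_suminf sm) auto
    finally show "integral {1..R} ?g \<le> C * suminf ?a + 1" by simp
  qed
qed

section \<open>Perron formula and contour shift\<close>

lemma integrable_inverse_1_plus_square_UNIV: "integrable lborel (\<lambda>t::real. inverse (1 + t\<^sup>2))"
  using integrable_inverse_1_plus_square by (simp add: set_integrable_def)

lemma integral_inverse_1_plus_square_UNIV: "(LINT t|lborel. inverse (1 + t\<^sup>2)) = pi"
  using LBINT_inverse_1_plus_square by (simp add: interval_lebesgue_integral_def set_lebesgue_integral_def)

lemma integrable_of_inverse_square_bound:
  fixes f :: "real \<Rightarrow> complex"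
  assumes "continuous_on UNIV f" "\<And>t. norm (f t) \<le> C / (1 + t\<^sup>2)"
  shows "integrable lborel f"
proof (rule Bochner_Integration.integrable_bound)
  show "integrable lborel (\<lambda>t. C * inverse (1 + t\<^sup>2))"
    by (intro integrable_mult_right integrable_inverse_1_plus_square_UNIV)
  show "f \<in> borel_measurable lborel" using borel_measurable_continuous_onI[OF assms(1)] by simp
  show "AE t in lborel. norm (f t) \<le> norm (C * inverse (1 + t\<^sup>2))"
  proof (rule AE_I2)
    fix t
    have "norm (f t) \<le> C * inverse (1 + t\<^sup>2)" using assms(2)[of t] by (simp add: divide_inverse)
    then show "norm (f t) \<le> norm (C * inverse (1 + t\<^sup>2))" by simp
  qed
qed

lemma symmetric_integral_limit:
  fixes f :: "real \<Rightarrow> 'a :: euclidean_space"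
  assumes int: "integrable lborel f"
  shows "(\<lambda>n. integral {- real n..real n} f) \<longlonglongrightarrow> (LINT t|lborel. f t)"
proof -
  have "(\<lambda>n. LINT t|lborel. indicat_real {- real n..real n} t *\<^sub>R f t) \<longlonglongrightarrow> (LINT t|lborel. f t)"
  proof (rule integral_dominated_convergence[where w = "\<lambda>t. norm (f t)"])
    show "integrable lborel (\<lambda>t. norm (f t))" using int by (rule integrable_norm)
    show "f \<in> borel_measurable lborel" using int by (rule borel_measurable_integrable)
    then show "(\<lambda>t. indicat_real {- real n..real n} t *\<^sub>R f t) \<in> borel_measurable lborel" for n by measurable
    show "AE t in lborel. (\<lambda>n. indicat_real {- real n..real n} t *\<^sub>R f t) \<longlonglongrightarrow> f t"
    proof (rule AE_I2)
      fix t :: real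
      have "\<forall>\<^sub>F n in sequentially. indicat_real {- real n..real n} t *\<^sub>R f t = f t"
        using eventually_ge_at_top[of "nat \<lceil>\<bar>t\<bar>\<rceil>"]
      proof eventually_elim
        case (elim n)
        then have "\<bar>t\<bar> \<le> real n" by linarith
        then show ?case by (simp add: indicator_def abs_le_iff)
      qed
      then show "(\<lambda>n. indicat_real {- real n..real n} t *\<^sub>R f t) \<longlonglongrightarrow> f t" by (rule tendsto_eventually)
    qed
    show "AE t in lborel. norm (indicat_real {- real n..real n} t *\<^sub>R f t) \<le> norm (f t)" for n
      by (rule AE_I2) (simp add: indicator_def)
  qed
  moreover have "(LINT t|lborel. indicat_real {- real n..real n} t *\<^sub>R f t) = integral {- real n..real n} f" for n
  proof -
    have "set_integrable lborel {- real n..real n} f"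
      by (rule set_integrable_subset[of lborel UNIV]) (use int in \<open>auto simp: set_integrable_def\<close>)
    from set_borel_integral_eq_integral(2)[OF this] show ?thesis by (simp add: set_lebesgue_integral_def)
  qed
  ultimately show ?thesis by simp
qed

text \<open>Serves as integration by parts: applied to suitable quotients e^(vz)/..., it yields
  relations between Perron integrals.\<close>

lemma LINT_derivative_eq_0:
  fixes h :: "real \<Rightarrow> complex"
  assumes d: "\<And>t. (h has_vector_derivative h' t) (at t)" and int: "integrable lborel h'"
    and lim: "(\<lambda>n. h (real n) - h (- real n)) \<longlonglongrightarrow> 0"
  shows "(LINT t|lborel. h' t) = 0"
proof -
  have "integral {- real n..real n} h' = h (real n) - h (- real n)" for n
    by (rule integral_unique, rule fundamental_theorem_of_calculus)
       (auto intro: has_vector_derivative_at_within d)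
  then have "(\<lambda>n. h (real n) - h (- real n)) \<longlonglongrightarrow> (LINT t|lborel. h' t)"
    using symmetric_integral_limit[OF int] by simp
  then show ?thesis using lim by (rule LIMSEQ_unique)
qed

lemma Complex_line_eq: "Complex c = (\<lambda>t. of_real c + \<i> * of_real t)"
  by (simp add: complex_eq_iff fun_eq_iff)

lemma continuous_on_line:
  assumes "continuous_on S g" "\<And>t. Complex c t \<in> S"
  shows "continuous_on UNIV (\<lambda>t. g (Complex c t))"
  by (rule continuous_on_compose2[OF assms(1)]) (use assms(2) in \<open>auto simp: Complex_line_eq intro!: continuous_intros\<close>)

lemma vertical_line_derivative:
  assumes "(G has_field_derivative g) (at (Complex c t))"
  shows "((\<lambda>t. G (Complex c t)) has_vector_derivative \<i> * g) (at t)"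
proof -
  have "((\<lambda>t. of_real c + \<i> * of_real t) has_vector_derivative \<i>) (at t)"
    by (auto intro!: derivative_eq_intros)
  then have "(Complex c has_vector_derivative \<i>) (at t)" by (simp only: Complex_line_eq)
  from field_vector_diff_chain_at[OF this assms] show ?thesis by (simp add: o_def)
qed

text \<open>The strip is convex, so \<open>g\<close> has a primitive \<open>G\<close> on it. The
  truncated integrals on both lines are increments of \<open>G\<close>, and their difference
  consists of the increments of \<open>G\<close> along the two horizontal edges, which the decay of
  \<open>g\<close> sends to 0.\<close>

lemma vertical_shift:
  assumes hol: "g holomorphic_on {z. a' < Re z \<and> Re z < b'}" and ab: "a' < a" "a \<le> b" "b < b'"
    and bd: "\<And>z. a \<le> Re z \<Longrightarrow> Re z \<le> b \<Longrightarrow> norm (g z) \<le> C / (1 + (Im z)\<^sup>2)"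
  shows "(LINT t|lborel. g (Complex a t)) = (LINT t|lborel. g (Complex b t))"
proof -
  let ?S = "{z. a' < Re z \<and> Re z < b'}"
  have op: "open ?S" and cv: "convex ?S"
    using open_Int[OF open_halfspace_Re_gt[of a'] open_halfspace_Re_lt[of b']]
      convex_Int[OF convex_halfspace_Re_gt[of a'] convex_halfspace_Re_lt[of b']]
    by (simp_all add: Collect_conj_eq[symmetric])
  obtain G where G: "\<And>z. z \<in> ?S \<Longrightarrow> (G has_field_derivative g z) (at z within ?S)"
    using holomorphic_convex_primitive'[OF cv op hol] by blast
  have G': "(G has_field_derivative g z) (at z)" if "z \<in> ?S" for z
    using G[OF that] at_within_open[OF that op] by simp
  have int: "integrable lborel (\<lambda>t. g (Complex c t))" if c: "a \<le> c" "c \<le> b" for c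
  proof (rule integrable_of_inverse_square_bound)
    show "continuous_on UNIV (\<lambda>t. g (Complex c t))"
      by (rule continuous_on_line[OF holomorphic_on_imp_continuous_on[OF hol]]) (use c ab in auto)
    show "norm (g (Complex c t)) \<le> C / (1 + t\<^sup>2)" for t using bd[of "Complex c t"] c by simp
  qed
  have FT: "\<i> * integral {- real n..real n} (\<lambda>t. g (Complex c t)) = G (Complex c (real n)) - G (Complex c (- real n))"
    if c: "a \<le> c" "c \<le> b" for c n
  proof -
    have "((\<lambda>t. \<i> * g (Complex c t)) has_integral G (Complex c (real n)) - G (Complex c (- real n))) {- real n..real n}"
      by (rule fundamental_theorem_of_calculus)
         (use c ab in \<open>auto intro!: has_vector_derivative_at_within vertical_line_derivative G'\<close>)
    from integral_unique[OF this] show ?thesis by (simp only: integral_mult_right)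
  qed
  define E where "E n = (G (Complex b (real n)) - G (Complex a (real n))) - (G (Complex b (- real n)) - G (Complex a (- real n)))" for n
  have lim: "(\<lambda>n. E n) \<longlonglongrightarrow> \<i> * (LINT t|lborel. g (Complex b t)) - \<i> * (LINT t|lborel. g (Complex a t))"
  proof -
    have "(\<lambda>n. \<i> * integral {- real n..real n} (\<lambda>t. g (Complex b t)) - \<i> * integral {- real n..real n} (\<lambda>t. g (Complex a t)))
       \<longlonglongrightarrow> \<i> * (LINT t|lborel. g (Complex b t)) - \<i> * (LINT t|lborel. g (Complex a t))"
      by (intro tendsto_intros symmetric_integral_limit int) (use ab in auto)
    moreover have "\<i> * integral {- real n..real n} (\<lambda>t. g (Complex b t)) - \<i> * integral {- real n..real n} (\<lambda>t. g (Complex a t)) = E n" for n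
      using FT[of b n] FT[of a n] ab by (simp add: E_def)
    ultimately show ?thesis by simp
  qed
  have edge: "norm (G (Complex b y) - G (Complex a y)) \<le> C / (1 + y\<^sup>2) * (b - a)" for y
  proof -
    let ?L = "closed_segment (Complex a y) (Complex b y)"
    have seg: "a \<le> Re z \<and> Re z \<le> b \<and> Im z = y" if "z \<in> ?L" for z
    proof -
      have "\<exists>u. 0 \<le> u \<and> u \<le> 1 \<and> z = (1 - u) *\<^sub>R Complex a y + u *\<^sub>R Complex b y"
        using that by (simp only: in_segment)
      then obtain u where u: "0 \<le> u" "u \<le> 1" "z = (1 - u) *\<^sub>R Complex a y + u *\<^sub>R Complex b y" by (elim exE conjE)
      have "Re z = a + u * (b - a)" "Re z = b - (1 - u) * (b - a)" "Im z = y"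
        unfolding u(3) by (simp_all add: algebra_simps)
      moreover have "0 \<le> u * (b - a)" "0 \<le> (1 - u) * (b - a)" using u ab by auto
      ultimately show ?thesis by simp
    qed
    have "norm (G (Complex b y) - G (Complex a y)) \<le> C / (1 + y\<^sup>2) * norm (Complex b y - Complex a y)"
    proof (rule field_differentiable_bound[of ?L])
      fix z assume z: "z \<in> ?L"
      show "(G has_field_derivative g z) (at z within ?L)"
        by (rule has_field_derivative_at_within[OF G']) (use seg[OF z] ab in auto)
      show "norm (g z) \<le> C / (1 + y\<^sup>2)" using bd[of z] seg[OF z] by simp
    qed (rule convex_closed_segment ends_in_segment)+
    also have "norm (Complex b y - Complex a y) = b - a" using ab by (simp add: complex_diff complex_norm)
    finally show ?thesis .
  qed
  have "(\<lambda>n. E n) \<longlonglongrightarrow> 0"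
  proof (rule Lim_null_comparison)
    show "\<forall>\<^sub>F n in sequentially. norm (E n) \<le> 2 * (C / (1 + (real n)\<^sup>2) * (b - a))"
    proof (rule always_eventually, rule allI)
      fix n
      have "norm (E n) \<le> norm (G (Complex b (real n)) - G (Complex a (real n))) + norm (G (Complex b (- real n)) - G (Complex a (- real n)))"
        unfolding E_def by (rule norm_triangle_ineq4)
      then show "norm (E n) \<le> 2 * (C / (1 + (real n)\<^sup>2) * (b - a))" using edge[of "real n"] edge[of "- real n"] by simp
    qed
    show "(\<lambda>n. 2 * (C / (1 + (real n)\<^sup>2) * (b - a))) \<longlonglongrightarrow> 0" by real_asymp
  qed
  from LIMSEQ_unique[OF lim this] show ?thesis by simp
qed

text \<open>Splits off one Taylor term in such a way that the remainder is holomorphic on all of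
  \<open>S\<close>, not only near \<open>a\<close>.\<close>

lemma holomorphic_quotient:
  assumes "f holomorphic_on S" "open S" "a \<in> S"
  obtains g where "g holomorphic_on S" "\<And>z. z \<in> S \<Longrightarrow> f z = f a + (z - a) * g z" "g a = deriv f a"
proof -
  define g where "g z = (if z = a then deriv f a else (f z - f a) / (z - a))" for z
  have "g holomorphic_on S" unfolding g_def [abs_def] by (rule pole_lemma_open[OF assms(1,2)])
  moreover have "f z = f a + (z - a) * g z" for z by (simp add: g_def)
  moreover have "g a = deriv f a" by (simp add: g_def)
  ultimately show ?thesis using that by blast
qed

text \<open>Decay has to be checked only for |Im z| \<ge> 1: the remaining rectangle is compact, and
  1 + (Im z)^2 \<le> 2 on it.\<close>

lemma strip_bound_extend:
  assumes cont: "continuous_on {z. a \<le> Re z \<and> Re z \<le> b} g"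
    and bd: "\<And>z. a \<le> Re z \<Longrightarrow> Re z \<le> b \<Longrightarrow> 1 \<le> \<bar>Im z\<bar> \<Longrightarrow> norm (g z) \<le> C / (1 + (Im z)\<^sup>2)"
  shows "\<exists>C'. \<forall>z. a \<le> Re z \<longrightarrow> Re z \<le> b \<longrightarrow> norm (g z) \<le> C' / (1 + (Im z)\<^sup>2)"
proof -
  let ?K = "{z. a \<le> Re z \<and> Re z \<le> b \<and> - 1 \<le> Im z \<and> Im z \<le> 1}"
  have "?K = cbox (Complex a (-1)) (Complex b 1)" by (auto simp: in_cbox_complex_iff)
  then have comp: "compact ?K" by simp
  have "compact (g ` ?K)" by (rule compact_continuous_image[OF continuous_on_subset[OF cont] comp]) auto
  then obtain B where B: "\<And>z. z \<in> ?K \<Longrightarrow> norm (g z) \<le> B" using compact_imp_bounded bounded_iff by (metis (no_types, lifting) imageI)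
  show ?thesis
  proof (intro exI[of _ "max C (2 * \<bar>B\<bar>)"] allI impI)
    fix z assume z: "a \<le> Re z" "Re z \<le> b"
    show "norm (g z) \<le> max C (2 * \<bar>B\<bar>) / (1 + (Im z)\<^sup>2)"
    proof (cases "1 \<le> \<bar>Im z\<bar>")
      case True
      then have "norm (g z) \<le> C / (1 + (Im z)\<^sup>2)" using bd z by blast
      also have "\<dots> \<le> max C (2 * \<bar>B\<bar>) / (1 + (Im z)\<^sup>2)" by (intro divide_right_mono) auto
      finally show ?thesis .
    next
      case False
      then have "norm (g z) \<le> \<bar>B\<bar>" using B[of z] z by (auto simp: abs_if split: if_splits)
      moreover have "(Im z)\<^sup>2 \<le> 1" using False by (simp add: abs_square_le_1)
      then have "\<bar>B\<bar> * (1 + (Im z)\<^sup>2) \<le> \<bar>B\<bar> * 2" by (intro mult_left_mono) auto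
      then have "\<bar>B\<bar> \<le> 2 * \<bar>B\<bar> / (1 + (Im z)\<^sup>2)" by (subst pos_le_divide_eq) (auto simp: add_pos_nonneg)
      also have "\<dots> \<le> max C (2 * \<bar>B\<bar>) / (1 + (Im z)\<^sup>2)" by (intro divide_right_mono) auto
      ultimately show ?thesis by linarith
    qed
  qed
qed

lemma norm_exp_line: "norm (exp (of_real v * z)) = exp (v * Re z)"
  by (simp add: norm_exp_eq_Re)

lemma inverse_square_le:
  fixes z :: complex
  assumes "0 < c" "c \<le> \<bar>Re z\<bar>"
  shows "1 / (norm z)\<^sup>2 \<le> max 1 (1 / c\<^sup>2) / (1 + (Im z)\<^sup>2)"
proof -
  define M where "M = max 1 (1 / c\<^sup>2)"
  have c2: "c\<^sup>2 \<le> (Re z)\<^sup>2" using assms by (metis abs_le_square_iff abs_of_pos)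
  have nz: "(norm z)\<^sup>2 = (Re z)\<^sup>2 + (Im z)\<^sup>2" by (simp add: cmod_power2)
  have p: "0 < (norm z)\<^sup>2" using c2 assms(1) unfolding nz by (intro add_pos_nonneg) (auto intro: less_le_trans[of 0 "c\<^sup>2"])
  have "1 = c\<^sup>2 * (1 / c\<^sup>2)" using assms by simp
  also have "\<dots> \<le> (Re z)\<^sup>2 * M" using c2 by (intro mult_mono) (auto simp: M_def)
  finally have "1 + (Im z)\<^sup>2 * 1 \<le> (Re z)\<^sup>2 * M + (Im z)\<^sup>2 * M" by (intro add_mono mult_left_mono) (auto simp: M_def)
  then have "1 + (Im z)\<^sup>2 \<le> M * (norm z)\<^sup>2" by (simp add: nz algebra_simps)
  then have "1 / (norm z)\<^sup>2 \<le> M / (1 + (Im z)\<^sup>2)" using p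
    by (simp add: divide_le_eq le_divide_eq add_pos_nonneg mult.commute)
  then show ?thesis by (simp add: M_def)
qed

lemma line_limit_0:
  fixes I :: complex
  assumes "\<And>n :: nat. N \<le> n \<Longrightarrow> norm I \<le> (LINT t|lborel. B / ((real n)\<^sup>2 + t\<^sup>2))"
  shows "I = 0"
proof -
  have "(\<lambda>n. LINT t|lborel. B / ((real (Suc n))\<^sup>2 + t\<^sup>2)) \<longlonglongrightarrow> (LINT (t::real)|lborel. (0::real))"
  proof (rule integral_dominated_convergence[where w = "\<lambda>t. \<bar>B\<bar> * inverse (1 + t\<^sup>2)"])
    show "integrable lborel (\<lambda>t. \<bar>B\<bar> * inverse (1 + t\<^sup>2))" by (intro integrable_mult_right integrable_inverse_1_plus_square_UNIV)
    show "AE t in lborel. (\<lambda>n. B / ((real (Suc n))\<^sup>2 + t\<^sup>2)) \<longlonglongrightarrow> 0" by (rule AE_I2) real_asymp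
    show "AE t in lborel. norm (B / ((real (Suc n))\<^sup>2 + t\<^sup>2)) \<le> \<bar>B\<bar> * inverse (1 + t\<^sup>2)" for n
    proof (rule AE_I2)
      fix t :: real
      have "1 \<le> (real (Suc n))\<^sup>2" by (simp add: one_le_power)
      then have "\<bar>B\<bar> / ((real (Suc n))\<^sup>2 + t\<^sup>2) \<le> \<bar>B\<bar> / (1 + t\<^sup>2)" by (intro divide_left_mono mult_pos_pos add_pos_nonneg) auto
      moreover have "0 \<le> (real (Suc n))\<^sup>2 + t\<^sup>2" by simp
      ultimately show "norm (B / ((real (Suc n))\<^sup>2 + t\<^sup>2)) \<le> \<bar>B\<bar> * inverse (1 + t\<^sup>2)"
        by (simp only: real_norm_def abs_divide abs_of_nonneg divide_inverse[of "\<bar>B\<bar>" "1 + t\<^sup>2", symmetric])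
    qed
  qed auto
  then have lim: "(\<lambda>n. LINT t|lborel. B / ((real n)\<^sup>2 + t\<^sup>2)) \<longlonglongrightarrow> 0"
    by (intro LIMSEQ_imp_Suc[of "\<lambda>n. LINT t|lborel. B / ((real n)\<^sup>2 + t\<^sup>2)"]) simp
  have "norm I \<le> 0"
    by (rule LIMSEQ_le_const[OF lim]) (use assms in blast)
  then show ?thesis by simp
qed

lemma integrable_inverse_square_shift:
  assumes "1 \<le> (c::real)"
  shows "integrable lborel (\<lambda>t. B / (c\<^sup>2 + t\<^sup>2))"
proof (rule Bochner_Integration.integrable_bound[of _ "\<lambda>t. \<bar>B\<bar> * inverse (1 + t\<^sup>2)"])
  show "integrable lborel (\<lambda>t. \<bar>B\<bar> * inverse (1 + t\<^sup>2))" by (intro integrable_mult_right integrable_inverse_1_plus_square_UNIV)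
  show "AE t in lborel. norm (B / (c\<^sup>2 + t\<^sup>2)) \<le> norm (\<bar>B\<bar> * inverse (1 + t\<^sup>2))"
  proof (rule AE_I2)
    fix t :: real
    have "1 \<le> c\<^sup>2" using assms by (simp add: one_le_power)
    then have "\<bar>B\<bar> / (c\<^sup>2 + t\<^sup>2) \<le> \<bar>B\<bar> / (1 + t\<^sup>2)" by (intro divide_left_mono mult_pos_pos add_pos_nonneg) auto
    moreover have "0 \<le> c\<^sup>2 + t\<^sup>2" "0 \<le> 1 + t\<^sup>2" by simp_all
    ultimately show "norm (B / (c\<^sup>2 + t\<^sup>2)) \<le> norm (\<bar>B\<bar> * inverse (1 + t\<^sup>2))"
      by (simp only: real_norm_def abs_divide abs_of_nonneg divide_inverse[of "\<bar>B\<bar>" "1 + t\<^sup>2", symmetric])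
  qed
qed auto

text \<open>The line is pushed to Re z = n \<rightarrow> \<infinity>, where the integral of B/(n^2 +
  t^2) tends to 0.\<close>

lemma decaying_line_integral_eq_0:
  assumes c: "0 < c" and hol: "f holomorphic_on {z. 0 < Re z}" and B: "0 \<le> B"
    and bd: "\<And>z. c \<le> Re z \<Longrightarrow> norm (f z) \<le> B / (norm z)\<^sup>2"
  shows "(LINT t|lborel. f (Complex c t)) = 0"
proof (rule line_limit_0)
  fix n :: nat assume n: "nat \<lceil>c\<rceil> + 1 \<le> n"
  then have cn: "c \<le> real n" "1 \<le> real n" by linarith+
  have bd': "norm (f z) \<le> (B * max 1 (1 / c\<^sup>2)) / (1 + (Im z)\<^sup>2)" if "c \<le> Re z" for z
  proof -
    have "norm (f z) \<le> B * (1 / (norm z)\<^sup>2)" using bd[OF that] by simp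
    also have "\<dots> \<le> B * (max 1 (1 / c\<^sup>2) / (1 + (Im z)\<^sup>2))"
      using inverse_square_le[OF c, of z] that c B by (intro mult_left_mono) auto
    finally show ?thesis by simp
  qed
  have "(LINT t|lborel. f (Complex c t)) = (LINT t|lborel. f (Complex (real n) t))"
  proof (rule vertical_shift[where a' = 0 and b' = "real n + 1"])
    show "f holomorphic_on {z. 0 < Re z \<and> Re z < real n + 1}" by (rule holomorphic_on_subset[OF hol]) auto
  qed (use cn c bd' in auto)
  also have "norm \<dots> \<le> (LINT t|lborel. norm (f (Complex (real n) t)))" by (rule integral_norm_bound)
  also have "\<dots> \<le> (LINT t|lborel. B / ((real n)\<^sup>2 + t\<^sup>2))"
  proof (intro integral_mono integrable_norm integrable_inverse_square_shift)
    show "integrable lborel (\<lambda>t. f (Complex (real n) t))"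
    proof (rule integrable_of_inverse_square_bound)
      show "continuous_on UNIV (\<lambda>t. f (Complex (real n) t))"
        by (rule continuous_on_line[OF holomorphic_on_imp_continuous_on[OF hol]]) (use cn in auto)
      show "norm (f (Complex (real n) t)) \<le> (B * max 1 (1 / c\<^sup>2)) / (1 + t\<^sup>2)" for t using bd'[of "Complex (real n) t"] cn by simp
    qed
    show "norm (f (Complex (real n) t)) \<le> B / ((real n)\<^sup>2 + t\<^sup>2)" for t
      using bd[of "Complex (real n) t"] cn by (simp add: cmod_power2)
  qed (use cn in auto)
  finally show "norm (LINT t|lborel. f (Complex c t)) \<le> (LINT t|lborel. B / ((real n)\<^sup>2 + t\<^sup>2))" .
qed

section \<open>Perron integrals\<close>

lemma continuous_line_id: "continuous_on UNIV (\<lambda>t. Complex c t)"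
  by (simp add: Complex_line_eq continuous_intros)

lemma line_exp_square_integrable:
  assumes "c \<noteq> 0"
  shows "integrable lborel (\<lambda>t. exp (of_real v * Complex c t) / (Complex c t)\<^sup>2)"
proof (rule integrable_of_inverse_square_bound)
  have nz: "Complex c t \<noteq> 0" for t using assms by (simp add: complex_eq_iff)
  show "continuous_on UNIV (\<lambda>t. exp (of_real v * Complex c t) / (Complex c t)\<^sup>2)"
    using nz by (intro continuous_intros continuous_line_id) auto
  fix t
  have "norm (exp (of_real v * Complex c t) / (Complex c t)\<^sup>2) = exp (v * c) * (1 / (norm (Complex c t))\<^sup>2)"
    by (simp only: norm_divide norm_power norm_exp_line) simp
  also have "\<dots> \<le> exp (v * c) * (max 1 (1 / c\<^sup>2) / (1 + t\<^sup>2))"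
    using inverse_square_le[of "\<bar>c\<bar>" "Complex c t"] assms by (intro mult_left_mono) auto
  finally show "norm (exp (of_real v * Complex c t) / (Complex c t)\<^sup>2) \<le> (exp (v * c) * max 1 (1 / c\<^sup>2)) / (1 + t\<^sup>2)" by simp
qed

lemma perron_nonpos:
  assumes c: "0 < c" and v: "v \<le> 0"
  shows "(LINT t|lborel. exp (of_real v * Complex c t) / (Complex c t)\<^sup>2) = 0"
proof (rule decaying_line_integral_eq_0[OF c, of "\<lambda>z. exp (of_real v * z) / z\<^sup>2" 1])
  show "(\<lambda>z. exp (of_real v * z) / z\<^sup>2) holomorphic_on {z. 0 < Re z}" by (intro holomorphic_intros) auto
  fix z :: complex assume "c \<le> Re z"
  then have "v * Re z \<le> 0" using v c by (intro mult_nonpos_nonneg) auto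
  then have "norm (exp (of_real v * z)) \<le> 1" by (simp only: norm_exp_line exp_le_one_iff)
  then show "norm (exp (of_real v * z) / z\<^sup>2) \<le> 1 / (norm z)\<^sup>2"
    by (simp only: norm_divide norm_power) (intro divide_right_mono, auto)
qed simp

lemma LINT_uminus_line:
  fixes f :: "complex \<Rightarrow> complex"
  shows "(LINT t|lborel. f (Complex (- c) t)) = (LINT t|lborel. f (- Complex c t))"
proof -
  have "(LINT t|lborel. f (Complex (- c) t)) = \<bar>- 1 :: real\<bar> *\<^sub>R (LINT t|lborel. f (Complex (- c) (0 + (- 1) * t)))"
    by (rule lborel_integral_real_affine) simp
  moreover have "Complex (- c) (0 + (- 1) * t) = - Complex c t" for t by (simp add: complex_eq_iff)
  ultimately show ?thesis by simp
qed

lemma LINT_arctan: "(LINT (t::real)|lborel. 1 / (1/4 + t\<^sup>2)) = 2 * (pi :: real)"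
proof -
  have "(LINT (t::real)|lborel. 1 / (1/4 + t\<^sup>2)) = \<bar>1/2 :: real\<bar> *\<^sub>R (LINT (t::real)|lborel. 1 / (1/4 + (0 + (1/2) * t)\<^sup>2))"
    by (rule lborel_integral_real_affine) simp
  also have "(\<lambda>t::real. 1 / (1/4 + (0 + (1/2) * t)\<^sup>2)) = (\<lambda>t. 4 * inverse (1 + t\<^sup>2))"
  proof
    fix t :: real
    have e: "1/4 + (0 + (1/2) * t)\<^sup>2 = (1 + t\<^sup>2) / 4" by (simp add: power2_eq_square)
    show "1 / (1/4 + (0 + (1/2) * t)\<^sup>2) = 4 * inverse (1 + t\<^sup>2)"
      unfolding e divide_divide_eq_right mult_1_left by (rule divide_inverse)
  qed
  finally show ?thesis by (simp add: integral_inverse_1_plus_square_UNIV)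
qed

text \<open>On Re z = -1/2 the product z(z + 1) equals -(1/4 + t^2). This arctangent integral is the
  source of the factor 2 pi in Perron's formula.\<close>

lemma LINT_partial_fraction: "(LINT t|lborel. 1 / (Complex (- (1/2)) t * (Complex (- (1/2)) t + 1))) = - (2 * of_real pi)"
proof -
  have "1 / (Complex (- (1/2)) t * (Complex (- (1/2)) t + 1)) = of_real (- (1 / (1/4 + t\<^sup>2)))" for t
  proof -
    have e: "Complex (- (1/2)) t * (Complex (- (1/2)) t + 1) = of_real (- (1/4 + t\<^sup>2))"
      by (simp add: complex_eq_iff power2_eq_square algebra_simps)
    show ?thesis unfolding e by (metis divide_minus_right of_real_1 of_real_divide)
  qed
  then have "(LINT t|lborel. 1 / (Complex (- (1/2)) t * (Complex (- (1/2)) t + 1))) = (LINT t|lborel. complex_of_real (- (1 / (1/4 + t\<^sup>2))))"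
    by simp
  also have "\<dots> = of_real (LINT t|lborel. - (1 / (1/4 + t\<^sup>2)))" by (rule integral_complex_of_real)
  also have "\<dots> = - (2 * of_real pi)" by (simp only: Bochner_Integration.integral_minus LINT_arctan) simp
  finally show ?thesis .
qed

lemma inverse_prod_le_Im:
  fixes z w :: complex
  assumes "1 \<le> \<bar>Im z\<bar>" "Im w = Im z"
  shows "1 / (norm z * norm w) \<le> 2 / (1 + (Im z)\<^sup>2)"
proof -
  have i1: "1 \<le> (Im z)\<^sup>2" using one_le_power[OF assms(1), of 2] by simp
  have n: "\<bar>Im z\<bar> \<le> norm z" "\<bar>Im z\<bar> \<le> norm w" using abs_Im_le_cmod[of z] abs_Im_le_cmod[of w] assms by auto
  have "(1 + (Im z)\<^sup>2) / 2 \<le> \<bar>Im z\<bar> * \<bar>Im z\<bar>" using i1 by (simp add: power2_eq_square)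
  also have "\<dots> \<le> norm z * norm w" using n by (intro mult_mono) auto
  finally have "(1 + (Im z)\<^sup>2) / 2 \<le> norm z * norm w" .
  then have "1 / (norm z * norm w) \<le> 1 / ((1 + (Im z)\<^sup>2) / 2)"
    using i1 by (intro divide_left_mono mult_pos_pos) (auto intro: less_le_trans[of 0 "(1 + (Im z)\<^sup>2) / 2"])
  then show ?thesis by simp
qed

text \<open>\<open>r\<close> has the same principal part at 0 as e^(vz)/z^2 but decays
  quadratically; its extra pole at -1 stays outside the strip. So the difference \<open>D\<close>
  can be moved from Re z = c to Re z = -1/2. There the exponential integral vanishes by reflection
  to \<open>perron_nonpos\<close>, the integrals of 1/z^2 vanish on both lines, and all that
  survives is v times the integral of 1/(z(z + 1)) on the left.\<close>

lemma perron_pos: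
  assumes c: "0 < c" and v: "0 < v"
  shows "(LINT t|lborel. exp (of_real v * Complex c t) / (Complex c t)\<^sup>2) = 2 * of_real pi * of_real v"
proof -
  define S where "S = {z. - 1 < Re z}"
  have op: "open S" unfolding S_def by (rule open_halfspace_Re_gt)
  obtain g1 where g1: "g1 holomorphic_on UNIV" "\<And>z. exp (of_real v * z) = exp (of_real v * 0) + (z - 0) * g1 z" "g1 0 = deriv (\<lambda>z. exp (of_real v * z)) 0"
    by (rule holomorphic_quotient[of "\<lambda>z. exp (of_real v * z)" UNIV 0]) (auto intro!: holomorphic_intros)
  have "((\<lambda>z. exp (of_real v * z)) has_field_derivative of_real v) (at 0)"
    by (auto intro!: derivative_eq_intros)
  then have g10: "g1 0 = of_real v" using g1(3) DERIV_imp_deriv by metis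
  obtain g2 where g2: "g2 holomorphic_on UNIV" "\<And>z. z \<in> UNIV \<Longrightarrow> g1 z = g1 0 + (z - 0) * g2 z" "g2 0 = deriv g1 0"
    by (rule holomorphic_quotient[OF g1(1) open_UNIV UNIV_I[of 0]], rule that)
  have ex: "exp (of_real v * z) = 1 + of_real v * z + z\<^sup>2 * g2 z" for z
  proof -
    have "exp (of_real v * z) = 1 + z * g1 z" using g1(2)[of z] by simp
    also have "g1 z = of_real v + z * g2 z" using g2(2)[of z] g10 by simp
    finally show ?thesis by (simp add: power2_eq_square algebra_simps)
  qed
  define D where "D z = g2 z + of_real v / (z + 1)" for z
  define r where "r z = 1 / z\<^sup>2 + of_real v * (1 / (z * (z + 1)))" for z :: complex
  have D: "D z = exp (of_real v * z) / z\<^sup>2 - r z" if "z \<noteq> 0" "z + 1 \<noteq> 0" for z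
  proof -
    have "1 / (z * (z + 1)) = 1 / z - 1 / (z + 1)" using that by (simp add: diff_frac_eq)
    then have "of_real v / (z + 1) = of_real v / z - of_real v * (1 / (z * (z + 1)))" by (simp only: right_diff_distrib) simp
    moreover have "exp (of_real v * z) / z\<^sup>2 = 1 / z\<^sup>2 + of_real v / z + g2 z"
      unfolding ex using that by (simp add: add_divide_distrib power2_eq_square)
    ultimately show ?thesis by (simp add: D_def r_def)
  qed
  have Dhol: "D holomorphic_on S"
  proof -
    have "z + 1 \<noteq> 0" if "z \<in> S" for z using that by (auto simp: S_def complex_eq_iff)
    then show ?thesis unfolding D_def [abs_def]
      by (intro holomorphic_intros holomorphic_on_subset[OF g2(1)]) auto
  qed
  define Cb where "Cb = exp (v * c) + (1 + v)"
  have r_le: "norm (r z) \<le> (1 + v) * (2 / (1 + (Im z)\<^sup>2))" if "1 \<le> \<bar>Im z\<bar>" for z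
  proof -
    have "norm (r z) \<le> norm (1 / z\<^sup>2) + norm (of_real v * (1 / (z * (z + 1))))" unfolding r_def by (rule norm_triangle_ineq)
    also have "\<dots> = 1 / (norm z * norm z) + v * (1 / (norm z * norm (z + 1)))"
      using v by (simp add: norm_mult norm_divide norm_power power2_eq_square)
    also have "\<dots> \<le> 2 / (1 + (Im z)\<^sup>2) + v * (2 / (1 + (Im z)\<^sup>2))"
      using v by (intro add_mono mult_left_mono inverse_prod_le_Im that) auto
    also have "\<dots> = (1 + v) * (2 / (1 + (Im z)\<^sup>2))" by (simp only: distrib_right mult_1_left)
    finally show ?thesis .
  qed
  have "\<exists>C'. \<forall>z. - (1/2) \<le> Re z \<longrightarrow> Re z \<le> c \<longrightarrow> norm (D z) \<le> C' / (1 + (Im z)\<^sup>2)"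
  proof (rule strip_bound_extend[where C = "2 * Cb"])
    show "continuous_on {z. - (1/2) \<le> Re z \<and> Re z \<le> c} D"
      by (rule continuous_on_subset[OF holomorphic_on_imp_continuous_on[OF Dhol]]) (auto simp: S_def)
    fix z assume z: "- (1/2) \<le> Re z" "Re z \<le> c" "1 \<le> \<bar>Im z\<bar>"
    have nz: "z \<noteq> 0" "z + 1 \<noteq> 0" using z(3) by (auto simp: complex_eq_iff)
    have "norm (exp (of_real v * z) / z\<^sup>2) = exp (v * Re z) * (1 / (norm z * norm z))"
      by (simp only: norm_divide norm_power norm_exp_line power2_eq_square norm_mult) simp
    also have "\<dots> \<le> exp (v * c) * (2 / (1 + (Im z)\<^sup>2))"
    proof (rule mult_mono)
      show "exp (v * Re z) \<le> exp (v * c)" using v z by simp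
      show "1 / (norm z * norm z) \<le> 2 / (1 + (Im z)\<^sup>2)" by (rule inverse_prod_le_Im[OF z(3)]) simp
    qed auto
    finally have "norm (exp (of_real v * z) / z\<^sup>2) \<le> exp (v * c) * (2 / (1 + (Im z)\<^sup>2))" .
    then have "norm (D z) \<le> exp (v * c) * (2 / (1 + (Im z)\<^sup>2)) + (1 + v) * (2 / (1 + (Im z)\<^sup>2))"
      unfolding D[OF nz] using r_le[OF z(3)] by (intro order.trans[OF norm_triangle_ineq4] add_mono) auto
    also have "\<dots> = (2 * Cb) / (1 + (Im z)\<^sup>2)" by (simp add: Cb_def add_divide_distrib[symmetric] algebra_simps)
    finally show "norm (D z) \<le> (2 * Cb) / (1 + (Im z)\<^sup>2)" .
  qed
  then obtain C' where C': "\<And>z. - (1/2) \<le> Re z \<Longrightarrow> Re z \<le> c \<Longrightarrow> norm (D z) \<le> C' / (1 + (Im z)\<^sup>2)" by blast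
  have shift: "(LINT t|lborel. D (Complex (- (1/2)) t)) = (LINT t|lborel. D (Complex c t))"
  proof (rule vertical_shift[where a' = "-1" and b' = "c + 1"])
    show "D holomorphic_on {z. - 1 < Re z \<and> Re z < c + 1}" by (rule holomorphic_on_subset[OF Dhol]) (auto simp: S_def)
  qed (use c C' in auto)
  have intsq: "integrable lborel (\<lambda>t. 1 / (Complex s t)\<^sup>2)" if "s \<noteq> 0" for s using line_exp_square_integrable[OF that, of 0] by simp
  have intpf: "integrable lborel (\<lambda>t. 1 / (Complex s t * (Complex s t + 1)))" if s: "s = c \<or> s = - (1/2)" for s
  proof (rule integrable_of_inverse_square_bound)
    have nz: "Complex s t \<noteq> 0" "Complex s t + 1 \<noteq> 0" for t using s c by (auto simp: complex_eq_iff)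
    show "continuous_on UNIV (\<lambda>t. 1 / (Complex s t * (Complex s t + 1)))"
      using nz by (intro continuous_intros continuous_line_id) auto
    fix t
    define m where "m = min c (1/2)"
    have m: "0 < m" "m \<le> \<bar>Re (Complex s t)\<bar>" "m \<le> \<bar>Re (Complex s t + 1)\<bar>" using s c by (auto simp: m_def)
    have "norm (1 / (Complex s t * (Complex s t + 1))) = (1 / norm (Complex s t)) * (1 / norm (Complex s t + 1))"
      by (simp add: norm_divide norm_mult)
    also have "\<dots> \<le> ((1 / norm (Complex s t))\<^sup>2 + (1 / norm (Complex s t + 1))\<^sup>2) / 2"
      using sum_squares_bound[of "1 / norm (Complex s t)" "1 / norm (Complex s t + 1)"] by simp
    also have "\<dots> = (1 / (norm (Complex s t))\<^sup>2 + 1 / (norm (Complex s t + 1))\<^sup>2) / 2" by (simp add: power_divide)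
    also have "\<dots> \<le> (max 1 (1 / m\<^sup>2) / (1 + t\<^sup>2) + max 1 (1 / m\<^sup>2) / (1 + t\<^sup>2)) / 2"
      using inverse_square_le[OF m(1,2)] inverse_square_le[OF m(1,3)] by (intro divide_right_mono add_mono) auto
    also have "\<dots> = max 1 (1 / m\<^sup>2) / (1 + t\<^sup>2)" by (simp only: add_divide_distrib field_sum_of_halves)
    finally show "norm (1 / (Complex s t * (Complex s t + 1))) \<le> max 1 (1 / m\<^sup>2) / (1 + t\<^sup>2)" by simp
  qed
  have intr: "integrable lborel (\<lambda>t. r (Complex s t))" if "s = c \<or> s = - (1/2)" for s
    unfolding r_def using that c by (intro Bochner_Integration.integrable_add integrable_mult_right intsq intpf) auto
  have LD: "(LINT t|lborel. D (Complex s t)) = (LINT t|lborel. exp (of_real v * Complex s t) / (Complex s t)\<^sup>2)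
      - (LINT t|lborel. r (Complex s t))" if s: "s = c \<or> s = - (1/2)" for s
  proof -
    have nz: "Complex s t \<noteq> 0" "Complex s t + 1 \<noteq> 0" for t using s c by (auto simp: complex_eq_iff)
    have "(LINT t|lborel. D (Complex s t)) = (LINT t|lborel. exp (of_real v * Complex s t) / (Complex s t)\<^sup>2 - r (Complex s t))"
      using D[OF nz] by simp
    also have "\<dots> = (LINT t|lborel. exp (of_real v * Complex s t) / (Complex s t)\<^sup>2) - (LINT t|lborel. r (Complex s t))"
      by (rule Bochner_Integration.integral_diff[OF line_exp_square_integrable intr[OF s]]) (use s c in auto)
    finally show ?thesis .
  qed
  have Lr: "(LINT t|lborel. r (Complex s t)) = (LINT t|lborel. 1 / (Complex s t)\<^sup>2) + of_real v * (LINT t|lborel. 1 / (Complex s t * (Complex s t + 1)))"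
    if s: "s = c \<or> s = - (1/2)" for s
  proof -
    have s0: "s \<noteq> 0" using s c by auto
    have "integrable lborel (\<lambda>t. of_real v * (1 / (Complex s t * (Complex s t + 1))))"
      by (intro integrable_mult_right intpf[OF s])
    from Bochner_Integration.integral_add[OF intsq[OF s0] this] show ?thesis
      unfolding r_def by (simp only: integral_mult_right_zero)
  qed
  have z1: "(LINT t|lborel. 1 / (Complex c t)\<^sup>2) = 0" using perron_nonpos[OF c, of 0] by simp
  have z2: "(LINT t|lborel. 1 / (Complex (- (1/2)) t)\<^sup>2) = 0"
    using perron_nonpos[of "1/2" 0] LINT_uminus_line[of "\<lambda>z. 1 / z\<^sup>2" "1/2"] by simp
  have z3: "(LINT t|lborel. exp (of_real v * Complex (- (1/2)) t) / (Complex (- (1/2)) t)\<^sup>2) = 0"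
    using perron_nonpos[of "1/2" "- v"] v LINT_uminus_line[of "\<lambda>z. exp (of_real v * z) / z\<^sup>2" "1/2"] by simp
  have z4: "(LINT t|lborel. 1 / (Complex c t * (Complex c t + 1))) = 0"
  proof (rule decaying_line_integral_eq_0[OF c, of "\<lambda>z. 1 / (z * (z + 1))" 1])
    have "z + 1 \<noteq> 0" if "0 < Re z" for z using that by (auto simp: complex_eq_iff)
    then show "(\<lambda>z. 1 / (z * (z + 1))) holomorphic_on {z. 0 < Re z}" by (intro holomorphic_intros) auto
    fix z assume z: "c \<le> Re z"
    have "norm z \<le> norm (z + 1)" using z c by (simp add: cmod_def power2_eq_square algebra_simps)
    then have "(norm z)\<^sup>2 \<le> norm z * norm (z + 1)" unfolding power2_eq_square by (intro mult_left_mono) auto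
    moreover have "0 < norm z" using z c by auto
    ultimately show "norm (1 / (z * (z + 1))) \<le> 1 / (norm z)\<^sup>2"
      by (simp only: norm_divide norm_mult norm_one) (intro divide_left_mono mult_pos_pos, auto intro: less_le_trans)
  qed simp
  show ?thesis
    using shift LD[of c] LD[of "- (1/2)"] Lr[of c] Lr[of "- (1/2)"] z1 z2 z3 z4 LINT_partial_fraction by (simp add: mult_ac)
qed

theorem perron_log:
  assumes "0 < c"
  shows "(LINT t|lborel. exp (of_real v * Complex c t) / (Complex c t)\<^sup>2) = 2 * of_real pi * of_real (max 0 v)"
  using perron_nonpos[OF assms, of v] perron_pos[OF assms, of v] by (cases "v \<le> 0") (auto simp: max_def)

lemma line_exp_power_integrable:
  assumes c: "0 < c" and i: "2 \<le> i"
  shows "integrable lborel (\<lambda>t. exp (of_real v * Complex c t) / (Complex c t) ^ i)"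
proof (rule integrable_of_inverse_square_bound)
  have nz: "Complex c t \<noteq> 0" for t using c by (simp add: complex_eq_iff)
  show "continuous_on UNIV (\<lambda>t. exp (of_real v * Complex c t) / (Complex c t) ^ i)"
    using nz by (intro continuous_intros continuous_line_id) auto
  fix t
  have cn: "c \<le> norm (Complex c t)" using abs_Re_le_cmod[of "Complex c t"] c by simp
  have "norm (exp (of_real v * Complex c t) / (Complex c t) ^ i) = exp (v * c) * (1 / norm (Complex c t) ^ (i - 2) * (1 / (norm (Complex c t))\<^sup>2))"
  proof -
    have "i = (i - 2) + 2" using i by simp
    then have "norm (Complex c t) ^ i = norm (Complex c t) ^ (i - 2) * (norm (Complex c t))\<^sup>2" by (metis power_add)
    then show ?thesis by (simp add: norm_divide norm_power norm_exp_line)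
  qed
  also have "\<dots> \<le> exp (v * c) * (1 / c ^ (i - 2) * (max 1 (1 / c\<^sup>2) / (1 + t\<^sup>2)))"
  proof (intro mult_left_mono mult_mono)
    show "1 / norm (Complex c t) ^ (i - 2) \<le> 1 / c ^ (i - 2)"
      using cn c by (intro divide_left_mono power_mono mult_pos_pos zero_less_power) auto
    show "1 / (norm (Complex c t))\<^sup>2 \<le> max 1 (1 / c\<^sup>2) / (1 + t\<^sup>2)" using inverse_square_le[OF c, of "Complex c t"] c by simp
  qed (use c in auto)
  finally show "norm (exp (of_real v * Complex c t) / (Complex c t) ^ i) \<le> (exp (v * c) * (1 / c ^ (i - 2) * max 1 (1 / c\<^sup>2))) / (1 + t\<^sup>2)"
    by (simp add: mult.assoc)
qed

lemma line_edge_limit: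
  assumes c: "0 < c" and bd: "\<And>t. 1 \<le> \<bar>t\<bar> \<Longrightarrow> norm (h t) \<le> B / \<bar>t\<bar>"
  shows "(\<lambda>n. h (real n) - h (- real n) :: complex) \<longlonglongrightarrow> 0"
proof (rule Lim_null_comparison)
  show "\<forall>\<^sub>F n in sequentially. norm (h (real n) - h (- real n)) \<le> 2 * B / real n"
    using eventually_ge_at_top[of 1]
  proof eventually_elim
    case (elim n)
    have "norm (h (real n) - h (- real n)) \<le> B / real n + B / real n"
      using bd[of "real n"] bd[of "- real n"] elim by (intro order.trans[OF norm_triangle_ineq4] add_mono) auto
    then show ?case by simp
  qed
  show "(\<lambda>n. 2 * B / real n) \<longlonglongrightarrow> 0" by real_asymp
qed

text \<open>The derivative of e^(vz)/z^i along the line integrates to 0, which links the exponents i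
  and i + 1.\<close>

lemma perron_power_Suc:
  assumes c: "0 < c" and i: "2 \<le> i"
  shows "of_nat i * (LINT t|lborel. exp (of_real v * Complex c t) / (Complex c t) ^ Suc i)
     = of_real v * (LINT t|lborel. exp (of_real v * Complex c t) / (Complex c t) ^ i)"
proof -
  let ?f = "\<lambda>k t. exp (of_real v * Complex c t) / (Complex c t) ^ k"
  have int: "integrable lborel (?f k)" if "2 \<le> k" for k using line_exp_power_integrable[OF c that] .
  have "(LINT t|lborel. \<i> * (of_real v * ?f i t - of_nat i * ?f (Suc i) t)) = 0"
  proof (rule LINT_derivative_eq_0[where h = "?f i"])
    fix t
    have nz: "Complex c t \<noteq> 0" using c by (simp add: complex_eq_iff)
    have "((\<lambda>z. exp (of_real v * z) / z ^ i) has_field_derivative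
       (of_real v * exp (of_real v * Complex c t) * Complex c t ^ i - exp (of_real v * Complex c t) * (of_nat i * Complex c t ^ (i - 1))) / (Complex c t ^ i * Complex c t ^ i)) (at (Complex c t))"
      using nz by (auto intro!: derivative_eq_intros)
    also have "(of_real v * exp (of_real v * Complex c t) * Complex c t ^ i - exp (of_real v * Complex c t) * (of_nat i * Complex c t ^ (i - 1))) / (Complex c t ^ i * Complex c t ^ i)
       = of_real v * ?f i t - of_nat i * ?f (Suc i) t"
    proof -
      obtain k where k: "i = Suc k" using i by (cases i) auto
      show ?thesis unfolding k using nz by (simp add: field_simps)
    qed
    finally show "(?f i has_vector_derivative \<i> * (of_real v * ?f i t - of_nat i * ?f (Suc i) t)) (at t)"
      by (rule vertical_line_derivative)
  next
    show "integrable lborel (\<lambda>t. \<i> * (of_real v * ?f i t - of_nat i * ?f (Suc i) t))"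
      using i by (intro integrable_mult_right Bochner_Integration.integrable_diff int) auto
    show "(\<lambda>n. ?f i (real n) - ?f i (- real n)) \<longlonglongrightarrow> 0"
    proof (rule line_edge_limit[OF c, where B = "exp (v * c)"])
      fix t :: real assume t: "1 \<le> \<bar>t\<bar>"
      have tn: "\<bar>t\<bar> \<le> norm (Complex c t)" using abs_Im_le_cmod[of "Complex c t"] by simp
      have "\<bar>t\<bar> \<le> norm (Complex c t) ^ 1" using tn by simp
      also have "\<dots> \<le> norm (Complex c t) ^ i" using tn t i by (intro power_increasing) auto
      finally have "\<bar>t\<bar> \<le> norm (Complex c t) ^ i" .
      then have "exp (v * c) / norm (Complex c t) ^ i \<le> exp (v * c) / \<bar>t\<bar>" using t by (intro divide_left_mono mult_pos_pos) auto
      then show "norm (?f i t) \<le> exp (v * c) / \<bar>t\<bar>" by (simp add: norm_divide norm_power norm_exp_line)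
    qed
  qed
  then have z: "(LINT t|lborel. of_real v * ?f i t - of_nat i * ?f (Suc i) t) = 0"
    unfolding integral_mult_right_zero by simp
  have i1: "integrable lborel (\<lambda>t. of_real v * ?f i t)" by (intro integrable_mult_right int i)
  have i2: "integrable lborel (\<lambda>t. of_nat i * ?f (Suc i) t)" by (intro integrable_mult_right int) (use i in simp)
  have "(LINT t|lborel. of_real v * ?f i t) - (LINT t|lborel. of_nat i * ?f (Suc i) t) = 0"
    using Bochner_Integration.integral_diff[OF i1 i2] z by simp
  then show ?thesis unfolding integral_mult_right_zero by simp
qed

lemma perron_power:
  assumes c: "0 < c" and v: "0 < v"
  shows "(LINT t|lborel. exp (of_real v * Complex c t) / (Complex c t) ^ (k + 2)) = 2 * of_real pi * of_real (v ^ (k + 1) / fact (k + 1))"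
proof (induction k)
  case 0
  then show ?case using perron_pos[OF c v] by (simp add: power2_eq_square)
next
  case (Suc k)
  have "of_nat (k + 2) * (LINT t|lborel. exp (of_real v * Complex c t) / (Complex c t) ^ Suc (k + 2))
     = of_real v * (2 * of_real pi * of_real (v ^ (k + 1) / fact (k + 1)))"
    using perron_power_Suc[OF c, of "k + 2" v] Suc by simp
  then have "of_nat (k + 2) * (LINT t|lborel. exp (of_real v * Complex c t) / (Complex c t) ^ (Suc k + 2))
     = of_nat (k + 2) * (2 * of_real pi * of_real (v ^ (Suc k + 1) / fact (Suc k + 1)))"
  proof -
    have f: "(fact (Suc k + 1) :: real) = real (k + 2) * fact (k + 1)" by simp
    have "v * (v ^ (k + 1) / fact (k + 1)) = real (k + 2) * (v ^ (Suc k + 1) / fact (Suc k + 1))"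
      unfolding f by (simp del: of_nat_add)
    then have "of_real v * (2 * of_real pi * of_real (v ^ (k + 1) / fact (k + 1)))
        = 2 * of_real pi * complex_of_real (real (k + 2) * (v ^ (Suc k + 1) / fact (Suc k + 1)))"
      by (metis (no_types, lifting) mult.left_commute of_real_mult)
    also have "\<dots> = of_nat (k + 2) * (2 * of_real pi * of_real (v ^ (Suc k + 1) / fact (Suc k + 1)))"
      by (simp only: of_real_mult of_real_of_nat_eq mult_ac)
    finally show ?thesis
      using \<open>of_nat (k + 2) * _ = of_real v * _\<close> by (simp only: add_Suc)
  qed
  moreover have "of_nat (k + 2) \<noteq> (0 :: complex)" by (simp only: of_nat_eq_0_iff)
  ultimately show ?case by (simp only: mult_cancel_left) simp
qed

lemma line_two_minus_one: "Complex 2 t - 1 = Complex 1 t"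
  by (simp add: complex_eq_iff)

lemma exp_line_two: "exp (of_real v * Complex 2 t) = of_real (exp v) * exp (of_real v * Complex 1 t)"
proof -
  have "of_real v * Complex 2 t = of_real v + of_real v * Complex 1 t" by (simp add: complex_eq_iff)
  then show ?thesis by (simp only: exp_add exp_of_real)
qed

lemma perron_power_shifted:
  assumes v: "0 < v"
  shows "integrable lborel (\<lambda>t. exp (of_real v * Complex 2 t) / (Complex 2 t - 1) ^ (k + 2))"
    and "(LINT t|lborel. exp (of_real v * Complex 2 t) / (Complex 2 t - 1) ^ (k + 2)) = 2 * of_real pi * of_real (exp v * (v ^ (k + 1) / fact (k + 1)))"
proof -
  have e: "(\<lambda>t. exp (of_real v * Complex 2 t) / (Complex 2 t - 1) ^ (k + 2)) = (\<lambda>t. of_real (exp v) * (exp (of_real v * Complex 1 t) / Complex 1 t ^ (k + 2)))"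
    by (simp add: line_two_minus_one exp_line_two)
  show "integrable lborel (\<lambda>t. exp (of_real v * Complex 2 t) / (Complex 2 t - 1) ^ (k + 2))"
    unfolding e by (intro integrable_mult_right line_exp_power_integrable) auto
  show "(LINT t|lborel. exp (of_real v * Complex 2 t) / (Complex 2 t - 1) ^ (k + 2)) = 2 * of_real pi * of_real (exp v * (v ^ (k + 1) / fact (k + 1)))"
    unfolding e integral_mult_right_zero perron_power[OF zero_less_one v] by (simp only: of_real_mult mult_ac)
qed

text \<open>The derivative of e^(vz)/(z(z - 1)) is v times this function minus e^(vz)(1/(z - 1)^2 -
  1/z^2), because z and z - 1 differ by 1. The two double poles are already evaluated, and v > 0
  allows the division by v.\<close>

lemma perron_simple:
  assumes v: "0 < v"
  shows "integrable lborel (\<lambda>t. exp (of_real v * Complex 2 t) / (Complex 2 t * (Complex 2 t - 1)))"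
    and "(LINT t|lborel. exp (of_real v * Complex 2 t) / (Complex 2 t * (Complex 2 t - 1))) = 2 * of_real pi * of_real (exp v - 1)"
proof -
  let ?f = "\<lambda>t. exp (of_real v * Complex 2 t) / (Complex 2 t * (Complex 2 t - 1))"
  let ?g = "\<lambda>t. exp (of_real v * Complex 2 t) / (Complex 2 t) ^ 2"
  let ?h = "\<lambda>t. exp (of_real v * Complex 2 t) / (Complex 2 t - 1) ^ 2"
  have nz: "Complex 2 t \<noteq> 0" "Complex 2 t - 1 \<noteq> 0" for t by (auto simp: complex_eq_iff)
  have nle: "norm (Complex 1 t) \<le> norm (Complex 2 t)" for t by (simp add: complex_norm)
  have np: "0 < norm (Complex 1 t)" for t by (simp add: complex_eq_iff)
  show int: "integrable lborel ?f"
  proof (rule integrable_of_inverse_square_bound)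
    show "continuous_on UNIV ?f" using nz by (intro continuous_intros continuous_line_id) auto
    fix t
    have "norm (?f t) = exp (v * 2) * (1 / (norm (Complex 2 t) * norm (Complex 1 t)))"
      by (simp add: norm_divide norm_mult norm_exp_line line_two_minus_one)
    also have "\<dots> \<le> exp (v * 2) * (1 / (norm (Complex 1 t))\<^sup>2)"
      unfolding power2_eq_square using nle[of t] np[of t] by (intro mult_left_mono divide_left_mono mult_right_mono mult_pos_pos) (auto intro: less_le_trans)
    also have "\<dots> \<le> exp (v * 2) * (max 1 (1 / 1\<^sup>2) / (1 + t\<^sup>2))"
      using inverse_square_le[of 1 "Complex 1 t"] by (intro mult_left_mono) auto
    finally show "norm (?f t) \<le> exp (v * 2) / (1 + t\<^sup>2)" by simp
  qed
  have intg: "integrable lborel ?g" by (rule line_exp_power_integrable) auto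
  have inth: "integrable lborel ?h" using perron_power_shifted(1)[OF v, of 0] by (simp add: numeral_2_eq_2)
  have "(LINT t|lborel. \<i> * (of_real v * ?f t - (?h t - ?g t))) = 0"
  proof (rule LINT_derivative_eq_0[where h = ?f])
    fix t
    let ?z = "Complex 2 t"
    have "((\<lambda>z. exp (of_real v * z) / (z * (z - 1))) has_field_derivative
       (of_real v * exp (of_real v * ?z) * (?z * (?z - 1)) - exp (of_real v * ?z) * (?z - 1 + ?z)) / (?z * (?z - 1) * (?z * (?z - 1)))) (at ?z)"
      using nz[of t] by (auto intro!: derivative_eq_intros)
    also have "(of_real v * exp (of_real v * ?z) * (?z * (?z - 1)) - exp (of_real v * ?z) * (?z - 1 + ?z)) / (?z * (?z - 1) * (?z * (?z - 1)))
       = of_real v * ?f t - (?h t - ?g t)"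
    proof -
      have "(V * X * (z * w) - X * (w + z)) / (z * w * (z * w)) = V * (X / (z * w)) - (X / w^2 - X / z^2)"
        if "z \<noteq> 0" "w \<noteq> 0" "z - w = 1" for V X z w :: complex
      proof -
        have z: "z = w + 1" using that(3) by (simp add: algebra_simps)
        have "X / w^2 - X / z^2 = X * ((z - w) * (z + w)) / (z * w * (z * w))"
          using that(1,2) by (simp add: field_simps power2_eq_square)
        also have "\<dots> = X * (w + z) / (z * w * (z * w))" using that(3) by (simp add: add.commute)
        finally show ?thesis using that(1,2) by (simp add: diff_divide_distrib)
      qed
      from this[OF nz, of _ t] show ?thesis by simp
    qed
    finally show "(?f has_vector_derivative \<i> * (of_real v * ?f t - (?h t - ?g t))) (at t)"
      by (rule vertical_line_derivative)
  next
    show "integrable lborel (\<lambda>t. \<i> * (of_real v * ?f t - (?h t - ?g t)))"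
      by (intro integrable_mult_right Bochner_Integration.integrable_diff int intg inth)
    show "(\<lambda>n. ?f (real n) - ?f (- real n)) \<longlonglongrightarrow> 0"
    proof (rule line_edge_limit[OF zero_less_one, where B = "exp (v * 2)"])
      fix t :: real assume t: "1 \<le> \<bar>t\<bar>"
      have "\<bar>t\<bar> * 1 \<le> norm (Complex 2 t) * norm (Complex 1 t)"
        using abs_Im_le_cmod[of "Complex 2 t"] abs_Re_le_cmod[of "Complex 1 t"] by (intro mult_mono) auto
      then have "exp (v * 2) / (norm (Complex 2 t) * norm (Complex 1 t)) \<le> exp (v * 2) / \<bar>t\<bar>"
        using t by (intro divide_left_mono mult_pos_pos) auto
      then show "norm (?f t) \<le> exp (v * 2) / \<bar>t\<bar>" by (simp add: norm_divide norm_mult norm_exp_line line_two_minus_one)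
    qed
  qed
  then have z: "(LINT t|lborel. of_real v * ?f t - (?h t - ?g t)) = 0"
    unfolding integral_mult_right_zero by simp
  have i1: "integrable lborel (\<lambda>t. of_real v * ?f t)" by (intro integrable_mult_right int)
  have i2: "integrable lborel (\<lambda>t. ?h t - ?g t)" by (rule Bochner_Integration.integrable_diff[OF inth intg])
  have "of_real v * (LINT t|lborel. ?f t) - ((LINT t|lborel. ?h t) - (LINT t|lborel. ?g t)) = 0"
    using Bochner_Integration.integral_diff[OF i1 i2] Bochner_Integration.integral_diff[OF inth intg] z
    unfolding integral_mult_right_zero by simp
  moreover have "(LINT t|lborel. ?g t) = 2 * of_real pi * of_real v" using perron_pos[of 2 v] v by simp
  moreover have "(LINT t|lborel. ?h t) = 2 * of_real pi * of_real (exp v * v)" using perron_power_shifted(2)[OF v, of 0] by (simp add: numeral_2_eq_2)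
  ultimately have "of_real v * (LINT t|lborel. ?f t) = of_real v * (2 * of_real pi * of_real (exp v - 1))"
    by (simp add: algebra_simps)
  then show "(LINT t|lborel. ?f t) = 2 * of_real pi * of_real (exp v - 1)" using v by simp
qed

lemma integrable_of_bounded_integrals:
  fixes f :: "real \<Rightarrow> real"
  assumes cont: "continuous_on UNIV f" and nn: "\<And>t. 0 \<le> f t" and bd: "\<And>n :: nat. integral {- real n..real n} f \<le> B"
  shows "integrable lborel f"
proof -
  define s where "s n t = indicat_real {- real n..real n} t * f t" for n t
  have ints: "integrable lborel (s n)" for n
    using borel_integrable_atLeastAtMost'[OF continuous_on_subset[OF cont subset_UNIV], of "- real n" "real n"]
    by (simp add: s_def [abs_def] set_integrable_def)
  have val: "(LINT t|lborel. s n t) = integral {- real n..real n} f" for n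
    using set_borel_integral_eq_integral(2)[OF borel_integrable_atLeastAtMost'[OF continuous_on_subset[OF cont subset_UNIV], of "- real n" "real n"]]
    by (simp add: s_def [abs_def] set_lebesgue_integral_def)
  have mono: "s n t \<le> s (Suc n) t" for n t
    using nn[of t] by (auto simp: s_def indicator_def)
  have conv: "convergent (\<lambda>n. LINT t|lborel. s n t)"
  proof (rule Bseq_mono_convergent)
    show "Bseq (\<lambda>n. LINT t|lborel. s n t)"
    proof (rule BseqI'[of _ "\<bar>B\<bar>"])
      fix n
      have "0 \<le> (LINT t|lborel. s n t)" by (rule integral_nonneg_AE) (simp add: s_def nn)
      then show "norm (LINT t|lborel. s n t) \<le> \<bar>B\<bar>" using bd[of n] val[of n] by simp
    qed
    show "\<forall>n m. n \<le> m \<longrightarrow> (LINT t|lborel. s n t) \<le> (LINT t|lborel. s m t)"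
    proof (intro allI impI)
      fix n m :: nat assume nm: "n \<le> m"
      have "s n t \<le> s m t" for t by (rule lift_Suc_mono_le[of "\<lambda>n. s n t", OF mono nm])
      then show "(LINT t|lborel. s n t) \<le> (LINT t|lborel. s m t)" by (intro integral_mono ints) auto
    qed
  qed
  then obtain L where L: "(\<lambda>n. LINT t|lborel. s n t) \<longlonglongrightarrow> L" by (auto simp: convergent_def)
  show ?thesis
  proof (rule integrable_monotone_convergence[OF ints _ _ L])
    show "AE t in lborel. mono (\<lambda>n. s n t)" by (rule AE_I2, rule incseq_SucI, rule mono)
    show "AE t in lborel. (\<lambda>n. s n t) \<longlonglongrightarrow> f t"
    proof (rule AE_I2)
      fix t :: real
      have "\<forall>\<^sub>F n in sequentially. s n t = f t"
        using eventually_ge_at_top[of "nat \<lceil>\<bar>t\<bar>\<rceil>"]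
      proof eventually_elim
        case (elim n)
        then have "\<bar>t\<bar> \<le> real n" by linarith
        then show ?case by (simp add: s_def indicator_def abs_le_iff)
      qed
      then show "(\<lambda>n. s n t) \<longlonglongrightarrow> f t" by (rule tendsto_eventually)
    qed
    show "f \<in> borel_measurable lborel" using borel_measurable_continuous_onI[OF cont] by simp
  qed
qed

section \<open>The sum T as an integral over Re z = 2\<close>

text \<open>For \<open>exp v \<le> N\<close> the truncation at \<open>N\<close> is immaterial, and \<open>Fz\<close> is the Dirichlet series of the sum.\<close>

definition TT :: "nat \<Rightarrow> real \<Rightarrow> real" where
  "TT N v = (\<Sum>a=1..N. \<Sum>b=1..N. \<Sum>c=1..N. \<Sum>d=1..N. \<Sum>l=1..N. real l * max 0 (v - ln (real (a * b * c * d * l\<^sup>2))))"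

lemma npow_double: "1 \<le> l \<Longrightarrow> npow (real l) (2 * z - 1) = of_nat l * npow (real l) z * npow (real l) z"
proof -
  assume l: "1 \<le> l"
  have "npow (real l) (2 * z - 1) = of_real (real l) * npow (real l) (2 * z)" using l npow_diff_one[of "real l" "2 * z"] by simp
  also have "npow (real l) (2 * z) = npow (real l) z * npow (real l) z"
    unfolding npow_def exp_add[symmetric] by (rule arg_cong[where f = exp]) (simp add: algebra_simps)
  finally show ?thesis by simp
qed

lemma Fz_partial_product:
  "(\<Sum>n=1..N. npow (real n) z) ^ 4 * (\<Sum>l=1..N. npow (real l) (2 * z - 1))
   = (\<Sum>a=1..N. \<Sum>b=1..N. \<Sum>c=1..N. \<Sum>d=1..N. \<Sum>l=1..N. of_nat l * exp (- of_real (ln (real (a * b * c * d * l\<^sup>2))) * z))"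
proof -
  have "(\<Sum>n=1..N. npow (real n) z) ^ 4 * (\<Sum>l=1..N. npow (real l) (2 * z - 1))
    = (\<Sum>a=1..N. \<Sum>b=1..N. \<Sum>c=1..N. \<Sum>d=1..N. \<Sum>l=1..N. npow (real a) z * (npow (real b) z * (npow (real c) z * (npow (real d) z * npow (real l) (2 * z - 1)))))"
    by (simp only: power4_eq_xxxx sum_distrib_right mult.assoc) (simp only: sum_distrib_left sum_distrib_right)
  also have "\<dots> = (\<Sum>a=1..N. \<Sum>b=1..N. \<Sum>c=1..N. \<Sum>d=1..N. \<Sum>l=1..N. of_nat l * exp (- of_real (ln (real (a * b * c * d * l\<^sup>2))) * z))"
  proof (intro sum.cong refl)
    fix a b c d l assume r: "a \<in> {1..N}" "b \<in> {1..N}" "c \<in> {1..N}" "d \<in> {1..N}" "l \<in> {1..N}"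
    have "ln (real (a * b * c * d * l\<^sup>2)) = ln (real a) + ln (real b) + ln (real c) + ln (real d) + (ln (real l) + ln (real l))"
      using r by (simp add: ln_mult power2_eq_square)
    then have R: "complex_of_real (ln (real (a * b * c * d * l\<^sup>2))) = of_real (ln (real a)) + of_real (ln (real b)) + of_real (ln (real c)) + of_real (ln (real d)) + (of_real (ln (real l)) + of_real (ln (real l)))"
      by (simp only: of_real_add)
    have "npow (real a) z * (npow (real b) z * (npow (real c) z * (npow (real d) z * npow (real l) (2 * z - 1))))
      = of_nat l * (npow (real a) z * (npow (real b) z * (npow (real c) z * (npow (real d) z * (npow (real l) z * npow (real l) z)))))"
      using r by (subst npow_double) (auto simp only: mult_ac atLeastAtMost_iff)
    also have "npow (real a) z * (npow (real b) z * (npow (real c) z * (npow (real d) z * (npow (real l) z * npow (real l) z))))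
      = exp (- of_real (ln (real (a * b * c * d * l\<^sup>2))) * z)"
      unfolding npow_def exp_add[symmetric] R by (rule arg_cong[where f = exp]) (simp add: algebra_simps)
    finally show "npow (real a) z * (npow (real b) z * (npow (real c) z * (npow (real d) z * npow (real l) (2 * z - 1))))
      = of_nat l * exp (- of_real (ln (real (a * b * c * d * l\<^sup>2))) * z)" .
  qed
  finally show ?thesis .
qed

lemma TT_line_integral:
  "(LINT t|lborel. exp (of_real v * Complex 2 t) / (Complex 2 t)\<^sup>2 * ((\<Sum>n=1..N. npow (real n) (Complex 2 t)) ^ 4 * (\<Sum>l=1..N. npow (real l) (2 * Complex 2 t - 1))))
   = 2 * of_real pi * of_real (TT N v)"
proof -
  define e where "e w t = exp (of_real w * Complex 2 t) / (Complex 2 t)\<^sup>2" for w t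
  have int: "integrable lborel (e w)" for w unfolding e_def by (rule line_exp_square_integrable) simp
  have val: "(LINT t|lborel. e w t) = 2 * of_real pi * of_real (max 0 w)" for w
    unfolding e_def by (rule perron_log) simp
  have eq: "exp (of_real v * Complex 2 t) / (Complex 2 t)\<^sup>2 * (of_nat l * exp (- of_real r * Complex 2 t)) = of_nat l * e (v - r) t" for l :: nat and r t
  proof -
    have "exp (of_real v * Complex 2 t) * exp (- of_real r * Complex 2 t) = exp (of_real (v - r) * Complex 2 t)"
      unfolding exp_add[symmetric] by (rule arg_cong[where f = exp]) (simp add: algebra_simps)
    then show ?thesis by (simp add: e_def mult_ac)
  qed
  have "exp (of_real v * Complex 2 t) / (Complex 2 t)\<^sup>2 * ((\<Sum>n=1..N. npow (real n) (Complex 2 t)) ^ 4 * (\<Sum>l=1..N. npow (real l) (2 * Complex 2 t - 1)))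
    = (\<Sum>a=1..N. \<Sum>b=1..N. \<Sum>c=1..N. \<Sum>d=1..N. \<Sum>l=1..N. of_nat l * e (v - ln (real (a * b * c * d * l\<^sup>2))) t)" for t
    by (subst Fz_partial_product) (simp only: sum_distrib_left eq)
  then have "(LINT t|lborel. exp (of_real v * Complex 2 t) / (Complex 2 t)\<^sup>2 * ((\<Sum>n=1..N. npow (real n) (Complex 2 t)) ^ 4 * (\<Sum>l=1..N. npow (real l) (2 * Complex 2 t - 1))))
    = (LINT t|lborel. (\<Sum>a=1..N. \<Sum>b=1..N. \<Sum>c=1..N. \<Sum>d=1..N. \<Sum>l=1..N. of_nat l * e (v - ln (real (a * b * c * d * l\<^sup>2))) t))"
    by (simp only:)
  also have "\<dots> = (\<Sum>a=1..N. \<Sum>b=1..N. \<Sum>c=1..N. \<Sum>d=1..N. \<Sum>l=1..N. of_nat l * (2 * of_real pi * of_real (max 0 (v - ln (real (a * b * c * d * l\<^sup>2))))))"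
    by (simp only: Bochner_Integration.integral_sum Bochner_Integration.integrable_sum integrable_mult_right int val integral_mult_right_zero)
  also have "\<dots> = 2 * of_real pi * of_real (TT N v)"
    by (simp add: TT_def sum_distrib_left mult_ac)
  finally show ?thesis .
qed

lemma sum_inverse_powr_le:
  assumes "2 \<le> a"
  shows "(\<Sum>n=1..N. real n powr (- a)) \<le> 2"
proof (cases "N = 0")
  case False
  have "(\<Sum>n=1..N. real n powr (- a)) \<le> 2 - 1 / real N" if "1 \<le> N" for N
    using that
  proof (induction N rule: dec_induct)
    case base
    then show ?case by simp
  next
    case (step N)
    have "real (Suc N) powr (- a) \<le> real (Suc N) powr (- 2)" using assms by (intro powr_mono) auto
    also have "\<dots> = 1 / (real (Suc N) * real (Suc N))" by (simp add: powr_minus_divide power2_eq_square)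
    also have "\<dots> \<le> 1 / (real N * real (Suc N))" using step by (intro divide_left_mono mult_right_mono) auto
    also have "\<dots> = 1 / real N - 1 / real (Suc N)" using step by (simp add: field_simps)
    finally show ?case using step by simp
  qed
  from this[of N] False have "(\<Sum>n=1..N. real n powr (- a)) \<le> 2 - 1 / real N" by simp
  moreover have "0 \<le> 1 / real N" by simp
  ultimately show ?thesis by linarith
qed simp

lemma norm_partial_zeta_le:
  assumes "2 \<le> Re s"
  shows "norm (\<Sum>n=1..N. npow (real n) s) \<le> 2"
proof -
  have "norm (\<Sum>n=1..N. npow (real n) s) \<le> (\<Sum>n=1..N. real n powr (- Re s))"
    by (rule order.trans[OF norm_sum], rule sum_mono) (simp add: norm_npow)
  then show ?thesis using sum_inverse_powr_le[OF assms, of N] by linarith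
qed

lemma Fz_line_two_limit:
  "(\<lambda>N. (\<Sum>n=1..N. npow (real n) (Complex 2 t)) ^ 4 * (\<Sum>l=1..N. npow (real l) (2 * Complex 2 t - 1))) \<longlonglongrightarrow> Fz (Complex 2 t)"
  unfolding Fz_def zet_def by (intro tendsto_intros Zser_limit) auto

text \<open>If a variable exceeds N \<ge> e^v, then the product is at least e^v and the summand is
  cut to 0. Hence the limit N \<rightarrow> \<infinity> in the line integrals changes nothing on the
  arithmetic side.\<close>

lemma TT_eventually_const:
  assumes "exp v \<le> real N" "N \<le> M"
  shows "TT M v = TT N v"
proof -
  have zero: "max 0 (v - ln (real (a * b * c * d * l\<^sup>2))) = 0"
    if r: "1 \<le> a" "1 \<le> b" "1 \<le> c" "1 \<le> d" "1 \<le> l" and big: "N < a \<or> N < b \<or> N < c \<or> N < d \<or> N < l" for a b c d l :: nat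
  proof -
    have l2: "l \<le> l\<^sup>2" by (simp add: power2_nat_le_imp_le self_le_power r)
    have pos: "1 \<le> a * b * c * d * l\<^sup>2" using r by simp
    have "a dvd a * b * c * d * l\<^sup>2" "b dvd a * b * c * d * l\<^sup>2" "c dvd a * b * c * d * l\<^sup>2" "d dvd a * b * c * d * l\<^sup>2" "l dvd a * b * c * d * l\<^sup>2"
      by (simp_all add: power2_eq_square)
    then have "a \<le> a * b * c * d * l\<^sup>2" "b \<le> a * b * c * d * l\<^sup>2" "c \<le> a * b * c * d * l\<^sup>2" "d \<le> a * b * c * d * l\<^sup>2" "l \<le> a * b * c * d * l\<^sup>2"
      using pos by (simp_all only: dvd_imp_le)
    then have "N \<le> a * b * c * d * l\<^sup>2" using big by linarith
    then have "exp v \<le> real (a * b * c * d * l\<^sup>2)" using assms(1) by (meson of_nat_le_iff order.trans)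
    then have "ln (exp v) \<le> ln (real (a * b * c * d * l\<^sup>2))" by (subst ln_le_cancel_iff) (use less_le_trans[OF exp_gt_zero[of v]] in auto)
    then show ?thesis by simp
  qed
  define g where "g a b c d l = real l * max 0 (v - ln (real (a * b * c * d * l\<^sup>2)))" for a b c d l :: nat
  have gz: "g a b c d l = 0" if "1 \<le> a" "1 \<le> b" "1 \<le> c" "1 \<le> d" "1 \<le> l" "N < a \<or> N < b \<or> N < c \<or> N < d \<or> N < l" for a b c d l
    using zero[OF that] by (simp add: g_def)
  have cut: "(\<Sum>n=1..M. f n) = (\<Sum>n=1..N. f n)" if "\<And>n. 1 \<le> n \<Longrightarrow> N < n \<Longrightarrow> f n = 0" for f :: "nat \<Rightarrow> real"
    by (rule sum.mono_neutral_right) (use assms(2) that in auto)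
  have "TT M v = (\<Sum>a=1..N. \<Sum>b=1..M. \<Sum>c=1..M. \<Sum>d=1..M. \<Sum>l=1..M. g a b c d l)"
    unfolding TT_def g_def[symmetric] by (rule cut) (auto intro!: sum.neutral gz)
  also have "\<dots> = (\<Sum>a=1..N. \<Sum>b=1..N. \<Sum>c=1..M. \<Sum>d=1..M. \<Sum>l=1..M. g a b c d l)"
    by (rule sum.cong[OF refl], rule cut) (auto intro!: sum.neutral gz)
  also have "\<dots> = (\<Sum>a=1..N. \<Sum>b=1..N. \<Sum>c=1..N. \<Sum>d=1..M. \<Sum>l=1..M. g a b c d l)"
    by (rule sum.cong[OF refl], rule sum.cong[OF refl], rule cut) (auto intro!: sum.neutral gz)
  also have "\<dots> = (\<Sum>a=1..N. \<Sum>b=1..N. \<Sum>c=1..N. \<Sum>d=1..N. \<Sum>l=1..M. g a b c d l)"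
    by (rule sum.cong[OF refl], rule sum.cong[OF refl], rule sum.cong[OF refl], rule cut) (auto intro!: sum.neutral gz)
  also have "\<dots> = (\<Sum>a=1..N. \<Sum>b=1..N. \<Sum>c=1..N. \<Sum>d=1..N. \<Sum>l=1..N. g a b c d l)"
    by (rule sum.cong[OF refl], rule sum.cong[OF refl], rule sum.cong[OF refl], rule sum.cong[OF refl], rule cut) (auto intro!: gz)
  finally show ?thesis by (simp only: TT_def g_def)
qed

lemma continuous_Fz_vertical:
  assumes "1/4 < c" "c \<noteq> 1"
  shows "continuous_on UNIV (\<lambda>t. Fz (Complex c t))"
proof -
  have lin: "2 * Complex c t - 1 = Complex (2 * c - 1) (2 * t)" for t by (simp add: complex_eq_iff)
  have "continuous_on UNIV (\<lambda>t. zet (Complex (2 * c - 1) t))" by (intro continuous_zet_line) (use assms in auto)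
  then have "continuous_on UNIV (\<lambda>t. zet (Complex (2 * c - 1) (2 * t)))"
    by (rule continuous_on_compose2) (auto intro!: continuous_intros)
  moreover have "continuous_on UNIV (\<lambda>t. zet (Complex c t))" by (intro continuous_zet_line) (use assms in auto)
  ultimately show ?thesis unfolding Fz_def lin by (intro continuous_intros) auto
qed

lemma norm_Fz_line_two: "norm (Fz (Complex 2 t)) \<le> 32"
proof (rule Lim_norm_ubound[OF _ Fz_line_two_limit])
  show "\<forall>\<^sub>F N in sequentially. norm ((\<Sum>n=1..N. npow (real n) (Complex 2 t)) ^ 4 * (\<Sum>l=1..N. npow (real l) (2 * Complex 2 t - 1))) \<le> 32"
  proof (rule always_eventually, rule allI)
    fix N
    have "norm (\<Sum>n=1..N. npow (real n) (Complex 2 t)) ^ 4 * norm (\<Sum>l=1..N. npow (real l) (2 * Complex 2 t - 1)) \<le> 2 ^ 4 * 2"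
      by (intro mult_mono power_mono norm_partial_zeta_le) auto
    then show "norm ((\<Sum>n=1..N. npow (real n) (Complex 2 t)) ^ 4 * (\<Sum>l=1..N. npow (real l) (2 * Complex 2 t - 1))) \<le> 32"
      by (simp add: norm_mult norm_power)
  qed
qed simp

lemma line_two_square_bound: "norm (exp (of_real v * Complex 2 t) / (Complex 2 t)\<^sup>2) \<le> exp (2 * v) * inverse (1 + t\<^sup>2)"
proof -
  have "norm (exp (of_real v * Complex 2 t) / (Complex 2 t)\<^sup>2) = exp (v * 2) * (1 / (norm (Complex 2 t))\<^sup>2)"
    by (simp add: norm_divide norm_power norm_exp_line)
  also have "\<dots> \<le> exp (v * 2) * (max 1 (1 / 1\<^sup>2) / (1 + t\<^sup>2))"
    using inverse_square_le[of 1 "Complex 2 t"] by (intro mult_left_mono) auto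
  finally show ?thesis by (simp add: mult.commute divide_inverse)
qed

lemma Fz_line_two_integral:
  assumes N: "exp v \<le> real N"
  shows "integrable lborel (\<lambda>t. exp (of_real v * Complex 2 t) / (Complex 2 t)\<^sup>2 * Fz (Complex 2 t))"
    and "(LINT t|lborel. exp (of_real v * Complex 2 t) / (Complex 2 t)\<^sup>2 * Fz (Complex 2 t)) = 2 * of_real pi * of_real (TT N v)"
proof -
  define e where "e t = exp (of_real v * Complex 2 t) / (Complex 2 t)\<^sup>2" for t
  define S where "S N t = (\<Sum>n=1..N. npow (real n) (Complex 2 t)) ^ 4 * (\<Sum>l=1..N. npow (real l) (2 * Complex 2 t - 1))" for N t
  have nz: "Complex 2 t \<noteq> 0" for t by (simp add: complex_eq_iff)
  have ce: "continuous_on UNIV e" unfolding e_def using nz by (intro continuous_intros continuous_line_id) auto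
  have lin: "2 * Complex 2 t - 1 = Complex 3 (2 * t)" for t by (simp add: complex_eq_iff)
  have c3: "continuous_on UNIV (\<lambda>t. npow u (Complex 3 (2 * t)))" for u
    by (rule continuous_on_compose2[OF continuous_npow_line[of UNIV u 3]]) (auto intro!: continuous_intros)
  have cS: "continuous_on UNIV (S N)" for N unfolding S_def lin by (intro continuous_intros continuous_npow_line c3)
  have cF: "continuous_on UNIV (\<lambda>t. Fz (Complex 2 t))" by (rule continuous_Fz_vertical) auto
  have bS: "norm (S N t) \<le> 32" for N t
  proof -
    have "norm (\<Sum>n=1..N. npow (real n) (Complex 2 t)) ^ 4 * norm (\<Sum>l=1..N. npow (real l) (2 * Complex 2 t - 1)) \<le> 2 ^ 4 * 2"
      by (intro mult_mono power_mono norm_partial_zeta_le) auto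
    then show ?thesis by (simp add: S_def norm_mult norm_power)
  qed
  have be: "norm (e t * w) \<le> (exp (2 * v) * 32) * inverse (1 + t\<^sup>2)" if "norm w \<le> 32" for t w
  proof -
    have "norm (e t) * norm w \<le> (exp (2 * v) * inverse (1 + t\<^sup>2)) * 32"
      using line_two_square_bound[of v t] that by (intro mult_mono) (auto simp: e_def)
    then show ?thesis by (simp add: norm_mult mult_ac)
  qed
  show "integrable lborel (\<lambda>t. exp (of_real v * Complex 2 t) / (Complex 2 t)\<^sup>2 * Fz (Complex 2 t))"
    unfolding e_def[symmetric]
    by (rule integrable_of_inverse_square_bound[where C = "exp (2 * v) * 32"])
       (use be[OF norm_Fz_line_two] in \<open>auto intro!: continuous_intros ce cF simp: divide_inverse\<close>)
  have "(\<lambda>N. LINT t|lborel. e t * S N t) \<longlonglongrightarrow> (LINT t|lborel. e t * Fz (Complex 2 t))"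
  proof (rule integral_dominated_convergence[where w = "\<lambda>t. (exp (2 * v) * 32) * inverse (1 + t\<^sup>2)"])
    show "(\<lambda>t. e t * Fz (Complex 2 t)) \<in> borel_measurable lborel"
      using borel_measurable_continuous_onI[OF continuous_on_mult[OF ce cF]] by simp
    show "(\<lambda>t. e t * S N t) \<in> borel_measurable lborel" for N
      using borel_measurable_continuous_onI[OF continuous_on_mult[OF ce cS]] by simp
    show "integrable lborel (\<lambda>t. (exp (2 * v) * 32) * inverse (1 + t\<^sup>2))"
      by (intro integrable_mult_right integrable_inverse_1_plus_square_UNIV)
    show "AE t in lborel. (\<lambda>N. e t * S N t) \<longlonglongrightarrow> e t * Fz (Complex 2 t)"
      unfolding S_def by (rule AE_I2) (intro tendsto_intros Fz_line_two_limit)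
    show "AE t in lborel. norm (e t * S N t) \<le> (exp (2 * v) * 32) * inverse (1 + t\<^sup>2)" for N
      by (rule AE_I2) (rule be[OF bS])
  qed
  then have l1: "(\<lambda>M. 2 * of_real pi * complex_of_real (TT M v)) \<longlonglongrightarrow> (LINT t|lborel. e t * Fz (Complex 2 t))"
    unfolding e_def S_def TT_line_integral .
  have "(\<lambda>M. 2 * of_real pi * complex_of_real (TT M v)) \<longlonglongrightarrow> 2 * of_real pi * complex_of_real (TT N v)"
  proof (rule tendsto_eventually)
    show "\<forall>\<^sub>F M in sequentially. 2 * of_real pi * complex_of_real (TT M v) = 2 * of_real pi * complex_of_real (TT N v)"
      using eventually_ge_at_top[of N]
    proof eventually_elim
      case (elim M)
      show ?case by (simp only: TT_eventually_const[OF N elim])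
    qed
  qed
  from LIMSEQ_unique[OF l1 this]
  show "(LINT t|lborel. exp (of_real v * Complex 2 t) / (Complex 2 t)\<^sup>2 * Fz (Complex 2 t)) = 2 * of_real pi * of_real (TT N v)"
    by (simp only: e_def)
qed

section \<open>The pole of order 5 at z = 1\<close>

text \<open>The factor 2 in the denominator comes from the pole of \<open>\<zeta>(2z - 1)\<close>.\<close>

definition Phi :: "complex \<Rightarrow> complex" where
  "Phi z = Zser z ^ 4 * Zser (2 * z - 1) / (2 * z\<^sup>2)"

lemma holomorphic_Phi: "Phi holomorphic_on {z. 1/4 < Re z}"
proof -
  have a: "Zser holomorphic_on {z. 1/4 < Re z}" by (rule holomorphic_on_subset[OF holomorphic_Zser]) auto
  have "(Zser \<circ> (\<lambda>z. 2 * z - 1)) holomorphic_on {z. 1/4 < Re z}"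
    by (rule holomorphic_on_compose_gen[OF _ holomorphic_Zser]) (auto intro!: holomorphic_intros)
  then have b: "(\<lambda>z. Zser (2 * z - 1)) holomorphic_on {z. 1/4 < Re z}" by (simp add: o_def)
  have "2 * z\<^sup>2 \<noteq> 0" if "z \<in> {z. 1/4 < Re z}" for z :: complex using that by auto
  then show ?thesis unfolding Phi_def [abs_def] by (intro holomorphic_intros a b) auto
qed

lemma Phi_1: "Phi 1 = 1/2"
  by (simp add: Phi_def Zser_1)

lemma Fz_eq_Phi: "z \<noteq> 1 \<Longrightarrow> Fz z / z\<^sup>2 = Phi z / (z - 1) ^ 5"
proof -
  assume z: "z \<noteq> 1"
  have "Fz z = Zser z ^ 4 * Zser (2 * z - 1) / ((z - 1) ^ 4 * (2 * (z - 1)))"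
    by (simp add: Fz_def zet_def power_divide)
  also have "(z - 1) ^ 4 * (2 * (z - 1)) = 2 * (z - 1) ^ 5" by (simp add: eval_nat_numeral)
  finally show ?thesis by (simp add: Phi_def mult_ac)
qed

text \<open>Five successive quotients instead of a power series, so that the remainder
  \<open>\<Psi>\<close> is holomorphic on the whole half plane through which the line is
  moved.\<close>

lemma Phi_taylor:
  "\<exists>\<phi>0 \<phi>1 \<phi>2 \<phi>3 \<phi>4 \<Psi>. \<Psi> holomorphic_on {z. 1/4 < Re z} \<and> \<phi>0 = 1/2 \<and>
    (\<forall>z. 1/4 < Re z \<longrightarrow> Phi z = \<phi>0 + (z - 1) * (\<phi>1 + (z - 1) * (\<phi>2 + (z - 1) * (\<phi>3 + (z - 1) * (\<phi>4 + (z - 1) * \<Psi> z)))))"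
proof -
  let ?S = "{z. 1/4 < Re z}"
  have op: "open ?S" by (rule open_halfspace_Re_gt)
  have m: "1 \<in> ?S" by simp
  obtain g1 where g1: "g1 holomorphic_on ?S" "\<And>z. z \<in> ?S \<Longrightarrow> Phi z = Phi 1 + (z - 1) * g1 z" "g1 1 = deriv Phi 1"
    by (rule holomorphic_quotient[OF holomorphic_Phi op m], rule that)
  obtain g2 where g2: "g2 holomorphic_on ?S" "\<And>z. z \<in> ?S \<Longrightarrow> g1 z = g1 1 + (z - 1) * g2 z" "g2 1 = deriv g1 1"
    by (rule holomorphic_quotient[OF g1(1) op m], rule that)
  obtain g3 where g3: "g3 holomorphic_on ?S" "\<And>z. z \<in> ?S \<Longrightarrow> g2 z = g2 1 + (z - 1) * g3 z" "g3 1 = deriv g2 1"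
    by (rule holomorphic_quotient[OF g2(1) op m], rule that)
  obtain g4 where g4: "g4 holomorphic_on ?S" "\<And>z. z \<in> ?S \<Longrightarrow> g3 z = g3 1 + (z - 1) * g4 z" "g4 1 = deriv g3 1"
    by (rule holomorphic_quotient[OF g3(1) op m], rule that)
  obtain g5 where g5: "g5 holomorphic_on ?S" "\<And>z. z \<in> ?S \<Longrightarrow> g4 z = g4 1 + (z - 1) * g5 z" "g5 1 = deriv g4 1"
    by (rule holomorphic_quotient[OF g4(1) op m], rule that)
  show ?thesis
  proof (rule exI[of _ "Phi 1"], rule exI[of _ "g1 1"], rule exI[of _ "g2 1"], rule exI[of _ "g3 1"], rule exI[of _ "g4 1"],
      rule exI[of _ g5], intro conjI allI impI)
    show "g5 holomorphic_on ?S" by (rule g5(1))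
    show "Phi 1 = 1/2" by (rule Phi_1)
    fix z :: complex assume "1/4 < Re z"
    then have z: "z \<in> ?S" by simp
    show "Phi z = Phi 1 + (z - 1) * (g1 1 + (z - 1) * (g2 1 + (z - 1) * (g3 1 + (z - 1) * (g4 1 + (z - 1) * g5 z))))"
      by (simp only: g1(2)[OF z] g2(2)[OF z] g3(2)[OF z] g4(2)[OF z] g5(2)[OF z])
  qed
qed

text \<open>The constants are the Taylor coefficients of \<open>Phi\<close> at 1, hence the Laurent
  coefficients of Fz(z)/z^2 there. The value of \<open>\<phi>0\<close> is recorded because its being
  nonzero makes the degree of the main term exactly 4.\<close>

locale laurent =
  fixes \<phi>0 \<phi>1 \<phi>2 \<phi>3 \<phi>4 :: complex and \<Psi> :: "complex \<Rightarrow> complex"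
  assumes holo: "\<Psi> holomorphic_on {z. 1/4 < Re z}" and \<phi>0: "\<phi>0 = 1/2"
    and Phi_eq: "\<And>z. 1/4 < Re z \<Longrightarrow> Phi z = \<phi>0 + (z - 1) * (\<phi>1 + (z - 1) * (\<phi>2 + (z - 1) * (\<phi>3 + (z - 1) * (\<phi>4 + (z - 1) * \<Psi> z))))"
begin

text \<open>The simple pole is removed with \<open>\<phi>4 / (z (z - 1))\<close> rather than \<open>\<phi>4 / (z - 1)\<close>, so that what remains
  decays quadratically on vertical lines.\<close>

definition H :: "complex \<Rightarrow> complex" where "H z = \<Psi> z + \<phi>4 / z"

lemma H_holo: "H holomorphic_on {z. 1/4 < Re z}"
  unfolding H_def [abs_def] by (intro holomorphic_intros holo) auto

lemma H_eq:
  assumes z: "1/4 < Re z" "z \<noteq> 1"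
  shows "H z = Fz z / z\<^sup>2 - \<phi>0 / (z - 1) ^ 5 - \<phi>1 / (z - 1) ^ 4 - \<phi>2 / (z - 1) ^ 3 - \<phi>3 / (z - 1) ^ 2 - \<phi>4 / (z * (z - 1))"
proof -
  define w where "w = z - 1"
  have w0: "w \<noteq> 0" and z0: "z \<noteq> 0" using z by (auto simp: w_def)
  have st: "(a + w * b) / w ^ Suc k = a / w ^ Suc k + b / w ^ k" for a b k
    using w0 by (simp add: add_divide_distrib)
  have "Fz z / z\<^sup>2 = (\<phi>0 + w * (\<phi>1 + w * (\<phi>2 + w * (\<phi>3 + w * (\<phi>4 + w * \<Psi> z))))) / w ^ 5"
    using Fz_eq_Phi[OF z(2)] Phi_eq[OF z(1)] by (simp add: w_def)
  also have "\<dots> = \<phi>0 / w ^ 5 + (\<phi>1 / w ^ 4 + (\<phi>2 / w ^ 3 + (\<phi>3 / w ^ 2 + (\<phi>4 / w ^ 1 + \<Psi> z / w ^ 0))))"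
    using st[of _ _ 4] st[of _ _ 3] st[of _ _ 2] st[of _ _ 1] st[of _ _ 0] by (simp add: numeral_eq_Suc)
  finally have F: "Fz z / z\<^sup>2 = \<phi>0 / w ^ 5 + (\<phi>1 / w ^ 4 + (\<phi>2 / w ^ 3 + (\<phi>3 / w ^ 2 + (\<phi>4 / w + \<Psi> z))))" by simp
  have "1 / (z * w) = 1 / w - 1 / z"
  proof -
    have "1 / w - 1 / z = (z - w) / (w * z)" using w0 z0 by (simp add: diff_frac_eq)
    then show ?thesis by (simp add: w_def mult.commute)
  qed
  then have "\<phi>4 * (1 / (z * w)) = \<phi>4 * (1 / w) - \<phi>4 * (1 / z)" by (simp only: right_diff_distrib)
  then have "\<phi>4 / (z * w) = \<phi>4 / w - \<phi>4 / z" by simp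
  then show ?thesis unfolding H_def F w_def[symmetric] by simp
qed

text \<open>A crude power suffices, since a Gaussian factor will absorb it. The exponent 15 = 4 * 3
  + 3 comes from the cubic bound for \<open>Zser\<close> in each of the five zeta factors.\<close>

lemma H_growth: "\<exists>C\<ge>0. \<forall>z. sig0 \<le> Re z \<longrightarrow> Re z \<le> 2 \<longrightarrow> 1 \<le> \<bar>Im z\<bar> \<longrightarrow> norm (H z) \<le> C * (3 + \<bar>Im z\<bar>) ^ 15"
proof -
  define C where "C = 262144 + norm \<phi>0 + norm \<phi>1 + norm \<phi>2 + norm \<phi>3 + norm \<phi>4"
  show ?thesis
  proof (intro exI[of _ C] conjI allI impI)
    show "0 \<le> C" by (simp add: C_def)
    fix z assume z: "sig0 \<le> Re z" "Re z \<le> 2" "1 \<le> \<bar>Im z\<bar>"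
    have re: "1/4 < Re z" using z(1) by (simp add: sig0_def)
    have zn1: "z \<noteq> 1" using z(3) by auto
    define M where "M = 3 + \<bar>Im z\<bar>"
    have M1: "1 \<le> M" by (simp add: M_def)
    have nz: "1 + norm z \<le> M" using cmod_le[of z] z re by (simp add: M_def)
    have n1: "1 \<le> norm (z - 1)" using abs_Im_le_cmod[of "z - 1"] z by simp
    have n0: "1 \<le> norm z" using abs_Im_le_cmod[of z] z by simp
    have n2: "1 \<le> norm (2 * z - 1 - 1)"
    proof -
      have "norm (2 * z - 1 - 1) = norm (2 * (z - 1))" by (rule arg_cong[where f = norm]) simp
      also have "\<dots> = 2 * norm (z - 1)" by (simp only: norm_mult norm_numeral)
      finally show ?thesis using n1 by linarith
    qed
    have le_div: "norm (a / b) \<le> norm a" if "1 \<le> norm b" for a b :: complex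
      using that norm_ge_zero[of a] by (simp add: norm_divide divide_le_eq mult_le_cancel_left1)
    have zz: "norm (zet z) \<le> 8 * M ^ 3"
    proof -
      have "norm (zet z) \<le> norm (Zser z)" unfolding zet_def by (rule le_div[OF n1])
      also have "\<dots> \<le> 8 * (1 + norm z) ^ 3" by (rule Zser_bound) (use re in simp)
      also have "\<dots> \<le> 8 * M ^ 3" using nz by (intro mult_left_mono power_mono) auto
      finally show ?thesis .
    qed
    have zz2: "norm (zet (2 * z - 1)) \<le> 64 * M ^ 3"
    proof -
      have "norm (zet (2 * z - 1)) \<le> norm (Zser (2 * z - 1))" unfolding zet_def by (rule le_div[OF n2])
      also have "\<dots> \<le> 8 * (1 + norm (2 * z - 1)) ^ 3" by (rule Zser_bound) (use re in simp)
      also have "\<dots> \<le> 8 * (2 * M) ^ 3"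
      proof (intro mult_left_mono power_mono)
        have "norm (2 * z - 1) \<le> norm (2 * z) + 1" using norm_triangle_ineq4[of "2 * z" 1] by simp
        also have "norm (2 * z) = 2 * norm z" by (simp add: norm_mult)
        finally show "1 + norm (2 * z - 1) \<le> 2 * M" using nz by linarith
      qed auto
      finally show ?thesis by (simp add: power_mult_distrib)
    qed
    have "norm (Fz z / z\<^sup>2) \<le> norm (Fz z)" using n0 by (intro le_div) (simp add: norm_power one_le_power)
    also have "\<dots> \<le> (8 * M ^ 3) ^ 4 * (64 * M ^ 3)" unfolding Fz_def norm_mult norm_power
      using zz zz2 M1 by (intro mult_mono power_mono) auto
    also have "\<dots> = 262144 * M ^ 15" by (simp add: power_mult_distrib flip: power_mult power_add)
    finally have b0: "norm (Fz z / z\<^sup>2) \<le> 262144 * M ^ 15" .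
    have M15: "1 \<le> M ^ 15" using M1 by (rule one_le_power)
    have pw: "norm (a / (z - 1) ^ k) \<le> norm a * M ^ 15" for a k
    proof -
      have "norm (a / (z - 1) ^ k) \<le> norm a" using n1 by (intro le_div) (simp add: norm_power one_le_power)
      also have "\<dots> \<le> norm a * M ^ 15" using M15 by (simp add: mult_le_cancel_left1)
      finally show ?thesis .
    qed
    have p4: "norm (\<phi>4 / (z * (z - 1))) \<le> norm \<phi>4 * M ^ 15"
    proof -
      have "1 * 1 \<le> norm z * norm (z - 1)" using n0 n1 by (intro mult_mono) auto
      then have "norm (\<phi>4 / (z * (z - 1))) \<le> norm \<phi>4" by (intro le_div) (simp add: norm_mult)
      also have "\<dots> \<le> norm \<phi>4 * M ^ 15" using M15 by (simp add: mult_le_cancel_left1)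
      finally show ?thesis .
    qed
    have "norm (H z) \<le> 262144 * M ^ 15 + norm \<phi>0 * M ^ 15 + norm \<phi>1 * M ^ 15 + norm \<phi>2 * M ^ 15 + norm \<phi>3 * M ^ 15 + norm \<phi>4 * M ^ 15"
      unfolding H_eq[OF re zn1]
      by (rule order.trans[OF norm_triangle_ineq4] add_mono b0 pw p4)+
    also have "\<dots> = C * M ^ 15" by (simp add: C_def algebra_simps)
    finally show "norm (H z) \<le> C * (3 + \<bar>Im z\<bar>) ^ 15" by (simp add: M_def)
  qed
qed

lemma pole_integrable:
  assumes "c = sig0 \<or> c = 2" "2 \<le> k"
  shows "integrable lborel (\<lambda>t. a / (Complex c t - 1) ^ k)"
proof (rule integrable_of_inverse_square_bound)
  define m :: real where "m = 1/2"
  have re: "m \<le> \<bar>Re (Complex c t - 1)\<bar>" for t using assms(1) by (auto simp: sig0_def m_def)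
  have nz: "Complex c t - 1 \<noteq> 0" for t using assms(1) by (auto simp: complex_eq_iff sig0_def)
  show "continuous_on UNIV (\<lambda>t. a / (Complex c t - 1) ^ k)" using nz by (intro continuous_intros continuous_line_id) auto
  fix t
  have mn: "m \<le> norm (Complex c t - 1)" using re[of t] abs_Re_le_cmod[of "Complex c t - 1"] by linarith
  have m0: "0 < m" by (simp add: m_def)
  have k: "k = (k - 2) + 2" using assms(2) by simp
  have "norm (a / (Complex c t - 1) ^ k) = norm a * (1 / norm (Complex c t - 1) ^ (k - 2) * (1 / (norm (Complex c t - 1))\<^sup>2))"
    by (subst k, simp only: norm_divide norm_power power_add norm_mult) simp
  also have "\<dots> \<le> norm a * (1 / m ^ (k - 2) * (max 1 (1 / m\<^sup>2) / (1 + t\<^sup>2)))"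
  proof (intro mult_left_mono mult_mono)
    show "1 / norm (Complex c t - 1) ^ (k - 2) \<le> 1 / m ^ (k - 2)"
      using mn m0 by (intro divide_left_mono power_mono mult_pos_pos zero_less_power) auto
    show "1 / (norm (Complex c t - 1))\<^sup>2 \<le> max 1 (1 / m\<^sup>2) / (1 + t\<^sup>2)" using inverse_square_le[OF m0 re, of t] by simp
  qed (use m0 in auto)
  finally show "norm (a / (Complex c t - 1) ^ k) \<le> (norm a * (1 / m ^ (k - 2) * max 1 (1 / m\<^sup>2))) / (1 + t\<^sup>2)" by simp
qed

lemma mixed_pole_integrable:
  assumes "c = sig0 \<or> c = 2"
  shows "integrable lborel (\<lambda>t. a / (Complex c t * (Complex c t - 1)))"
proof (rule integrable_of_inverse_square_bound)
  define m :: real where "m = 1/4"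
  have m0: "0 < m" by (simp add: m_def)
  have re: "m \<le> \<bar>Re (Complex c t - 1)\<bar>" "m \<le> \<bar>Re (Complex c t)\<bar>" for t using assms(1) by (auto simp: sig0_def m_def)
  have nz: "Complex c t - 1 \<noteq> 0" "Complex c t \<noteq> 0" for t using assms(1) by (auto simp: complex_eq_iff sig0_def)
  show "continuous_on UNIV (\<lambda>t. a / (Complex c t * (Complex c t - 1)))" using nz by (intro continuous_intros continuous_line_id) auto
  fix t
  let ?x = "1 / norm (Complex c t)" and ?y = "1 / norm (Complex c t - 1)"
  have "norm (a / (Complex c t * (Complex c t - 1))) = norm a * (?x * ?y)" by (simp add: norm_divide norm_mult)
  also have "\<dots> \<le> norm a * ((?x\<^sup>2 + ?y\<^sup>2) / 2)" using sum_squares_bound[of ?x ?y] by (intro mult_left_mono) auto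
  also have "\<dots> \<le> norm a * ((max 1 (1 / m\<^sup>2) / (1 + t\<^sup>2) + max 1 (1 / m\<^sup>2) / (1 + t\<^sup>2)) / 2)"
    using inverse_square_le[OF m0 re(1), of t] inverse_square_le[OF m0 re(2), of t]
    by (intro mult_left_mono divide_right_mono add_mono) (auto simp: power_divide)
  also have "\<dots> = (norm a * max 1 (1 / m\<^sup>2)) / (1 + t\<^sup>2)" by (simp only: add_divide_distrib field_sum_of_halves times_divide_eq_right)
  finally show "norm (a / (Complex c t * (Complex c t - 1))) \<le> (norm a * max 1 (1 / m\<^sup>2)) / (1 + t\<^sup>2)" .
qed

lemma H_line_eq:
  assumes "c = sig0 \<or> c = 2"
  shows "H (Complex c t) = Fz (Complex c t) / (Complex c t)\<^sup>2 - \<phi>0 / (Complex c t - 1) ^ 5 - \<phi>1 / (Complex c t - 1) ^ 4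
    - \<phi>2 / (Complex c t - 1) ^ 3 - \<phi>3 / (Complex c t - 1) ^ 2 - \<phi>4 / (Complex c t * (Complex c t - 1))"
  by (rule H_eq) (use assms in \<open>auto simp: sig0_def complex_eq_iff\<close>)

end

section \<open>The shift to the line Re z = 1/2 - 1/108\<close>

lemma cnj_zet: "- 1/2 \<le> Re s \<Longrightarrow> zet (cnj s) = cnj (zet s)"
  by (simp add: zet_def cnj_Zser)

lemma norm_Fz_reflect:
  assumes "1/4 \<le> Re z"
  shows "norm (Fz (cnj z)) = norm (Fz z)"
proof -
  have "2 * cnj z - 1 = cnj (2 * z - 1)" by simp
  then have "Fz (cnj z) = cnj (Fz z)" unfolding Fz_def using assms
    by (simp only: cnj_zet complex_cnj_mult complex_cnj_power) (subst cnj_zet, auto)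
  then show ?thesis by simp
qed

text \<open>The moment bound controls t \<ge> 1, conjugation carries it to t \<le> -1, and monotone
  convergence turns bounded truncated integrals into integrability.\<close>

lemma Fz_left_line_integrable: "integrable lborel (\<lambda>t. Fz (Complex sig0 t) / (Complex sig0 t)\<^sup>2)"
proof -
  define f where "f t = norm (Fz (Complex sig0 t) / (Complex sig0 t)\<^sup>2)" for t
  have nz: "Complex sig0 t \<noteq> 0" for t by (simp add: complex_eq_iff sig0_def)
  have cF: "continuous_on UNIV (\<lambda>t. Fz (Complex sig0 t) / (Complex sig0 t)\<^sup>2)"
    using nz by (intro continuous_intros continuous_line_id continuous_Fz_vertical) (auto simp: sig0_def)
  have cf: "continuous_on UNIV f" unfolding f_def by (intro continuous_intros cF)
  have intf: "f integrable_on {a..b}" for a b by (rule integrable_continuous_interval, rule continuous_on_subset[OF cf]) auto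
  obtain C where C: "C > 0" "\<And>R. 1 \<le> R \<Longrightarrow> integral {1..R} (\<lambda>t. norm (Fz (Complex sig0 t)) / t\<^sup>2) \<le> C" using Fz_moment by blast
  have sym: "f (- t) = f t" for t
  proof -
    have "Complex sig0 (- t) = cnj (Complex sig0 t)" by (simp add: complex_eq_iff)
    then show ?thesis unfolding f_def norm_divide norm_power
      using norm_Fz_reflect[of "Complex sig0 t"] by (simp add: sig0_def complex_norm)
  qed
  have one: "integral {1..R} f \<le> C" if "1 \<le> R" for R
  proof -
    have "integral {1..R} f \<le> integral {1..R} (\<lambda>t. norm (Fz (Complex sig0 t)) / t\<^sup>2)"
    proof (rule integral_le[OF intf])
      show "(\<lambda>t. norm (Fz (Complex sig0 t)) / t\<^sup>2) integrable_on {1..R}"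
        by (rule integrable_continuous_interval, rule continuous_on_subset[OF continuous_Fz_line]) auto
      fix t :: real assume t: "t \<in> {1..R}"
      have "t\<^sup>2 \<le> (norm (Complex sig0 t))\<^sup>2" by (simp add: cmod_power2)
      then show "f t \<le> norm (Fz (Complex sig0 t)) / t\<^sup>2" unfolding f_def norm_divide norm_power
        using t by (intro divide_left_mono mult_pos_pos) (auto intro: less_le_trans[of 0 "t\<^sup>2"])
    qed
    then show ?thesis using C(2)[OF that] by linarith
  qed
  have bdd: "integral {- real n..real n} f \<le> integral {-1..1} f + 2 * C" for n :: nat
  proof (cases "n = 0")
    case True
    have "0 \<le> integral {-1..1} f" by (rule integral_nonneg[OF intf]) (simp add: f_def)
    then show ?thesis using True C by simp
  next
    case False
    then have n: "1 \<le> real n" by simp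
    have "integral {- real n..real n} f = integral {- real n..-1} f + integral {-1..real n} f"
      by (rule Henstock_Kurzweil_Integration.integral_combine[symmetric]) (use n intf in auto)
    also have "integral {-1..real n} f = integral {-1..1} f + integral {1..real n} f"
      by (rule Henstock_Kurzweil_Integration.integral_combine[symmetric]) (use n intf in auto)
    also have "integral {- real n..-1} f = integral {1..real n} f"
      using Henstock_Kurzweil_Integration.integral_reflect_real[of "real n" 1 f] by (simp add: sym)
    finally show ?thesis using one[OF n] by linarith
  qed
  have "integrable lborel f"
    by (rule integrable_of_bounded_integrals[OF cf _ bdd]) (simp add: f_def)
  then show ?thesis unfolding f_def
    by (subst (asm) integrable_norm_iff) (use borel_measurable_continuous_onI[OF cF] in auto)
qed

text \<open>For x \<ge> 1 the polynomial is at most a constant times x^18 = (x^2)^9, and y \<le> exp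
  y at y = e x^2/9, raised to the power 9, gives (e x^2/9)^9 \<le> exp(e x^2).\<close>

lemma power_times_gauss_le:
  assumes e: "0 < e"
  shows "\<exists>C\<ge>0. \<forall>x::real. 1 \<le> x \<longrightarrow> (3 + x) ^ 15 * (1 + x\<^sup>2) * exp (- e * x\<^sup>2) \<le> C"
proof (intro exI[of _ "4 ^ 15 * 2 * (9 / e) ^ 9"] conjI allI impI)
  show "0 \<le> 4 ^ 15 * 2 * (9 / e) ^ 9" using e by simp
  fix x :: real assume x: "1 \<le> x"
  have "e * x\<^sup>2 / 9 \<le> exp (e * x\<^sup>2 / 9)" using exp_ge_add_one_self[of "e * x\<^sup>2 / 9"] by linarith
  then have "(e * x\<^sup>2 / 9) ^ 9 \<le> exp (e * x\<^sup>2 / 9) ^ 9" using e by (intro power_mono) auto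
  also have "\<dots> = exp (e * x\<^sup>2)" by (simp flip: exp_of_nat_mult)
  finally have le: "(e * x\<^sup>2 / 9) ^ 9 \<le> exp (e * x\<^sup>2)" .
  have "(3 + x) ^ 15 * (1 + x\<^sup>2) \<le> (4 * x) ^ 15 * (2 * x ^ 3)"
  proof (intro mult_mono power_mono)
    have "x\<^sup>2 \<le> x ^ 3" "1 \<le> x ^ 3" using x by (auto intro: power_increasing one_le_power)
    then show "1 + x\<^sup>2 \<le> 2 * x ^ 3" by linarith
  qed (use x in auto)
  also have "\<dots> = 4 ^ 15 * 2 * x ^ 18" by (simp add: power_mult_distrib flip: power_add)
  also have "x ^ 18 = (9 / e) ^ 9 * (e * x\<^sup>2 / 9) ^ 9"
  proof -
    have "(9 / e) ^ 9 * (e * x\<^sup>2 / 9) ^ 9 = (x\<^sup>2) ^ 9" using e by (simp flip: power_mult_distrib)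
    then show ?thesis by (simp flip: power_mult)
  qed
  also have "4 ^ 15 * 2 * ((9 / e) ^ 9 * (e * x\<^sup>2 / 9) ^ 9) \<le> 4 ^ 15 * 2 * ((9 / e) ^ 9 * exp (e * x\<^sup>2))"
    using le e by (intro mult_left_mono) auto
  finally have "(3 + x) ^ 15 * (1 + x\<^sup>2) * exp (- e * x\<^sup>2) \<le> (4 ^ 15 * 2 * ((9 / e) ^ 9 * exp (e * x\<^sup>2))) * exp (- e * x\<^sup>2)"
    by (rule mult_right_mono) simp
  also have "\<dots> = 4 ^ 15 * 2 * (9 / e) ^ 9 * (exp (e * x\<^sup>2) * exp (- e * x\<^sup>2))" by (simp only: mult.assoc)
  also have "exp (e * x\<^sup>2) * exp (- e * x\<^sup>2) = 1" by (simp flip: exp_add)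
  finally show "(3 + x) ^ 15 * (1 + x\<^sup>2) * exp (- e * x\<^sup>2) \<le> 4 ^ 15 * 2 * (9 / e) ^ 9" by simp
qed

lemma norm_gauss: "norm (exp (of_real e * z\<^sup>2)) = exp (e * ((Re z)\<^sup>2 - (Im z)\<^sup>2))"
  by (simp add: norm_exp_eq_Re power2_eq_square)

context laurent
begin

lemma H_left_integrable: "integrable lborel (\<lambda>t. H (Complex sig0 t))"
  unfolding H_line_eq[OF disjI1[OF refl]]
  by (intro Bochner_Integration.integrable_diff Fz_left_line_integrable pole_integrable mixed_pole_integrable) auto

text \<open>Between the two lines \<open>H\<close> is bounded only by a power of |Im z|. Since
  |exp(e z^2)| = exp(e((Re z)^2 - (Im z)^2)), the extra factor restores the quadratic decay that
  \<open>vertical_shift\<close> requires.\<close>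

lemma shifted_gauss_integral:
  assumes e: "0 < e"
  shows "(LINT t|lborel. exp (of_real e * (Complex sig0 t)\<^sup>2) * (exp (of_real v * Complex sig0 t) * H (Complex sig0 t)))
       = (LINT t|lborel. exp (of_real e * (Complex 2 t)\<^sup>2) * (exp (of_real v * Complex 2 t) * H (Complex 2 t)))"
proof -
  define g where "g z = exp (of_real e * z\<^sup>2) * (exp (of_real v * z) * H z)" for z
  have ghol: "g holomorphic_on {z. 1/4 < Re z}" unfolding g_def [abs_def] by (intro holomorphic_intros H_holo)
  obtain C1 where C1: "C1 \<ge> 0" "\<And>z. sig0 \<le> Re z \<Longrightarrow> Re z \<le> 2 \<Longrightarrow> 1 \<le> \<bar>Im z\<bar> \<Longrightarrow> norm (H z) \<le> C1 * (3 + \<bar>Im z\<bar>) ^ 15"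
    using H_growth by blast
  obtain C2 where C2: "C2 \<ge> 0" "\<And>x::real. 1 \<le> x \<Longrightarrow> (3 + x) ^ 15 * (1 + x\<^sup>2) * exp (- e * x\<^sup>2) \<le> C2"
    using power_times_gauss_le[OF e] by blast
  define C3 where "C3 = exp (e * 4) * (exp (\<bar>v\<bar> * 2) * C1) * C2"
  have "\<exists>C'. \<forall>z. sig0 \<le> Re z \<longrightarrow> Re z \<le> 2 \<longrightarrow> norm (g z) \<le> C' / (1 + (Im z)\<^sup>2)"
  proof (rule strip_bound_extend[where C = C3])
    show "continuous_on {z. sig0 \<le> Re z \<and> Re z \<le> 2} g"
      by (rule continuous_on_subset[OF holomorphic_on_imp_continuous_on[OF ghol]]) (auto simp: sig0_def)
    fix z assume z: "sig0 \<le> Re z" "Re z \<le> 2" "1 \<le> \<bar>Im z\<bar>"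
    define x where "x = \<bar>Im z\<bar>"
    have x2: "x\<^sup>2 = (Im z)\<^sup>2" by (simp add: x_def)
    have re0: "0 \<le> Re z" using z(1) by (simp add: sig0_def)
    have "(Re z)\<^sup>2 \<le> 2\<^sup>2" using z re0 by (intro power_mono) auto
    then have "e * ((Re z)\<^sup>2 - (Im z)\<^sup>2) \<le> e * 4 + - e * x\<^sup>2" using e by (simp add: x2 algebra_simps)
    then have a: "norm (exp (of_real e * z\<^sup>2)) \<le> exp (e * 4) * exp (- e * x\<^sup>2)" unfolding norm_gauss exp_add[symmetric] by simp
    have "v * Re z \<le> \<bar>v\<bar> * 2" using z re0 by (intro mult_mono) auto
    then have b: "norm (exp (of_real v * z)) \<le> exp (\<bar>v\<bar> * 2)" unfolding norm_exp_line by simp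
    have c: "norm (H z) \<le> C1 * (3 + x) ^ 15" unfolding x_def by (rule C1(2)[OF z])
    have "norm (g z) \<le> (exp (e * 4) * exp (- e * x\<^sup>2)) * (exp (\<bar>v\<bar> * 2) * (C1 * (3 + x) ^ 15))"
      unfolding g_def norm_mult using a b c by (intro mult_mono) auto
    also have "\<dots> = (exp (e * 4) * (exp (\<bar>v\<bar> * 2) * C1)) * ((3 + x) ^ 15 * exp (- e * x\<^sup>2))" by (simp only: mult_ac)
    also have "\<dots> \<le> (exp (e * 4) * (exp (\<bar>v\<bar> * 2) * C1)) * (C2 / (1 + x\<^sup>2))"
    proof (rule mult_left_mono)
      have p: "0 < 1 + x\<^sup>2" by (intro add_pos_nonneg) auto
      have "(3 + x) ^ 15 * (1 + x\<^sup>2) * exp (- e * x\<^sup>2) \<le> C2" by (rule C2(2)) (use z in \<open>simp add: x_def\<close>)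
      then have "((3 + x) ^ 15 * exp (- e * x\<^sup>2)) * (1 + x\<^sup>2) \<le> C2" by (simp only: mult_ac)
      then show "(3 + x) ^ 15 * exp (- e * x\<^sup>2) \<le> C2 / (1 + x\<^sup>2)" using p by (simp only: pos_le_divide_eq)
    qed (use C1 in auto)
    also have "\<dots> = C3 / (1 + (Im z)\<^sup>2)" by (simp add: C3_def x2)
    finally show "norm (g z) \<le> C3 / (1 + (Im z)\<^sup>2)" .
  qed
  then obtain C' where C': "\<And>z. sig0 \<le> Re z \<Longrightarrow> Re z \<le> 2 \<Longrightarrow> norm (g z) \<le> C' / (1 + (Im z)\<^sup>2)" by blast
  have "(LINT t|lborel. g (Complex sig0 t)) = (LINT t|lborel. g (Complex 2 t))"
  proof (rule vertical_shift[where a' = "1/4" and b' = 3])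
    show "g holomorphic_on {z. 1/4 < Re z \<and> Re z < 3}" by (rule holomorphic_on_subset[OF ghol]) auto
  qed (use C' in \<open>auto simp: sig0_def\<close>)
  then show ?thesis by (simp only: g_def)
qed

text \<open>Uniform in \<open>e\<close>, because sig0 < 1 and e \<le> 1 keep |exp(e z^2)| \<le> exp
  1 on this line. The factor exp(v * sig0) is the x^(1/2 - 1/108) of the error term, with v = log
  x.\<close>

lemma left_gauss_bound:
  assumes e: "0 < e" "e \<le> 1"
  shows "norm (LINT t|lborel. exp (of_real e * (Complex sig0 t)\<^sup>2) * (exp (of_real v * Complex sig0 t) * H (Complex sig0 t)))
    \<le> exp 1 * exp (v * sig0) * (LINT t|lborel. norm (H (Complex sig0 t)))"
proof -
  have cH: "continuous_on UNIV (\<lambda>t. H (Complex sig0 t))"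
    by (rule continuous_on_line[OF holomorphic_on_imp_continuous_on[OF H_holo]]) (simp add: sig0_def)
  have ptw: "norm (exp (of_real e * (Complex sig0 t)\<^sup>2) * (exp (of_real v * Complex sig0 t) * H (Complex sig0 t)))
     \<le> exp 1 * exp (v * sig0) * norm (H (Complex sig0 t))" for t
  proof -
    have "e * (sig0\<^sup>2 - t\<^sup>2) \<le> 1"
    proof -
      have "e * (sig0\<^sup>2 - t\<^sup>2) \<le> e * sig0\<^sup>2" using e by (intro mult_left_mono) auto
      also have "\<dots> \<le> 1 * 1" using e by (intro mult_mono) (auto simp: sig0_def power2_eq_square)
      finally show ?thesis by simp
    qed
    then have "norm (exp (of_real e * (Complex sig0 t)\<^sup>2)) \<le> exp 1" unfolding norm_gauss by simp
    then have "norm (exp (of_real e * (Complex sig0 t)\<^sup>2)) * (norm (exp (of_real v * Complex sig0 t)) * norm (H (Complex sig0 t)))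
       \<le> exp 1 * (norm (exp (of_real v * Complex sig0 t)) * norm (H (Complex sig0 t)))" by (intro mult_right_mono) auto
    then show ?thesis unfolding norm_mult by (simp add: norm_exp_line)
  qed
  have intn: "integrable lborel (\<lambda>t. exp 1 * exp (v * sig0) * norm (H (Complex sig0 t)))"
    by (intro integrable_mult_right integrable_norm H_left_integrable)
  have int: "integrable lborel (\<lambda>t. exp (of_real e * (Complex sig0 t)\<^sup>2) * (exp (of_real v * Complex sig0 t) * H (Complex sig0 t)))"
  proof (rule Bochner_Integration.integrable_bound[OF intn])
    have "continuous_on UNIV (\<lambda>t. exp (of_real e * (Complex sig0 t)\<^sup>2) * (exp (of_real v * Complex sig0 t) * H (Complex sig0 t)))"
      by (intro continuous_intros continuous_line_id cH)
    then show "(\<lambda>t. exp (of_real e * (Complex sig0 t)\<^sup>2) * (exp (of_real v * Complex sig0 t) * H (Complex sig0 t))) \<in> borel_measurable lborel"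
      using borel_measurable_continuous_onI by simp
    show "AE t in lborel. norm (exp (of_real e * (Complex sig0 t)\<^sup>2) * (exp (of_real v * Complex sig0 t) * H (Complex sig0 t)))
      \<le> norm (exp 1 * exp (v * sig0) * norm (H (Complex sig0 t)))"
      by (rule AE_I2) (use ptw in \<open>simp add: abs_mult\<close>)
  qed
  have "norm (LINT t|lborel. exp (of_real e * (Complex sig0 t)\<^sup>2) * (exp (of_real v * Complex sig0 t) * H (Complex sig0 t)))
     \<le> (LINT t|lborel. norm (exp (of_real e * (Complex sig0 t)\<^sup>2) * (exp (of_real v * Complex sig0 t) * H (Complex sig0 t))))"
    by (rule integral_norm_bound)
  also have "\<dots> \<le> (LINT t|lborel. exp 1 * exp (v * sig0) * norm (H (Complex sig0 t)))"
    by (rule integral_mono[OF integrable_norm[OF int] intn ptw])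
  also have "\<dots> = exp 1 * exp (v * sig0) * (LINT t|lborel. norm (H (Complex sig0 t)))" by (rule integral_mult_right_zero)
  finally show ?thesis .
qed

lemma H_right_value:
  assumes v: "0 < v" and N: "exp v \<le> real N"
  shows "integrable lborel (\<lambda>t. exp (of_real v * Complex 2 t) * H (Complex 2 t))"
    and "(LINT t|lborel. exp (of_real v * Complex 2 t) * H (Complex 2 t)) = 2 * of_real pi * (of_real (TT N v)
       - \<phi>0 * of_real (exp v * (v ^ 4 / 24)) - \<phi>1 * of_real (exp v * (v ^ 3 / 6)) - \<phi>2 * of_real (exp v * (v ^ 2 / 2))
       - \<phi>3 * of_real (exp v * v) - \<phi>4 * of_real (exp v - 1))"
proof -
  define e where "e t = exp (of_real v * Complex 2 t)" for t
  have p: "integrable lborel (\<lambda>t. e t / (Complex 2 t - 1) ^ (k + 2))"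
    "(LINT t|lborel. e t / (Complex 2 t - 1) ^ (k + 2)) = 2 * of_real pi * of_real (exp v * (v ^ (k + 1) / fact (k + 1)))" for k
    unfolding e_def using perron_power_shifted[OF v] by auto
  have s: "integrable lborel (\<lambda>t. e t / (Complex 2 t * (Complex 2 t - 1)))"
    "(LINT t|lborel. e t / (Complex 2 t * (Complex 2 t - 1))) = 2 * of_real pi * of_real (exp v - 1)"
    unfolding e_def using perron_simple[OF v] by auto
  have F: "integrable lborel (\<lambda>t. e t / (Complex 2 t)\<^sup>2 * Fz (Complex 2 t))"
    "(LINT t|lborel. e t / (Complex 2 t)\<^sup>2 * Fz (Complex 2 t)) = 2 * of_real pi * of_real (TT N v)"
    unfolding e_def using Fz_line_two_integral[OF N] by auto
  define q5 q4 q3 q2 q1 where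
    "q5 t = \<phi>0 * (e t / (Complex 2 t - 1) ^ 5)" and "q4 t = \<phi>1 * (e t / (Complex 2 t - 1) ^ 4)"
    and "q3 t = \<phi>2 * (e t / (Complex 2 t - 1) ^ 3)" and "q2 t = \<phi>3 * (e t / (Complex 2 t - 1) ^ 2)"
    and "q1 t = \<phi>4 * (e t / (Complex 2 t * (Complex 2 t - 1)))" for t
  define qF where "qF t = e t / (Complex 2 t)\<^sup>2 * Fz (Complex 2 t)" for t
  have eq: "e t * H (Complex 2 t) = qF t - q5 t - q4 t - q3 t - q2 t - q1 t" for t
    unfolding H_line_eq[OF disjI2[OF refl]] q5_def q4_def q3_def q2_def q1_def qF_def
    by (simp add: right_diff_distrib mult_ac)
  have i5: "integrable lborel q5" unfolding q5_def using p(1)[of 3] by (intro integrable_mult_right) simp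
  have i4: "integrable lborel q4" unfolding q4_def using p(1)[of 2] by (intro integrable_mult_right) simp
  have i3: "integrable lborel q3" unfolding q3_def by (intro integrable_mult_right p(1)[of 1, unfolded nat_1_add_1 one_plus_numeral Num.add_num_simps])
  have i2: "integrable lborel q2" unfolding q2_def by (intro integrable_mult_right p(1)[of 0, unfolded add_0])
  have i1: "integrable lborel q1" unfolding q1_def using s(1) by (intro integrable_mult_right)
  have iF: "integrable lborel qF" unfolding qF_def by (rule F(1))
  note d5 = Bochner_Integration.integrable_diff[OF iF i5]
  note d4 = Bochner_Integration.integrable_diff[OF d5 i4]
  note d3 = Bochner_Integration.integrable_diff[OF d4 i3]
  note d2 = Bochner_Integration.integrable_diff[OF d3 i2]
  note d1 = Bochner_Integration.integrable_diff[OF d2 i1]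
  show "integrable lborel (\<lambda>t. exp (of_real v * Complex 2 t) * H (Complex 2 t))"
    unfolding e_def[symmetric] eq by (rule d1)
  have v5: "(LINT t|lborel. q5 t) = \<phi>0 * (2 * of_real pi * of_real (exp v * (v ^ 4 / 24)))"
    unfolding q5_def integral_mult_right_zero using p(2)[of 3] by (simp add: fact_numeral)
  have v4: "(LINT t|lborel. q4 t) = \<phi>1 * (2 * of_real pi * of_real (exp v * (v ^ 3 / 6)))"
    unfolding q4_def integral_mult_right_zero using p(2)[of 2] by (simp add: fact_numeral)
  have v3: "(LINT t|lborel. q3 t) = \<phi>2 * (2 * of_real pi * of_real (exp v * (v ^ 2 / 2)))"
    unfolding q3_def integral_mult_right_zero using p(2)[of 1] by (simp add: numeral_3_eq_3 power2_eq_square)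
  have v2: "(LINT t|lborel. q2 t) = \<phi>3 * (2 * of_real pi * of_real (exp v * v))"
    unfolding q2_def integral_mult_right_zero using p(2)[of 0] by (simp add: numeral_2_eq_2)
  have v1: "(LINT t|lborel. q1 t) = \<phi>4 * (2 * of_real pi * of_real (exp v - 1))"
    unfolding q1_def integral_mult_right_zero using s(2) by simp
  have vF: "(LINT t|lborel. qF t) = 2 * of_real pi * of_real (TT N v)" unfolding qF_def by (rule F(2))
  have "(LINT t|lborel. e t * H (Complex 2 t)) = (LINT t|lborel. qF t) - (LINT t|lborel. q5 t) - (LINT t|lborel. q4 t) - (LINT t|lborel. q3 t) - (LINT t|lborel. q2 t) - (LINT t|lborel. q1 t)"
    unfolding eq
    by (simp only: Bochner_Integration.integral_diff[OF d2 i1] Bochner_Integration.integral_diff[OF d3 i2] Bochner_Integration.integral_diff[OF d4 i3]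
        Bochner_Integration.integral_diff[OF d5 i4] Bochner_Integration.integral_diff[OF iF i5])
  also have "\<dots> = 2 * of_real pi * (of_real (TT N v)
       - \<phi>0 * of_real (exp v * (v ^ 4 / 24)) - \<phi>1 * of_real (exp v * (v ^ 3 / 6)) - \<phi>2 * of_real (exp v * (v ^ 2 / 2))
       - \<phi>3 * of_real (exp v * v) - \<phi>4 * of_real (exp v - 1))"
    unfolding vF v5 v4 v3 v2 v1 by (simp only: right_diff_distrib mult_ac)
  finally show "(LINT t|lborel. exp (of_real v * Complex 2 t) * H (Complex 2 t)) = 2 * of_real pi * (of_real (TT N v)
       - \<phi>0 * of_real (exp v * (v ^ 4 / 24)) - \<phi>1 * of_real (exp v * (v ^ 3 / 6)) - \<phi>2 * of_real (exp v * (v ^ 2 / 2))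
       - \<phi>3 * of_real (exp v * v) - \<phi>4 * of_real (exp v - 1))" unfolding e_def .
qed

text \<open>The limit e \<rightarrow> 0 is taken on the right line only, by dominated convergence
  with the factor exp 4; on the left line the bound uniform in e is enough.\<close>

lemma H_right_bound:
  assumes v: "0 < v"
  shows "norm (LINT t|lborel. exp (of_real v * Complex 2 t) * H (Complex 2 t))
    \<le> exp 1 * exp (v * sig0) * (LINT t|lborel. norm (H (Complex sig0 t)))"
proof -
  obtain N :: nat where N: "exp v \<le> real N" using real_arch_simple by blast
  define f where "f t = exp (of_real v * Complex 2 t) * H (Complex 2 t)" for t
  define g where "g n t = exp (of_real (1 / real (Suc n)) * (Complex 2 t)\<^sup>2) * f t" for n t
  have int: "integrable lborel f" unfolding f_def by (rule H_right_value(1)[OF v N])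
  have cH: "continuous_on UNIV (\<lambda>t. H (Complex 2 t))"
    by (rule continuous_on_line[OF holomorphic_on_imp_continuous_on[OF H_holo]]) simp
  have cf: "continuous_on UNIV f" unfolding f_def by (intro continuous_intros continuous_line_id cH)
  have lim: "(\<lambda>n. LINT t|lborel. g n t) \<longlonglongrightarrow> (LINT t|lborel. f t)"
  proof (rule integral_dominated_convergence[where w = "\<lambda>t. exp 4 * norm (f t)"])
    show "f \<in> borel_measurable lborel" using int by (rule borel_measurable_integrable)
    have cg: "continuous_on UNIV (g n)" for n unfolding g_def by (intro continuous_intros continuous_line_id cf)
    show "g n \<in> borel_measurable lborel" for n using borel_measurable_continuous_onI[OF cg[of n]] by simp
    show "integrable lborel (\<lambda>t. exp 4 * norm (f t))" by (intro integrable_mult_right integrable_norm int)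
    show "AE t in lborel. (\<lambda>n. g n t) \<longlonglongrightarrow> f t"
    proof (rule AE_I2)
      fix t :: real
      have "(\<lambda>n. 1 / real (Suc n)) \<longlonglongrightarrow> 0" by real_asymp
      then have "(\<lambda>n. exp (of_real (1 / real (Suc n)) * (Complex 2 t)\<^sup>2) * f t) \<longlonglongrightarrow> exp (of_real 0 * (Complex 2 t)\<^sup>2) * f t"
        by (intro tendsto_intros)
      then show "(\<lambda>n. g n t) \<longlonglongrightarrow> f t" by (simp add: g_def)
    qed
    show "AE t in lborel. norm (g n t) \<le> exp 4 * norm (f t)" for n
    proof (rule AE_I2)
      fix t :: real
      have "1 / real (Suc n) * (2\<^sup>2 - t\<^sup>2) \<le> 1 / real (Suc n) * 2\<^sup>2" by (intro mult_left_mono) auto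
      also have "\<dots> \<le> 1 * 2\<^sup>2" by (intro mult_right_mono) auto
      finally have "norm (exp (of_real (1 / real (Suc n)) * (Complex 2 t)\<^sup>2)) \<le> exp 4" unfolding norm_gauss by simp
      then show "norm (g n t) \<le> exp 4 * norm (f t)" unfolding g_def norm_mult by (intro mult_right_mono) auto
    qed
  qed
  show ?thesis unfolding f_def[symmetric]
  proof (rule Lim_norm_ubound[OF _ lim])
    show "\<forall>\<^sub>F n in sequentially. norm (LINT t|lborel. g n t) \<le> exp 1 * exp (v * sig0) * (LINT t|lborel. norm (H (Complex sig0 t)))"
    proof (rule always_eventually, rule allI)
      fix n
      have e: "0 < 1 / real (Suc n)" "1 / real (Suc n) \<le> 1" by auto
      have "(LINT t|lborel. g n t) = (LINT t|lborel. exp (of_real (1 / real (Suc n)) * (Complex sig0 t)\<^sup>2) * (exp (of_real v * Complex sig0 t) * H (Complex sig0 t)))"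
        unfolding g_def f_def by (rule shifted_gauss_integral[OF e(1), symmetric])
      then show "norm (LINT t|lborel. g n t) \<le> exp 1 * exp (v * sig0) * (LINT t|lborel. norm (H (Complex sig0 t)))"
        using left_gauss_bound[OF e, of v] by (simp only:)
    qed
  qed simp
qed

end

theorem TT_asymptotics:
  "\<exists>Q :: real poly. degree Q = 4 \<and> (\<exists>C. \<forall>v>0. \<forall>N. exp v \<le> real N \<longrightarrow> \<bar>TT N v - exp v * poly Q v\<bar> \<le> C * exp (v * sig0))"
proof -
  obtain \<phi>0 \<phi>1 \<phi>2 \<phi>3 \<phi>4 \<Psi> where L: "\<Psi> holomorphic_on {z. 1/4 < Re z}" "\<phi>0 = 1/2"
    "\<And>z. 1/4 < Re z \<Longrightarrow> Phi z = \<phi>0 + (z - 1) * (\<phi>1 + (z - 1) * (\<phi>2 + (z - 1) * (\<phi>3 + (z - 1) * (\<phi>4 + (z - 1) * \<Psi> z))))"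
    using Phi_taylor by blast
  interpret laurent \<phi>0 \<phi>1 \<phi>2 \<phi>3 \<phi>4 \<Psi> by unfold_locales (use L in auto)
  define K where "K = exp 1 * (LINT t|lborel. norm (H (Complex sig0 t)))"
  \<comment> \<open>A pole term of order k + 1 contributes its coefficient times e^v v^k/k!, so the
    coefficient of v^4 is (1/2)/24 \<noteq> 0. The simple pole, removed by means of 1/(z(z - 1)),
    gives e^v - 1 instead of e^v; the leftover constant Re \<phi>4 goes into the error.\<close>
  define Q :: "real poly" where "Q = [:Re \<phi>4, Re \<phi>3, Re \<phi>2 / 2, Re \<phi>1 / 6, Re \<phi>0 / 24:]"
  have "degree Q = 4" by (simp add: Q_def L(2))
  moreover have "\<bar>TT N v - exp v * poly Q v\<bar> \<le> (K + \<bar>Re \<phi>4\<bar>) * exp (v * sig0)" if v: "0 < v" and N: "exp v \<le> real N" for v N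
  proof -
    define I where "I = (LINT t|lborel. exp (of_real v * Complex 2 t) * H (Complex 2 t))"
    have I: "I = 2 * of_real pi * (of_real (TT N v)
       - \<phi>0 * of_real (exp v * (v ^ 4 / 24)) - \<phi>1 * of_real (exp v * (v ^ 3 / 6)) - \<phi>2 * of_real (exp v * (v ^ 2 / 2))
       - \<phi>3 * of_real (exp v * v) - \<phi>4 * of_real (exp v - 1))" unfolding I_def by (rule H_right_value(2)[OF v N])
    have rr: "Re (w * of_real r) = Re w * r" "Re (of_real r * w) = r * Re w" for w :: complex and r by simp_all
    have "Re I = Re (of_real (2 * pi) * (of_real (TT N v)
       - \<phi>0 * of_real (exp v * (v ^ 4 / 24)) - \<phi>1 * of_real (exp v * (v ^ 3 / 6)) - \<phi>2 * of_real (exp v * (v ^ 2 / 2))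
       - \<phi>3 * of_real (exp v * v) - \<phi>4 * of_real (exp v - 1)))" unfolding I by simp
    also have "\<dots> = 2 * pi * (TT N v - Re \<phi>0 * (exp v * (v ^ 4 / 24)) - Re \<phi>1 * (exp v * (v ^ 3 / 6)) - Re \<phi>2 * (exp v * (v ^ 2 / 2))
       - Re \<phi>3 * (exp v * v) - Re \<phi>4 * (exp v - 1))"
      by (simp only: rr minus_complex.simps(1) Re_complex_of_real)
    also have "TT N v - Re \<phi>0 * (exp v * (v ^ 4 / 24)) - Re \<phi>1 * (exp v * (v ^ 3 / 6)) - Re \<phi>2 * (exp v * (v ^ 2 / 2))
       - Re \<phi>3 * (exp v * v) - Re \<phi>4 * (exp v - 1) = (TT N v - exp v * poly Q v) + Re \<phi>4"
      by (simp add: Q_def algebra_simps power2_eq_square power3_eq_cube power4_eq_xxxx)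
    finally have R: "Re I = 2 * pi * ((TT N v - exp v * poly Q v) + Re \<phi>4)" .
    have "\<bar>Re I\<bar> \<le> K * exp (v * sig0)"
      using abs_Re_le_cmod[of I] H_right_bound[OF v] by (simp add: I_def K_def mult_ac)
    then have "2 * pi * \<bar>(TT N v - exp v * poly Q v) + Re \<phi>4\<bar> \<le> K * exp (v * sig0)" unfolding R abs_mult by simp
    moreover have "1 * \<bar>(TT N v - exp v * poly Q v) + Re \<phi>4\<bar> \<le> 2 * pi * \<bar>(TT N v - exp v * poly Q v) + Re \<phi>4\<bar>"
      using pi_gt3 by (intro mult_right_mono) auto
    ultimately have "\<bar>(TT N v - exp v * poly Q v) + Re \<phi>4\<bar> \<le> K * exp (v * sig0)" by (simp only: mult_1_left)
    moreover have "\<bar>TT N v - exp v * poly Q v\<bar> \<le> \<bar>(TT N v - exp v * poly Q v) + Re \<phi>4\<bar> + \<bar>Re \<phi>4\<bar>"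
      using abs_triangle_ineq4[of "(TT N v - exp v * poly Q v) + Re \<phi>4" "Re \<phi>4"] by (simp only: add_diff_cancel_right')
    ultimately have "\<bar>TT N v - exp v * poly Q v\<bar> \<le> K * exp (v * sig0) + \<bar>Re \<phi>4\<bar>" by (meson add_right_mono order.trans)
    also have "\<bar>Re \<phi>4\<bar> \<le> \<bar>Re \<phi>4\<bar> * exp (v * sig0)"
    proof -
      have "1 \<le> exp (v * sig0)" using v by (simp add: sig0_def)
      then show ?thesis by (simp add: mult_le_cancel_left1)
    qed
    finally show ?thesis by (simp add: distrib_right)
  qed
  ultimately show ?thesis by blast
qed

section \<open>Subgroups of a product of two cyclic groups\<close>

lemma card_le_mult_dvd:
  fixes a e :: nat
  assumes "0 < e"
  shows "card {t. t < e \<and> e dvd a * t} = gcd a e"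
proof -
  define g where "g = gcd a e"
  have g: "g > 0" "g dvd e" "g dvd a" using assms by (auto simp: g_def)
  have eg: "(e div g) * g = e" using g by simp
  have eg0: "0 < e div g" using eg assms by (metis gr0I mult_is_0)
  have "{t. t < e \<and> e dvd a * t} = (\<lambda>k. (e div g) * k) ` {..<g}"
  proof (intro Set.set_eqI iffI)
    fix t assume "t \<in> {t. t < e \<and> e dvd a * t}"
    then have t: "t < e" "e dvd a * t" by auto
    have "coprime (a div g) (e div g)" using assms by (auto simp: g_def div_gcd_coprime)
    moreover have "((a div g) * t) * g = a * t" using g(3) by (metis dvd_div_mult_self mult.commute mult.left_commute)
    then have "(e div g) * g dvd ((a div g) * t) * g" using t(2) by (simp only: eg)
    then have "e div g dvd (a div g) * t" using g(1) nat_mult_dvd_cancel1[of g] by (simp only: mult.commute[of _ g])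
    ultimately have "e div g dvd t" by (simp add: coprime_commute coprime_dvd_mult_right_iff)
    then obtain k where k: "t = (e div g) * k" by blast
    have "(e div g) * k < (e div g) * g" using t(1) unfolding k eg .
    then have "k < g" by simp
    then show "t \<in> (\<lambda>k. (e div g) * k) ` {..<g}" using k by auto
  next
    fix t assume "t \<in> (\<lambda>k. (e div g) * k) ` {..<g}"
    then obtain k where k: "k < g" "t = (e div g) * k" by auto
    have "(e div g) * k < (e div g) * g" using k(1) eg0 by simp
    then have "t < e" by (simp only: k(2) eg)
    moreover have "e dvd a * t"
    proof -
      have "a * t = ((a div g) * g) * ((e div g) * k)" using g(3) k(2) by simp
      also have "\<dots> = ((a div g) * k) * ((e div g) * g)" by (simp only: mult_ac)
      also have "\<dots> = ((a div g) * k) * e" by (simp only: eg)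
      finally have "a * t = ((a div g) * k) * e" .
      then show ?thesis by simp
    qed
    ultimately show "t \<in> {t. t < e \<and> e dvd a * t}" by simp
  qed
  moreover have "inj_on (\<lambda>k. (e div g) * k) {..<g}"
    using eg0 by (auto simp: inj_on_def)
  ultimately show ?thesis by (simp add: card_image g_def)
qed

lemma carrier_ZZ: "0 < m \<Longrightarrow> 0 < n \<Longrightarrow> carrier (ZZ m n) = {0..<int m} \<times> {0..<int n}"
  by (simp add: carrier_integer_mod_group)

lemma group_ZZ: "Group.group (ZZ m n)"
  by (simp add: DirProd_group)

lemma inv_ZZ:
  assumes "(x, y) \<in> carrier (ZZ m n)"
  shows "inv\<^bsub>ZZ m n\<^esub> (x, y) = ((- x) mod int m, (- y) mod int n)"
  using assms by (subst inv_DirProd) auto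

text \<open>Lifting to \<open>\<int>\<^sup>2\<close>: a subgroup of \<open>\<int>\<^sub>m \<times> \<int>\<^sub>n\<close> becomes a sublattice of \<open>\<int>\<^sup>2\<close> containing \<open>m\<int> \<times> n\<int>\<close>.\<close>

definition lift_lattice :: "nat \<Rightarrow> nat \<Rightarrow> (int \<times> int) set \<Rightarrow> (int \<times> int) set" where
  "lift_lattice m n H = {(x, y). (x mod int m, y mod int n) \<in> H}"

lemma lift_lattice_closed:
  assumes H: "subgroup H (ZZ m n)" and mn: "0 < m" "0 < n"
  shows "(0, 0) \<in> lift_lattice m n H"
    and "(x, y) \<in> lift_lattice m n H \<Longrightarrow> (x', y') \<in> lift_lattice m n H \<Longrightarrow> (x + x', y + y') \<in> lift_lattice m n H"
    and "(x, y) \<in> lift_lattice m n H \<Longrightarrow> (- x, - y) \<in> lift_lattice m n H"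
    and "(int m * i, int n * j) \<in> lift_lattice m n H"
proof -
  have z: "(0, 0) \<in> H" using subgroup.one_closed[OF H] by simp
  then show "(0, 0) \<in> lift_lattice m n H" by (simp add: lift_lattice_def)
  show "(int m * i, int n * j) \<in> lift_lattice m n H" using z by (simp add: lift_lattice_def)
  show "(x + x', y + y') \<in> lift_lattice m n H" if "(x, y) \<in> lift_lattice m n H" "(x', y') \<in> lift_lattice m n H"
    using subgroup.m_closed[OF H, of "(x mod int m, y mod int n)" "(x' mod int m, y' mod int n)"] that
    by (simp add: lift_lattice_def mod_simps)
  show "(- x, - y) \<in> lift_lattice m n H" if xy: "(x, y) \<in> lift_lattice m n H"
  proof -
    have "(x mod int m, y mod int n) \<in> H" using xy by (simp add: lift_lattice_def)
    moreover from this have "inv\<^bsub>ZZ m n\<^esub> (x mod int m, y mod int n) \<in> H"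
      by (rule subgroup.m_inv_closed[OF H])
    moreover have "(x mod int m, y mod int n) \<in> carrier (ZZ m n)"
      using subgroup.subset[OF H] calculation(1) by blast
    ultimately show ?thesis by (simp add: inv_ZZ lift_lattice_def mod_simps del: inv_DirProd)
  qed
qed

lemma lift_lattice_int_mult:
  assumes H: "subgroup H (ZZ m n)" and mn: "0 < m" "0 < n" and xy: "(x, y) \<in> lift_lattice m n H"
  shows "(k * x, k * y) \<in> lift_lattice m n H"
proof -
  have nat: "(int j * x, int j * y) \<in> lift_lattice m n H" for j :: nat
  proof (induction j)
    case 0
    then show ?case using lift_lattice_closed(1)[OF H mn] by simp
  next
    case (Suc j)
    then show ?case using lift_lattice_closed(2)[OF H mn Suc xy] by (simp add: algebra_simps)
  qed
  show ?thesis
  proof (cases "k \<ge> 0")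
    case True
    then show ?thesis using nat[of "nat k"] by simp
  next
    case False
    then show ?thesis using lift_lattice_closed(3)[OF H mn nat[of "nat (- k)"]] by simp
  qed
qed

lemma int_subgroup_generator:
  fixes I :: "int set"
  assumes m: "0 < m" "int m \<in> I" and add: "\<And>x y. x \<in> I \<Longrightarrow> y \<in> I \<Longrightarrow> x + y \<in> I"
    and mult: "\<And>x k. x \<in> I \<Longrightarrow> k * x \<in> I"
  obtains d :: nat where "0 < d" "d dvd m" "\<And>x. x \<in> I \<longleftrightarrow> int d dvd x"
proof -
  define d where "d = (LEAST d :: nat. 0 < d \<and> int d \<in> I)"
  have d: "0 < d" "int d \<in> I" using LeastI[of "\<lambda>d. 0 < d \<and> int d \<in> I" m] m by (auto simp: d_def)
  have iff: "x \<in> I \<longleftrightarrow> int d dvd x" for x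
  proof
    assume x: "x \<in> I"
    have "x + (- (x div int d)) * int d \<in> I" using add[OF x mult[OF d(2)]] .
    then have r: "x mod int d \<in> I" by (simp add: minus_mult_div_eq_mod algebra_simps)
    show "int d dvd x"
    proof (rule ccontr)
      assume "\<not> int d dvd x"
      then have "x mod int d \<noteq> 0" by (metis dvd_eq_mod_eq_0)
      moreover have "0 \<le> x mod int d" using d by (intro pos_mod_sign) simp
      ultimately have "0 < x mod int d" by linarith
      then have "0 < nat (x mod int d) \<and> int (nat (x mod int d)) \<in> I" using r by simp
      then have "d \<le> nat (x mod int d)" unfolding d_def by (rule Least_le)
      moreover have "x mod int d < int d" using d by simp
      ultimately show False using \<open>0 < x mod int d\<close> by linarith
    qed
  next
    assume "int d dvd x"
    then show "x \<in> I" using mult[OF d(2)] by (metis dvd_def mult.commute)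
  qed
  then show ?thesis using that[of d] d m by (metis int_dvd_int_iff)
qed

text \<open>The lattice with basis \<open>(d, t)\<close>, \<open>(0, e)\<close>.\<close>

definition hnf_lattice :: "nat \<Rightarrow> nat \<Rightarrow> nat \<Rightarrow> (int \<times> int) set" where
  "hnf_lattice d e t = {(x, y). int d dvd x \<and> int e dvd (y - (x div int d) * int t)}"

text \<open>The last condition says that the lattice contains (m, 0), which is (m/d)(d, t) minus (0,
  (m/d) t); \<open>e dvd n\<close> does the same for (0, n), and \<open>t < e\<close> makes the
  basis unique.\<close>

definition hnf_params :: "nat \<Rightarrow> nat \<Rightarrow> (nat \<times> nat \<times> nat) set" where
  "hnf_params m n = {(d, e, t). d dvd m \<and> e dvd n \<and> t < e \<and> e dvd (m div d) * t}"

text \<open>\<open>d\<close> generates the projection to the first coordinate and \<open>e\<close>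
  the fibre over 0. The second coordinate of a lattice point above \<open>d\<close> is determined
  modulo \<open>e\<close>, which gives \<open>t\<close>.\<close>

lemma lift_lattice_hnf:
  assumes H: "subgroup H (ZZ m n)" and mn: "0 < m" "0 < n"
  obtains d e t where "(d, e, t) \<in> hnf_params m n" "lift_lattice m n H = hnf_lattice d e t"
proof -
  note cl = lift_lattice_closed[OF H mn] and sc = lift_lattice_int_mult[OF H mn]
  obtain d where d: "0 < d" "d dvd m" and d_iff: "\<And>x. x \<in> fst ` lift_lattice m n H \<longleftrightarrow> int d dvd x"
  proof (rule int_subgroup_generator[of m "fst ` lift_lattice m n H"])
    show "int m \<in> fst ` lift_lattice m n H" using cl(4)[of 1 0] by force
    show "x + y \<in> fst ` lift_lattice m n H" if "x \<in> fst ` lift_lattice m n H" "y \<in> fst ` lift_lattice m n H" for x y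
      using that cl(2) by force
    show "k * x \<in> fst ` lift_lattice m n H" if "x \<in> fst ` lift_lattice m n H" for x k
      using that sc by force
  qed (use mn in auto)
  obtain e where e: "0 < e" "e dvd n" and e_iff: "\<And>y. y \<in> {y. (0, y) \<in> lift_lattice m n H} \<longleftrightarrow> int e dvd y"
  proof (rule int_subgroup_generator[of n "{y. (0, y) \<in> lift_lattice m n H}"])
    show "int n \<in> {y. (0, y) \<in> lift_lattice m n H}" using cl(4)[of 0 1] by simp
    show "x + y \<in> {y. (0, y) \<in> lift_lattice m n H}" if "x \<in> {y. (0, y) \<in> lift_lattice m n H}" "y \<in> {y. (0, y) \<in> lift_lattice m n H}" for x y
      using that cl(2)[of 0 x 0 y] by simp
    show "k * x \<in> {y. (0, y) \<in> lift_lattice m n H}" if "x \<in> {y. (0, y) \<in> lift_lattice m n H}" for x k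
      using that sc[of 0 x k] by simp
  qed (use mn in auto)
  obtain t0 where t0: "(int d, t0) \<in> lift_lattice m n H" using d_iff[of "int d"] by force
  define t where "t = nat (t0 mod int e)"
  have t: "int t = t0 mod int e" "t < e" using e by (auto simp: t_def nat_less_iff)
  have "(int d + 0, t0 + (- (t0 div int e)) * int e) \<in> lift_lattice m n H"
    by (rule cl(2)[OF t0]) (use e_iff in auto)
  then have tin: "(int d, int t) \<in> lift_lattice m n H" by (simp add: t minus_mult_div_eq_mod algebra_simps)
  have eq: "lift_lattice m n H = hnf_lattice d e t"
  proof (intro Set.set_eqI iffI; clarify)
    fix x y assume xy: "(x, y) \<in> lift_lattice m n H"
    then have dx: "int d dvd x" using d_iff by force
    have "(x + (- (x div int d)) * int d, y + (- (x div int d)) * int t) \<in> lift_lattice m n H"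
      by (rule cl(2)[OF xy sc[OF tin]])
    then have "(0, y - (x div int d) * int t) \<in> lift_lattice m n H" using dx by simp
    then show "(x, y) \<in> hnf_lattice d e t" using e_iff dx by (auto simp: hnf_lattice_def)
  next
    fix x y assume "(x, y) \<in> hnf_lattice d e t"
    then have dx: "int d dvd x" and ey: "int e dvd (y - (x div int d) * int t)" by (auto simp: hnf_lattice_def)
    have "(0 + (x div int d) * int d, (y - (x div int d) * int t) + (x div int d) * int t) \<in> lift_lattice m n H"
      by (rule cl(2)[OF _ sc[OF tin]]) (use e_iff ey in auto)
    then show "(x, y) \<in> lift_lattice m n H" using dx by simp
  qed
  have "(int m, 0) \<in> hnf_lattice d e t" using cl(4)[of 1 0] eq by simp
  then have "int e dvd int ((m div d) * t)" by (simp add: hnf_lattice_def zdiv_int)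
  then have "(d, e, t) \<in> hnf_params m n" using d e t by (auto simp: hnf_params_def simp del: of_nat_mult)
  then show ?thesis using that eq by blast
qed

lemma hnf_lattice_inj:
  assumes "(d, e, t) \<in> hnf_params m n" "(d', e', t') \<in> hnf_params m n" "0 < m" "0 < n"
    and eq: "hnf_lattice d e t = hnf_lattice d' e' t'"
  shows "(d, e, t) = (d', e', t')"
proof -
  have pos: "0 < d" "0 < e" "0 < d'" "0 < e'" "t < e" "t' < e'" using assms by (auto simp: hnf_params_def intro: gr0I)
  have mem: "(x, y) \<in> hnf_lattice d e t \<longleftrightarrow> (x, y) \<in> hnf_lattice d' e' t'" for x y using eq by simp
  have "int d' dvd int d" using mem[of "int d" "int t"] pos by (simp add: hnf_lattice_def)
  moreover have "int d dvd int d'" using mem[of "int d'" "int t'"] pos by (simp add: hnf_lattice_def)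
  ultimately have dd: "d = d'" by (simp add: dvd_antisym)
  have "int e' dvd int e" using mem[of 0 "int e"] pos by (simp add: hnf_lattice_def)
  moreover have "int e dvd int e'" using mem[of 0 "int e'"] pos by (simp add: hnf_lattice_def)
  ultimately have ee: "e = e'" by (simp add: dvd_antisym)
  have "int e dvd int t - int t'" using mem[of "int d" "int t"] pos dd ee by (simp add: hnf_lattice_def)
  then have "t = t'" using pos ee by (metis mod_eq_dvd_iff mod_less of_nat_eq_iff of_nat_mod)
  then show ?thesis using dd ee by simp
qed

lemma hnf_lattice_subgroup:
  assumes p: "(d, e, t) \<in> hnf_params m n" and mn: "0 < m" "0 < n"
  defines "H \<equiv> hnf_lattice d e t \<inter> carrier (ZZ m n)"
  shows "subgroup H (ZZ m n)" "lift_lattice m n H = hnf_lattice d e t"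
proof -
  have pos: "0 < d" "0 < e" "d dvd m" "e dvd n" "e dvd (m div d) * t" using p mn
    by (auto simp: hnf_params_def intro: gr0I)
  have add: "(x + x', y + y') \<in> hnf_lattice d e t" if "(x, y) \<in> hnf_lattice d e t" "(x', y') \<in> hnf_lattice d e t" for x y x' y'
  proof -
    from that have dv: "int d dvd x" "int d dvd x'" and ev: "int e dvd (y - (x div int d) * int t)" "int e dvd (y' - (x' div int d) * int t)"
      by (auto simp: hnf_lattice_def)
    have "(x + x') div int d = x div int d + x' div int d" using dv by (simp add: div_plus_div_distrib_dvd_left)
    then have "y + y' - ((x + x') div int d) * int t = (y - (x div int d) * int t) + (y' - (x' div int d) * int t)"
      by (simp add: algebra_simps)
    then have "int e dvd y + y' - ((x + x') div int d) * int t" using dvd_add[OF ev] by (simp only:)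
    then show ?thesis using dv by (simp add: hnf_lattice_def)
  qed
  have neg: "(- x, - y) \<in> hnf_lattice d e t" if "(x, y) \<in> hnf_lattice d e t" for x y
  proof -
    from that have dv: "int d dvd x" and ev: "int e dvd (y - (x div int d) * int t)" by (auto simp: hnf_lattice_def)
    have "(- x) div int d = - (x div int d)" using dv by (simp add: dvd_neg_div)
    then have "- y - ((- x) div int d) * int t = - (y - (x div int d) * int t)" by (simp add: algebra_simps)
    then have "int e dvd - y - ((- x) div int d) * int t" using ev by (simp only: dvd_minus_iff)
    then show ?thesis using dv by (simp add: hnf_lattice_def)
  qed
  have per: "(int m * i, int n * j) \<in> hnf_lattice d e t" for i j
  proof -
    have "int m * i div int d = int (m div d) * i" using pos by (simp add: zdiv_int div_mult_swap mult.commute)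
    moreover have "int e dvd int n * j" "int e dvd int (m div d * t) * i" using pos by (meson dvd_mult2 int_dvd_int_iff)+
    ultimately show ?thesis using pos
      by (auto simp: hnf_lattice_def algebra_simps intro!: dvd_diff)
  qed
  have mod_iff: "(x mod int m, y mod int n) \<in> hnf_lattice d e t \<longleftrightarrow> (x, y) \<in> hnf_lattice d e t" for x y
  proof
    assume "(x mod int m, y mod int n) \<in> hnf_lattice d e t"
    from add[OF this per[of "x div int m" "y div int n"]] show "(x, y) \<in> hnf_lattice d e t" by simp
  next
    assume "(x, y) \<in> hnf_lattice d e t"
    from add[OF this per[of "- (x div int m)" "- (y div int n)"]]
    show "(x mod int m, y mod int n) \<in> hnf_lattice d e t" by (simp add: minus_mult_div_eq_mod)
  qed
  show lift: "lift_lattice m n H = hnf_lattice d e t"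
    using mod_iff mn unfolding H_def carrier_ZZ[OF mn] by (auto simp: lift_lattice_def)
  interpret Group.group "ZZ m n" by (rule group_ZZ)
  show "subgroup H (ZZ m n)"
  proof (rule subgroupI)
    show "H \<subseteq> carrier (ZZ m n)" by (simp add: H_def)
    show "H \<noteq> {}" using per[of 0 0] mn by (auto simp: H_def carrier_ZZ)
    fix a assume a: "a \<in> H"
    obtain x y where xy: "a = (x, y)" by force
    have c: "(x, y) \<in> carrier (ZZ m n)" and h: "(x, y) \<in> hnf_lattice d e t" using a xy by (auto simp: H_def)
    show "inv\<^bsub>ZZ m n\<^esub> a \<in> H" using neg[OF h] mn
      unfolding xy inv_ZZ[OF c] H_def carrier_ZZ[OF mn] by (simp add: mod_iff)
    fix b assume b: "b \<in> H"
    obtain x' y' where xy': "b = (x', y')" by force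
    have h': "(x', y') \<in> hnf_lattice d e t" using b xy' by (auto simp: H_def)
    show "a \<otimes>\<^bsub>ZZ m n\<^esub> b \<in> H" using add[OF h h'] mn
      unfolding xy xy' H_def carrier_ZZ[OF mn] by (simp add: mod_iff)
  qed
qed

lemma num_subgroups_eq_card:
  assumes mn: "0 < m" "0 < n"
  shows "num_subgroups m n = card (hnf_params m n)"
proof -
  define f where "f = (\<lambda>(d, e, t). hnf_lattice d e t \<inter> carrier (ZZ m n))"
  have "bij_betw f (hnf_params m n) {H. subgroup H (ZZ m n)}"
  proof (rule bij_betwI')
    fix p q assume pq: "p \<in> hnf_params m n" "q \<in> hnf_params m n"
    obtain d e t d' e' t' where e: "p = (d, e, t)" "q = (d', e', t')" by (metis prod_cases3)
    show "(f p = f q) = (p = q)"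
    proof
      assume "f p = f q"
      then have "hnf_lattice d e t = hnf_lattice d' e' t'"
        using hnf_lattice_subgroup(2)[OF pq(1)[unfolded e] mn] hnf_lattice_subgroup(2)[OF pq(2)[unfolded e] mn]
        by (simp add: f_def e)
      then show "p = q" using hnf_lattice_inj pq mn e by blast
    qed simp
    show "f p \<in> {H. subgroup H (ZZ m n)}" using hnf_lattice_subgroup(1)[OF pq(1)[unfolded e] mn] by (simp add: f_def e)
  next
    fix H assume "H \<in> {H. subgroup H (ZZ m n)}"
    then have H: "subgroup H (ZZ m n)" by simp
    obtain d e t where p: "(d, e, t) \<in> hnf_params m n" "lift_lattice m n H = hnf_lattice d e t"
      using lift_lattice_hnf[OF H mn] by blast
    have "H \<subseteq> {0..<int m} \<times> {0..<int n}" using subgroup.subset[OF H] carrier_ZZ[OF mn] by simp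
    then have "H = lift_lattice m n H \<inter> carrier (ZZ m n)"
      unfolding carrier_ZZ[OF mn] by (auto simp: lift_lattice_def subset_iff)
    then show "\<exists>x\<in>hnf_params m n. H = f x" using p by (auto simp: f_def)
  qed
  then show ?thesis unfolding num_subgroups_def using bij_betw_same_card by fastforce
qed

lemma sum_divisors_div:
  fixes f :: "nat \<Rightarrow> 'a :: comm_monoid_add"
  assumes "0 < m"
  shows "(\<Sum>d | d dvd m. f (m div d)) = (\<Sum>a | a dvd m. f a)"
  by (rule sum.reindex_bij_witness[of _ "\<lambda>d. m div d" "\<lambda>d. m div d"])
     (use assms in \<open>auto simp: div_div_eq_right\<close>)

text \<open>For fixed d and e the admissible t are the multiples of e/gcd(m/d, e) below e, and d
  \<mapsto> m/d permutes the divisors of m.\<close>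

theorem num_subgroups_eq_sum_gcd:
  assumes mn: "0 < m" "0 < n"
  shows "num_subgroups m n = (\<Sum>a | a dvd m. \<Sum>b | b dvd n. gcd a b)"
proof -
  have fin: "finite {d. d dvd m}" "finite {e. e dvd n}" using mn by auto
  have "hnf_params m n = Sigma {d. d dvd m} (\<lambda>d. Sigma {e. e dvd n} (\<lambda>e. {t. t < e \<and> e dvd (m div d) * t}))"
    by (auto simp: hnf_params_def)
  then have "num_subgroups m n = (\<Sum>d | d dvd m. \<Sum>e | e dvd n. card {t. t < e \<and> e dvd (m div d) * t})"
    using fin by (simp add: num_subgroups_eq_card[OF mn] card_SigmaI)
  also have "\<dots> = (\<Sum>d | d dvd m. \<Sum>e | e dvd n. gcd (m div d) e)"
  proof (intro sum.cong refl)
    fix e assume "e \<in> {e. e dvd n}"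
    then have "0 < e" using mn by (auto intro: gr0I)
    then show "card {t. t < e \<and> e dvd (m div d) * t} = gcd (m div d) e" for d by (rule card_le_mult_dvd)
  qed
  also have "\<dots> = (\<Sum>a | a dvd m. \<Sum>b | b dvd n. gcd a b)"
    by (rule sum_divisors_div[OF mn(1), of "\<lambda>a. \<Sum>b | b dvd n. gcd a b"])
  finally show ?thesis .
qed

section \<open>Counting cyclic subgroups\<close>

lemma finite_carrier_ZZ: "0 < m \<Longrightarrow> 0 < n \<Longrightarrow> finite (carrier (ZZ m n))"
  by (simp add: carrier_ZZ del: carrier_DirProd)

lemma pow_ZZ: "(x, y) [^]\<^bsub>ZZ m n\<^esub> k = ((int k * x) mod int m, (int k * y) mod int n)"
proof (induction k)
  case 0
  then show ?case by simp
next
  case (Suc k)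
  then show ?case by (simp add: mod_simps algebra_simps)
qed

lemma dvd_mult_iff_div_gcd:
  fixes m k :: nat and x :: int
  assumes "0 < m"
  shows "int m dvd int k * x \<longleftrightarrow> m div gcd (nat (x mod int m)) m dvd k"
proof -
  define u where "u = nat (x mod int m)"
  define g where "g = gcd u m"
  have u: "int u = x mod int m" using assms by (simp add: u_def)
  have g: "g > 0" "g dvd m" "g dvd u" using assms by (auto simp: g_def)
  have "int m dvd int k * x \<longleftrightarrow> int m dvd int k * int u" by (simp add: u dvd_eq_mod_eq_0 mod_mult_right_eq)
  also have "\<dots> \<longleftrightarrow> m dvd k * u" by (metis int_dvd_int_iff of_nat_mult)
  also have "\<dots> \<longleftrightarrow> (m div g) * g dvd (k * (u div g)) * g"
  proof -
    have "m div g * g = m" "u div g * g = u" using g by auto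
    then show ?thesis by (simp only: mult.assoc)
  qed
  also have "\<dots> \<longleftrightarrow> m div g dvd k * (u div g)" by (rule dvd_times_right_cancel_iff) (use g in simp)
  also have "\<dots> \<longleftrightarrow> m div g dvd k"
  proof -
    have "coprime (u div g) (m div g)" unfolding g_def using assms by (intro div_gcd_coprime) auto
    then show ?thesis by (simp add: coprime_dvd_mult_left_iff coprime_commute)
  qed
  finally show ?thesis by (simp add: u_def g_def)
qed

definition additive_order :: "nat \<Rightarrow> int \<Rightarrow> nat" where
  "additive_order m x = m div gcd (nat (x mod int m)) m"

lemma ord_ZZ:
  assumes mn: "0 < m" "0 < n" and xy: "(x, y) \<in> carrier (ZZ m n)"
  shows "group.ord (ZZ m n) (x, y) = lcm (additive_order m x) (additive_order n y)"
proof -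
  interpret Group.group "ZZ m n" by (rule group_ZZ)
  have "(x, y) [^]\<^bsub>ZZ m n\<^esub> k = \<one>\<^bsub>ZZ m n\<^esub> \<longleftrightarrow> lcm (additive_order m x) (additive_order n y) dvd k" for k :: nat
  proof -
    have "(x, y) [^]\<^bsub>ZZ m n\<^esub> k = \<one>\<^bsub>ZZ m n\<^esub> \<longleftrightarrow> (int k * x) mod int m = 0 \<and> (int k * y) mod int n = 0"
      by (simp add: pow_ZZ)
    also have "\<dots> \<longleftrightarrow> int m dvd int k * x \<and> int n dvd int k * y" by (simp only: dvd_eq_mod_eq_0)
    also have "\<dots> \<longleftrightarrow> lcm (additive_order m x) (additive_order n y) dvd k"
      by (simp only: dvd_mult_iff_div_gcd[OF mn(1)] dvd_mult_iff_div_gcd[OF mn(2)] additive_order_def lcm_least_iff)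
    finally show ?thesis .
  qed
  then show ?thesis using ord_unique[OF xy] by blast
qed

lemma card_additive_order:
  assumes m: "0 < m" and a: "a dvd m"
  shows "card {x \<in> {0..<int m}. additive_order m x = a} = totient a"
proof -
  have a0: "0 < a" using assms by (auto intro: gr0I)
  have iff: "m div g = a \<longleftrightarrow> g = m div a" if "g dvd m" for g
  proof
    assume "m div g = a"
    then have "m = a * g" using that by auto
    then show "g = m div a" using a0 by simp
  next
    assume "g = m div a"
    then have "m = g * a" using a by auto
    moreover from this have "0 < g" using m by (cases g) auto
    ultimately show "m div g = a" by simp
  qed
  have "{x \<in> {0..<int m}. additive_order m x = a} = int ` {k \<in> {0..<m}. m div gcd k m = a}"
  proof (intro Set.set_eqI iffI)
    fix x assume "x \<in> {x \<in> {0..<int m}. additive_order m x = a}"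
    then have "x = int (nat x)" "nat x \<in> {k \<in> {0..<m}. m div gcd k m = a}" by (auto simp: additive_order_def)
    then show "x \<in> int ` {k \<in> {0..<m}. m div gcd k m = a}" by blast
  qed (auto simp: additive_order_def)
  then have "card {x \<in> {0..<int m}. additive_order m x = a} = card {k \<in> {0..<m}. m div gcd k m = a}"
    by (simp add: card_image)
  also have "{k \<in> {0..<m}. m div gcd k m = a} = {k \<in> {0..<m}. gcd k m = m div a}"
    using iff by (intro Collect_cong conj_cong refl) auto
  also have "card \<dots> = card {k \<in> {0<..m}. gcd k m = m div a}"
  proof (rule bij_betw_same_card)
    \<comment> \<open>The residue 0 is traded for m, which has the same gcd with m, to match the
      range 1..m in \<open>card_gcd_eq_totient\<close>.\<close>
    show "bij_betw (\<lambda>k. if k = 0 then m else k) {k \<in> {0..<m}. gcd k m = m div a} {k \<in> {0<..m}. gcd k m = m div a}"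
      by (rule bij_betw_byWitness[where f' = "\<lambda>k. if k = m then 0 else k"]) (use m in auto)
  qed
  also have "\<dots> = totient (m div (m div a))" using m a by (intro card_gcd_eq_totient) auto
  also have "m div (m div a) = a" using m a a0 by (auto elim!: dvdE)
  finally show ?thesis .
qed

lemma additive_order_dvd: "additive_order m x dvd m"
  unfolding additive_order_def by (metis dvd_div_mult_self dvd_triv_left gcd_dvd2)

context Group.group
begin

lemma card_generators:
  assumes fin: "finite (carrier G)" and g: "g \<in> carrier G"
  shows "card {h \<in> carrier G. generate G {h} = generate G {g}} = totient (ord g)"
proof -
  have o: "0 < ord g" using ord_ge_1[OF fin g] by simp
  have "{h \<in> carrier G. generate G {h} = generate G {g}} = (\<lambda>k. g [^] k) ` {k \<in> {..<ord g}. coprime k (ord g)}"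
  proof (intro Set.set_eqI iffI)
    fix h assume "h \<in> {h \<in> carrier G. generate G {h} = generate G {g}}"
    then have h: "h \<in> carrier G" "generate G {h} = generate G {g}" by auto
    have "h \<in> generate G {g}" using h generate.incl[of h "{h}" G] by auto
    then obtain k where k: "h = g [^] (k :: nat)" using generate_pow_on_finite_carrier[OF fin g] by auto
    have e: "h = g [^] (k mod ord g)"
    proof -
      have "g [^] k = g [^] (ord g * (k div ord g) + k mod ord g)" by simp
      also have "\<dots> = (g [^] ord g) [^] (k div ord g) \<otimes> g [^] (k mod ord g)"
        using g by (simp only: nat_pow_mult[symmetric] nat_pow_pow)
      also have "\<dots> = g [^] (k mod ord g)" using g by simp
      finally show ?thesis using k by simp
    qed
    have "ord h = ord g" using h generate_pow_card g by metis
    then have "coprime (k mod ord g) (ord g)" using pow_ord_eq_ord_iff[OF fin g] e by metis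
    then show "h \<in> (\<lambda>k. g [^] k) ` {k \<in> {..<ord g}. coprime k (ord g)}" using e o by auto
  next
    fix h assume "h \<in> (\<lambda>k. g [^] k) ` {k \<in> {..<ord g}. coprime k (ord g)}"
    then obtain k where k: "h = g [^] k" "coprime k (ord g)" by auto
    have h: "h \<in> carrier G" using k g by simp
    have oh: "ord h = ord g" using pow_ord_eq_ord_iff[OF fin g] k by metis
    have sub: "generate G {h} \<subseteq> generate G {g}"
    proof (rule generate_subgroup_incl)
      show "{h} \<subseteq> generate G {g}" using k generate_pow_on_finite_carrier[OF fin g] by auto
      show "subgroup (generate G {g}) G" using g by (intro generate_is_subgroup) auto
    qed
    have finc: "finite (generate G {g})"
      using generate_incl[of "{g}"] g fin finite_subset by blast
    have "generate G {h} = generate G {g}"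
      by (rule card_subset_eq[OF finc sub]) (use generate_pow_card h g oh in metis)
    then show "h \<in> {h \<in> carrier G. generate G {h} = generate G {g}}" using h by simp
  qed
  moreover have "inj_on (\<lambda>k. g [^] k) {k \<in> {..<ord g}. coprime k (ord g)}"
  proof (rule inj_on_subset)
    show "inj_on (\<lambda>k. g [^] k) {0..ord g - 1}" using g by (rule ord_inj)
  qed (use o in auto)
  ultimately have "card {h \<in> carrier G. generate G {h} = generate G {g}} = card {k \<in> {..<ord g}. coprime k (ord g)}"
    by (simp add: card_image)
  also have "\<dots> = totient (ord g)"
  \<comment> \<open>For order 1 the exponent set is {0} while \<open>totatives 1\<close> is {1}; the
    sets differ, but both have one element.\<close>
  proof (cases "ord g = 1")
    case True
    then have "{k \<in> {..<ord g}. coprime k (ord g)} = {0}" by auto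
    then show ?thesis using True by simp
  next
    case False
    then have "{k \<in> {..<ord g}. coprime k (ord g)} = totatives (ord g)"
      using o by (auto simp: totatives_def order_le_less intro: gr0I)
    then show ?thesis by (simp add: totient_def)
  qed
  finally show ?thesis .
qed

lemma cyclic_subgroup_iff:
  assumes fin: "finite (carrier G)"
  shows "{H. subgroup H G \<and> cyclic_group (G\<lparr>carrier := H\<rparr>)} = (\<lambda>g. generate G {g}) ` carrier G"
proof (intro Set.set_eqI iffI)
  fix H assume "H \<in> {H. subgroup H G \<and> cyclic_group (G\<lparr>carrier := H\<rparr>)}"
  then have H: "subgroup H G" and cyc: "cyclic_group (G\<lparr>carrier := H\<rparr>)" by auto
  have gH: "Group.group (G\<lparr>carrier := H\<rparr>)" using H by (rule subgroup_imp_group)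
  then obtain g where g: "g \<in> H" and r: "H = range (\<lambda>k :: int. g [^]\<^bsub>G\<lparr>carrier := H\<rparr>\<^esub> k)"
    using cyc group.cyclic_group[OF gH] by auto
  have gG: "g \<in> carrier G" using g subgroup.mem_carrier[OF H] by blast
  have "H = {g [^] (k :: int) | k. k \<in> UNIV}"
    using r int_pow_consistent[OF H g] by (auto simp: image_def)
  then have "H = generate G {g}" using generate_pow[OF gG] by simp
  then show "H \<in> (\<lambda>g. generate G {g}) ` carrier G" using gG by blast
next
  fix H assume "H \<in> (\<lambda>g. generate G {g}) ` carrier G"
  then obtain g where g: "g \<in> carrier G" and H: "H = generate G {g}" by auto
  have sub: "subgroup H G" unfolding H using g by (intro generate_is_subgroup) auto
  have gH: "Group.group (G\<lparr>carrier := H\<rparr>)" using sub by (rule subgroup_imp_group)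
  have gin: "g \<in> H" unfolding H by (simp add: generate.incl)
  have "H = range (\<lambda>k :: int. g [^]\<^bsub>G\<lparr>carrier := H\<rparr>\<^esub> k)"
    using generate_pow[OF g] int_pow_consistent[OF sub gin] by (auto simp: H[symmetric] image_def)
  then have "cyclic_group (G\<lparr>carrier := H\<rparr>)" using group.cyclic_group[OF gH] gin by auto
  then show "H \<in> {H. subgroup H G \<and> cyclic_group (G\<lparr>carrier := H\<rparr>)}" using sub by simp
qed

text \<open>A cyclic subgroup generated by \<open>g\<close> has \<open>totient (ord g)\<close>
  generators, so weighting each generator by the reciprocal counts every cyclic subgroup
  once.\<close>

lemma card_cyclic_subgroups:
  assumes fin: "finite (carrier G)"
  shows "real (card {H. subgroup H G \<and> cyclic_group (G\<lparr>carrier := H\<rparr>)}) = (\<Sum>g\<in>carrier G. 1 / real (totient (ord g)))"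
proof -
  have "(\<Sum>g\<in>carrier G. 1 / real (totient (ord g)))
     = (\<Sum>H\<in>(\<lambda>g. generate G {g}) ` carrier G. \<Sum>g | g \<in> carrier G \<and> generate G {g} = H. 1 / real (totient (ord g)))"
    by (rule sum.image_gen[OF fin])
  also have "\<dots> = (\<Sum>H\<in>(\<lambda>g. generate G {g}) ` carrier G. 1)"
  proof (rule sum.cong[OF refl])
    fix H assume "H \<in> (\<lambda>g. generate G {g}) ` carrier G"
    then obtain g where g: "g \<in> carrier G" and H: "H = generate G {g}" by auto
    have o: "0 < ord g" using ord_ge_1[OF fin g] by simp
    have "(\<Sum>h | h \<in> carrier G \<and> generate G {h} = H. 1 / real (totient (ord h)))
        = (\<Sum>h | h \<in> carrier G \<and> generate G {h} = H. 1 / real (totient (ord g)))"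
    proof (rule sum.cong[OF refl])
      fix h assume "h \<in> {h. h \<in> carrier G \<and> generate G {h} = H}"
      then have "ord h = ord g" using generate_pow_card g H by auto
      then show "1 / real (totient (ord h)) = 1 / real (totient (ord g))" by simp
    qed
    also have "\<dots> = 1" using card_generators[OF fin g] o by (simp add: H)
    finally show "(\<Sum>h | h \<in> carrier G \<and> generate G {h} = H. 1 / real (totient (ord h))) = 1" .
  qed
  finally show ?thesis by (simp add: cyclic_subgroup_iff[OF fin])
qed

end

text \<open>Group the elements by the orders a and b of their two coordinates: there are totient(a)
  totient(b) of them, all of order lcm(a, b), and totient(a) totient(b) = totient(gcd(a, b))
  totient(lcm(a, b)).\<close>

theorem num_cyclic_subgroups_eq_sum_totient_gcd:
  assumes mn: "0 < m" "0 < n"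
  shows "num_cyclic_subgroups m n = (\<Sum>a | a dvd m. \<Sum>b | b dvd n. totient (gcd a b))"
proof -
  interpret Group.group "ZZ m n" by (rule group_ZZ)
  have fin: "finite (carrier (ZZ m n))" using mn by (rule finite_carrier_ZZ)
  define A where "A a = {x \<in> {0..<int m}. additive_order m x = a}" for a
  define B where "B b = {y \<in> {0..<int n}. additive_order n y = b}" for b
  have A: "finite {a. a dvd m}" "finite {b. b dvd n}" using mn by auto
  have "real (num_cyclic_subgroups m n) = (\<Sum>g\<in>carrier (ZZ m n). 1 / real (totient (ord g)))"
    unfolding num_cyclic_subgroups_def by (rule card_cyclic_subgroups[OF fin])
  also have "\<dots> = (\<Sum>(x, y)\<in>{0..<int m} \<times> {0..<int n}. 1 / real (totient (lcm (additive_order m x) (additive_order n y))))"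
    by (rule sum.cong) (use mn ord_ZZ[OF mn] carrier_ZZ[OF mn] in \<open>auto simp del: carrier_DirProd\<close>)
  also have "\<dots> = (\<Sum>x\<in>{0..<int m}. \<Sum>y\<in>{0..<int n}. 1 / real (totient (lcm (additive_order m x) (additive_order n y))))"
    by (simp add: sum.cartesian_product)
  also have "\<dots> = (\<Sum>a | a dvd m. \<Sum>x\<in>A a. \<Sum>y\<in>{0..<int n}. 1 / real (totient (lcm (additive_order m x) (additive_order n y))))"
    unfolding A_def by (rule sum.group[symmetric]) (use A additive_order_dvd in auto)
  also have "\<dots> = (\<Sum>a | a dvd m. \<Sum>x\<in>A a. \<Sum>b | b dvd n. \<Sum>y\<in>B b. 1 / real (totient (lcm (additive_order m x) (additive_order n y))))"
    unfolding B_def by (intro sum.cong refl, rule sum.group[symmetric]) (use A additive_order_dvd in auto)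
  also have "\<dots> = (\<Sum>a | a dvd m. \<Sum>x\<in>A a. \<Sum>b | b dvd n. \<Sum>y\<in>B b. 1 / real (totient (lcm a b)))"
    by (intro sum.cong refl) (auto simp: A_def B_def)
  also have "\<dots> = (\<Sum>a | a dvd m. \<Sum>b | b dvd n. real (card (A a)) * real (card (B b)) / real (totient (lcm a b)))"
    by (simp add: sum_distrib_left)
  also have "\<dots> = (\<Sum>a | a dvd m. \<Sum>b | b dvd n. real (totient (gcd a b)))"
  proof (intro sum.cong refl)
    fix a b assume ab: "a \<in> {a. a dvd m}" "b \<in> {b. b dvd n}"
    then have pos: "0 < lcm a b" using mn by (metis dvd_pos_nat lcm_pos_nat mem_Collect_eq)
    have "real (card (A a)) * real (card (B b)) = real (totient (gcd a b) * totient (lcm a b))"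
      using card_additive_order[of m a] card_additive_order[of n b] ab mn by (simp add: A_def B_def totient_gcd_lcm)
    then show "real (card (A a)) * real (card (B b)) / real (totient (lcm a b)) = real (totient (gcd a b))"
    proof -
      have "real (totient (lcm a b)) \<noteq> 0" using pos by (metis of_nat_eq_0_iff totient_0_iff less_irrefl)
      then show ?thesis unfolding \<open>real (card (A a)) * real (card (B b)) = _\<close> of_nat_mult
        by (rule nonzero_mult_div_cancel_right)
    qed
  qed
  also have "\<dots> = real (\<Sum>a | a dvd m. \<Sum>b | b dvd n. totient (gcd a b))" by simp
  finally show ?thesis by (simp only: of_nat_eq_iff)
qed

section \<open>Moebius inversion over squares\<close>

definition moeb :: "nat \<Rightarrow> real" where
  "moeb n = (if squarefree n then (-1) ^ card (prime_factors n) else 0)"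

lemma abs_moeb_le: "\<bar>moeb n\<bar> \<le> 1"
  by (simp add: moeb_def power_abs)

lemma moeb_1 [simp]: "moeb 1 = 1" "moeb (Suc 0) = 1"
  by (simp_all add: moeb_def)

lemma moeb_prime_mult:
  assumes p: "prime p" and d: "\<not> p dvd d" "0 < d"
  shows "moeb (p * d) = - moeb d"
proof -
  have cop: "coprime p d" using p d by (simp add: prime_imp_coprime)
  have sqp: "squarefree p" using p by (simp add: squarefree_prime)
  have sq: "squarefree (p * d) \<longleftrightarrow> squarefree d"
    using squarefree_mult_coprime[OF cop sqp] squarefree_mono[of d "p * d"] by auto
  have "prime_factors (p * d) = insert p (prime_factors d)"
    using p d by (simp add: prime_factors_product prime_prime_factors)
  moreover have "p \<notin> prime_factors d" using d by auto
  ultimately have "card (prime_factors (p * d)) = Suc (card (prime_factors d))" by simp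
  then show ?thesis by (simp add: moeb_def sq)
qed

text \<open>For a prime p dividing n, multiplication by p pairs the squarefree divisors not
  divisible by p with those divisible by p, with opposite signs.\<close>

lemma sum_moeb_divisors:
  assumes n: "0 < n"
  shows "(\<Sum>d | d dvd n. moeb d) = (if n = 1 then 1 else 0)"
proof (cases "n = 1")
  case True
  then show ?thesis by simp
next
  case False
  then obtain p where p: "prime p" "p dvd n" using prime_factor_nat by blast
  define D0 where "D0 = {d. d dvd n \<and> squarefree d \<and> \<not> p dvd d}"
  define D1 where "D1 = {d. d dvd n \<and> squarefree d \<and> p dvd d}"
  have fin: "finite {d. d dvd n}" using n by simp
  have fin0: "finite D0" "finite D1" by (rule finite_subset[OF _ fin], auto simp: D0_def D1_def)+
  have "(\<Sum>d | d dvd n. moeb d) = (\<Sum>d\<in>D0 \<union> D1. moeb d)"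
    by (rule sum.mono_neutral_right) (use fin in \<open>auto simp: D0_def D1_def moeb_def\<close>)
  also have "\<dots> = (\<Sum>d\<in>D0. moeb d) + (\<Sum>d\<in>D1. moeb d)"
    by (rule sum.union_disjoint[OF fin0]) (auto simp: D0_def D1_def)
  also have "(\<Sum>d\<in>D1. moeb d) = (\<Sum>d\<in>D0. - moeb d)"
  proof (rule sum.reindex_bij_witness[of _ "\<lambda>d. p * d" "\<lambda>d. d div p"])
    fix d assume d: "d \<in> D1"
    then obtain c where c: "d = p * c" by (auto simp: D1_def)
    have d0: "0 < d" using d n by (auto simp: D1_def intro: gr0I)
    have p0: "0 < p" using p by (simp add: prime_gt_0_nat)
    have npc: "\<not> p dvd c"
    proof
      assume "p dvd c"
      then have "p\<^sup>2 dvd d" by (auto simp: c power2_eq_square)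
      then have "is_unit p" using d by (auto simp: D1_def squarefree_def)
      then show False using p by auto
    qed
    show "p * (d div p) = d" using c p0 by simp
    have "p * c dvd n" "squarefree (p * c)" using d c by (auto simp: D1_def)
    then have "c dvd n" "squarefree c" using squarefree_mono[of c "p * c"] dvd_mult_right[of p c n] by simp_all
    then show "d div p \<in> D0" using npc c p0 by (simp add: D0_def)
    have "0 < c" using d0 c by (auto intro: gr0I)
    then show "- moeb (d div p) = moeb d" using moeb_prime_mult[OF p(1) npc] c p0 by simp
  next
    fix d assume d: "d \<in> D0"
    have p0: "0 < p" using p by (simp add: prime_gt_0_nat)
    show "p * d div p = d" using p0 by simp
    have cop: "coprime p d" using p d by (auto simp: D0_def prime_imp_coprime)
    have "p * d dvd n" using d p cop by (auto simp: D0_def intro: divides_mult)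
    moreover have "squarefree (p * d)"
      using d by (intro squarefree_mult_coprime[OF cop]) (auto simp: D0_def squarefree_prime p)
    ultimately show "p * d \<in> D1" by (simp add: D1_def)
  qed
  finally show ?thesis using False by (simp add: sum_negf)
qed

definition sqset :: "real \<Rightarrow> nat set" where
  "sqset x = {k. 1 \<le> k \<and> real (k\<^sup>2) \<le> x}"

lemma finite_sqset [simp]: "finite (sqset x)"
proof (rule finite_subset)
  show "sqset x \<subseteq> {..nat \<lfloor>x\<rfloor>}"
  proof
    fix k assume k: "k \<in> sqset x"
    have "k \<le> k\<^sup>2" by (simp add: power2_eq_square)
    then have "real k \<le> x" using k by (auto simp: sqset_def intro: order.trans[of _ "real (k\<^sup>2)"] simp del: of_nat_power)
    then show "k \<in> {..nat \<lfloor>x\<rfloor>}" by (simp add: le_nat_floor)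
  qed
qed simp

text \<open>Regrouped by n = k j, the term A(x/n^2) receives the sum of \<open>moeb\<close> over the
  divisors of n, which vanishes unless n = 1.\<close>

lemma moebius_inversion_squares:
  fixes A B :: "real \<Rightarrow> real"
  assumes B: "\<And>y. 0 < y \<Longrightarrow> B y = (\<Sum>k\<in>sqset y. A (y / (real k)\<^sup>2))" and x: "1 \<le> x"
  shows "A x = (\<Sum>k\<in>sqset x. moeb k * B (x / (real k)\<^sup>2))"
proof -
  have "(\<Sum>k\<in>sqset x. moeb k * B (x / (real k)\<^sup>2))
     = (\<Sum>k\<in>sqset x. \<Sum>j\<in>sqset (x / (real k)\<^sup>2). moeb k * A (x / (real (k * j))\<^sup>2))"
  proof (rule sum.cong[OF refl])
    fix k assume k: "k \<in> sqset x"
    then have "0 < x / (real k)\<^sup>2" using x by (auto simp: sqset_def)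
    then show "moeb k * B (x / (real k)\<^sup>2) = (\<Sum>j\<in>sqset (x / (real k)\<^sup>2). moeb k * A (x / (real (k * j))\<^sup>2))"
      by (simp add: B sum_distrib_left power_mult_distrib)
  qed
  also have "\<dots> = (\<Sum>(k, j)\<in>Sigma (sqset x) (\<lambda>k. sqset (x / (real k)\<^sup>2)). moeb k * A (x / (real (k * j))\<^sup>2))"
    by (rule sum.Sigma) auto
  also have "\<dots> = (\<Sum>(n, k)\<in>Sigma (sqset x) (\<lambda>n. {k. k dvd n}). moeb k * A (x / (real n)\<^sup>2))"
  proof (rule sum.reindex_bij_witness[of _ "\<lambda>(n, k). (k, n div k)" "\<lambda>(k, j). (k * j, k)"])
    fix p assume "p \<in> Sigma (sqset x) (\<lambda>k. sqset (x / (real k)\<^sup>2))"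
    then obtain k j where p: "p = (k, j)" and k: "1 \<le> k" and j: "1 \<le> j" and le: "(real j)\<^sup>2 \<le> x / (real k)\<^sup>2"
      by (auto simp: sqset_def)
    have "(real k)\<^sup>2 * (real j)\<^sup>2 \<le> x" using le k by (simp add: pos_le_divide_eq mult.commute)
    then show "(case p of (k, j) \<Rightarrow> (k * j, k)) \<in> Sigma (sqset x) (\<lambda>n. {k. k dvd n})"
      using k j by (simp add: p sqset_def power_mult_distrib)
    show "(case case p of (k, j) \<Rightarrow> (k * j, k) of (n, k) \<Rightarrow> (k, n div k)) = p" using k by (simp add: p)
    show "(case case p of (k, j) \<Rightarrow> (k * j, k) of (n, k) \<Rightarrow> moeb k * A (x / (real n)\<^sup>2)) = (case p of (k, j) \<Rightarrow> moeb k * A (x / (real (k * j))\<^sup>2))"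
      by (simp add: p)
  next
    fix p assume "p \<in> Sigma (sqset x) (\<lambda>n. {k. k dvd n})"
    then obtain n k where p: "p = (n, k)" and n: "1 \<le> n" "(real n)\<^sup>2 \<le> x" and kn: "k dvd n" by (auto simp: sqset_def)
    obtain j where j: "n = k * j" using kn by blast
    have pos: "1 \<le> k" "1 \<le> j" using n(1) j by (auto intro: Suc_leI gr0I)
    have e: "(real n)\<^sup>2 = (real k)\<^sup>2 * (real j)\<^sup>2" by (simp add: j power_mult_distrib)
    have "(real k)\<^sup>2 * 1 \<le> (real k)\<^sup>2 * (real j)\<^sup>2" using pos by (intro mult_left_mono) (auto simp: one_le_power)
    then have kx: "(real k)\<^sup>2 \<le> x" using n(2) e by linarith
    have jx: "(real j)\<^sup>2 \<le> x / (real k)\<^sup>2" using n(2) e pos by (simp add: pos_le_divide_eq mult.commute)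
    show "(case p of (n, k) \<Rightarrow> (k, n div k)) \<in> Sigma (sqset x) (\<lambda>k. sqset (x / (real k)\<^sup>2))"
      using pos kx jx by (simp add: p j sqset_def)
    show "(case case p of (n, k) \<Rightarrow> (k, n div k) of (k, j) \<Rightarrow> (k * j, k)) = p" using pos by (simp add: p j)
  qed
  also have "\<dots> = (\<Sum>n\<in>sqset x. \<Sum>k | k dvd n. moeb k * A (x / (real n)\<^sup>2))"
  proof (rule sum.Sigma[symmetric, OF finite_sqset], rule ballI)
    fix n assume "n \<in> sqset x"
    then have "0 < n" by (simp add: sqset_def)
    then show "finite {k. k dvd n}" by simp
  qed
  also have "\<dots> = (\<Sum>n\<in>sqset x. (if n = 1 then A x else 0))"
  proof (rule sum.cong[OF refl])
    fix n assume n: "n \<in> sqset x"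
    have "(\<Sum>k | k dvd n. moeb k * A (x / (real n)\<^sup>2)) = (\<Sum>k | k dvd n. moeb k) * A (x / (real n)\<^sup>2)"
      by (rule sum_distrib_right[symmetric])
    then show "(\<Sum>k | k dvd n. moeb k * A (x / (real n)\<^sup>2)) = (if n = 1 then A x else 0)"
      using n by (simp add: sum_moeb_divisors sqset_def)
  qed
  also have "\<dots> = A x"
    using sum.delta[OF finite_sqset[of x], of 1 "\<lambda>_. A x"] x by (simp add: sqset_def)
  finally show ?thesis by simp
qed

section \<open>Main terms and error terms under inversion\<close>

lemma summable_ln_power_over_square: "summable (\<lambda>k. ln (real (Suc k)) ^ j / (real (Suc k))\<^sup>2)"
proof (rule summable_comparison_test_bigo)
  have "summable (\<lambda>n. real n powr (-3/2))" by (simp add: summable_real_powr_iff)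
  then have "summable (\<lambda>n. real (Suc n) powr (-3/2))" by (subst summable_Suc_iff)
  then show "summable (\<lambda>n. norm (real (Suc n) powr (-3/2)))" by simp
  show "(\<lambda>k. ln (real (Suc k)) ^ j / (real (Suc k))\<^sup>2) \<in> O(\<lambda>n. real (Suc n) powr (-3/2))" by real_asymp
qed

lemma summable_moeb_ln: "summable (\<lambda>k. moeb (Suc k) / (real (Suc k))\<^sup>2 * ln (real (Suc k)) ^ j)"
proof (rule summable_comparison_test'[OF summable_ln_power_over_square[of j]])
  fix k :: nat
  have "norm (moeb (Suc k) / (real (Suc k))\<^sup>2 * ln (real (Suc k)) ^ j) = \<bar>moeb (Suc k)\<bar> * (ln (real (Suc k)) ^ j / (real (Suc k))\<^sup>2)"
    by (simp add: abs_mult abs_divide power_abs)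
  also have "\<dots> \<le> 1 * (ln (real (Suc k)) ^ j / (real (Suc k))\<^sup>2)" by (intro mult_right_mono abs_moeb_le) simp
  finally show "norm (moeb (Suc k) / (real (Suc k))\<^sup>2 * ln (real (Suc k)) ^ j) \<le> ln (real (Suc k)) ^ j / (real (Suc k))\<^sup>2" by simp
qed

definition moeb_const :: "nat \<Rightarrow> real" where
  "moeb_const j = (\<Sum>k. moeb (Suc k) / (real (Suc k))\<^sup>2 * ln (real (Suc k)) ^ j)"

text \<open>The value is 1/zeta(2), but what counts is that inversion keeps the degree of the main
  term. The first two terms give at least 1 - 1/4, and the rest is at most 1/2 in absolute value by
  telescoping.\<close>

lemma moeb_const_0_nonzero: "moeb_const 0 \<noteq> 0"
proof -
  let ?f = "\<lambda>k. moeb (Suc k) / (real (Suc k))\<^sup>2 :: real"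
  have sm: "summable ?f" using summable_moeb_ln[of 0] by simp
  have "(\<Sum>k. ?f k) = (\<Sum>k. ?f (k + 2)) + (\<Sum>k<2. ?f k)" by (rule suminf_split_initial_segment[OF sm])
  also have "(\<Sum>k<2. ?f k) = 1 + moeb 2 / 4" by (simp add: numeral_2_eq_2)
  finally have e: "(\<Sum>k. ?f k) = (\<Sum>k. ?f (k + 2)) + (1 + moeb 2 / 4)" .
  define g where "g k = 1 / real (k + 2)" for k :: nat
  have "g \<longlonglongrightarrow> 0" unfolding g_def by real_asymp
  then have tele: "(\<lambda>k. g k - g (Suc k)) sums (g 0 - 0)" by (rule telescope_sums')
  have le: "norm (?f (k + 2)) \<le> g k - g (Suc k)" for k
  proof -
    have "norm (?f (k + 2)) = \<bar>moeb (Suc (k + 2))\<bar> / (real (k + 3))\<^sup>2" by (simp add: abs_divide eval_nat_numeral)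
    also have "\<dots> \<le> 1 / (real (k + 3))\<^sup>2" by (intro divide_right_mono abs_moeb_le) simp
    also have "\<dots> \<le> 1 / (real (k + 2) * real (k + 3))"
      unfolding power2_eq_square by (intro divide_left_mono mult_right_mono mult_pos_pos) auto
    also have "\<dots> = g k - g (Suc k)" by (simp add: g_def field_simps)
    finally show ?thesis .
  qed
  have "norm (\<Sum>k. ?f (k + 2)) \<le> (\<Sum>k. g k - g (Suc k))" by (rule norm_suminf_le[OF le sums_summable[OF tele]])
  also have "\<dots> = 1/2" using sums_unique[OF tele] by (simp add: g_def)
  finally have "- (1/2) \<le> (\<Sum>k. ?f (k + 2))" by simp
  moreover have "- 1 \<le> moeb 2" using abs_moeb_le[of 2] by linarith
  ultimately have "0 < (\<Sum>k. ?f k)" unfolding e by simp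
  then show ?thesis by (simp add: moeb_const_def)
qed

text \<open>The induction step multiplies by u - 2 ln k and so brings in another factor ln k;
  therefore the claim is made for all powers \<open>j\<close> at once. The coefficients from degree
  Q upwards only meet \<open>moeb_const j\<close>.\<close>

lemma moeb_poly_sums_aux:
  fixes Q :: "real poly"
  shows "\<exists>R. (\<forall>j u. (\<lambda>k. moeb (Suc k) / (real (Suc k))\<^sup>2 * ln (real (Suc k)) ^ j * poly Q (u - 2 * ln (real (Suc k)))) sums poly (R j) u) \<and>
    (\<forall>j. \<forall>n\<ge>degree Q. coeff (R j) n = moeb_const j * coeff Q n)"
proof (induction Q)
  case 0
  show ?case by (intro exI[of _ "\<lambda>_. 0"]) simp
next
  case (pCons a Q)
  then obtain R where R: "\<And>j u. (\<lambda>k. moeb (Suc k) / (real (Suc k))\<^sup>2 * ln (real (Suc k)) ^ j * poly Q (u - 2 * ln (real (Suc k)))) sums poly (R j) u"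
    and deg: "\<And>j n. degree Q \<le> n \<Longrightarrow> coeff (R j) n = moeb_const j * coeff Q n" by blast
  define R' where "R' j = [:a * moeb_const j:] + pCons 0 (R j) - smult 2 (R (Suc j))" for j
  have "(\<lambda>k. moeb (Suc k) / (real (Suc k))\<^sup>2 * ln (real (Suc k)) ^ j * poly (pCons a Q) (u - 2 * ln (real (Suc k)))) sums poly (R' j) u" for j u
  proof -
    have s0: "(\<lambda>k. moeb (Suc k) / (real (Suc k))\<^sup>2 * ln (real (Suc k)) ^ j) sums moeb_const j"
      unfolding moeb_const_def by (rule summable_sums[OF summable_moeb_ln])
    have "(\<lambda>k. a * (moeb (Suc k) / (real (Suc k))\<^sup>2 * ln (real (Suc k)) ^ j)
        + u * (moeb (Suc k) / (real (Suc k))\<^sup>2 * ln (real (Suc k)) ^ j * poly Q (u - 2 * ln (real (Suc k))))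
        - 2 * (moeb (Suc k) / (real (Suc k))\<^sup>2 * ln (real (Suc k)) ^ Suc j * poly Q (u - 2 * ln (real (Suc k)))))
      sums (a * moeb_const j + u * poly (R j) u - 2 * poly (R (Suc j)) u)"
      by (intro sums_diff sums_add sums_mult s0 R)
    moreover have "a * (c * l ^ j) + u * (c * l ^ j * q) - 2 * (c * l ^ Suc j * q) = c * l ^ j * (a + (u - 2 * l) * q)" for c l q :: real
      by (simp add: algebra_simps)
    ultimately have "(\<lambda>k. moeb (Suc k) / (real (Suc k))\<^sup>2 * ln (real (Suc k)) ^ j * (a + (u - 2 * ln (real (Suc k))) * poly Q (u - 2 * ln (real (Suc k)))))
      sums (a * moeb_const j + u * poly (R j) u - 2 * poly (R (Suc j)) u)"
      by (simp only:)
    then show ?thesis by (simp only: R'_def poly_pCons poly_add poly_diff poly_smult poly_0 mult_zero_right add_0_right add_0_left)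
  qed
  moreover have "coeff (R' j) n = moeb_const j * coeff (pCons a Q) n" if n: "degree (pCons a Q) \<le> n" for j n
  proof (cases n)
    case 0
    then have "Q = 0" using n by (auto simp: degree_pCons_eq_if split: if_splits)
    then show ?thesis using 0 deg[of 0 "Suc j"] by (simp add: R'_def)
  next
    case (Suc m)
    have "degree Q \<le> m" using n Suc by (auto simp: degree_pCons_eq_if split: if_splits)
    moreover from this have "coeff Q (Suc m) = 0" by (intro coeff_eq_0) simp
    ultimately show ?thesis using deg[of m j] deg[of "Suc m" "Suc j"] Suc by (simp add: R'_def)
  qed
  ultimately show ?case by blast
qed

lemma moeb_poly_sums:
  fixes Q :: "real poly"
  obtains R where "\<And>u. (\<lambda>k. moeb (Suc k) / (real (Suc k))\<^sup>2 * poly Q (u - 2 * ln (real (Suc k)))) sums poly R u"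
    and "degree R = degree Q"
proof -
  obtain R where R: "\<forall>j u. (\<lambda>k. moeb (Suc k) / (real (Suc k))\<^sup>2 * ln (real (Suc k)) ^ j * poly Q (u - 2 * ln (real (Suc k)))) sums poly (R j) u"
    and deg: "\<forall>j. \<forall>n\<ge>degree Q. coeff (R j) n = moeb_const j * coeff Q n"
    using moeb_poly_sums_aux by blast
  have "degree (R 0) \<le> degree Q"
    by (rule degree_le) (use deg in \<open>auto simp: coeff_eq_0\<close>)
  moreover have "degree Q \<le> degree (R 0)"
  proof (cases "Q = 0")
    case False
    then have "coeff (R 0) (degree Q) \<noteq> 0" using deg moeb_const_0_nonzero by (simp add: leading_coeff_0_iff)
    then show ?thesis by (rule le_degree)
  qed simp
  moreover have "(\<lambda>k. moeb (Suc k) / (real (Suc k))\<^sup>2 * poly Q (u - 2 * ln (real (Suc k)))) sums poly (R 0) u" for u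
    using R[rule_format, where j = 0] by simp
  ultimately show ?thesis using that[of "R 0"] by simp
qed

lemma sqset_eq: "sqset x = {1..nat \<lfloor>sqrt x\<rfloor>}"
proof (rule Set.set_eqI)
  fix k :: nat
  have "(real k)\<^sup>2 \<le> x \<longleftrightarrow> real k \<le> sqrt x" if "1 \<le> k"
  proof
    assume "(real k)\<^sup>2 \<le> x"
    then show "real k \<le> sqrt x" by (rule real_le_rsqrt)
  next
    assume le: "real k \<le> sqrt x"
    then have "0 \<le> x" using that by (metis of_nat_0_le_iff order.trans real_sqrt_ge_0_iff)
    have "(real k)\<^sup>2 \<le> (sqrt x)\<^sup>2" using le by (rule power_mono) simp
    then show "(real k)\<^sup>2 \<le> x" using \<open>0 \<le> x\<close> by simp
  qed
  moreover have "real k \<le> sqrt x \<longleftrightarrow> k \<le> nat \<lfloor>sqrt x\<rfloor>" if "1 \<le> k"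
  proof -
    have "k \<le> nat \<lfloor>sqrt x\<rfloor> \<longleftrightarrow> int k \<le> \<lfloor>sqrt x\<rfloor>" using that by arith
    then show ?thesis by (simp add: le_floor_iff)
  qed
  ultimately show "k \<in> sqset x \<longleftrightarrow> k \<in> {1..nat \<lfloor>sqrt x\<rfloor>}" by (auto simp: sqset_def)
qed

lemma poly_le_exp:
  fixes Q :: "real poly"
  assumes "0 < d"
  shows "\<exists>C\<ge>0. \<forall>w\<ge>0. \<bar>poly Q (- 2 * w)\<bar> \<le> C * exp (d * w)"
  using assms
proof (induction Q arbitrary: d)
  case 0
  show ?case by (intro exI[of _ 0]) simp
next
  case (pCons a Q)
  have d2: "0 < d / 2" using pCons.prems by simp
  obtain C where C: "0 \<le> C" and le: "\<And>w. 0 \<le> w \<Longrightarrow> \<bar>poly Q (- 2 * w)\<bar> \<le> C * exp (d / 2 * w)"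
    using pCons.IH[OF d2] by blast
  have "\<bar>poly (pCons a Q) (- 2 * w)\<bar> \<le> (\<bar>a\<bar> + 4 * C / d) * exp (d * w)" if w: "0 \<le> w" for w
  proof -
    have w_le: "w \<le> 2 / d * exp (d / 2 * w)"
    proof -
      have "d / 2 * w \<le> exp (d / 2 * w)" using exp_ge_add_one_self[of "d / 2 * w"] by linarith
      then show ?thesis using pCons.prems by (simp add: field_simps)
    qed
    have "\<bar>poly (pCons a Q) (- 2 * w)\<bar> \<le> \<bar>a\<bar> + \<bar>2 * w * poly Q (- 2 * w)\<bar>"
      by (simp only: poly_pCons)
    also have "\<bar>2 * w * poly Q (- 2 * w)\<bar> = 2 * (w * \<bar>poly Q (- 2 * w)\<bar>)" using w by (simp add: abs_mult)
    also have "w * \<bar>poly Q (- 2 * w)\<bar> \<le> (2 / d * exp (d / 2 * w)) * (C * exp (d / 2 * w))"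
      by (rule mult_mono[OF w_le le[OF w]]) (use pCons.prems in auto)
    also have "(2 / d * exp (d / 2 * w)) * (C * exp (d / 2 * w)) = 2 * C / d * (exp (d / 2 * w) * exp (d / 2 * w))" by simp
    also have "exp (d / 2 * w) * exp (d / 2 * w) = exp (d * w)" by (simp add: exp_add[symmetric])
    finally have "\<bar>poly (pCons a Q) (- 2 * w)\<bar> \<le> \<bar>a\<bar> + 2 * (2 * C / d * exp (d * w))" by simp
    moreover have "\<bar>a\<bar> * 1 \<le> \<bar>a\<bar> * exp (d * w)" using w pCons.prems by (intro mult_left_mono) auto
    ultimately show ?thesis by (simp add: algebra_simps)
  qed
  moreover have "0 \<le> \<bar>a\<bar> + 4 * C / d" using C pCons.prems by simp
  ultimately show ?case by blast
qed

text \<open>In the main term the sum over k \<le> sqrt x is completed to the full series, which is a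
  polynomial in ln x. In the tail k > sqrt x one has ln(x/k^2) = -2w with w \<ge> 0, and
  \<open>poly_le_exp\<close> bounds the polynomial by a constant times (k/sqrt x)^(1/2). Summed
  against 1/k^2 this is O(x^(-1/2)), without any logarithm.\<close>

lemma sum_moeb_transfer:
  fixes Q :: "real poly" and B E :: "real \<Rightarrow> real"
  assumes B: "\<And>y. 1 \<le> y \<Longrightarrow> \<bar>B y - y * poly Q (ln y)\<bar> \<le> E y"
  obtains R C where "degree R = degree Q"
    and "\<And>x. 1 \<le> x \<Longrightarrow> \<bar>(\<Sum>k\<in>sqset x. moeb k * B (x / (real k)\<^sup>2)) - x * poly R (ln x)\<bar>
      \<le> C * sqrt x + (\<Sum>k\<in>sqset x. E (x / (real k)\<^sup>2))"
proof -
  obtain R where R: "\<And>u. (\<lambda>k. moeb (Suc k) / (real (Suc k))\<^sup>2 * poly Q (u - 2 * ln (real (Suc k)))) sums poly R u"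
    and deg: "degree R = degree Q" by (rule moeb_poly_sums[of Q]) blast
  obtain C where C0: "0 \<le> C" and C: "\<And>w. 0 \<le> w \<Longrightarrow> \<bar>poly Q (- 2 * w)\<bar> \<le> C * exp (1/2 * w)"
    using poly_le_exp[of "1/2" Q] by auto
  have main: "\<bar>(\<Sum>k\<in>sqset x. moeb k * B (x / (real k)\<^sup>2)) - x * poly R (ln x)\<bar>
      \<le> 6 * C * sqrt x + (\<Sum>k\<in>sqset x. E (x / (real k)\<^sup>2))" if x: "1 \<le> x" for x
  proof -
    define M where "M = nat \<lfloor>sqrt x\<rfloor>"
    define u where "u = ln x"
    define f where "f = (\<lambda>k. moeb (Suc k) / (real (Suc k))\<^sup>2 * poly Q (u - 2 * ln (real (Suc k))))"
    have sf: "f sums poly R u" unfolding f_def by (rule R)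
    have summ: "summable f" by (rule sums_summable[OF sf])
    have split: "poly R u = (\<Sum>k. f (k + M)) + (\<Sum>k<M. f k)"
      using suminf_split_initial_segment[OF summ, of M] sums_unique[OF sf] by simp
    have Mx: "sqrt x < real (k + M) + 1" for k
    proof -
      have "sqrt x < real M + 1" unfolding M_def using x by (simp add: floor_less_iff)
      then show ?thesis by simp
    qed
    define g where "g k = 6 * C * x powr (-1/4) * real (k + M + 1) powr (-1/2)" for k
    have "g \<longlonglongrightarrow> 0" unfolding g_def by real_asymp
    then have tele: "(\<lambda>k. g k - g (Suc k)) sums (g 0 - 0)" by (rule telescope_sums')
    have f_le: "norm (f (k + M)) \<le> g k - g (Suc k)" for k
    proof -
      define n where "n = k + M + 1"
      have n1: "1 \<le> n" by (simp add: n_def)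
      have sx: "sqrt x \<le> real n" using Mx[of k] by (simp add: n_def)
      define w where "w = ln (real n) - u / 2"
      have "ln (sqrt x) \<le> ln (real n)" using sx x n1 by (subst ln_le_cancel_iff) auto
      then have w0: "0 \<le> w" using x by (simp add: w_def u_def ln_sqrt)
      have ew: "exp (1/2 * w) = real n powr (1/2) * x powr (-1/4)"
        using n1 x by (simp add: w_def u_def powr_def exp_add[symmetric] algebra_simps)
      have "norm (f (k + M)) = \<bar>moeb n\<bar> * (\<bar>poly Q (- 2 * w)\<bar> / (real n)\<^sup>2)"
        by (simp add: f_def n_def w_def abs_mult abs_divide algebra_simps)
      also have "\<dots> \<le> 1 * (\<bar>poly Q (- 2 * w)\<bar> / (real n)\<^sup>2)" by (intro mult_right_mono abs_moeb_le) simp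
      also have "\<dots> \<le> 1 * (C * exp (1/2 * w) / (real n)\<^sup>2)" by (intro mult_left_mono divide_right_mono C w0) auto
      also have "\<dots> = C * x powr (-1/4) * (real n powr (1/2) / real n powr 2)" using n1 by (simp only: ew) (simp add: powr_numeral)
      also have "real n powr (1/2) / real n powr 2 = real n powr (-3/2)" by (simp only: powr_diff[symmetric]) simp
      also have "C * x powr (-1/4) * real n powr (-3/2) \<le> C * x powr (-1/4) * (6 * (real n powr (-1/2) - real (Suc n) powr (-1/2)))"
        by (intro mult_left_mono powr_three_halves_telescope n1) (use C0 in auto)
      also have "\<dots> = g k - g (Suc k)" by (simp add: g_def n_def algebra_simps)
      finally show ?thesis .
    qed
    have "norm (\<Sum>k. f (k + M)) \<le> (\<Sum>k. g k - g (Suc k))" by (rule norm_suminf_le[OF f_le sums_summable[OF tele]])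
    also have "\<dots> = g 0" using sums_unique[OF tele] by simp
    also have "g 0 \<le> 6 * C * x powr (-1/4) * (sqrt x) powr (-1/2)"
      unfolding g_def using Mx[of 0] x C0 by (intro mult_left_mono powr_mono2') auto
    also have "\<dots> = 6 * C * x powr (-1/2)" using x by (simp add: powr_half_sqrt[symmetric] powr_powr powr_add[symmetric])
    finally have tail: "\<bar>\<Sum>k. f (k + M)\<bar> \<le> 6 * C * x powr (-1/2)" by simp
    have main_eq: "(\<Sum>k\<in>sqset x. moeb k * (x / (real k)\<^sup>2 * poly Q (ln (x / (real k)\<^sup>2)))) = x * (\<Sum>k<M. f k)"
    proof -
      have "(\<Sum>k\<in>sqset x. moeb k * (x / (real k)\<^sup>2 * poly Q (ln (x / (real k)\<^sup>2))))
          = (\<Sum>k\<in>{1..M}. moeb k * (x / (real k)\<^sup>2 * poly Q (ln (x / (real k)\<^sup>2))))" by (simp add: sqset_eq M_def)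
      also have "{1..M} = Suc ` {..<M}" by (simp add: image_Suc_lessThan)
      also have "(\<Sum>k\<in>Suc ` {..<M}. moeb k * (x / (real k)\<^sup>2 * poly Q (ln (x / (real k)\<^sup>2)))) = (\<Sum>k<M. x * f k)"
      proof (subst sum.reindex, simp, rule sum.cong[OF refl])
        fix k assume "k \<in> {..<M}"
        have "ln (x / (real (Suc k))\<^sup>2) = u - 2 * ln (real (Suc k))" using x by (simp add: u_def ln_div ln_realpow)
        then show "((\<lambda>k. moeb k * (x / (real k)\<^sup>2 * poly Q (ln (x / (real k)\<^sup>2)))) \<circ> Suc) k = x * f k"
          by (simp only: o_def f_def) (simp only: times_divide_eq_left times_divide_eq_right mult_ac)
      qed
      also have "\<dots> = x * (\<Sum>k<M. f k)" by (simp add: sum_distrib_left)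
      finally show ?thesis .
    qed
    have "\<bar>(\<Sum>k\<in>sqset x. moeb k * B (x / (real k)\<^sup>2)) - (\<Sum>k\<in>sqset x. moeb k * (x / (real k)\<^sup>2 * poly Q (ln (x / (real k)\<^sup>2))))\<bar>
      \<le> (\<Sum>k\<in>sqset x. E (x / (real k)\<^sup>2))"
    proof -
      have "\<bar>\<Sum>k\<in>sqset x. moeb k * (B (x / (real k)\<^sup>2) - x / (real k)\<^sup>2 * poly Q (ln (x / (real k)\<^sup>2)))\<bar>
        \<le> (\<Sum>k\<in>sqset x. E (x / (real k)\<^sup>2))"
      proof (rule order.trans[OF sum_abs], rule sum_mono)
        fix k assume k: "k \<in> sqset x"
        then have y: "1 \<le> x / (real k)\<^sup>2" by (simp add: sqset_def)
        have "\<bar>moeb k * (B (x / (real k)\<^sup>2) - x / (real k)\<^sup>2 * poly Q (ln (x / (real k)\<^sup>2)))\<bar>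
          \<le> 1 * E (x / (real k)\<^sup>2)" unfolding abs_mult by (intro mult_mono abs_moeb_le B y) auto
        then show "\<bar>moeb k * (B (x / (real k)\<^sup>2) - x / (real k)\<^sup>2 * poly Q (ln (x / (real k)\<^sup>2)))\<bar> \<le> E (x / (real k)\<^sup>2)" by simp
      qed
      then show ?thesis by (simp only: right_diff_distrib sum_subtractf)
    qed
    moreover have "\<bar>x * (\<Sum>k<M. f k) - x * poly R u\<bar> \<le> 6 * C * sqrt x"
    proof -
      have "\<bar>x * (\<Sum>k<M. f k) - x * poly R u\<bar> = x * \<bar>\<Sum>k. f (k + M)\<bar>" using x by (simp add: split abs_mult algebra_simps)
      also have "\<dots> \<le> x * (6 * C * x powr (-1/2))" using x by (intro mult_left_mono tail) auto
      also have "\<dots> = 6 * C * (x powr 1 * x powr (-1/2))" using x by simp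
      also have "x powr 1 * x powr (-1/2) = sqrt x" using x by (simp only: powr_add[symmetric]) (simp add: powr_half_sqrt)
      finally show ?thesis .
    qed
    ultimately show ?thesis unfolding main_eq u_def by linarith
  qed
  show ?thesis by (rule that[OF deg main])
qed

lemma sum_powr_le:
  fixes a :: real
  assumes a: "0 < a" "a \<le> 1"
  shows "(\<Sum>k=1..M. real k powr (a - 1)) \<le> real M powr a / a"
proof (induction M)
  case 0
  show ?case using a by simp
next
  case (Suc M)
  have "real (Suc M) powr (a - 1) \<le> (real (Suc M) powr a - real M powr a) / a"
  proof (cases "M = 0")
    case True
    then show ?thesis using a by simp
  next
    case False
    define s where "s = real M / real (Suc M)"
    have s: "0 < s" using False by (simp add: s_def)
    \<comment> \<open>Bernoulli's inequality s^a \<le> 1 - a + a s, from convexity of exp. With s =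
      M/(M + 1) it bounds the new term by an increment of M^a/a.\<close>
    have "exp ((1 - a) *\<^sub>R 0 + a *\<^sub>R ln s) \<le> (1 - a) * exp 0 + a * exp (ln s)"
      by (rule convex_onD[OF exp_convex]) (use a in auto)
    then have "s powr a \<le> 1 - a + a * s" using s by (simp add: powr_def)
    also have "\<dots> = 1 - a / real (Suc M)" by (simp add: s_def field_simps)
    finally have "real (Suc M) powr a * s powr a \<le> real (Suc M) powr a * (1 - a / real (Suc M))"
      by (rule mult_left_mono) simp
    moreover have "real (Suc M) powr a * s powr a = real M powr a"
      by (simp add: s_def powr_divide)
    moreover have "real (Suc M) powr (a - 1) = real (Suc M) powr a / real (Suc M)" by (simp add: powr_diff)
    ultimately have "a * real (Suc M) powr (a - 1) \<le> real (Suc M) powr a - real M powr a" by (simp add: algebra_simps)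
    then show ?thesis using a by (simp add: pos_le_divide_eq mult.commute)
  qed
  with Suc show ?case by (simp add: diff_divide_distrib)
qed

text \<open>For an exponent below 1/2 the sum of k^(-2s) up to sqrt x is governed by its upper end,
  and the powers of x combine to x^(1/2). At exponent 1/2 the sum becomes harmonic and a logarithm
  appears, as in \<open>sum_sqset_sqrt_le\<close>; this is the difference between the errors
  obtained for \<open>D_s\<close> and \<open>D_c\<close>.\<close>

lemma sum_sqset_powr_le:
  assumes x: "1 \<le> x" and s: "0 \<le> s" "s < 1/2"
  shows "(\<Sum>k\<in>sqset x. (x / (real k)\<^sup>2) powr s) \<le> sqrt x / (1 - 2 * s)"
proof -
  define a where "a = 1 - 2 * s"
  have a: "0 < a" "a \<le> 1" using s by (auto simp: a_def)
  define M where "M = nat \<lfloor>sqrt x\<rfloor>"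
  have "(\<Sum>k\<in>sqset x. (x / (real k)\<^sup>2) powr s) = (\<Sum>k=1..M. x powr s * real k powr (a - 1))"
  proof (rule sum.cong)
    fix k assume "k \<in> {1..M}"
    then have k: "0 < real k" by simp
    have "(real k)\<^sup>2 = real k powr 2" using k by (simp add: powr_numeral)
    then have "(x / (real k)\<^sup>2) powr s = x powr s / (real k powr 2) powr s" using x k by (simp only: powr_divide)
    also have "\<dots> = x powr s * real k powr (a - 1)" by (simp only: powr_powr a_def) (simp add: powr_minus divide_inverse)
    finally show "(x / (real k)\<^sup>2) powr s = x powr s * real k powr (a - 1)" .
  qed (simp add: sqset_eq M_def)
  also have "\<dots> = x powr s * (\<Sum>k=1..M. real k powr (a - 1))" by (simp add: sum_distrib_left)
  also have "\<dots> \<le> x powr s * (real M powr a / a)" by (intro mult_left_mono sum_powr_le a) simp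
  also have "\<dots> \<le> x powr s * (sqrt x powr a / a)"
    using a x by (intro mult_left_mono divide_right_mono powr_mono2) (auto simp: M_def)
  also have "\<dots> = (x powr s * x powr (a / 2)) / a" using x by (simp add: powr_half_sqrt[symmetric] powr_powr)
  also have "x powr s * x powr (a / 2) = sqrt x"
    using x by (simp add: powr_add[symmetric] a_def powr_half_sqrt[symmetric] algebra_simps diff_divide_distrib add_divide_distrib)
  finally show ?thesis by (simp add: a_def)
qed

lemma sum_sqset_sqrt_le:
  assumes x: "1 \<le> x"
  shows "(\<Sum>k\<in>sqset x. sqrt (x / (real k)\<^sup>2)) \<le> sqrt x * (1 + ln x)"
proof -
  define M where "M = nat \<lfloor>sqrt x\<rfloor>"
  have M1: "1 \<le> M" using x by (simp add: M_def le_nat_iff le_floor_iff)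
  have Mx: "real M \<le> sqrt x" using x by (simp add: M_def)
  have "(\<Sum>k\<in>sqset x. sqrt (x / (real k)\<^sup>2)) = (\<Sum>k=1..M. sqrt x * (1 / real k))"
    by (rule sum.cong) (auto simp: sqset_eq M_def real_sqrt_divide)
  also have "\<dots> = sqrt x * harm M" by (simp add: sum_distrib_left harm_def divide_inverse)
  also have "\<dots> \<le> sqrt x * (1 + ln (real M))" using x M1 by (intro mult_left_mono harm_le_one_plus_ln) auto
  also have "\<dots> \<le> sqrt x * (1 + ln x)"
  proof -
    have "ln (real M) \<le> ln (sqrt x)" using M1 Mx x by (subst ln_le_cancel_iff) auto
    also have "\<dots> \<le> ln x" using x by (simp add: ln_sqrt)
    finally show ?thesis using x by (intro mult_left_mono) auto
  qed
  finally show ?thesis .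
qed

section \<open>Rearrangement of the hyperbola sums\<close>

definition quadset :: "real \<Rightarrow> (nat \<times> nat \<times> nat \<times> nat) set" where
  "quadset x = {(i, j, a, b). 1 \<le> i \<and> 1 \<le> j \<and> 1 \<le> a \<and> 1 \<le> b \<and> real (i * j * a * b) \<le> x}"

lemma finite_quadset [simp]: "finite (quadset x)"
proof (rule finite_subset)
  let ?N = "nat \<lfloor>x\<rfloor>"
  show "quadset x \<subseteq> {..?N} \<times> {..?N} \<times> {..?N} \<times> {..?N}"
  proof
    fix q assume "q \<in> quadset x"
    then obtain i j a b where q: "q = (i, j, a, b)" and pos: "1 \<le> i" "1 \<le> j" "1 \<le> a" "1 \<le> b"
      and le: "real (i * j * a * b) \<le> x" by (auto simp: quadset_def)
    define P where "P = i * j * a * b"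
    have P: "P \<le> ?N" using le unfolding P_def by (rule le_nat_floor)
    have P0: "0 < P" using pos by (simp add: P_def)
    have "i dvd P" "j dvd P" "a dvd P" "b dvd P" by (auto simp: P_def)
    then have "i \<le> P" "j \<le> P" "a \<le> P" "b \<le> P" using P0 by (auto intro: dvd_imp_le)
    then show "q \<in> {..?N} \<times> {..?N} \<times> {..?N} \<times> {..?N}" using P by (simp add: q)
  qed
qed simp

text \<open>The common form of \<open>D_s\<close> (\<open>w\<close> the identity) and
  \<open>D_c\<close> (\<open>w\<close> the totient): with m = i a and n = j b the divisors a, b
  become summation variables of equal standing with i, j.\<close>

definition gsum :: "(nat \<Rightarrow> real) \<Rightarrow> real \<Rightarrow> real" where
  "gsum w x = (\<Sum>(i, j, a, b)\<in>quadset x. w (gcd a b) * ln (x / real (i * j * a * b)))"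

lemma hyperbola_sum_eq_gsum:
  "(\<Sum>(m, n)\<in>hyperbola_region x. (\<Sum>a | a dvd m. \<Sum>b | b dvd n. w (gcd a b)) * ln (x / real (m * n))) = gsum w x"
proof -
  let ?D = "\<lambda>p :: nat \<times> nat. {a. a dvd fst p} \<times> {b. b dvd snd p}"
  have "(\<Sum>(m, n)\<in>hyperbola_region x. (\<Sum>a | a dvd m. \<Sum>b | b dvd n. w (gcd a b)) * ln (x / real (m * n)))
    = (\<Sum>p\<in>hyperbola_region x. \<Sum>q\<in>?D p. w (gcd (fst q) (snd q)) * ln (x / real (fst p * snd p)))"
    by (simp add: case_prod_beta sum.cartesian_product sum_distrib_right)
  also have "\<dots> = (\<Sum>(p, q)\<in>Sigma (hyperbola_region x) ?D. w (gcd (fst q) (snd q)) * ln (x / real (fst p * snd p)))"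
  proof (rule sum.Sigma[OF finite_hyperbola_region], rule ballI)
    fix p assume "p \<in> hyperbola_region x"
    then have "0 < fst p" "0 < snd p" by (auto simp: hyperbola_region_def)
    then show "finite (?D p)" by simp
  qed
  also have "\<dots> = gsum w x" unfolding gsum_def
  proof (rule sum.reindex_bij_witness[of _ "\<lambda>(i, j, a, b). ((i * a, j * b), (a, b))" "\<lambda>((m, n), (a, b)). (m div a, n div b, a, b)"])
    fix t assume "t \<in> Sigma (hyperbola_region x) ?D"
    then obtain m n a b where t: "t = ((m, n), (a, b))" and mn: "1 \<le> m" "1 \<le> n" "real (m * n) \<le> x"
      and dv: "a dvd m" "b dvd n" by (auto simp: hyperbola_region_def)
    obtain i j where ij: "m = a * i" "n = b * j" using dv by (auto simp: dvd_def)
    have pos: "0 < a" "0 < i" "0 < b" "0 < j" using mn ij by (auto intro: gr0I)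
    have le: "real (i * j * a * b) \<le> x" using mn(3) by (simp add: ij mult_ac)
    have div: "a * i div a = i" "b * j div b = j" using pos by simp_all
    show "(\<lambda>(i, j, a, b). ((i * a, j * b), (a, b))) ((\<lambda>((m, n), (a, b)). (m div a, n div b, a, b)) t) = t"
      by (simp add: t ij div mult.commute)
    show "(\<lambda>((m, n), (a, b)). (m div a, n div b, a, b)) t \<in> quadset x"
      using pos le by (simp add: t ij div quadset_def Suc_le_eq)
    show "(case (\<lambda>((m, n), (a, b)). (m div a, n div b, a, b)) t of (i, j, a, b) \<Rightarrow> w (gcd a b) * ln (x / real (i * j * a * b)))
      = (case t of (p, q) \<Rightarrow> w (gcd (fst q) (snd q)) * ln (x / real (fst p * snd p)))"
      by (simp add: t ij div mult_ac)
  next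
    fix t assume "t \<in> quadset x"
    then obtain i j a b where t: "t = (i, j, a, b)" and pos: "1 \<le> i" "1 \<le> j" "1 \<le> a" "1 \<le> b"
      and le: "real (i * j * a * b) \<le> x" by (auto simp: quadset_def)
    have le': "real (i * a * (j * b)) \<le> x" using le by (simp add: mult_ac)
    show "(\<lambda>((m, n), (a, b)). (m div a, n div b, a, b)) ((\<lambda>(i, j, a, b). ((i * a, j * b), (a, b))) t) = t"
      using pos by (simp add: t)
    show "(case t of (i, j, a, b) \<Rightarrow> ((i * a, j * b), a, b)) \<in> Sigma (hyperbola_region x) ?D"
      using pos le' by (simp add: t hyperbola_region_def)
  qed
  finally show ?thesis .
qed

lemma D_s_eq_gsum: "D_s x = gsum real x"
  unfolding hyperbola_sum_eq_gsum[symmetric] D_s_def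
  by (intro sum.cong refl) (auto simp: hyperbola_region_def num_subgroups_eq_sum_gcd)

lemma D_c_eq_gsum: "D_c x = gsum (\<lambda>n. real (totient n)) x"
  unfolding hyperbola_sum_eq_gsum[symmetric] D_c_def
  by (intro sum.cong refl) (auto simp: hyperbola_region_def num_cyclic_subgroups_eq_sum_totient_gcd)

lemma sum_sqset_gsum:
  "(\<Sum>k\<in>sqset x. gsum w (x / (real k)\<^sup>2)) =
   (\<Sum>(k, i, j, a, b)\<in>Sigma (sqset x) (\<lambda>k. quadset (x / (real k)\<^sup>2)). w (gcd a b) * ln (x / real (i * j * a * b * k\<^sup>2)))"
proof -
  have "(\<Sum>k\<in>sqset x. gsum w (x / (real k)\<^sup>2)) =
    (\<Sum>k\<in>sqset x. \<Sum>(i, j, a, b)\<in>quadset (x / (real k)\<^sup>2). w (gcd a b) * ln (x / real (i * j * a * b * k\<^sup>2)))"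
    by (simp add: gsum_def mult_ac)
  also have "\<dots> = (\<Sum>(k, q)\<in>Sigma (sqset x) (\<lambda>k. quadset (x / (real k)\<^sup>2)). case q of (i, j, a, b) \<Rightarrow> w (gcd a b) * ln (x / real (i * j * a * b * k\<^sup>2)))"
    by (rule sum.Sigma) auto
  finally show ?thesis by (simp add: case_prod_beta)
qed

lemma mem_Sigma_sqset_quadset:
  "(k, i, j, a, b) \<in> Sigma (sqset x) (\<lambda>k. quadset (x / (real k)\<^sup>2)) \<longleftrightarrow>
    0 < k \<and> 0 < i \<and> 0 < j \<and> 0 < a \<and> 0 < b \<and> real (i * j * a * b * k\<^sup>2) \<le> x"
proof (cases "0 < k \<and> 0 < i \<and> 0 < j \<and> 0 < a \<and> 0 < b")
  case True
  have "1 \<le> i * j * a * b" using True by (simp add: Suc_le_eq)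
  then have "1 \<le> real (i * j * a * b)" by (simp only: real_of_nat_ge_one_iff)
  then have "1 * (real k)\<^sup>2 \<le> real (i * j * a * b) * (real k)\<^sup>2" by (rule mult_right_mono) simp
  then have "(real k)\<^sup>2 \<le> x" if "real (i * j * a * b) * (real k)\<^sup>2 \<le> x" using that by linarith
  moreover have "real (i * j * a * b) \<le> x / (real k)\<^sup>2 \<longleftrightarrow> real (i * j * a * b) * (real k)\<^sup>2 \<le> x"
    using True by (simp add: pos_le_divide_eq)
  ultimately show ?thesis using True by (auto simp: sqset_def quadset_def Suc_le_eq)
qed (auto simp: sqset_def quadset_def)

text \<open>gcd(a, b) is the sum of totient(gcd(a, b)/k) over its divisors k. With a = k a' and b =
  k b' the summand is totient(gcd(a', b')), and the product i j a b = i j a' b' k^2 turns the sum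
  over k into dilations of \<open>D_c\<close>.\<close>

lemma D_s_eq_sum_D_c: "D_s x = (\<Sum>k\<in>sqset x. D_c (x / (real k)\<^sup>2))"
proof -
  let ?V = "Sigma (sqset x) (\<lambda>k. quadset (x / (real k)\<^sup>2))"
  let ?G = "\<lambda>(i, j, a, b). {k. k dvd gcd a b} :: nat set"
  have fin: "finite (?G q)" if "q \<in> quadset x" for q
  proof -
    obtain i j a b where q: "q = (i, j, a, b)" by (cases q)
    then have "0 < gcd a b" using that by (auto simp: quadset_def)
    then have "finite {k. k dvd gcd a b}" by (rule finite_divisors_nat)
    then show ?thesis by (simp only: q prod.case)
  qed
  have "D_s x = (\<Sum>q\<in>quadset x. \<Sum>k\<in>?G q. case q of (i, j, a, b) \<Rightarrow> real (totient (gcd a b div k)) * ln (x / real (i * j * a * b)))"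
    unfolding D_s_eq_gsum gsum_def
  proof (rule sum.cong[OF refl])
    fix q assume qq: "q \<in> quadset x"
    obtain i j a b where q: "q = (i, j, a, b)" by (cases q)
    have g0: "0 < gcd a b" using qq q by (auto simp: quadset_def)
    have "(\<Sum>k | k dvd gcd a b. totient (gcd a b div k)) = (\<Sum>d | d dvd gcd a b. totient d)"
      by (rule sum.reindex_bij_witness[of _ "\<lambda>d. gcd a b div d" "\<lambda>d. gcd a b div d"]) (use g0 in \<open>auto simp: dvd_div_eq_0_iff div_dvd_iff_mult div_div_eq_right\<close>)
    then have "real (gcd a b) = (\<Sum>k | k dvd gcd a b. real (totient (gcd a b div k)))"
      by (simp only: of_nat_sum[symmetric] totient_divisor_sum)
    then have "real (gcd a b) * ln (x / real (i * j * a * b)) = (\<Sum>k | k dvd gcd a b. real (totient (gcd a b div k)) * ln (x / real (i * j * a * b)))"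
      by (simp only: sum_distrib_right)
    then show "(case q of (i, j, a, b) \<Rightarrow> real (gcd a b) * ln (x / real (i * j * a * b)))
      = (\<Sum>k\<in>?G q. case q of (i, j, a, b) \<Rightarrow> real (totient (gcd a b div k)) * ln (x / real (i * j * a * b)))"
      by (simp only: q prod.case)
  qed
  also have "\<dots> = (\<Sum>(q, k)\<in>Sigma (quadset x) ?G. case q of (i, j, a, b) \<Rightarrow> real (totient (gcd a b div k)) * ln (x / real (i * j * a * b)))"
    by (rule sum.Sigma) (use fin in auto)
  also have "\<dots> = (\<Sum>(k, i, j, a, b)\<in>?V. real (totient (gcd a b)) * ln (x / real (i * j * a * b * k\<^sup>2)))"
  proof (rule sum.reindex_bij_witness[of _ "\<lambda>(k, i, j, a, b). ((i, j, k * a, k * b), k)" "\<lambda>((i, j, a, b), k). (k, i, j, a div k, b div k)"])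
    fix t assume "t \<in> Sigma (quadset x) ?G"
    then obtain i j a b k where t: "t = ((i, j, a, b), k)" and q: "0 < i" "0 < j" "0 < a" "0 < b" "real (i * j * a * b) \<le> x"
      and k: "k dvd a" "k dvd b" by (auto simp: quadset_def)
    obtain a' b' where ab: "a = k * a'" "b = k * b'" using k by (auto simp: dvd_def)
    have pos: "0 < k" "0 < a'" "0 < b'" using q ab by (auto intro: gr0I)
    have le: "real (i * j * a' * b' * k\<^sup>2) \<le> x" using q(5) by (simp add: ab power2_eq_square mult_ac)
    have g: "gcd (k * a') (k * b') div k = gcd a' b'" using pos by (simp add: gcd_mult_distrib_nat[symmetric])
    show "(\<lambda>(k, i, j, a, b). ((i, j, k * a, k * b), k)) ((\<lambda>((i, j, a, b), k). (k, i, j, a div k, b div k)) t) = t"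
      using pos by (simp add: t ab)
    show "(\<lambda>((i, j, a, b), k). (k, i, j, a div k, b div k)) t \<in> ?V"
      using pos q le by (simp only: t prod.case mem_Sigma_sqset_quadset) (simp add: ab)
    show "(case (\<lambda>((i, j, a, b), k). (k, i, j, a div k, b div k)) t of (k, i, j, a, b) \<Rightarrow> real (totient (gcd a b)) * ln (x / real (i * j * a * b * k\<^sup>2)))
      = (case t of (q, k) \<Rightarrow> case q of (i, j, a, b) \<Rightarrow> real (totient (gcd a b div k)) * ln (x / real (i * j * a * b)))"
      unfolding t prod.case ab using pos by (simp add: g) (simp add: power2_eq_square mult_ac)
  next
    fix t assume tV: "t \<in> ?V"
    obtain k i j a b where t: "t = (k, i, j, a, b)" by (cases t)
    have q: "0 < k" "0 < i" "0 < j" "0 < a" "0 < b" "real (i * j * a * b * k\<^sup>2) \<le> x"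
      using tV unfolding t mem_Sigma_sqset_quadset by auto
    have le: "real (i * j * (k * a) * (k * b)) \<le> x" using q(6) by (simp add: power2_eq_square mult_ac)
    show "(\<lambda>((i, j, a, b), k). (k, i, j, a div k, b div k)) ((\<lambda>(k, i, j, a, b). ((i, j, k * a, k * b), k)) t) = t"
      using q by (simp add: t)
    show "(case t of (k, i, j, a, b) \<Rightarrow> ((i, j, k * a, k * b), k)) \<in> Sigma (quadset x) ?G"
      using q le by (simp add: t quadset_def Suc_le_eq del: of_nat_mult)
  qed
  also have "\<dots> = (\<Sum>k\<in>sqset x. D_c (x / (real k)\<^sup>2))"
    by (simp only: sum_sqset_gsum D_c_eq_gsum)
  finally show ?thesis .
qed

text \<open>The map \<open>(k, a, b) \<mapsto> (g, ka/g, kb/g)\<close> with \<open>g = gcd a b\<close> is an involution preserving \<open>abk\<^sup>2\<close>, and it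
  exchanges \<open>k\<close> with \<open>gcd a b\<close>.\<close>

lemma TT_eq_sum_D_s:
  assumes x: "0 < x" and N: "x \<le> real N"
  shows "TT N (ln x) = (\<Sum>k\<in>sqset x. D_s (x / (real k)\<^sup>2))"
proof -
  let ?V = "Sigma (sqset x) (\<lambda>k. quadset (x / (real k)\<^sup>2))"
  define W where "W = {(i, j, a, b, l). 0 < i \<and> 0 < j \<and> 0 < a \<and> 0 < b \<and> 0 < l \<and> real (i * j * a * b * l\<^sup>2) \<le> x}"
  let ?f = "\<lambda>(i, j, a, b, l). real l * max 0 (ln x - ln (real (i * j * a * b * l\<^sup>2)))"
  have "TT N (ln x) = (\<Sum>q\<in>{1..N} \<times> {1..N} \<times> {1..N} \<times> {1..N} \<times> {1..N}. ?f q)"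
    by (simp only: TT_def sum.cartesian_product)
  also have "\<dots> = (\<Sum>q\<in>W. ?f q)"
  proof (rule sum.mono_neutral_right)
    show "W \<subseteq> {1..N} \<times> {1..N} \<times> {1..N} \<times> {1..N} \<times> {1..N}"
    proof
      fix q assume "q \<in> W"
      then obtain i j a b l where q: "q = (i, j, a, b, l)" and pos: "0 < i" "0 < j" "0 < a" "0 < b" "0 < l"
        and le: "real (i * j * a * b * l\<^sup>2) \<le> x" by (auto simp: W_def)
      define P where "P = i * j * a * b * l\<^sup>2"
      have "real P \<le> real N" using le N unfolding P_def by linarith
      then have P: "P \<le> N" by simp
      have P0: "0 < P" using pos by (simp add: P_def)
      have "i dvd P" "j dvd P" "a dvd P" "b dvd P" "l dvd P" by (auto simp: P_def power2_eq_square)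
      then have "i \<le> P" "j \<le> P" "a \<le> P" "b \<le> P" "l \<le> P" using P0 by (auto intro: dvd_imp_le)
      then show "q \<in> {1..N} \<times> {1..N} \<times> {1..N} \<times> {1..N} \<times> {1..N}" using P pos by (auto simp: q)
    qed
    show "\<forall>q\<in>{1..N} \<times> {1..N} \<times> {1..N} \<times> {1..N} \<times> {1..N} - W. ?f q = 0"
    proof
      fix q assume qW: "q \<in> {1..N} \<times> {1..N} \<times> {1..N} \<times> {1..N} \<times> {1..N} - W"
      obtain i j a b l where q: "q = (i, j, a, b, l)" by (cases q)
      have pos: "0 < i" "0 < j" "0 < a" "0 < b" "0 < l" using qW by (auto simp: q)
      then have "x < real (i * j * a * b * l\<^sup>2)" using qW by (auto simp: q W_def)
      then have "ln x < ln (real (i * j * a * b * l\<^sup>2))" using x by (intro ln_less_cancel_iff[THEN iffD2]) linarith+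
      then show "?f q = 0" by (simp only: q prod.case)
    qed
  qed simp
  also have "\<dots> = (\<Sum>(k, i, j, a, b)\<in>?V. real (gcd a b) * ln (x / real (i * j * a * b * k\<^sup>2)))"
  proof (rule sum.reindex_bij_witness[of _ "\<lambda>(k, i, j, a, b). (i, j, k * (a div gcd a b), k * (b div gcd a b), gcd a b)"
        "\<lambda>(i, j, a, b, l). (gcd a b, i, j, l * (a div gcd a b), l * (b div gcd a b))"])
    fix t assume tW: "t \<in> W"
    obtain i j a b l where t: "t = (i, j, a, b, l)" by (cases t)
    have q: "0 < i" "0 < j" "0 < a" "0 < b" "0 < l" "real (i * j * a * b * l\<^sup>2) \<le> x"
      using tW by (auto simp: t W_def)
    define g where "g = gcd a b"
    have g0: "0 < g" using q by (simp add: g_def)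
    define a' b' where "a' = a div g" and "b' = b div g"
    have ab: "a = g * a'" "b = g * b'" by (simp_all add: a'_def b'_def g_def)
    have pos: "0 < a'" "0 < b'" using q ab by (auto intro: gr0I)
    have cop: "gcd a' b' = 1" using g0 unfolding a'_def b'_def g_def by (simp add: div_gcd_coprime)
    have gl: "gcd (l * a') (l * b') = l" using cop by (simp add: gcd_mult_distrib_nat[symmetric])
    have prod: "i * j * (l * a') * (l * b') * g\<^sup>2 = i * j * a * b * l\<^sup>2" by (simp add: ab power2_eq_square mult_ac)
    have to: "(case t of (i, j, a, b, l) \<Rightarrow> (gcd a b, i, j, l * (a div gcd a b), l * (b div gcd a b))) = (g, i, j, l * a', l * b')"
      by (simp only: t prod.case) (simp only: a'_def b'_def g_def)
    have dl: "l * a' div l = a'" "l * b' div l = b'" using q by simp_all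
    show "(case case t of (i, j, a, b, l) \<Rightarrow> (gcd a b, i, j, l * (a div gcd a b), l * (b div gcd a b)) of
       (k, i, j, a, b) \<Rightarrow> (i, j, k * (a div gcd a b), k * (b div gcd a b), gcd a b)) = t"
      unfolding to by (simp only: prod.case gl dl t ab[symmetric])
    show "(case t of (i, j, a, b, l) \<Rightarrow> (gcd a b, i, j, l * (a div gcd a b), l * (b div gcd a b))) \<in> ?V"
      unfolding to mem_Sigma_sqset_quadset prod using q g0 pos by simp
    have "ln (real (i * j * a * b * l\<^sup>2)) \<le> ln x" using q x by (intro ln_le_cancel_iff[THEN iffD2]) auto
    moreover have "ln (x / real (i * j * a * b * l\<^sup>2)) = ln x - ln (real (i * j * a * b * l\<^sup>2))"
      using q(1-5) x by (intro ln_divide_pos) auto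
    ultimately show "(case case t of (i, j, a, b, l) \<Rightarrow> (gcd a b, i, j, l * (a div gcd a b), l * (b div gcd a b)) of
       (k, i, j, a, b) \<Rightarrow> real (gcd a b) * ln (x / real (i * j * a * b * k\<^sup>2))) = ?f t"
      unfolding to by (simp only: prod.case gl prod t)
  next
    fix t assume tV: "t \<in> ?V"
    obtain l i j a b where t: "t = (l, i, j, a, b)" by (cases t)
    have q: "0 < l" "0 < i" "0 < j" "0 < a" "0 < b" "real (i * j * a * b * l\<^sup>2) \<le> x"
      using tV unfolding t mem_Sigma_sqset_quadset by auto
    define g where "g = gcd a b"
    have g0: "0 < g" using q by (simp add: g_def)
    define a' b' where "a' = a div g" and "b' = b div g"
    have ab: "a = g * a'" "b = g * b'" by (simp_all add: a'_def b'_def g_def)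
    have pos: "0 < a'" "0 < b'" using q ab by (auto intro: gr0I)
    have cop: "gcd a' b' = 1" using g0 unfolding a'_def b'_def g_def by (simp add: div_gcd_coprime)
    have gl: "gcd (l * a') (l * b') = l" using cop by (simp add: gcd_mult_distrib_nat[symmetric])
    have prod: "i * j * (l * a') * (l * b') * g\<^sup>2 = i * j * a * b * l\<^sup>2" by (simp add: ab power2_eq_square mult_ac)
    have to: "(case t of (k, i, j, a, b) \<Rightarrow> (i, j, k * (a div gcd a b), k * (b div gcd a b), gcd a b)) = (i, j, l * a', l * b', g)"
      by (simp only: t prod.case) (simp only: a'_def b'_def g_def)
    have dl: "l * a' div l = a'" "l * b' div l = b'" using q by simp_all
    show "(case case t of (k, i, j, a, b) \<Rightarrow> (i, j, k * (a div gcd a b), k * (b div gcd a b), gcd a b) of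
       (i, j, a, b, l) \<Rightarrow> (gcd a b, i, j, l * (a div gcd a b), l * (b div gcd a b))) = t"
      unfolding to by (simp only: prod.case gl dl t ab[symmetric])
    have "real (i * j * (l * a') * (l * b') * g\<^sup>2) \<le> x" unfolding prod by (rule q(6))
    then show "(case t of (k, i, j, a, b) \<Rightarrow> (i, j, k * (a div gcd a b), k * (b div gcd a b), gcd a b)) \<in> W"
      unfolding to W_def mem_Collect_eq prod.case using q g0 pos by simp
  qed
  also have "\<dots> = (\<Sum>k\<in>sqset x. D_s (x / (real k)\<^sup>2))"
    by (simp only: sum_sqset_gsum D_s_eq_gsum)
  finally show ?thesis .
qed

theorem D_s_D_c_asymptotics:
  obtains P R :: "real poly" where "degree P = 4" "degree R = 4"
    and "\<exists>C. \<forall>x\<ge>1. \<bar>D_s x - x * poly P (ln x)\<bar> \<le> C * sqrt x"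
    and "\<exists>C. \<forall>x\<ge>1. \<bar>D_c x - x * poly R (ln x)\<bar> \<le> C * (sqrt x * (1 + ln x))"
proof -
  obtain Q :: "real poly" and C where dQ: "degree Q = 4"
    and C: "\<And>v N. 0 < v \<Longrightarrow> exp v \<le> real N \<Longrightarrow> \<bar>TT N v - exp v * poly Q v\<bar> \<le> C * exp (v * sig0)"
    using TT_asymptotics by blast
  define B where "B y = TT (nat \<lceil>y\<rceil>) (ln y)" for y
  have BN: "y \<le> real (nat \<lceil>y\<rceil>)" for y by (rule real_nat_ceiling_ge)
  have sg: "0 \<le> sig0" "sig0 < 1/2" by (simp_all add: sig0_def)
  define C' where "C' = \<bar>C\<bar> + \<bar>poly Q 0\<bar>"
  have B_le: "\<bar>B y - y * poly Q (ln y)\<bar> \<le> C' * y powr sig0" if y: "1 \<le> y" for y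
  \<comment> \<open>\<open>TT_asymptotics\<close> needs ln y > 0. At y = 1 the sum T vanishes, and
    |poly Q 0| is put into the constant.\<close>
  proof (cases "y = 1")
    case True
    have "TT N 0 = 0" for N unfolding TT_def
    proof (intro sum.neutral ballI)
      fix a b c d l :: nat assume "a \<in> {1..N}" "b \<in> {1..N}" "c \<in> {1..N}" "d \<in> {1..N}" "l \<in> {1..N}"
      then have "1 \<le> a * b * c * d * l\<^sup>2" by (simp add: Suc_le_eq)
      then have "1 \<le> real (a * b * c * d * l\<^sup>2)" by (simp only: real_of_nat_ge_one_iff)
      then have "0 \<le> ln (real (a * b * c * d * l\<^sup>2))" by (rule ln_ge_zero)
      then show "real l * max 0 (0 - ln (real (a * b * c * d * l\<^sup>2))) = 0" by simp
    qed
    then show ?thesis using True by (simp add: B_def C'_def)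
  next
    case False
    then have v: "0 < ln y" using y by simp
    have "exp (ln y) \<le> real (nat \<lceil>y\<rceil>)" using y BN[of y] by simp
    then have "\<bar>B y - y * poly Q (ln y)\<bar> \<le> C * exp (ln y * sig0)" using C[OF v] y by (simp add: B_def)
    also have "\<dots> \<le> C' * exp (ln y * sig0)" by (intro mult_right_mono) (auto simp: C'_def)
    finally show ?thesis using y by (simp add: powr_def mult.commute)
  qed
  obtain P CP where dP: "degree P = degree Q"
    and P: "\<And>x. 1 \<le> x \<Longrightarrow> \<bar>(\<Sum>k\<in>sqset x. moeb k * B (x / (real k)\<^sup>2)) - x * poly P (ln x)\<bar>
      \<le> CP * sqrt x + (\<Sum>k\<in>sqset x. C' * (x / (real k)\<^sup>2) powr sig0)"
    by (rule sum_moeb_transfer[of B Q "\<lambda>y. C' * y powr sig0"]) (use B_le in blast)+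
  define C1 where "C1 = CP + C' / (1 - 2 * sig0)"
  have Ds: "\<bar>D_s x - x * poly P (ln x)\<bar> \<le> C1 * sqrt x" if x: "1 \<le> x" for x
  proof -
    have "D_s x = (\<Sum>k\<in>sqset x. moeb k * B (x / (real k)\<^sup>2))"
      by (rule moebius_inversion_squares[OF _ x]) (simp only: B_def, rule TT_eq_sum_D_s, assumption, rule BN)
    moreover have "(\<Sum>k\<in>sqset x. C' * (x / (real k)\<^sup>2) powr sig0) \<le> C' * (sqrt x / (1 - 2 * sig0))"
      unfolding sum_distrib_left[symmetric] by (intro mult_left_mono sum_sqset_powr_le x sg) (simp add: C'_def)
    ultimately show ?thesis using P[OF x] by (simp add: C1_def algebra_simps)
  qed
  obtain R CR where dR: "degree R = degree P"
    and R: "\<And>x. 1 \<le> x \<Longrightarrow> \<bar>(\<Sum>k\<in>sqset x. moeb k * D_s (x / (real k)\<^sup>2)) - x * poly R (ln x)\<bar>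
      \<le> CR * sqrt x + (\<Sum>k\<in>sqset x. C1 * sqrt (x / (real k)\<^sup>2))"
    by (rule sum_moeb_transfer[of D_s P "\<lambda>y. C1 * sqrt y"]) (use Ds in blast)+
  have C1: "0 \<le> C1" using Ds[of 1] by (simp add: abs_ge_zero order.trans)
  have Dc: "\<bar>D_c x - x * poly R (ln x)\<bar> \<le> (\<bar>CR\<bar> + C1) * (sqrt x * (1 + ln x))" if x: "1 \<le> x" for x
  proof -
    have "D_c x = (\<Sum>k\<in>sqset x. moeb k * D_s (x / (real k)\<^sup>2))"
      by (rule moebius_inversion_squares[OF _ x]) (rule D_s_eq_sum_D_c)
    moreover have "(\<Sum>k\<in>sqset x. C1 * sqrt (x / (real k)\<^sup>2)) \<le> C1 * (sqrt x * (1 + ln x))"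
      unfolding sum_distrib_left[symmetric] by (intro mult_left_mono sum_sqset_sqrt_le x C1)
    moreover have "CR * (sqrt x * 1) \<le> \<bar>CR\<bar> * (sqrt x * (1 + ln x))"
      using x by (intro mult_mono mult_left_mono) auto
    ultimately show ?thesis using R[OF x] by (simp add: algebra_simps)
  qed
  show ?thesis
  proof (rule that)
    show "degree P = 4" "degree R = 4" using dQ dP dR by simp_all
    show "\<exists>C. \<forall>x\<ge>1. \<bar>D_s x - x * poly P (ln x)\<bar> \<le> C * sqrt x" using Ds by blast
    show "\<exists>C. \<forall>x\<ge>1. \<bar>D_c x - x * poly R (ln x)\<bar> \<le> C * (sqrt x * (1 + ln x))" using Dc by blast
  qed
qed

section \<open>Computability of the coefficients\<close>

text \<open>\<open>recursive_fn\<close> pins down the values on lists of every length. Closing it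
  under equality on lists of length n gives a notion that depends only on the relevant values and
  for which closure rules can be stated pointwise.\<close>

definition rfun :: "nat \<Rightarrow> (nat list \<Rightarrow> nat) \<Rightarrow> bool" where
  "rfun n F \<longleftrightarrow> (\<exists>f. recursive_fn n f \<and> (\<forall>xs. length xs = n \<longrightarrow> F xs = f xs))"

lemma rfunI: "recursive_fn n f \<Longrightarrow> (\<And>xs. length xs = n \<Longrightarrow> F xs = f xs) \<Longrightarrow> rfun n F"
  by (auto simp: rfun_def)

lemma rfun_cong: "rfun n f \<Longrightarrow> (\<And>xs. length xs = n \<Longrightarrow> F xs = f xs) \<Longrightarrow> rfun n F"
  by (auto simp: rfun_def)

lemma rfun_nth: "i < n \<Longrightarrow> rfun n (\<lambda>xs. xs ! i)"
  by (rule rfunI[OF recursive_fn.proj]) auto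

lemma rfun_comp:
  assumes f: "rfun (length gs) f" and gs: "\<And>g. g \<in> set gs \<Longrightarrow> rfun n g"
  shows "rfun n (\<lambda>xs. f (map (\<lambda>g. g xs) gs))"
proof -
  obtain f' where f': "recursive_fn (length gs) f'" "\<And>xs. length xs = length gs \<Longrightarrow> f xs = f' xs"
    using f by (auto simp: rfun_def)
  have "\<forall>g\<in>set gs. \<exists>g'. recursive_fn n g' \<and> (\<forall>xs. length xs = n \<longrightarrow> g xs = g' xs)"
    using gs by (simp add: rfun_def)
  then obtain h where h: "\<forall>g\<in>set gs. recursive_fn n (h g) \<and> (\<forall>xs. length xs = n \<longrightarrow> g xs = h g xs)"
    by (rule bchoice[THEN exE])
  have "recursive_fn n (\<lambda>xs. f' (map (\<lambda>g. g xs) (map h gs)))"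
    by (rule recursive_fn.comp) (use f' h in auto)
  then show ?thesis
  proof (rule rfunI)
    fix xs :: "nat list" assume "length xs = n"
    then have "map (\<lambda>g. g xs) gs = map (\<lambda>g. g xs) (map h gs)" using h by simp
    then show "f (map (\<lambda>g. g xs) gs) = f' (map (\<lambda>g. g xs) (map h gs))"
      by (simp only:) (rule f'(2), simp)
  qed
qed

lemma rfun_comp1: "rfun (Suc 0) f \<Longrightarrow> rfun n g \<Longrightarrow> rfun n (\<lambda>xs. f [g xs])"
  using rfun_comp[of "[g]" f n] by simp

lemma rfun_Suc: "rfun n f \<Longrightarrow> rfun n (\<lambda>xs. Suc (f xs))"
  using rfun_comp1[of "\<lambda>xs. Suc (xs ! 0)" n f] rfunI[OF recursive_fn.succ, of "\<lambda>xs. Suc (xs ! 0)"] by simp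

lemma rfun_const: "rfun n (\<lambda>xs. c)"
proof (induction c)
  case 0
  show ?case by (rule rfunI[OF recursive_fn.zero]) simp
qed (rule rfun_Suc)

lemma rfun_tl:
  assumes "rfun n f"
  shows "rfun (Suc n) (\<lambda>ys. f (tl ys))"
proof (rule rfun_cong)
  show "rfun (Suc n) (\<lambda>ys. f (map (\<lambda>g. g ys) (map (\<lambda>i ys. ys ! Suc i) [0..<n])))"
    by (rule rfun_comp) (use assms in \<open>auto intro: rfun_nth\<close>)
  fix ys :: "nat list" assume l: "length ys = Suc n"
  have "tl ys = map (\<lambda>i. ys ! Suc i) [0..<n]"
    by (rule nth_equalityI) (use l in \<open>auto simp: nth_tl\<close>)
  then show "f (tl ys) = f (map (\<lambda>g. g ys) (map (\<lambda>i ys. ys ! Suc i) [0..<n]))" by (simp add: comp_def)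
qed

lemma rfun_hd: "rfun (Suc n) hd"
  by (rule rfun_cong[OF rfun_nth[of 0]]) (auto simp: length_Suc_conv)

text \<open>Binders prepend the bound variable to the argument list, so that in the premises of
  the rules below \<open>hd ys\<close> is the bound variable and \<open>tl ys\<close> the surrounding arguments.\<close>

lemma rfun_rec:
  assumes b: "rfun n b" and g: "rfun n g" and h: "rfun (Suc (Suc n)) (\<lambda>ys. h (tl (tl ys)) (hd ys) (hd (tl ys)))"
  shows "rfun n (\<lambda>xs. rec_nat (g xs) (h xs) (b xs))"
proof -
  obtain g' where g': "recursive_fn n g'" "\<And>xs. length xs = n \<Longrightarrow> g xs = g' xs" using g by (auto simp: rfun_def)
  obtain h' where h': "recursive_fn (Suc (Suc n)) h'"
    "\<And>ys. length ys = Suc (Suc n) \<Longrightarrow> h (tl (tl ys)) (hd ys) (hd (tl ys)) = h' ys" using h by (auto simp: rfun_def)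
  let ?r = "\<lambda>ys. rec_nat (g' (tl ys)) (\<lambda>k r. h' (k # r # tl ys)) (hd ys)"
  have r: "rfun (Suc n) ?r" by (rule rfunI[OF recursive_fn.prec[OF g'(1) h'(1)]]) simp
  let ?gs = "b # map (\<lambda>i xs. xs ! i) [0..<n]"
  have "rfun n (\<lambda>xs. ?r (map (\<lambda>g. g xs) ?gs))"
    by (rule rfun_comp) (use r b in \<open>auto intro: rfun_nth\<close>)
  then show ?thesis
  proof (rule rfun_cong)
    fix xs :: "nat list" assume l: "length xs = n"
    have "map (\<lambda>g. g xs) ?gs = b xs # xs"
      using l by (auto simp: comp_def intro: nth_equalityI)
    moreover have "rec_nat (g xs) (h xs) m = rec_nat (g' xs) (\<lambda>k r. h' (k # r # xs)) m" for m
      by (induction m) (use l g'(2) h'(2)[of "_ # _ # xs"] in auto)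
    ultimately show "rec_nat (g xs) (h xs) (b xs) = ?r (map (\<lambda>g. g xs) ?gs)" by simp
  qed
qed

lemma rfun_add:
  assumes "rfun n f" "rfun n g"
  shows "rfun n (\<lambda>xs. f xs + g xs)"
proof -
  have "rfun n (\<lambda>xs. rec_nat (f xs) (\<lambda>k r. Suc r) (g xs))"
    by (intro rfun_rec assms rfun_Suc rfun_tl[OF rfun_hd])
  moreover have "rec_nat a (\<lambda>k r. Suc r) b = a + b" for a b by (induction b) auto
  ultimately show ?thesis by simp
qed

lemma rfun_mult:
  assumes "rfun n f" "rfun n g"
  shows "rfun n (\<lambda>xs. f xs * g xs)"
proof -
  have "rfun n (\<lambda>xs. rec_nat 0 (\<lambda>k r. r + f xs) (g xs))"
    by (intro rfun_rec assms rfun_const rfun_add rfun_tl[OF rfun_hd] rfun_tl[OF rfun_tl[OF assms(1)]])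
  moreover have "rec_nat 0 (\<lambda>k r. r + a) b = a * b" for a b :: nat by (induction b) auto
  ultimately show ?thesis by simp
qed

lemma rfun_power:
  assumes "rfun n f" "rfun n g"
  shows "rfun n (\<lambda>xs. f xs ^ g xs)"
proof -
  have "rfun n (\<lambda>xs. rec_nat 1 (\<lambda>k r. f xs * r) (g xs))"
    by (intro rfun_rec assms rfun_const rfun_mult rfun_tl[OF rfun_hd] rfun_tl[OF rfun_tl[OF assms(1)]])
  moreover have "rec_nat 1 (\<lambda>k r. a * r) b = a ^ b" for a b :: nat by (induction b) auto
  ultimately show ?thesis by simp
qed

lemma rfun_diff:
  assumes "rfun n f" "rfun n g"
  shows "rfun n (\<lambda>xs. f xs - g xs)"
proof -
  have pred: "rfun m (\<lambda>xs. e xs - 1)" if "rfun m e" for m e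
  proof -
    have "rfun m (\<lambda>xs. rec_nat 0 (\<lambda>k r. k) (e xs))"
      by (intro rfun_rec that rfun_const rfun_hd)
    moreover have "rec_nat 0 (\<lambda>k r. k) b = b - 1" for b by (cases b) auto
    ultimately show ?thesis by simp
  qed
  have "rfun n (\<lambda>xs. rec_nat (f xs) (\<lambda>k r. r - 1) (g xs))"
    by (intro rfun_rec assms pred rfun_tl[OF rfun_hd])
  moreover have "rec_nat a (\<lambda>k r. r - 1) b = a - b" for a b :: nat by (induction b) auto
  ultimately show ?thesis by simp
qed

lemma rfun_sum:
  assumes b: "rfun n b" and F: "rfun (Suc n) (\<lambda>ys. F (tl ys) (hd ys))"
  shows "rfun n (\<lambda>xs. \<Sum>i<b xs. F xs i)"
proof -
  \<comment> \<open>The recursion step sees counter, accumulator and parameters, in this order;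
    these projections hide the accumulator from \<open>F\<close>.\<close>
  let ?gs = "(\<lambda>ys. ys ! 0) # map (\<lambda>i ys. ys ! Suc (Suc i)) [0..<n]"
  have "rfun (Suc (Suc n)) (\<lambda>ys. F (tl (tl ys)) (hd ys))"
  proof (rule rfun_cong)
    show "rfun (Suc (Suc n)) (\<lambda>ys. (\<lambda>ys. F (tl ys) (hd ys)) (map (\<lambda>g. g ys) ?gs))"
      by (rule rfun_comp) (use F in \<open>auto intro: rfun_nth\<close>)
    fix ys :: "nat list" assume l: "length ys = Suc (Suc n)"
    have "tl (tl ys) = map (\<lambda>i. ys ! Suc (Suc i)) [0..<n]"
      by (rule nth_equalityI) (use l in \<open>auto simp: nth_tl\<close>)
    moreover have "hd ys = ys ! 0" using l by (intro hd_conv_nth) auto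
    ultimately show "F (tl (tl ys)) (hd ys) = F (tl (map (\<lambda>g. g ys) ?gs)) (hd (map (\<lambda>g. g ys) ?gs))"
      by (simp add: comp_def)
  qed
  then have "rfun n (\<lambda>xs. rec_nat 0 (\<lambda>k r. r + F xs k) (b xs))"
    by (intro rfun_rec b rfun_const rfun_add rfun_tl[OF rfun_hd])
  moreover have "rec_nat 0 (\<lambda>k r. r + F xs k) m = (\<Sum>i<m. F xs i)" for xs m by (induction m) auto
  ultimately show ?thesis by (simp only:)
qed

definition rpred :: "nat \<Rightarrow> (nat list \<Rightarrow> bool) \<Rightarrow> bool" where
  "rpred n P \<longleftrightarrow> rfun n (\<lambda>xs. if P xs then 1 else 0)"

lemma rpred_le: "rfun n f \<Longrightarrow> rfun n g \<Longrightarrow> rpred n (\<lambda>xs. f xs \<le> g xs)"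
  unfolding rpred_def
  by (rule rfun_cong[of _ "\<lambda>xs. 1 - (f xs - g xs)"]) (auto intro: rfun_diff rfun_const)

lemma rpred_less: "rfun n f \<Longrightarrow> rfun n g \<Longrightarrow> rpred n (\<lambda>xs. f xs < g xs)"
  using rpred_le[OF rfun_Suc, of n f g] by (simp add: Suc_le_eq)

lemma rpred_and: "rpred n P \<Longrightarrow> rpred n Q \<Longrightarrow> rpred n (\<lambda>xs. P xs \<and> Q xs)"
  unfolding rpred_def
  by (rule rfun_cong[of _ "\<lambda>xs. (if P xs then 1 else 0) * (if Q xs then 1 else 0)"]) (auto intro: rfun_mult)

lemma rpred_eq: "rfun n f \<Longrightarrow> rfun n g \<Longrightarrow> rpred n (\<lambda>xs. f xs = g xs)"
  using rpred_and[OF rpred_le rpred_le, of n f g g f] by (simp add: antisym_conv eq_iff)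

lemma rfun_if:
  assumes "rpred n P" "rfun n f" "rfun n g"
  shows "rfun n (\<lambda>xs. if P xs then f xs else g xs)"
proof (rule rfun_cong)
  show "rfun n (\<lambda>xs. (if P xs then 1 else 0) * f xs + (1 - (if P xs then 1 else 0)) * g xs)"
    using assms unfolding rpred_def by (intro rfun_add rfun_mult rfun_diff rfun_const)
qed simp

text \<open>The quotient is the number of i < f with (i + 1) g \<le> f; the guard 0 < g reproduces
  the value 0 of division by 0.\<close>

lemma rfun_div:
  assumes "rfun n f" "rfun n g"
  shows "rfun n (\<lambda>xs. f xs div g xs)"
proof -
  have "rfun n (\<lambda>xs. \<Sum>i<f xs. if 0 < g xs \<and> Suc i * g xs \<le> f xs then 1 else 0)"
    by (intro rfun_sum rfun_if rpred_and rpred_less rpred_le rfun_const rfun_mult rfun_Suc rfun_hd assms rfun_tl[OF assms(1)] rfun_tl[OF assms(2)])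
  moreover have "(\<Sum>i<a. if 0 < b \<and> Suc i * b \<le> a then 1 else 0) = a div b" for a b :: nat
  proof (cases "b = 0")
    case False
    have "(\<Sum>i<a. if 0 < b \<and> Suc i * b \<le> a then 1 else (0::nat)) = (\<Sum>i<a. if i \<in> {..<a div b} then 1 else 0)"
    proof (rule sum.cong[OF refl])
      fix i
      have "Suc i \<le> a div b \<longleftrightarrow> Suc i * b \<le> a" using False by (intro less_eq_div_iff_mult_less_eq) simp
      then show "(if 0 < b \<and> Suc i * b \<le> a then 1 else (0::nat)) = (if i \<in> {..<a div b} then 1 else 0)"
        using False by (simp add: Suc_le_eq)
    qed
    also have "\<dots> = (\<Sum>i\<in>{..<a} \<inter> {..<a div b}. 1)" by (rule sum.inter_restrict[symmetric]) simp
    also have "{..<a} \<inter> {..<a div b} = {..<a div b}" by auto (meson div_le_dividend order.strict_trans2)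
    finally show ?thesis by simp
  qed simp
  ultimately show ?thesis by simp
qed

lemma rpred_dvd:
  assumes "rfun n f" "rfun n g"
  shows "rpred n (\<lambda>xs. f xs dvd g xs)"
proof -
  have "rpred n (\<lambda>xs. g xs = f xs * (g xs div f xs))"
    by (intro rpred_eq rfun_mult rfun_div assms)
  moreover have "b = a * (b div a) \<longleftrightarrow> a dvd b" for a b :: nat by (metis dvd_mult_div_cancel dvd_triv_left)
  ultimately show ?thesis by simp
qed

text \<open>A bounded sum acts as a search: only the common divisor with no larger common divisor
  contributes, and the inner sum being 0 expresses a bounded quantifier. If the first argument is 0
  it does not bound its divisors, hence the case distinction.\<close>

lemma rfun_gcd:
  assumes "rfun n f" "rfun n g"
  shows "rfun n (\<lambda>xs. gcd (f xs) (g xs))"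
proof -
  let ?S = "\<lambda>a b::nat. \<Sum>c<Suc a. if c dvd a \<and> c dvd b \<and> (\<Sum>e<Suc a. if e dvd a \<and> e dvd b \<and> c < e then 1 else 0) = (0::nat) then c else (0::nat)"
  note t = rfun_tl[OF assms(1)] rfun_tl[OF assms(2)]
  note tt = rfun_tl[OF t(1)] rfun_tl[OF t(2)]
  have "rfun n (\<lambda>xs. if 0 < f xs then ?S (f xs) (g xs) else g xs)"
    by (intro rfun_sum rfun_if rpred_and rpred_less rpred_dvd rpred_eq rfun_const rfun_Suc rfun_hd assms t tt rfun_tl[OF rfun_hd])
  moreover have "?S a b = gcd a b" if "0 < a" for a b
  proof -
    have in1: "(\<Sum>e<Suc a. if e dvd a \<and> e dvd b \<and> c < e then 1 else 0) = (0::nat) \<longleftrightarrow> (\<forall>e. e dvd a \<and> e dvd b \<longrightarrow> e \<le> c)" for c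
    proof -
      have "(\<Sum>e<Suc a. if e dvd a \<and> e dvd b \<and> c < e then 1 else 0) = (0::nat) \<longleftrightarrow> (\<forall>e\<in>{..<Suc a}. \<not> (e dvd a \<and> e dvd b \<and> c < e))"
        by (subst sum_eq_0_iff) (simp_all del: sum.lessThan_Suc)
      moreover have "e \<in> {..<Suc a}" if "e dvd a" for e using dvd_imp_le[OF that \<open>0 < a\<close>] by simp
      ultimately show ?thesis unfolding not_less[symmetric] by blast
    qed
    have "(c dvd a \<and> c dvd b \<and> (\<forall>e. e dvd a \<and> e dvd b \<longrightarrow> e \<le> c)) \<longleftrightarrow> c = gcd a b" for c
    proof
      assume c: "c dvd a \<and> c dvd b \<and> (\<forall>e. e dvd a \<and> e dvd b \<longrightarrow> e \<le> c)"
      then have "c dvd gcd a b" "gcd a b \<le> c" by auto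
      moreover from this(1) have "c \<le> gcd a b" by (rule dvd_imp_le) (use that in simp)
      ultimately show "c = gcd a b" by simp
    qed (use that in \<open>auto intro!: dvd_imp_le\<close>)
    then have "?S a b = (\<Sum>c<Suc a. if c = gcd a b then c else 0)" by (simp only: in1)
    also have "\<dots> = gcd a b" using that by (subst sum.delta) (auto simp: less_Suc_eq_le dvd_imp_le)
    finally show ?thesis .
  qed
  then have "(if 0 < a then ?S a b else b) = gcd a b" for a b :: nat by simp
  ultimately show ?thesis by simp
qed

lemma rfun_totient:
  assumes "rfun n f"
  shows "rfun n (\<lambda>xs. totient (f xs))"
proof -
  have "rfun n (\<lambda>xs. \<Sum>i<f xs. if gcd (Suc i) (f xs) = 1 then 1 else 0)"
    by (intro rfun_sum rfun_if rpred_eq rfun_gcd rfun_const rfun_Suc rfun_hd assms rfun_tl[OF assms])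
  moreover have "(\<Sum>i<m. if gcd (Suc i) m = 1 then 1 else 0) = totient m" for m :: nat
  proof -
    have "(\<Sum>i<m. if gcd (Suc i) m = 1 then 1 else 0) = (\<Sum>k\<in>Suc ` {..<m}. if gcd k m = 1 then 1 else (0::nat))"
      by (subst sum.reindex) auto
    also have "Suc ` {..<m} = {0<..m}" by (auto simp: image_Suc_lessThan)
    also have "(\<Sum>k\<in>{0<..m}. if gcd k m = 1 then 1 else (0::nat)) = card ({0<..m} \<inter> {k. gcd k m = 1})"
      by (simp add: sum.If_cases)
    also have "{0<..m} \<inter> {k. gcd k m = 1} = totatives m" by (auto simp: totatives_def coprime_iff_gcd_eq_1)
    finally show ?thesis by (simp add: totient_def)
  qed
  ultimately show ?thesis by simp
qed

section \<open>Computable fractions and approximation at rate 1/k\<close>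

lemma computable_nat_fun_iff: "computable_nat_fun a \<longleftrightarrow> rfun (Suc 0) (\<lambda>xs. a (hd xs))"
proof
  assume "computable_nat_fun a"
  then obtain f where f: "recursive_fn 1 f" "\<And>n. a n = f [n]" by (auto simp: computable_nat_fun_def)
  show "rfun (Suc 0) (\<lambda>xs. a (hd xs))"
    by (rule rfunI[of _ f]) (use f in \<open>auto simp: length_Suc_conv\<close>)
next
  assume "rfun (Suc 0) (\<lambda>xs. a (hd xs))"
  then obtain f where f: "recursive_fn (Suc 0) f" "\<And>xs. length xs = Suc 0 \<Longrightarrow> a (hd xs) = f xs" by (auto simp: rfun_def)
  then have "a n = f [n]" for n using f(2)[of "[n]"] by simp
  then show "computable_nat_fun a" using f(1) by (auto simp: computable_nat_fun_def)
qed

lemma rfun_computable_nat_fun: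
  assumes "computable_nat_fun a" "rfun n f"
  shows "rfun n (\<lambda>xs. a (f xs))"
  using rfun_comp1[OF assms(1)[unfolded computable_nat_fun_iff] assms(2)] by simp

lemmas rfun_intros = rfun_const rfun_Suc rfun_add rfun_mult rfun_power rfun_diff rfun_div rfun_hd

definition computable_frac :: "(nat \<Rightarrow> real) \<Rightarrow> bool" where
  "computable_frac q \<longleftrightarrow> (\<exists>a b c. computable_nat_fun a \<and> computable_nat_fun b \<and> computable_nat_fun c \<and>
     (\<forall>k. 0 < c k \<and> q k = (real (a k) - real (b k)) / real (c k)))"

text \<open>Looser than \<open>computable_real\<close>: arbitrary denominators, and an error K/(k +
  1) whose constant need not be known. This form is stable under arithmetic; the exact rate 1/(n +
  1) is restored at the end by sampling at a larger index.\<close>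

definition effectively_approx :: "real \<Rightarrow> bool" where
  "effectively_approx r \<longleftrightarrow> (\<exists>q K. computable_frac q \<and> (\<forall>k. \<bar>r - q k\<bar> \<le> K / real (Suc k)))"

lemma computable_fracI:
  assumes "rfun (Suc 0) (\<lambda>xs. a (hd xs))" "rfun (Suc 0) (\<lambda>xs. b (hd xs))" "rfun (Suc 0) (\<lambda>xs. c (hd xs))"
    and "\<And>k. 0 < c k" and "\<And>k. q k = (real (a k) - real (b k)) / real (c k)"
  shows "computable_frac q"
  unfolding computable_frac_def computable_nat_fun_iff using assms by blast

lemma computable_frac_of_nat: "computable_nat_fun a \<Longrightarrow> computable_frac (\<lambda>k. real (a k))"
  by (rule computable_fracI[of a "\<lambda>_. 0" "\<lambda>_. 1"]) (auto simp: computable_nat_fun_iff intro: rfun_intros)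

lemma computable_frac_comp:
  assumes "computable_frac q" "computable_nat_fun e"
  shows "computable_frac (\<lambda>k. q (e k))"
proof -
  obtain a b c where abc: "computable_nat_fun a" "computable_nat_fun b" "computable_nat_fun c"
    and q: "\<And>k. 0 < c k" "\<And>k. q k = (real (a k) - real (b k)) / real (c k)" using assms(1) by (auto simp: computable_frac_def)
  have e: "rfun (Suc 0) (\<lambda>xs. e (hd xs))" using assms(2) by (simp add: computable_nat_fun_iff)
  show ?thesis
    by (rule computable_fracI[of "\<lambda>k. a (e k)" "\<lambda>k. b (e k)" "\<lambda>k. c (e k)"]) (auto intro!: abc[THEN rfun_computable_nat_fun] e q)
qed

lemma computable_frac_add:
  assumes "computable_frac p" "computable_frac q"
  shows "computable_frac (\<lambda>k. p k + q k)"
proof -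
  obtain a b c where abc: "computable_nat_fun a" "computable_nat_fun b" "computable_nat_fun c"
    and p: "\<And>k. 0 < c k" "\<And>k. p k = (real (a k) - real (b k)) / real (c k)" using assms(1) by (auto simp: computable_frac_def)
  obtain a' b' c' where abc': "computable_nat_fun a'" "computable_nat_fun b'" "computable_nat_fun c'"
    and q: "\<And>k. 0 < c' k" "\<And>k. q k = (real (a' k) - real (b' k)) / real (c' k)" using assms(2) by (auto simp: computable_frac_def)
  show ?thesis
  proof (rule computable_fracI[of "\<lambda>k. a k * c' k + a' k * c k" "\<lambda>k. b k * c' k + b' k * c k" "\<lambda>k. c k * c' k"])
    fix k
    show "0 < c k * c' k" using p q by simp
    show "p k + q k = (real (a k * c' k + a' k * c k) - real (b k * c' k + b' k * c k)) / real (c k * c' k)"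
    proof -
      have "real (c k) \<noteq> 0" "real (c' k) \<noteq> 0" using p(1)[of k] q(1)[of k] by simp_all
      then have "p k + q k = ((real (a k) - real (b k)) * real (c' k) + (real (a' k) - real (b' k)) * real (c k)) / (real (c k) * real (c' k))"
        unfolding p(2) q(2) by (rule add_frac_eq)
      then show ?thesis by (simp add: algebra_simps)
    qed
  qed (intro rfun_intros abc[THEN rfun_computable_nat_fun] abc'[THEN rfun_computable_nat_fun])+
qed

lemma computable_frac_mult:
  assumes "computable_frac p" "computable_frac q"
  shows "computable_frac (\<lambda>k. p k * q k)"
proof -
  obtain a b c where abc: "computable_nat_fun a" "computable_nat_fun b" "computable_nat_fun c"
    and p: "\<And>k. 0 < c k" "\<And>k. p k = (real (a k) - real (b k)) / real (c k)" using assms(1) by (auto simp: computable_frac_def)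
  obtain a' b' c' where abc': "computable_nat_fun a'" "computable_nat_fun b'" "computable_nat_fun c'"
    and q: "\<And>k. 0 < c' k" "\<And>k. q k = (real (a' k) - real (b' k)) / real (c' k)" using assms(2) by (auto simp: computable_frac_def)
  show ?thesis
  proof (rule computable_fracI[of "\<lambda>k. a k * a' k + b k * b' k" "\<lambda>k. a k * b' k + b k * a' k" "\<lambda>k. c k * c' k"])
    fix k
    show "0 < c k * c' k" using p q by simp
    show "p k * q k = (real (a k * a' k + b k * b' k) - real (a k * b' k + b k * a' k)) / real (c k * c' k)"
      by (simp add: p(2) q(2) algebra_simps)
  qed (intro rfun_intros abc[THEN rfun_computable_nat_fun] abc'[THEN rfun_computable_nat_fun])+
qed

lemma computable_frac_uminus:
  assumes "computable_frac p"
  shows "computable_frac (\<lambda>k. - p k)"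
proof -
  obtain a b c where abc: "computable_nat_fun a" "computable_nat_fun b" "computable_nat_fun c"
    and p: "\<And>k. 0 < c k" "\<And>k. p k = (real (a k) - real (b k)) / real (c k)" using assms by (auto simp: computable_frac_def)
  show ?thesis
    by (rule computable_fracI[of b a c]) (auto intro!: rfun_intros abc[THEN rfun_computable_nat_fun] simp: p minus_divide_left)
qed

lemma effectively_approxI: "computable_frac q \<Longrightarrow> (\<And>k. \<bar>r - q k\<bar> \<le> K / real (Suc k)) \<Longrightarrow> effectively_approx r"
  by (auto simp: effectively_approx_def)

lemma effectively_approx_mult:
  assumes "effectively_approx r" "effectively_approx s" shows "effectively_approx (r * s)"
proof -
  obtain p K where p: "computable_frac p" "\<And>k. \<bar>r - p k\<bar> \<le> K / real (Suc k)"
    using assms(1) by (auto simp: effectively_approx_def)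
  obtain q M where q: "computable_frac q" "\<And>k. \<bar>s - q k\<bar> \<le> M / real (Suc k)"
    using assms(2) by (auto simp: effectively_approx_def)
  have K0: "0 \<le> K" using p(2)[of 0] by (simp add: order.trans[OF abs_ge_zero])
  have M0: "0 \<le> M" using q(2)[of 0] by (simp add: order.trans[OF abs_ge_zero])
  show ?thesis
  proof (rule effectively_approxI[OF computable_frac_mult[OF p(1) q(1)]])
    fix k
    have "M / real (Suc k) \<le> M / 1" by (rule divide_left_mono) (use M0 in auto)
    then have qb: "\<bar>q k\<bar> \<le> \<bar>s\<bar> + M" using q(2)[of k] by linarith
    have "r * s - p k * q k = r * (s - q k) + (r - p k) * q k" by (simp add: algebra_simps)
    then have "\<bar>r * s - p k * q k\<bar> \<le> \<bar>r\<bar> * \<bar>s - q k\<bar> + \<bar>r - p k\<bar> * \<bar>q k\<bar>"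
      by (simp add: abs_mult[symmetric] abs_triangle_ineq)
    also have "\<dots> \<le> \<bar>r\<bar> * (M / real (Suc k)) + (K / real (Suc k)) * (\<bar>s\<bar> + M)"
      by (intro add_mono mult_left_mono mult_mono q(2) p(2) qb) (use K0 in auto)
    also have "\<dots> = (\<bar>r\<bar> * M + K * (\<bar>s\<bar> + M)) / real (Suc k)" by (simp add: add_divide_distrib)
    finally show "\<bar>r * s - p k * q k\<bar> \<le> (\<bar>r\<bar> * M + K * (\<bar>s\<bar> + M)) / real (Suc k)" .
  qed
qed

lemma effectively_approx_power:
  assumes "effectively_approx r" shows "effectively_approx (r ^ n)"
proof (induction n)
  case 0
  have "computable_frac (\<lambda>k. real 1)"
    by (rule computable_frac_of_nat) (auto simp: computable_nat_fun_iff intro: rfun_intros)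
  then show ?case by (intro effectively_approxI[of "\<lambda>k. 1" _ 0]) auto
next
  case (Suc n)
  then show ?case using effectively_approx_mult[OF assms] by simp
qed

lemma effectively_approx_inverse_pos:
  assumes "effectively_approx r" and r: "0 < r"
  shows "effectively_approx (inverse r)"
proof -
  obtain q K where q: "computable_frac q" and K: "\<And>k. \<bar>r - q k\<bar> \<le> K / real (Suc k)"
    using assms by (auto simp: effectively_approx_def)
  have K0: "0 \<le> K" using K[of 0] by (simp add: order.trans[OF abs_ge_zero])
  \<comment> \<open>From index m on the approximations are at least r/2, so they can be inverted. As
    a fixed numeral in the algorithm, m only has to exist.\<close>
  obtain m :: nat where m: "2 * K / r \<le> real m" using real_arch_simple by blast
  obtain a b c where abc: "computable_nat_fun a" "computable_nat_fun b" "computable_nat_fun c"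
    and c: "\<And>k. 0 < c k" "\<And>k. q k = (real (a k) - real (b k)) / real (c k)" using q by (auto simp: computable_frac_def)
  have qr: "r / 2 \<le> q (k + m)" for k
  proof -
    have "2 * K / r \<le> real (Suc (k + m))" using m by simp
    then have "K / real (Suc (k + m)) \<le> r / 2" using r by (simp add: field_simps)
    then show ?thesis using K[of "k + m"] by linarith
  qed
  have ab: "b (k + m) < a (k + m)" for k
  proof -
    have "0 < q (k + m)" using qr[of k] r by linarith
    then show ?thesis using c by (simp add: zero_less_divide_iff)
  qed
  have "computable_frac (\<lambda>k. inverse (q (k + m)))"
  proof (rule computable_fracI[of "\<lambda>k. c (k + m)" "\<lambda>k. 0" "\<lambda>k. a (k + m) - b (k + m)"])
    fix k
    show "0 < a (k + m) - b (k + m)" using ab by simp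
    show "inverse (q (k + m)) = (real (c (k + m)) - real 0) / real (a (k + m) - b (k + m))"
      using ab[of k] by (simp add: c(2) of_nat_diff)
  qed (intro rfun_intros abc[THEN rfun_computable_nat_fun])+
  then show ?thesis
  proof (rule effectively_approxI)
    fix k
    have qp: "0 < q (k + m)" using qr[of k] r by linarith
    have "\<bar>inverse r - inverse (q (k + m))\<bar> = \<bar>r - q (k + m)\<bar> / (r * q (k + m))"
      using r qp by (simp add: inverse_eq_divide diff_frac_eq abs_mult abs_minus_commute)
    also have "\<dots> \<le> (K / real (Suc k)) / (r * (r / 2))"
    proof (rule frac_le)
      have "K / real (Suc (k + m)) \<le> K / real (Suc k)" using K0 by (intro divide_left_mono) auto
      then show "\<bar>r - q (k + m)\<bar> \<le> K / real (Suc k)" using K[of "k + m"] by linarith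
    qed (use r qr K0 in auto)
    also have "\<dots> = (2 * K / r\<^sup>2) / real (Suc k)" by (simp add: power2_eq_square mult_ac)
    finally show "\<bar>inverse r - inverse (q (k + m))\<bar> \<le> (2 * K / r\<^sup>2) / real (Suc k)" .
  qed
qed

text \<open>Adding half of the denominator before dividing rounds x/c to a nearest integer. Plain
  division would only guarantee an error below 1, too much for the error budget of
  \<open>computable_real\<close>.\<close>

lemma nat_div_round:
  fixes x c :: nat
  assumes "0 < c"
  shows "\<bar>real x / real c - real ((2 * x + c) div (2 * c))\<bar> \<le> 1/2"
proof -
  define d where "d = (2 * x + c) div (2 * c)"
  define r where "r = (2 * x + c) mod (2 * c)"
  have e: "2 * x + c = 2 * c * d + r" by (simp add: d_def r_def)
  have r: "r < 2 * c" using assms by (simp add: r_def)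
  have "2 * real x + real c = 2 * real c * real d + real r" using arg_cong[OF e, of real] by simp
  moreover have "real r \<le> 2 * real c" using r by linarith
  moreover have "0 \<le> real r" by simp
  ultimately have "real c * (2 * real d - 1) \<le> 2 * real x" "2 * real x \<le> real c * (2 * real d + 1)" by (simp_all add: algebra_simps)
  then have "2 * real d - 1 \<le> 2 * real x / real c" "2 * real x / real c \<le> 2 * real d + 1"
    using assms by (simp_all add: pos_le_divide_eq pos_divide_le_eq mult.commute)
  moreover have "2 * real x / real c = 2 * (real x / real c)" by simp
  ultimately show ?thesis unfolding d_def[symmetric] by linarith
qed

lemma computable_real_if_effectively_approx:
  assumes "effectively_approx r"
  shows "computable_real r"
proof -
  obtain q K where q: "computable_frac q" and K: "\<And>k. \<bar>r - q k\<bar> \<le> K / real (Suc k)"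
    using assms by (auto simp: effectively_approx_def)
  obtain m :: nat where m: "K \<le> real m" using real_arch_simple by blast
  obtain a b c where abc: "computable_nat_fun a" "computable_nat_fun b" "computable_nat_fun c"
    and c: "\<And>k. 0 < c k" "\<And>k. q k = (real (a k) - real (b k)) / real (c k)" using q by (auto simp: computable_frac_def)
  \<comment> \<open>Half of the allowed error 1/(n + 1) goes to the approximation, reached at index
    2m(n + 1) with m \<ge> K, and half to rounding the numerator. In \<open>A\<close> and
    \<open>B\<close> below, subtraction of naturals leaves at most one of the two nonzero.\<close>
  define e where "e n = 2 * m * Suc n" for n
  define A where "A n = (2 * ((a (e n) - b (e n)) * Suc n) + c (e n)) div (2 * c (e n))" for n
  define B where "B n = (2 * ((b (e n) - a (e n)) * Suc n) + c (e n)) div (2 * c (e n))" for n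
  have "computable_nat_fun A" "computable_nat_fun B"
    unfolding computable_nat_fun_iff A_def B_def e_def by (intro rfun_intros abc[THEN rfun_computable_nat_fun])+
  moreover have "\<bar>r - (real (A n) - real (B n)) / real (n + 1)\<bar> \<le> 1 / real (n + 1)" for n
  proof -
    have "K / real (Suc (e n)) \<le> (1/2) / real (Suc n)"
    proof -
      have "2 * K * real (Suc n) \<le> 2 * real m * real (Suc n)" using m by (intro mult_right_mono mult_left_mono) auto
      also have "\<dots> = real (e n)" by (simp add: e_def algebra_simps)
      also have "\<dots> \<le> real (Suc (e n))" by simp
      finally show ?thesis by (simp add: field_simps)
    qed
    then have rq: "\<bar>r - q (e n)\<bar> \<le> (1/2) / real (Suc n)" using K[of "e n"] by linarith
    have "\<bar>q (e n) * real (Suc n) - (real (A n) - real (B n))\<bar> \<le> 1/2"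
    proof (cases "b (e n) \<le> a (e n)")
      case True
      then have "B n = 0" using c(1)[of "e n"] by (simp add: B_def)
      moreover have "q (e n) * real (Suc n) = real ((a (e n) - b (e n)) * Suc n) / real (c (e n))"
        unfolding c(2) of_nat_mult of_nat_diff[OF True] by simp
      ultimately show ?thesis using nat_div_round[OF c(1), of "(a (e n) - b (e n)) * Suc n" "e n"] by (simp add: A_def)
    next
      case False
      then have "A n = 0" using c(1)[of "e n"] by (simp add: A_def)
      moreover have "q (e n) * real (Suc n) = - (real ((b (e n) - a (e n)) * Suc n) / real (c (e n)))"
      proof -
        have "a (e n) \<le> b (e n)" using False by simp
        then show ?thesis
          unfolding c(2) of_nat_mult by (simp only: of_nat_diff minus_divide_left times_divide_eq_left) (simp add: algebra_simps)
      qed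
      moreover have "\<bar>real ((b (e n) - a (e n)) * Suc n) / real (c (e n)) - real (B n)\<bar> \<le> 1/2"
        unfolding B_def by (rule nat_div_round[OF c(1)])
      ultimately show ?thesis by linarith
    qed
    then have "\<bar>q (e n) * real (Suc n) - (real (A n) - real (B n))\<bar> / real (Suc n) \<le> (1/2) / real (Suc n)"
      by (rule divide_right_mono) simp
    moreover have "\<bar>q (e n) * real (Suc n) - (real (A n) - real (B n))\<bar> / real (Suc n)
        = \<bar>q (e n) - (real (A n) - real (B n)) / real (Suc n)\<bar>"
    proof -
      have "q (e n) - (real (A n) - real (B n)) / real (Suc n) = (q (e n) * real (Suc n) - (real (A n) - real (B n))) / real (Suc n)"
        by (simp add: diff_divide_distrib del: of_nat_Suc)
      then show ?thesis by (simp del: of_nat_Suc)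
    qed
    moreover have "(1/2) / real (Suc n) + (1/2) / real (Suc n) = 1 / real (n + 1)" by (simp add: field_simps)
    moreover have "(real (A n) - real (B n)) / real (n + 1) = (real (A n) - real (B n)) / real (Suc n)" by simp
    ultimately show ?thesis using rq by linarith
  qed
  ultimately show ?thesis unfolding computable_real_def by blast
qed

lemma poly_le_power:
  fixes p :: "real poly"
  assumes "degree p \<le> d"
  shows "\<exists>C. \<forall>x\<ge>1. \<bar>poly p x\<bar> \<le> C * x ^ d"
proof (intro exI allI impI)
  fix x :: real assume x: "1 \<le> x"
  have "\<bar>poly p x\<bar> \<le> (\<Sum>i\<le>degree p. \<bar>coeff p i * x ^ i\<bar>)" unfolding poly_altdef by (rule sum_abs)
  also have "\<dots> \<le> (\<Sum>i\<le>degree p. \<bar>coeff p i\<bar> * x ^ d)"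
  proof (rule sum_mono)
    fix i assume "i \<in> {..degree p}"
    then have "x ^ i \<le> x ^ d" using assms x by (intro power_increasing) auto
    then show "\<bar>coeff p i * x ^ i\<bar> \<le> \<bar>coeff p i\<bar> * x ^ d" using x by (simp add: abs_mult mult_left_mono)
  qed
  finally show "\<bar>poly p x\<bar> \<le> (\<Sum>i\<le>degree p. \<bar>coeff p i\<bar>) * x ^ d" by (simp add: sum_distrib_right)
qed

text \<open>The leading coefficient is the limit of \<open>q k / (k + 1)\<^sup>d\<close>. It is then subtracted from \<open>q\<close>, for which it
  must be known to precision \<open>(k + 1)\<^bsup>- d - 1\<^esup>\<close>.\<close>

lemma effectively_approx_coeff:
  fixes p :: "real poly"
  assumes "degree p \<le> d" "computable_frac q" "\<And>k. \<bar>q k - poly p (real (Suc k))\<bar> \<le> K / real (Suc k)"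
  shows "effectively_approx (coeff p i)"
  using assms
proof (induction d arbitrary: p q K i)
  case 0
  then obtain c where p: "p = [:c:]" using degree_eq_zeroE[of p] by auto
  have "effectively_approx c"
    by (rule effectively_approxI[OF 0(2), of _ K]) (use 0(3) p in \<open>simp add: abs_minus_commute\<close>)
  moreover have "effectively_approx 0"
  proof -
    have "computable_frac (\<lambda>k. real 0)"
      by (rule computable_frac_of_nat) (auto simp: computable_nat_fun_iff intro: rfun_intros)
    then show ?thesis by (intro effectively_approxI[of "\<lambda>k. 0" _ 0]) auto
  qed
  ultimately show ?case by (simp add: p coeff_pCons split: nat.split)
next
  case (Suc d)
  define c where "c = coeff p (Suc d)"
  define p' where "p' = p - monom c (Suc d)"
  have deg': "degree p' \<le> d"
  proof (rule degree_le, intro allI impI)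
    fix j assume "d < j"
    then show "coeff p' j = 0" using Suc.prems(1) by (cases "j = Suc d") (auto simp: p'_def c_def coeff_eq_0)
  qed
  have pp: "poly p x = poly p' x + c * x ^ Suc d" for x by (simp add: p'_def poly_monom)
  obtain C where C: "\<And>x. 1 \<le> x \<Longrightarrow> \<bar>poly p' x\<bar> \<le> C * x ^ d" using poly_le_power[OF deg'] by blast
  have K0: "0 \<le> K" using Suc.prems(3)[of 0] by (simp add: order.trans[OF abs_ge_zero])
  have inv: "computable_frac (\<lambda>k. 1 / real (Suc k ^ Suc d))"
    by (rule computable_fracI[of "\<lambda>_. 1" "\<lambda>_. 0" "\<lambda>k. Suc k ^ Suc d"]) (auto intro!: rfun_intros simp del: power_Suc)
  have c: "effectively_approx c"
  proof (rule effectively_approxI[OF computable_frac_mult[OF Suc.prems(2) inv]])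
    fix k
    define x where "x = real (Suc k)"
    have x: "1 \<le> x" by (simp add: x_def)
    have rp: "real (Suc k ^ Suc d) = x ^ Suc d" by (simp only: x_def of_nat_power)
    have "c - q k * (1 / real (Suc k ^ Suc d)) = - ((q k - poly p x) + poly p' x) / x ^ Suc d"
      unfolding rp pp using x by (simp add: field_simps)
    then have "\<bar>c - q k * (1 / real (Suc k ^ Suc d))\<bar> = \<bar>(q k - poly p x) + poly p' x\<bar> / x ^ Suc d"
      using x by (simp add: abs_divide abs_mult power_abs)
    also have "\<dots> \<le> (K + C * x ^ d) / x ^ Suc d"
    proof (rule divide_right_mono)
      have "K / x \<le> K / 1" by (rule divide_left_mono) (use K0 x in auto)
      then show "\<bar>(q k - poly p x) + poly p' x\<bar> \<le> K + C * x ^ d"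
        using Suc.prems(3)[of k] C[OF x] by (simp only: x_def)
    qed (use x in simp)
    also have "\<dots> \<le> (K * x ^ d + C * x ^ d) / x ^ Suc d"
    proof (intro divide_right_mono add_right_mono)
      have "K * 1 \<le> K * x ^ d" using K0 x by (intro mult_left_mono) auto
      then show "K \<le> K * x ^ d" by simp
    qed (use x in auto)
    also have "\<dots> = (K + C) / x" using x by (simp add: field_simps)
    finally show "\<bar>c - q k * (1 / real (Suc k ^ Suc d))\<bar> \<le> (K + C) / real (Suc k)" by (simp only: x_def)
  qed
  obtain r M where r: "computable_frac r" and M: "\<And>k. \<bar>c - r k\<bar> \<le> M / real (Suc k)"
    using c by (auto simp: effectively_approx_def)
  have M0: "0 \<le> M" using M[of 0] by (simp add: order.trans[OF abs_ge_zero])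
  \<comment> \<open>The error M/e(k) of the leading coefficient is multiplied by (k + 1)^(d + 1) and
    still leaves M/(k + 1).\<close>
  define e where "e k = Suc k ^ Suc (Suc d)" for k
  have "computable_frac (\<lambda>k. r (e k))"
    by (rule computable_frac_comp[OF r]) (unfold computable_nat_fun_iff e_def, intro rfun_intros)
  moreover have "computable_frac (\<lambda>k. real (Suc k ^ Suc d))"
    by (rule computable_frac_of_nat) (unfold computable_nat_fun_iff, intro rfun_intros)
  ultimately have q': "computable_frac (\<lambda>k. q k + - (r (e k) * real (Suc k ^ Suc d)))"
    by (intro computable_frac_add computable_frac_uminus computable_frac_mult Suc.prems(2))
  have p'_approx: "effectively_approx (coeff p' j)" for j
  proof (rule Suc.IH[OF deg' q'])
    fix k
    define x where "x = real (Suc k)"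
    have x: "1 \<le> x" by (simp add: x_def)
    have "q k + - (r (e k) * real (Suc k ^ Suc d)) - poly p' x = (q k - poly p x) + (c - r (e k)) * x ^ Suc d"
      by (simp only: pp of_nat_power x_def[symmetric]) (simp add: algebra_simps)
    then have "\<bar>q k + - (r (e k) * real (Suc k ^ Suc d)) - poly p' x\<bar> \<le> \<bar>q k - poly p x\<bar> + \<bar>c - r (e k)\<bar> * x ^ Suc d"
      using x abs_triangle_ineq[of "q k - poly p x" "(c - r (e k)) * x ^ Suc d"] by (simp only: abs_mult) simp
    also have "\<dots> \<le> K / x + (M / x ^ Suc (Suc d)) * x ^ Suc d"
    proof (intro add_mono mult_right_mono)
      show "\<bar>q k - poly p x\<bar> \<le> K / x" using Suc.prems(3)[of k] by (simp only: x_def)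
      have "M / real (Suc (e k)) \<le> M / real (e k)" 
      proof (rule divide_left_mono)
        have "0 < e k" by (simp add: e_def)
        then show "0 < real (Suc (e k)) * real (e k)" by simp
      qed (use M0 in auto)
      also have "real (e k) = x ^ Suc (Suc d)" by (simp only: e_def x_def of_nat_power)
      finally show "\<bar>c - r (e k)\<bar> \<le> M / x ^ Suc (Suc d)" using M[of "e k"] by linarith
    qed (use x in simp)
    also have "\<dots> = (K + M) / x" using x by (simp add: field_simps)
    finally show "\<bar>q k + - (r (e k) * real (Suc k ^ Suc d)) - poly p' (real (Suc k))\<bar> \<le> (K + M) / real (Suc k)"
      by (simp only: x_def)
  qed
  show ?case
  proof (cases "i = Suc d")
    case True
    then show ?thesis using c by (simp add: c_def)
  next
    case False
    then have "coeff p i = coeff p' i" by (simp add: p'_def)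
    then show ?thesis using p'_approx by simp
  qed
qed

section \<open>Rational approximation of logarithms and of the hyperbola sums\<close>

lemma ln_approx_by_quotients:
  assumes c: "0 < c" and K: "0 < K"
  shows "\<bar>ln (real (c + n) / real c) - real (\<Sum>j<n. K div (c + j)) / real K\<bar> \<le> 1 / real c - 1 / real (c + n) + real n / real K"
proof (induction n)
  case 0
  show ?case using c by simp
next
  case (Suc n)
  define y where "y = real (c + n)"
  have y: "0 < y" using c by (simp add: y_def)
  define t where "t = real (K div (c + n)) / real K"
  have y1: "real (c + Suc n) = y + 1" by (simp add: y_def)
  \<comment> \<open>One step adds ln((y + 1)/y), which lies between 1/(y + 1) and 1/y, and compares
    it with 1/y rounded down to a multiple of 1/K. The first gap telescopes to 1/c - 1/(c + n), the
    second costs 1/K per step.\<close>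
  have "ln ((y + 1) / real c) = ln ((y + 1) / y) + ln (y / real c)"
    using y c by (simp add: ln_divide_pos)
  moreover have "ln ((y + 1) / y) \<le> 1 / y"
    using ln_add_one_self_le_self[of "1 / y"] y by (simp add: field_simps)
  moreover have "1 / (y + 1) \<le> ln ((y + 1) / y)"
  proof -
    have "ln (y / (y + 1)) \<le> y / (y + 1) - 1" using y by (intro ln_le_minus_one) simp
    also have "\<dots> = - (1 / (y + 1))" using y by (simp add: field_simps)
    finally show ?thesis using y by (simp add: ln_divide_pos)
  qed
  moreover have "t \<le> 1 / y"
  proof -
    have "t \<le> (real K / y) / real K"
      unfolding t_def y_def by (intro divide_right_mono of_nat_div_le_of_nat) simp
    then show ?thesis using K by simp
  qed
  moreover have "1 / y \<le> t + 1 / real K"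
  proof -
    have "K \<le> (K div (c + n) + 1) * (c + n)" using c
      by (metis add_gr_0 dividend_less_div_times less_imp_le add.commute mult_Suc plus_1_eq_Suc)
    then have "real K \<le> (real (K div (c + n)) + 1) * y"
      unfolding y_def by (metis of_nat_1 of_nat_add of_nat_le_iff of_nat_mult)
    then have "real K / y \<le> real (K div (c + n)) + 1" using y by (simp add: pos_divide_le_eq)
    then have "(real K / y) / real K \<le> (real (K div (c + n)) + 1) / real K" by (rule divide_right_mono) simp
    then show ?thesis using K by (simp add: t_def add_divide_distrib)
  qed
  moreover have "1 / (y + 1) \<le> 1 / y" using y by (intro divide_left_mono) auto
  moreover have "0 \<le> 1 / real K" by simp
  moreover have "real (\<Sum>j<Suc n. K div (c + j)) / real K = real (\<Sum>j<n. K div (c + j)) / real K + t"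
    by (simp add: t_def add_divide_distrib)
  moreover have "real (Suc n) / real K = real n / real K + 1 / real K" by (simp add: add_divide_distrib)
  ultimately show ?case using Suc.IH unfolding y1 y_def[symmetric] by linarith
qed

text \<open>Writing a/b as aM/(bM) refines the harmonic sum: its own error drops from 1/b to 1/(bM),
  at the price of more terms to round.\<close>

lemma ln_quotient_approx:
  assumes b: "0 < b" "b \<le> a" and M: "0 < M" and K: "0 < K"
  shows "\<bar>ln (real a / real b) - real (\<Sum>j<(a - b) * M. K div (b * M + j)) / real K\<bar> \<le> 1 / real M + real (a * M) / real K"
proof -
  have sum: "b * M + (a - b) * M = a * M" using b by (simp add: add_mult_distrib[symmetric])
  have "\<bar>ln (real (a * M) / real (b * M)) - real (\<Sum>j<(a - b) * M. K div (b * M + j)) / real K\<bar>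
    \<le> 1 / real (b * M) - 1 / real (a * M) + real ((a - b) * M) / real K"
    using ln_approx_by_quotients[of "b * M" K "(a - b) * M"] b M K by (simp only: sum) simp
  moreover have "real (a * M) / real (b * M) = real a / real b" using M by simp
  moreover have "1 / real (b * M) \<le> 1 / real M" using b M by (intro divide_left_mono) (auto simp: Suc_le_eq)
  moreover have "0 \<le> 1 / real (a * M)" by simp
  moreover have "real ((a - b) * M) / real K \<le> real (a * M) / real K" by (intro divide_right_mono) (auto simp: mult_le_mono1 simp del: of_nat_mult)
  ultimately show ?thesis by (simp only:)
qed

lemma effectively_approx_ln2: "effectively_approx (ln 2)"
proof -
  have "computable_frac (\<lambda>k. real (\<Sum>j<(2 - 1) * Suc k. (Suc k)\<^sup>2 div (1 * Suc k + j)) / real ((Suc k)\<^sup>2))"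
    by (rule computable_fracI[of "\<lambda>k. \<Sum>j<(2 - 1) * Suc k. (Suc k)\<^sup>2 div (1 * Suc k + j)" "\<lambda>_. 0" "\<lambda>k. (Suc k)\<^sup>2"])
      (intro rfun_intros rfun_sum rfun_tl[OF rfun_hd] | simp)+
  then show ?thesis
  proof (rule effectively_approxI)
    fix k
    have "\<bar>ln (real 2 / real 1) - real (\<Sum>j<(2 - 1) * Suc k. (Suc k)\<^sup>2 div (1 * Suc k + j)) / real ((Suc k)\<^sup>2)\<bar>
      \<le> 1 / real (Suc k) + real (2 * Suc k) / real ((Suc k)\<^sup>2)"
      by (rule ln_quotient_approx) auto
    also have "real (2 * Suc k) / real ((Suc k)\<^sup>2) = 2 / real (Suc k)" 
      by (simp only: of_nat_mult of_nat_power power2_eq_square of_nat_numeral) (simp del: of_nat_Suc)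
    also have "1 / real (Suc k) + 2 / real (Suc k) = 3 / real (Suc k)" by (simp add: add_divide_distrib[symmetric] del: of_nat_Suc)
    finally show "\<bar>ln 2 - real (\<Sum>j<(2 - 1) * Suc k. (Suc k)\<^sup>2 div (1 * Suc k + j)) / real ((Suc k)\<^sup>2)\<bar> \<le> 3 / real (Suc k)"
      by (simp only: of_nat_numeral of_nat_1 div_by_1)
  qed
qed

definition divisor_pair_sum :: "(nat \<Rightarrow> nat) \<Rightarrow> nat \<Rightarrow> nat \<Rightarrow> nat" where
  "divisor_pair_sum w m n = (\<Sum>a<Suc m. \<Sum>b<Suc n. if a dvd m \<and> b dvd n then w (gcd a b) else 0)"

text \<open>Divided by \<open>K\<close>, this approximates the logarithmic sum at \<open>N\<close>: \<open>ln (N / mn)\<close> is replaced by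
  the sum of \<open>1/j\<close> over \<open>mnM \<le> j < NM\<close>, each term rounded down to a multiple of \<open>1/K\<close>.\<close>

definition approx_num :: "(nat \<Rightarrow> nat) \<Rightarrow> nat \<Rightarrow> nat \<Rightarrow> nat \<Rightarrow> nat" where
  "approx_num w N M K = (\<Sum>m<Suc N. \<Sum>n<Suc N. if 0 < m \<and> 0 < n \<and> m * n \<le> N
     then divisor_pair_sum w m n * (\<Sum>j<(N - m * n) * M. K div (m * n * M + j)) else 0)"

lemma divisor_pair_sum_eq:
  assumes "0 < m" "0 < n"
  shows "divisor_pair_sum w m n = (\<Sum>a | a dvd m. \<Sum>b | b dvd n. w (gcd a b))"
proof -
  have dm: "{a. a dvd k} = {a \<in> {..<Suc k}. a dvd k}" if "0 < k" for k :: nat using that by (auto dest: dvd_imp_le)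
  have "(\<Sum>a | a dvd m. \<Sum>b | b dvd n. w (gcd a b)) = (\<Sum>a<Suc m. if a dvd m then \<Sum>b<Suc n. if b dvd n then w (gcd a b) else 0 else 0)"
    unfolding dm[OF assms(1)] dm[OF assms(2)] by (simp only: sum.inter_filter finite_lessThan)
  also have "\<dots> = divisor_pair_sum w m n"
    unfolding divisor_pair_sum_def by (intro sum.cong refl) (auto intro: sum.cong)
  finally show ?thesis by simp
qed

lemma divisor_pair_sum_le:
  assumes w: "\<And>g. w g \<le> g" and m: "0 < m" "m \<le> N" "n \<le> N"
  shows "divisor_pair_sum w m n \<le> 4 * N ^ 3"
proof -
  have N: "1 \<le> N" using m by simp
  have "divisor_pair_sum w m n \<le> (\<Sum>a<Suc m. \<Sum>b<Suc n. N)"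
    unfolding divisor_pair_sum_def
  proof (intro sum_mono)
    fix a b
    show "(if a dvd m \<and> b dvd n then w (gcd a b) else 0) \<le> N"
    proof (cases "a dvd m")
      case True
      then have a: "0 < a" "a \<le> m" using m by (auto dest: dvd_imp_le intro: gr0I)
      have "w (gcd a b) \<le> gcd a b" by (rule w)
      also have "gcd a b \<le> a" using a by (intro dvd_imp_le) auto
      finally show ?thesis using a m by simp
    qed simp
  qed
  also have "\<dots> = Suc m * (Suc n * N)" by simp
  also have "\<dots> \<le> (2 * N) * ((2 * N) * N)" using m N by (intro mult_le_mono) auto
  also have "\<dots> = 4 * N ^ 3" by (simp add: power3_eq_cube)
  finally show ?thesis .
qed

lemma hyperbola_region_of_nat:
  "hyperbola_region (real N) = {p \<in> {..<Suc N} \<times> {..<Suc N}. 0 < fst p \<and> 0 < snd p \<and> fst p * snd p \<le> N}"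
proof (rule Set.set_eqI)
  fix p :: "nat \<times> nat"
  obtain m n where p: "p = (m, n)" by (cases p)
  have "m < Suc N \<and> n < Suc N" if "0 < m" "0 < n" "m * n \<le> N"
  proof -
    have "m * 1 \<le> m * n" "1 * n \<le> m * n" using that by (intro mult_le_mono; simp)+
    then show ?thesis using that(3) by (intro conjI; linarith)
  qed
  moreover have "p \<in> hyperbola_region (real N) \<longleftrightarrow> 0 < m \<and> 0 < n \<and> m * n \<le> N"
    by (simp only: p hyperbola_region_def mem_Collect_eq prod.case of_nat_le_iff One_nat_def Suc_le_eq)
  ultimately show "p \<in> hyperbola_region (real N) \<longleftrightarrow>
      p \<in> {p \<in> {..<Suc N} \<times> {..<Suc N}. 0 < fst p \<and> 0 < snd p \<and> fst p * snd p \<le> N}"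
    by (simp only: p mem_Collect_eq mem_Sigma_iff lessThan_iff fst_conv snd_conv) blast
qed

text \<open>There are (N + 1)^2 \<le> 4 N^2 pairs, each with a divisor sum of at most 4 N^3 and a
  logarithm that is off by at most the bound of \<open>ln_quotient_approx\<close>.\<close>

lemma approx_num_error:
  assumes w: "\<And>g. w g \<le> g" and N: "0 < N" and M: "0 < M" and K: "0 < K"
  shows "\<bar>gsum (\<lambda>g. real (w g)) (real N) - real (approx_num w N M K) / real K\<bar>
    \<le> 16 * real N ^ 5 * (1 / real M + real (N * M) / real K)"
proof -
  define err where "err = 1 / real M + real (N * M) / real K"
  have err0: "0 \<le> err" by (simp add: err_def)
  let ?in = "\<lambda>m n. 0 < m \<and> 0 < n \<and> m * n \<le> N"
  let ?f = "\<lambda>m n. real (divisor_pair_sum w m n) * ln (real N / real (m * n))"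
  let ?g = "\<lambda>m n. real (divisor_pair_sum w m n * (\<Sum>j<(N - m * n) * M. K div (m * n * M + j))) / real K"
  have "gsum (\<lambda>g. real (w g)) (real N) = (\<Sum>(m, n)\<in>hyperbola_region (real N). ?f m n)"
    unfolding hyperbola_sum_eq_gsum[symmetric]
  proof (rule sum.cong[OF refl])
    fix p assume p: "p \<in> hyperbola_region (real N)"
    obtain m n where mn: "p = (m, n)" by (cases p)
    then have "0 < m" "0 < n" using p by (auto simp: hyperbola_region_def)
    then show "(case p of (m, n) \<Rightarrow> (\<Sum>a | a dvd m. \<Sum>b | b dvd n. real (w (gcd a b))) * ln (real N / real (m * n))) = (case p of (m, n) \<Rightarrow> ?f m n)"
      by (simp only: mn prod.case divisor_pair_sum_eq of_nat_sum)
  qed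
  also have "\<dots> = (\<Sum>(m, n)\<in>{p \<in> {..<Suc N} \<times> {..<Suc N}. ?in (fst p) (snd p)}. ?f m n)"
    unfolding hyperbola_region_of_nat ..
  also have "\<dots> = (\<Sum>p\<in>{..<Suc N} \<times> {..<Suc N}. if ?in (fst p) (snd p) then ?f (fst p) (snd p) else 0)"
    unfolding case_prod_beta' by (rule sum.inter_filter) simp
  also have "\<dots> = (\<Sum>m<Suc N. \<Sum>n<Suc N. if ?in m n then ?f m n else 0)"
    by (simp only: sum.cartesian_product case_prod_beta')
  finally have D: "gsum (\<lambda>g. real (w g)) (real N) = (\<Sum>m<Suc N. \<Sum>n<Suc N. if ?in m n then ?f m n else 0)" .
  have A: "real (approx_num w N M K) / real K = (\<Sum>m<Suc N. \<Sum>n<Suc N. if ?in m n then ?g m n else 0)"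
    unfolding approx_num_def of_nat_sum sum_divide_distrib by (intro sum.cong refl) simp
  have "\<bar>gsum (\<lambda>g. real (w g)) (real N) - real (approx_num w N M K) / real K\<bar>
     \<le> (\<Sum>m<Suc N. \<Sum>n<Suc N. 4 * real N ^ 3 * err)"
    unfolding D A sum_subtractf[symmetric]
  proof (rule order.trans[OF sum_abs], rule sum_mono, rule order.trans[OF sum_abs], rule sum_mono)
    fix m n assume mn: "m \<in> {..<Suc N}" "n \<in> {..<Suc N}"
    show "\<bar>(if ?in m n then ?f m n else 0) - (if ?in m n then ?g m n else 0)\<bar> \<le> 4 * real N ^ 3 * err"
    proof (cases "?in m n")
      case True
      have "?f m n - ?g m n = real (divisor_pair_sum w m n) * (ln (real N / real (m * n)) - real (\<Sum>j<(N - m * n) * M. K div (m * n * M + j)) / real K)"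
        by (simp add: right_diff_distrib)
      then have "\<bar>?f m n - ?g m n\<bar> = real (divisor_pair_sum w m n) * \<bar>ln (real N / real (m * n)) - real (\<Sum>j<(N - m * n) * M. K div (m * n * M + j)) / real K\<bar>"
        by (simp only: abs_mult abs_of_nat)
      also have "\<dots> \<le> real (4 * N ^ 3) * err"
      proof (rule mult_mono)
        show "real (divisor_pair_sum w m n) \<le> real (4 * N ^ 3)"
          using divisor_pair_sum_le[OF w, of m N n] mn True by (simp only: of_nat_le_iff) simp
        show "\<bar>ln (real N / real (m * n)) - real (\<Sum>j<(N - m * n) * M. K div (m * n * M + j)) / real K\<bar> \<le> err"
          unfolding err_def using True M K by (intro ln_quotient_approx) auto
      qed auto
      finally show ?thesis using True by simp
    next
      case False
      have "0 \<le> 4 * real N ^ 3 * err" using err0 by simp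
      then show ?thesis by (simp only: False if_False diff_self abs_zero)
    qed
  qed
  also have "\<dots> = (real (Suc N))\<^sup>2 * (4 * real N ^ 3 * err)" by (simp add: power2_eq_square)
  also have "\<dots> \<le> (2 * real N)\<^sup>2 * (4 * real N ^ 3 * err)"
    using N err0 by (intro mult_right_mono power_mono) auto
  also have "\<dots> = 16 * real N ^ 5 * err" by (simp add: power2_eq_square eval_nat_numeral)
  finally show ?thesis by (simp only: err_def)
qed

lemma rfun_divisor_pair_sum:
  assumes w: "\<And>n f. rfun n f \<Longrightarrow> rfun n (\<lambda>xs. w (f xs))" and fg: "rfun n f" "rfun n g"
  shows "rfun n (\<lambda>xs. divisor_pair_sum w (f xs) (g xs))"
  unfolding divisor_pair_sum_def
  by (intro rfun_sum rfun_if rpred_and rpred_dvd w rfun_gcd rfun_intros rfun_tl[OF rfun_hd] fg fg[THEN rfun_tl] fg[THEN rfun_tl, THEN rfun_tl])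

lemma rfun_approx_num:
  assumes w: "\<And>n f. rfun n f \<Longrightarrow> rfun n (\<lambda>xs. w (f xs))" and f: "rfun n f" "rfun n g" "rfun n h"
  shows "rfun n (\<lambda>xs. approx_num w (f xs) (g xs) (h xs))"
  unfolding approx_num_def
  by (intro rfun_sum rfun_if rpred_and rpred_less rpred_le rfun_divisor_pair_sum[OF w] rfun_intros
      rfun_tl[OF rfun_hd] rfun_tl[OF rfun_tl[OF rfun_hd]] f f[THEN rfun_tl] f[THEN rfun_tl, THEN rfun_tl]
      f[THEN rfun_tl, THEN rfun_tl, THEN rfun_tl])

text \<open>At \<open>x = 2\<^bsup>k + 1\<^esup>\<close> the main term is a polynomial in \<open>k + 1\<close> with coefficients scaled by powers of \<open>ln 2\<close>.\<close>

lemma computable_real_coeff: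
  fixes P :: "real poly"
  assumes w: "\<And>n f. rfun n f \<Longrightarrow> rfun n (\<lambda>xs. w (f xs))" and w_le: "\<And>g. w g \<le> g"
    and D: "\<And>x. 1 \<le> x \<Longrightarrow> \<bar>gsum (\<lambda>g. real (w g)) x - x * poly P (ln x)\<bar> \<le> C * (sqrt x * (1 + ln x))"
  shows "computable_real (coeff P i)"
proof -
  define N :: "nat \<Rightarrow> nat" where "N k = 2 ^ Suc k" for k
  \<comment> \<open>With M = N^6 and K = N^13 the error 16 N^5 (1/M + N M/K) of
    \<open>approx_num_error\<close> becomes 32/N, even before the division by x = N.\<close>
  define q where "q k = real (approx_num w (N k) (N k ^ 6) (N k ^ 13)) / real (N k ^ 13 * N k)" for k
  define p where "p = pcompose P [:0, ln 2:]"
  have q: "computable_frac q"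
  proof (rule computable_fracI[of "\<lambda>k. approx_num w (N k) (N k ^ 6) (N k ^ 13)" "\<lambda>_. 0" "\<lambda>k. N k ^ 13 * N k"])
    show "rfun (Suc 0) (\<lambda>xs. approx_num w (N (hd xs)) (N (hd xs) ^ 6) (N (hd xs) ^ 13))"
      unfolding N_def by (intro rfun_approx_num[OF w] rfun_intros)
    show "rfun (Suc 0) (\<lambda>xs. N (hd xs) ^ 13 * N (hd xs))" unfolding N_def by (intro rfun_intros)
  qed (auto simp: q_def N_def intro: rfun_intros)
  \<comment> \<open>At x = 2^(k + 1) the analytic error divided by x is of order (1 + ln x)/sqrt x,
    exponentially small in k; here it is only brought below a multiple of 1/(k + 1).\<close>
  have "(\<lambda>k. (1 + real (Suc k) * ln 2) / sqrt (2 ^ Suc k) * real (Suc k)) \<longlonglongrightarrow> 0" by real_asymp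
  then have "Bseq (\<lambda>k. (1 + real (Suc k) * ln 2) / sqrt (2 ^ Suc k) * real (Suc k))"
    by (intro convergent_imp_Bseq) (auto simp: convergent_def)
  then obtain B where B: "\<And>k. norm ((1 + real (Suc k) * ln 2) / sqrt (2 ^ Suc k) * real (Suc k)) \<le> B"
    unfolding Bseq_def by blast
  have "\<bar>q k - poly p (real (Suc k))\<bar> \<le> (32 + \<bar>C\<bar> * B) / real (Suc k)" for k
  proof -
    define x where "x = real (N k)"
    define Dx where "Dx = gsum (\<lambda>g. real (w g)) x"
    have N1: "0 < N k" by (simp add: N_def)
    have x1: "1 \<le> x" using N1 by (simp add: x_def Suc_le_eq)
    have lnx: "ln x = real (Suc k) * ln 2" by (simp add: x_def N_def ln_realpow del: power_Suc)
    have kx: "real (Suc k) \<le> x"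
    proof -
      have "Suc k < 2 ^ Suc k" by (rule less_exp)
      then show ?thesis by (simp only: x_def N_def of_nat_le_iff less_imp_le)
    qed
    have "\<bar>Dx - real (approx_num w (N k) (N k ^ 6) (N k ^ 13)) / real (N k ^ 13)\<bar>
      \<le> 16 * real (N k) ^ 5 * (1 / real (N k ^ 6) + real (N k * N k ^ 6) / real (N k ^ 13))"
      unfolding Dx_def x_def by (rule approx_num_error[OF w_le]) (use N1 in auto)
    also have "\<dots> = 16 * x ^ 5 * (1 / x ^ 6 + x ^ 7 / x ^ 13)"
      by (simp only: x_def of_nat_mult of_nat_power power_Suc[symmetric]) simp
    also have "x ^ 7 / x ^ 13 = 1 / x ^ 6" using x1 by (simp add: field_simps flip: power_add)
    also have "16 * x ^ 5 * (1 / x ^ 6 + 1 / x ^ 6) = 32 / x" using x1 by (simp add: field_simps eval_nat_numeral)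
    finally have e1: "\<bar>Dx - real (approx_num w (N k) (N k ^ 6) (N k ^ 13)) / real (N k ^ 13)\<bar> \<le> 32 / x" .
    have "\<bar>Dx / x - q k\<bar> = \<bar>Dx - real (approx_num w (N k) (N k ^ 6) (N k ^ 13)) / real (N k ^ 13)\<bar> / x"
    proof -
      have "Dx / x - q k = (Dx - real (approx_num w (N k) (N k ^ 6) (N k ^ 13)) / real (N k ^ 13)) / x"
        by (simp add: q_def x_def diff_divide_distrib)
      then show ?thesis using x1 by (simp add: abs_divide)
    qed
    also have "\<dots> \<le> (32 / x) / 1" using x1 by (intro frac_le e1) auto
    also have "\<dots> \<le> 32 / real (Suc k)" using kx x1 by (simp add: divide_left_mono)
    finally have h1: "\<bar>Dx / x - q k\<bar> \<le> 32 / real (Suc k)" .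
    have "Dx / x - poly P (ln x) = (Dx - x * poly P (ln x)) / x" using x1 by (simp add: field_simps)
    then have "\<bar>Dx / x - poly P (ln x)\<bar> = \<bar>Dx - x * poly P (ln x)\<bar> / x" using x1 by (simp add: abs_divide)
    also have "\<dots> \<le> \<bar>C\<bar> * (sqrt x * (1 + ln x)) / x"
    proof (intro divide_right_mono)
      have "C * (sqrt x * (1 + ln x)) \<le> \<bar>C\<bar> * (sqrt x * (1 + ln x))" using x1 by (intro mult_right_mono) auto
      then show "\<bar>Dx - x * poly P (ln x)\<bar> \<le> \<bar>C\<bar> * (sqrt x * (1 + ln x))" using D[OF x1] by (simp add: Dx_def)
    qed (use x1 in simp)
    also have "\<dots> = \<bar>C\<bar> * ((1 + ln x) * (sqrt x / x))" by simp
    also have "sqrt x / x = 1 / sqrt x"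
    proof -
      have "0 < sqrt x" "sqrt x * sqrt x = x" using x1 by simp_all
      then show ?thesis by (metis nonzero_divide_mult_cancel_left less_irrefl)
    qed
    also have "\<bar>C\<bar> * ((1 + ln x) * (1 / sqrt x)) = \<bar>C\<bar> * ((1 + ln x) / sqrt x)" by simp
    also have "\<dots> \<le> \<bar>C\<bar> * (B / real (Suc k))"
    proof (rule mult_left_mono)
      have "(1 + ln x) / sqrt x * real (Suc k) \<le> B"
        using B[of k] unfolding lnx by (simp add: x_def N_def abs_le_iff del: power_Suc of_nat_Suc)
      then show "(1 + ln x) / sqrt x \<le> B / real (Suc k)" by (simp add: pos_le_divide_eq)
    qed simp
    finally have h2: "\<bar>Dx / x - poly P (ln x)\<bar> \<le> \<bar>C\<bar> * B / real (Suc k)" by simp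
    have "poly p (real (Suc k)) = poly P (ln x)" by (simp add: p_def poly_pcompose lnx del: of_nat_Suc)
    moreover have "(32 + \<bar>C\<bar> * B) / real (Suc k) = 32 / real (Suc k) + \<bar>C\<bar> * B / real (Suc k)" by (rule add_divide_distrib)
    ultimately show ?thesis using h1 h2 by linarith
  qed
  then have "effectively_approx (coeff p i)" by (rule effectively_approx_coeff[OF order.refl q])
  \<comment> \<open>Substituting (k + 1) ln 2 for ln x has multiplied the i-th coefficient by (ln
    2)^i, which is undone here.\<close>
  moreover have "effectively_approx (inverse (ln 2) ^ i)"
    by (intro effectively_approx_power effectively_approx_inverse_pos effectively_approx_ln2) simp
  ultimately have "effectively_approx (coeff p i * inverse (ln 2) ^ i)" by (rule effectively_approx_mult)
  moreover have "coeff p i * inverse (ln 2) ^ i = coeff P i"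
    by (simp add: p_def coeff_pcompose_linear power_inverse)
  ultimately show ?thesis by (simp only: computable_real_if_effectively_approx)
qed

theorem theorem1:
  shows "\<exists>P R :: real poly.
    degree P = 4 \<and> (\<forall>i. computable_real (coeff P i)) \<and>
    degree R = 4 \<and> (\<forall>i. computable_real (coeff R i)) \<and>
    (\<exists>C. \<forall>x>2. \<bar>D_s x - x * poly P (ln x)\<bar> \<le> C * (x powr (1/2) * ln x)) \<and>
    (\<exists>C. \<forall>x>2. \<bar>D_c x - x * poly R (ln x)\<bar> \<le> C * (x powr (1/2) * ln x))"
proof -
  obtain P R :: "real poly" where deg: "degree P = 4" "degree R = 4"
    and exP: "\<exists>C. \<forall>x\<ge>1. \<bar>D_s x - x * poly P (ln x)\<bar> \<le> C * sqrt x"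
    and exR: "\<exists>C. \<forall>x\<ge>1. \<bar>D_c x - x * poly R (ln x)\<bar> \<le> C * (sqrt x * (1 + ln x))"
    by (rule D_s_D_c_asymptotics)
  obtain CP where CP: "\<And>x. 1 \<le> x \<Longrightarrow> \<bar>D_s x - x * poly P (ln x)\<bar> \<le> CP * sqrt x" using exP by blast
  obtain CR where CR: "\<And>x. 1 \<le> x \<Longrightarrow> \<bar>D_c x - x * poly R (ln x)\<bar> \<le> CR * (sqrt x * (1 + ln x))" using exR by blast
  have P': "\<bar>D_s x - x * poly P (ln x)\<bar> \<le> \<bar>CP\<bar> * (sqrt x * (1 + ln x))" if x: "1 \<le> x" for x
  proof -
    have "CP * (sqrt x * 1) \<le> \<bar>CP\<bar> * (sqrt x * (1 + ln x))" using x by (intro mult_mono mult_left_mono) auto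
    then show ?thesis using CP[OF x] by simp
  qed
  have weaken: "\<exists>C. \<forall>x>2. \<bar>f x\<bar> \<le> C * (x powr (1/2) * ln x)"
    if f: "\<And>x::real. 1 \<le> x \<Longrightarrow> \<bar>f x\<bar> \<le> C * (sqrt x * (1 + ln x))" for f :: "real \<Rightarrow> real" and C
  proof (intro exI allI impI)
    fix x :: real assume x: "2 < x"
    \<comment> \<open>x > 2 \<ge> exp(1/2) gives ln x \<ge> 1/2, hence 1 + ln x \<le> 3 ln
      x.\<close>
    have "exp (1/2) \<le> (2::real)" using exp_half_le2 .
    then have "1/2 \<le> ln x" using x by (subst ln_ge_iff) auto
    then have h: "C * (sqrt x * (1 + ln x)) \<le> \<bar>C\<bar> * (sqrt x * (3 * ln x))" using x by (intro mult_mono mult_left_mono) auto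
    have "\<bar>f x\<bar> \<le> \<bar>C\<bar> * (sqrt x * (3 * ln x))" using x by (intro order.trans[OF f h]) simp
    also have "\<dots> = (3 * \<bar>C\<bar>) * (x powr (1/2) * ln x)" using x by (simp add: powr_half_sqrt)
    finally show "\<bar>f x\<bar> \<le> (3 * \<bar>C\<bar>) * (x powr (1/2) * ln x)" .
  qed
  have "computable_real (coeff P i)" for i
    by (rule computable_real_coeff[of "\<lambda>g. g", OF _ _ P'[unfolded D_s_eq_gsum]]) auto
  moreover have "computable_real (coeff R i)" for i
    by (rule computable_real_coeff[of totient, OF _ _ CR[unfolded D_c_eq_gsum]]) (auto intro: rfun_totient totient_le)
  ultimately show ?thesis using deg weaken[OF P'] weaken[OF CR] by blast
qed

end
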